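(* For all integers $n,k\ge1$ there exists an $O(\log k)$-stretch correlated sampling algorithm for $\Delta_{n,k}$ (implied constant independent of $n,k$) which can be implemented in parallel with total sampling time (work) $O(n\cdot\log^* n)$ and depth $O(\log n\cdot\log^* n)$.
   Context: $\Delta_{n,k}=\{\mathbf{x}\in[0,1]^n:\|\mathbf{x}\|_1\le k\}$. A correlated sampling algorithm for $\Delta_{n,k}$ is a distribution $\mathcal{D}$ over deterministic maps $\mathcal{A}:\Delta_{n,k}\to2^{[n]}$, drawn once and applied to all inputs; it has stretch $\alpha$ if for all $\mathbf{x},\mathbf{y}\in\Delta_{n,k}$: (P1) $|\mathcal{A}(\mathbf{x})|\in\{\lfloor\|\mathbf{x}\|_1\rfloor,\lceil\|\mathbf{x}\|_1\rceil\}$ for all $\mathcal{A}$ in the support; (P2) $\Pr[i\in\mathcal{A}(\mathbf{x})]=x_i$ for all $i$; (P3) $\mathbb{E}|\mathcal{A}(\mathbf{x})\oplus\mathcal{A}(\mathbf{y})|\le\alpha\|\mathbf{x}-\mathbf{y}\|_1$. $\log^* n=\min\{i:\log^{(i)}n\le1\}$ where $\log^{(i)}$ is the $i$-fold iterated base-2 logarithm. *)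

theory Defs
  imports "HOL-Probability.Probability"
begin

section \<open>Correlated sampling\<close>

text \<open>Vectors of dimension \<open>n\<close> are real lists of length \<open>n\<close>, and \<open>[n]\<close> is rendered as
  \<open>{..<n}\<close>, so that coordinates are numbered from \<open>0\<close>.\<close>

definition l1 :: "real list \<Rightarrow> real" where
  "l1 x = (\<Sum>i<length x. \<bar>x ! i\<bar>)"

definition l1_dist :: "real list \<Rightarrow> real list \<Rightarrow> real" where
  "l1_dist x y = l1 (map2 (-) x y)"

definition Delta :: "nat \<Rightarrow> nat \<Rightarrow> real list set" where
  "Delta n k = {x. length x = n \<and> (\<forall>i<n. 0 \<le> x ! i \<and> x ! i \<le> 1) \<and> l1 x \<le> real k}"

text \<open>A distribution over deterministic maps is a probability measure whose points are the maps
  themselves; \<open>space D\<close> is the set of maps that can be drawn, so a property of all maps in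
  the support is required of every element of \<open>space D\<close>, with no exceptional null set. The
  \<open>\<sigma>\<close>-algebra has to make every evaluation \<open>A \<mapsto> A x\<close> a random variable. In the stretch condition the
  integrand is then measurable and bounded by \<open>n\<close>, hence integrable.\<close>

definition correlated_sampling ::
    "nat \<Rightarrow> nat \<Rightarrow> real \<Rightarrow> (real list \<Rightarrow> nat set) measure \<Rightarrow> bool" where
  "correlated_sampling n k \<alpha> D \<longleftrightarrow>
     prob_space D \<and>
     space D \<subseteq> (Delta n k \<rightarrow> Pow {..<n}) \<and>
     (\<forall>x\<in>Delta n k. (\<lambda>A. A x) \<in> measurable D (count_space (Pow {..<n}))) \<and>
     (\<forall>A\<in>space D. \<forall>x\<in>Delta n k. int (card (A x)) \<in> {\<lfloor>l1 x\<rfloor>, \<lceil>l1 x\<rceil>}) \<and>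
     (\<forall>x\<in>Delta n k. \<forall>i<n. measure D {A \<in> space D. i \<in> A x} = x ! i) \<and>
     (\<forall>x\<in>Delta n k. \<forall>y\<in>Delta n k.
        (\<integral>A. real (card (sym_diff (A x) (A y))) \<partial>D) \<le> \<alpha> * l1_dist x y)"

definition log_star :: "nat \<Rightarrow> nat" where
  "log_star n = (LEAST i. (log 2 ^^ i) (real n) \<le> 1)"


section \<open>The parallel machine\<close>

text \<open>
  The machine is a randomized exclusive-write real-number PRAM in the work-depth presentation. A
  main program issues sequential steps and parallel steps; in one parallel step, every processor
  \<open>i < e\<close> evaluates an address and a value in the memory as it was before the step, and then all
  the values are written at once. Concurrent reads are allowed, concurrent writes are not.

  Exact real arithmetic, comparisons, the natural logarithm (for drawing exponential variates) and
  a read of the random tape have unit cost. There is no rounding from reals to integers. The only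
  integer operations are addition, truncated subtraction and halving, so that one step increases
  the bit length of an integer by at most a constant and no separate bound on the word size is
  needed. Every expression costs one unit: its number of operations is fixed by the text of the
  program.

  Totality conventions of HOL apply to \<open>x / 0\<close> and to the logarithm of a nonpositive number.
\<close>

type_synonym vname = string

record state =
  ivar :: "vname \<Rightarrow> nat"
  rvar :: "vname \<Rightarrow> real"
  iarr :: "vname \<Rightarrow> nat \<Rightarrow> nat"
  rarr :: "vname \<Rightarrow> nat \<Rightarrow> real"

datatype iexp =
    IConst nat | IVar vname | IAt vname iexp
  | IAdd iexp iexp | ISub iexp iexp | IHalf iexp | IIf bexp iexp iexp
and rexp =
    RVar vname | RAt vname iexp | RRand iexp | ROfNat iexp
  | RAdd rexp rexp | RSub rexp rexp | RMul rexp rexp | RDiv rexp rexp | RLn rexp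
  | RIf bexp rexp rexp
and bexp =
    ILess iexp iexp | RLess rexp rexp | BNot bexp | BAnd bexp bexp

text \<open>The infinite sequence \<open>\<omega>\<close> is the random tape.\<close>

primrec ival :: "(nat \<Rightarrow> real) \<Rightarrow> state \<Rightarrow> iexp \<Rightarrow> nat"
    and rval :: "(nat \<Rightarrow> real) \<Rightarrow> state \<Rightarrow> rexp \<Rightarrow> real"
    and bval :: "(nat \<Rightarrow> real) \<Rightarrow> state \<Rightarrow> bexp \<Rightarrow> bool" where
  "ival \<omega> s (IConst m) = m"
| "ival \<omega> s (IVar v) = ivar s v"
| "ival \<omega> s (IAt a e) = iarr s a (ival \<omega> s e)"
| "ival \<omega> s (IAdd e f) = ival \<omega> s e + ival \<omega> s f"
| "ival \<omega> s (ISub e f) = ival \<omega> s e - ival \<omega> s f"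
| "ival \<omega> s (IHalf e) = ival \<omega> s e div 2"
| "ival \<omega> s (IIf b e f) = (if bval \<omega> s b then ival \<omega> s e else ival \<omega> s f)"
| "rval \<omega> s (RVar v) = rvar s v"
| "rval \<omega> s (RAt a e) = rarr s a (ival \<omega> s e)"
| "rval \<omega> s (RRand e) = \<omega> (ival \<omega> s e)"
| "rval \<omega> s (ROfNat e) = real (ival \<omega> s e)"
| "rval \<omega> s (RAdd e f) = rval \<omega> s e + rval \<omega> s f"
| "rval \<omega> s (RSub e f) = rval \<omega> s e - rval \<omega> s f"
| "rval \<omega> s (RMul e f) = rval \<omega> s e * rval \<omega> s f"
| "rval \<omega> s (RDiv e f) = rval \<omega> s e / rval \<omega> s f"
| "rval \<omega> s (RLn e) = ln (rval \<omega> s e)"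
| "rval \<omega> s (RIf b e f) = (if bval \<omega> s b then rval \<omega> s e else rval \<omega> s f)"
| "bval \<omega> s (ILess e f) \<longleftrightarrow> ival \<omega> s e < ival \<omega> s f"
| "bval \<omega> s (RLess e f) \<longleftrightarrow> rval \<omega> s e < rval \<omega> s f"
| "bval \<omega> s (BNot b) \<longleftrightarrow> \<not> bval \<omega> s b"
| "bval \<omega> s (BAnd b c) \<longleftrightarrow> bval \<omega> s b \<and> bval \<omega> s c"

text \<open>\<open>IPar v e a p t\<close>: for all \<open>v < e\<close> in parallel, write the value of \<open>t\<close> to cell \<open>p\<close> of
  array \<open>a\<close>. The variable \<open>v\<close> is local to the step.\<close>

datatype com =
    Skip
  | ISet vname iexp
  | RSet vname rexp
  | IPar vname iexp vname iexp iexp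
  | RPar vname iexp vname iexp rexp
  | Seq com com
  | Cond bexp com com
  | While bexp com

definition with_index :: "state \<Rightarrow> vname \<Rightarrow> nat \<Rightarrow> state" where
  "with_index s v i = s\<lparr>ivar := (ivar s)(v := i)\<rparr>"

text \<open>Simultaneous update of the distinct cells \<open>p 0, \<dots>, p (m - 1)\<close>; only meaningful if \<open>p\<close> is
  injective on \<open>{..<m}\<close>.\<close>

definition scatter :: "nat \<Rightarrow> (nat \<Rightarrow> nat) \<Rightarrow> (nat \<Rightarrow> 'a) \<Rightarrow> (nat \<Rightarrow> 'a) \<Rightarrow> nat \<Rightarrow> 'a" where
  "scatter m p t f = (\<lambda>j. if j \<in> p ` {..<m} then t (inv_into {..<m} p j) else f j)"

text \<open>\<open>run \<omega> c s s' w d\<close>: started in \<open>s\<close>, program \<open>c\<close> terminates in \<open>s'\<close> with work \<open>w\<close> and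
  depth \<open>d\<close>. A write conflict leaves the machine without a successor state.\<close>

inductive run :: "(nat \<Rightarrow> real) \<Rightarrow> com \<Rightarrow> state \<Rightarrow> state \<Rightarrow> nat \<Rightarrow> nat \<Rightarrow> bool"
  for \<omega> :: "nat \<Rightarrow> real" where
  run_Skip: "run \<omega> Skip s s 1 1"
| run_ISet: "run \<omega> (ISet v e) s (s\<lparr>ivar := (ivar s)(v := ival \<omega> s e)\<rparr>) 1 1"
| run_RSet: "run \<omega> (RSet v e) s (s\<lparr>rvar := (rvar s)(v := rval \<omega> s e)\<rparr>) 1 1"
| run_IPar:
    "\<lbrakk>m = ival \<omega> s e;
      p' = (\<lambda>i. ival \<omega> (with_index s v i) p);
      t' = (\<lambda>i. ival \<omega> (with_index s v i) t);
      inj_on p' {..<m}\<rbrakk>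
     \<Longrightarrow> run \<omega> (IPar v e a p t) s
           (s\<lparr>iarr := (iarr s)(a := scatter m p' t' (iarr s a))\<rparr>) (1 + m) 1"
| run_RPar:
    "\<lbrakk>m = ival \<omega> s e;
      p' = (\<lambda>i. ival \<omega> (with_index s v i) p);
      t' = (\<lambda>i. rval \<omega> (with_index s v i) t);
      inj_on p' {..<m}\<rbrakk>
     \<Longrightarrow> run \<omega> (RPar v e a p t) s
           (s\<lparr>rarr := (rarr s)(a := scatter m p' t' (rarr s a))\<rparr>) (1 + m) 1"
| run_Seq:
    "\<lbrakk>run \<omega> c1 s1 s2 w1 d1; run \<omega> c2 s2 s3 w2 d2\<rbrakk>
     \<Longrightarrow> run \<omega> (Seq c1 c2) s1 s3 (w1 + w2) (d1 + d2)"
| run_CondTrue: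
    "\<lbrakk>bval \<omega> s b; run \<omega> c1 s s' w d\<rbrakk> \<Longrightarrow> run \<omega> (Cond b c1 c2) s s' (1 + w) (1 + d)"
| run_CondFalse:
    "\<lbrakk>\<not> bval \<omega> s b; run \<omega> c2 s s' w d\<rbrakk> \<Longrightarrow> run \<omega> (Cond b c1 c2) s s' (1 + w) (1 + d)"
| run_WhileFalse:
    "\<not> bval \<omega> s b \<Longrightarrow> run \<omega> (While b c) s s 1 1"
| run_WhileTrue:
    "\<lbrakk>bval \<omega> s1 b; run \<omega> c s1 s2 w1 d1; run \<omega> (While b c) s2 s3 w2 d2\<rbrakk>
     \<Longrightarrow> run \<omega> (While b c) s1 s3 (1 + w1 + w2) (1 + d1 + d2)"

inductive_cases run_SkipE: "run \<omega> Skip s s' w d"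
inductive_cases run_ISetE: "run \<omega> (ISet v e) s s' w d"
inductive_cases run_RSetE: "run \<omega> (RSet v e) s s' w d"
inductive_cases run_IParE: "run \<omega> (IPar v e a p t) s s' w d"
inductive_cases run_RParE: "run \<omega> (RPar v e a p t) s s' w d"
inductive_cases run_SeqE: "run \<omega> (Seq c1 c2) s s' w d"
inductive_cases run_CondE: "run \<omega> (Cond b c1 c2) s s' w d"
inductive_cases run_WhileE: "run \<omega> (While b c) s s' w d"

lemma run_deterministic:
  assumes "run \<omega> c s s' w d" "run \<omega> c s s'' w' d'"
  shows "s' = s'' \<and> w = w' \<and> d = d'"
  using assms
proof (induction arbitrary: s'' w' d' rule: run.induct)
  case (run_Skip s)
  then show ?case by (elim run_SkipE) simp
next
  case (run_ISet v e s)
  then show ?case by (elim run_ISetE) simp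
next
  case (run_RSet v e s)
  then show ?case by (elim run_RSetE) simp
next
  case (run_IPar m s e p' v p t' t a)
  from run_IPar.prems show ?case by (elim run_IParE) (simp add: run_IPar.hyps)
next
  case (run_RPar m s e p' v p t' t a)
  from run_RPar.prems show ?case by (elim run_RParE) (simp add: run_RPar.hyps)
next
  case (run_Seq c1 s1 s2 w1 d1 c2 s3 w2 d2)
  from run_Seq.prems show ?case
    by (rule run_SeqE) (metis run_Seq.IH)
next
  case (run_CondTrue s b c1 s' w d c2)
  from run_CondTrue.prems show ?case
    by (rule run_CondE) (use run_CondTrue.IH run_CondTrue.hyps(1) in \<open>simp, fastforce?\<close>)+
next
  case (run_CondFalse s b c2 s' w d c1)
  from run_CondFalse.prems show ?case
    by (rule run_CondE) (use run_CondFalse.IH run_CondFalse.hyps(1) in \<open>simp, fastforce?\<close>)+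
next
  case (run_WhileFalse s b c)
  from run_WhileFalse.prems show ?case
    by (rule run_WhileE) (use run_WhileFalse.hyps in simp_all)
next
  case (run_WhileTrue s1 b c s2 w1 d1 s3 w2 d2)
  from run_WhileTrue.prems show ?case
    by (rule run_WhileE) (use run_WhileTrue.IH run_WhileTrue.hyps(1) in \<open>simp, fastforce?\<close>)+
qed


section \<open>Parallel implementation of a correlated sampling algorithm\<close>

text \<open>The random tape holds independent uniform variates in the open unit interval.\<close>

definition tape :: "(nat \<Rightarrow> real) measure" where
  "tape = PiM UNIV (\<lambda>_. restrict_space lborel {0<..<1})"

definition input_state :: "nat \<Rightarrow> nat \<Rightarrow> real list \<Rightarrow> state" where
  "input_state n k x =
     \<lparr>ivar = (\<lambda>_. 0)(''n'' := n, ''k'' := k),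
      rvar = (\<lambda>_. 0),
      iarr = (\<lambda>_ _. 0),
      rarr = (\<lambda>_ _. 0)(''x'' := (\<lambda>i. if i < length x then x ! i else 0))\<rparr>"

definition output_set :: "nat \<Rightarrow> state \<Rightarrow> nat set" where
  "output_set n s = {i. i < n \<and> iarr s ''out'' i \<noteq> 0}"

text \<open>The tape \<open>\<omega>\<close> is the shared randomness: it determines the drawn map \<open>f \<omega>\<close>, which the program
  then computes on every input. The bounds hold in the worst case over tapes and inputs, and they
  include all processing that depends on the tape.\<close>

definition implements ::
    "com \<Rightarrow> nat \<Rightarrow> nat \<Rightarrow> (real list \<Rightarrow> nat set) measure \<Rightarrow> real \<Rightarrow> real \<Rightarrow> bool" where
  "implements c n k D W T \<longleftrightarrow>
     (\<exists>f. f \<in> measurable tape D \<and> distr tape D f = D \<and>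
        (\<forall>\<omega>\<in>space tape. \<forall>x\<in>Delta n k.
           \<exists>s w d. run \<omega> c (input_state n k x) s w d \<and>
             output_set n s = f \<omega> x \<and> real w \<le> W \<and> real d \<le> T))"

end

(*
  The coordinates are placed in N = 2^p positions, split into K blocks. Each row of positions with equal
  offset inside its block is rotated by a random number of blocks, so two fixed coordinates of different
  rows share a block with probability 1/K. The line of every block is cut at the integers shifted by a
  common uniform offset: the items strictly between two cuts form a group of mass at most one, and an item
  containing a cut is a group of its own. Moving x by d in the l1 norm perturbs the grouping by O(d) in
  expectation as soon as the total mass is O(K).

  The masses of the groups are rounded along a binary tree over the groups, the count of a node being
  rounded to a neighbouring integer and split among its children with a shared coin; the stretch grows
  linearly in the depth, and there are poly(k) groups, so the depth is O(log k). A group with count one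
  elects its member by shared exponential clocks. All sums are tree sums, so the program has linear work
  and logarithmic depth, which is stronger than what is asked.
*)
theory Submission
  imports Defs
begin

section \<open>The random tape\<close>

text \<open>The obstacle is \<open>n\<close>. A rounding tree over all coordinates would cost a
  factor log n, and cuts along a single line would be displaced by every change to their left. With
  blocks, a change moves only the cuts of its own block, and another coordinate lies in that block
  with probability at most 1/K. The mass regrouped by a change of size d is therefore O(d (1 + k/K))
  in expectation, which is O(d) once K is at least k. Such a block needs about 2k slots, whence
  O(k^2) slots in all. If k exceeds about the square root of n, every position is its own block, and
  no coordinate disturbs another. The split probability at a node is chosen to preserve
  expectations, and it is monotone in the masses; monotonicity controls the counts off the changed
  path. Counts are valid for every outcome of the coins, so the size condition holds without an
  exceptional null set. Independent choices occupy disjoint cells of the tape: cells 4r hold the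
  rotations of the rows, cell 1 the offset of the cuts, cells 4v + 2 the coins of the tree (cell 2
  rounds the root), cells 4p + 3 the clocks.\<close>

definition unit_interval :: "real measure" where
  "unit_interval = restrict_space lborel {0<..<1}"

lemma space_unit_interval [simp]: "space unit_interval = {0<..<1}"
  by (simp add: unit_interval_def space_restrict_space)

lemma prob_space_unit_interval: "prob_space unit_interval"
  by (rule prob_spaceI) (simp add: unit_interval_def emeasure_restrict_space space_restrict_space)

lemma measurable_unit_interval_ident: "(\<lambda>t. t) \<in> borel_measurable unit_interval"
  by (simp add: unit_interval_def measurable_restrict_space1)

lemma sets_unit_interval_less: "{t \<in> space unit_interval. t < c} \<in> sets unit_interval"
proof -
  have "(\<lambda>t. t) -` {..<c} \<inter> space unit_interval \<in> sets unit_interval"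
    by (rule measurable_sets[OF measurable_unit_interval_ident]) simp
  also have "(\<lambda>t. t) -` {..<c} \<inter> space unit_interval = {t \<in> space unit_interval. t < c}" by blast
  finally show ?thesis .
qed

lemma measure_unit_interval_less:
  assumes "0 \<le> c" "c \<le> 1"
  shows "measure unit_interval {t \<in> space unit_interval. t < c} = c"
proof -
  have eq: "{t \<in> space unit_interval. t < c} = {0<..<c}" using assms by auto
  have "measure unit_interval {t \<in> space unit_interval. t < c} = measure lborel {0<..<c}"
    unfolding eq unfolding unit_interval_def by (rule measure_restrict_space) (use assms in auto)
  also have "\<dots> = c" using assms by simp
  finally show ?thesis .
qed

lemma tape_eq: "tape = PiM UNIV (\<lambda>_. unit_interval)"
  by (simp add: tape_def unit_interval_def)

lemma space_tape: "space tape = {\<omega>. \<forall>i. 0 < \<omega> i \<and> \<omega> i < 1}"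
  by (auto simp: tape_eq space_PiM PiE_iff)

lemma product_prob_space_tape: "product_prob_space (\<lambda>_::nat. unit_interval)"
  unfolding product_prob_space_def product_prob_space_axioms_def product_sigma_finite_def
  using prob_space_unit_interval by (auto intro: prob_space_imp_sigma_finite)

interpretation tape: prob_space tape
  unfolding tape_eq by (intro prob_space_PiM prob_space_unit_interval)

interpretation tape_pair: pair_prob_space tape tape ..

lemma measurable_tape_coordinate': "(\<lambda>\<omega>. \<omega> i) \<in> measurable tape unit_interval"
  unfolding tape_eq by measurable

lemma measurable_tape_coordinate: "(\<lambda>\<omega>. \<omega> i) \<in> borel_measurable tape"
  using measurable_compose[OF measurable_tape_coordinate' measurable_unit_interval_ident] by simp

lemma sets_tape_coordinate_less [simp]: "{\<omega> \<in> space tape. \<omega> i < c} \<in> sets tape"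
  by (intro borel_measurable_less measurable_tape_coordinate borel_measurable_const)

lemma measurable_floor_shift: "(\<lambda>\<omega>. real_of_int \<lfloor>\<omega> i + Y\<rfloor>) \<in> borel_measurable tape"
  by (rule measurable_compose[OF _ borel_measurable_real_floor])
     (intro borel_measurable_add measurable_tape_coordinate borel_measurable_const)

lemma integral_tape_coordinate:
  fixes g :: "real \<Rightarrow> real"
  assumes "g \<in> borel_measurable unit_interval"
  shows "(\<integral>\<omega>. g (\<omega> i) \<partial>tape) = (\<integral>t. g t \<partial>unit_interval)"
proof -
  interpret product_prob_space "\<lambda>_::nat. unit_interval" UNIV by (rule product_prob_space_tape)
  have "distr tape unit_interval (\<lambda>\<omega>. \<omega> i) = unit_interval"
    unfolding tape_eq by (rule PiM_component) simp
  then show ?thesis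
    using integral_distr[OF measurable_tape_coordinate' assms, of i] by simp
qed

lemma prob_tape_coordinate_less:
  assumes "0 \<le> c" "c \<le> 1"
  shows "measure tape {\<omega> \<in> space tape. \<omega> i < c} = c"
proof -
  interpret U: prob_space unit_interval by (rule prob_space_unit_interval)
  interpret product_prob_space "\<lambda>_::nat. unit_interval" UNIV by (rule product_prob_space_tape)
  let ?A = "{t \<in> space unit_interval. t < c}"
  have "measure tape {\<omega> \<in> space tape. \<omega> i < c} = measure tape {\<omega> \<in> space tape. \<omega> i \<in> ?A}"
    by (rule arg_cong[where f = "measure tape"]) (auto simp: space_tape)
  also have "\<dots> = measure unit_interval ?A"
  proof -
    have "emeasure tape {\<omega> \<in> space tape. \<omega> i \<in> ?A} = emeasure unit_interval ?A"
      unfolding tape_eq by (rule emeasure_PiM_Collect_single[OF UNIV_I sets_unit_interval_less])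
    then show ?thesis by (simp only: measure_def)
  qed
  finally show ?thesis using measure_unit_interval_less[OF assms] by simp
qed

section \<open>Splicing two independent tapes\<close>

definition tape_merge :: "nat set \<Rightarrow> (nat \<Rightarrow> real) \<Rightarrow> (nat \<Rightarrow> real) \<Rightarrow> nat \<Rightarrow> real" where
  "tape_merge J \<omega> \<omega>' = (\<lambda>j. if j \<in> J then \<omega> j else \<omega>' j)"

lemma tape_merge_in_space [simp, intro]:
  "\<omega> \<in> space tape \<Longrightarrow> \<omega>' \<in> space tape \<Longrightarrow> tape_merge J \<omega> \<omega>' \<in> space tape"
  by (simp add: space_tape tape_merge_def)

lemma measurable_tape_merge [measurable]:
  "(\<lambda>(\<omega>, \<omega>'). tape_merge J \<omega> \<omega>') \<in> measurable (tape \<Otimes>\<^sub>M tape) tape"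
  unfolding tape_eq
proof (rule measurable_PiM_single')
  fix i
  show "(\<lambda>x. (case x of (\<omega>, \<omega>') \<Rightarrow> tape_merge J \<omega> \<omega>') i)
      \<in> measurable (PiM UNIV (\<lambda>_. unit_interval) \<Otimes>\<^sub>M PiM UNIV (\<lambda>_. unit_interval)) unit_interval"
    by (cases "i \<in> J") (simp_all add: tape_merge_def split_beta')
qed (auto simp: space_pair_measure space_PiM tape_merge_def PiE_iff)

text \<open>A product measure is determined by its values on finite boxes. The preimage of a box is
  a rectangle: its conditions on cells in \<open>J\<close> concern the first tape, the others the
  second, and the two partial products multiply to the full one.\<close>

lemma distr_tape_merge: "distr (tape \<Otimes>\<^sub>M tape) tape (\<lambda>(\<omega>, \<omega>'). tape_merge J \<omega> \<omega>') = tape"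
proof -
  interpret product_prob_space "\<lambda>_::nat. unit_interval" UNIV by (rule product_prob_space_tape)
  let ?M = "\<lambda>_::nat. unit_interval" and ?f = "\<lambda>(\<omega>, \<omega>'). tape_merge J \<omega> \<omega>'"
  let ?D = "distr (tape \<Otimes>\<^sub>M tape) tape ?f"
  have "?D = PiM UNIV ?M"
  proof (rule PiM_eq)
    show "sets ?D = sets (PiM UNIV ?M)" by (simp add: tape_eq)
    fix F :: "nat set" and E assume F: "finite F" "\<And>j. j \<in> F \<Longrightarrow> E j \<in> sets unit_interval"
    let ?X = "prod_emb UNIV ?M F (Pi\<^sub>E F E)"
    let ?E1 = "prod_emb UNIV ?M (F \<inter> J) (Pi\<^sub>E (F \<inter> J) E)"
    let ?E2 = "prod_emb UNIV ?M (F - J) (Pi\<^sub>E (F - J) E)"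
    have X: "?X \<in> sets tape" "?E1 \<in> sets tape" "?E2 \<in> sets tape"
      using F by (auto simp: tape_eq intro!: sets_PiM_I)
    have "?f -` ?X \<inter> space (tape \<Otimes>\<^sub>M tape) = ?E1 \<times> ?E2"
      unfolding tape_eq
      by (auto simp: space_pair_measure space_PiM prod_emb_def PiE_iff tape_merge_def split: if_splits)
    then have "emeasure ?D ?X = emeasure (tape \<Otimes>\<^sub>M tape) (?E1 \<times> ?E2)"
      using X by (subst emeasure_distr) auto
    also have "\<dots> = emeasure tape ?E1 * emeasure tape ?E2"
      using X by (intro tape.emeasure_pair_measure_Times) auto
    also have "emeasure tape ?E1 = (\<Prod>j\<in>F \<inter> J. emeasure unit_interval (E j))"
      unfolding tape_eq using F by (intro emeasure_PiM_emb) auto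
    also have "emeasure tape ?E2 = (\<Prod>j\<in>F - J. emeasure unit_interval (E j))"
      unfolding tape_eq using F by (intro emeasure_PiM_emb) auto
    also have "(\<Prod>j\<in>F \<inter> J. emeasure unit_interval (E j)) * (\<Prod>j\<in>F - J. emeasure unit_interval (E j))
        = (\<Prod>j\<in>F. emeasure unit_interval (E j))"
      using F by (subst prod.Int_Diff[of F _ J]) auto
    finally show "emeasure ?D ?X = (\<Prod>j\<in>F. emeasure unit_interval (E j))" .
  qed
  then show ?thesis by (simp add: tape_eq)
qed

text \<open>Conditioning by Fubini: the outer integral fixes the cells in \<open>J\<close>, the
  inner one draws all others afresh. Boundedness supplies integrability. Every later argument that
  conditions on part of the randomness has this form.\<close>

lemma expectation_tape_merge:
  fixes f :: "(nat \<Rightarrow> real) \<Rightarrow> real"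
  assumes [measurable]: "f \<in> borel_measurable tape" and bd: "\<And>\<omega>. \<omega> \<in> space tape \<Longrightarrow> \<bar>f \<omega>\<bar> \<le> B"
  shows "(\<integral>\<omega>. f \<omega> \<partial>tape) = (\<integral>\<omega>. (\<integral>\<omega>'. f (tape_merge J \<omega> \<omega>') \<partial>tape) \<partial>tape)"
proof -
  have int: "integrable (tape \<Otimes>\<^sub>M tape) (\<lambda>(\<omega>, \<omega>'). f (tape_merge J \<omega> \<omega>'))"
    by (rule tape_pair.P.integrable_const_bound[where B = B]) (auto simp: space_pair_measure intro!: AE_I2 bd)
  have "(\<integral>\<omega>. f \<omega> \<partial>tape) = (\<integral>\<omega>. f \<omega> \<partial>distr (tape \<Otimes>\<^sub>M tape) tape (\<lambda>(\<omega>, \<omega>'). tape_merge J \<omega> \<omega>'))"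
    by (simp only: distr_tape_merge)
  also have "\<dots> = (\<integral>z. f (case z of (\<omega>, \<omega>') \<Rightarrow> tape_merge J \<omega> \<omega>') \<partial>(tape \<Otimes>\<^sub>M tape))"
    by (rule integral_distr) measurable
  also have "\<dots> = (\<integral>(\<omega>, \<omega>'). f (tape_merge J \<omega> \<omega>') \<partial>(tape \<Otimes>\<^sub>M tape))"
    by (simp add: split_beta')
  also have "\<dots> = (\<integral>\<omega>. (\<integral>\<omega>'. f (tape_merge J \<omega> \<omega>') \<partial>tape) \<partial>tape)"
    by (rule tape_pair.integral_fst[OF int, symmetric])
  finally show ?thesis .
qed

lemma prob_tape_box:
  assumes "finite F" "\<And>j. j \<in> F \<Longrightarrow> 0 \<le> c j \<and> c j \<le> 1"
  shows "measure tape {\<omega> \<in> space tape. \<forall>j\<in>F. \<omega> j < c j} = (\<Prod>j\<in>F. c j)"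
proof -
  interpret product_prob_space "\<lambda>_::nat. unit_interval" UNIV by (rule product_prob_space_tape)
  let ?E = "\<lambda>j. {t \<in> space unit_interval. t < c j}"
  have "measure tape (prod_emb UNIV (\<lambda>_. unit_interval) F (Pi\<^sub>E F ?E))
      = (\<Prod>j\<in>F. measure unit_interval (?E j))"
    unfolding tape_eq using assms by (intro measure_PiM_emb sets_unit_interval_less) auto
  also have "\<dots> = (\<Prod>j\<in>F. c j)"
    using assms by (intro prod.cong measure_unit_interval_less refl) auto
  also have "prod_emb UNIV (\<lambda>_. unit_interval) F (Pi\<^sub>E F ?E) = {\<omega> \<in> space tape. \<forall>j\<in>F. \<omega> j < c j}"
    by (auto simp: prod_emb_def tape_eq space_PiM PiE_iff)
  finally show ?thesis .
qed

text \<open>The last step in the race of exponential clocks: in \<open>prob_strict_winner\<close>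
  the exponent is the total mass of the competitors divided by the mass of the winner.\<close>

lemma integral_unit_interval_powr:
  assumes "0 \<le> r"
  shows "(\<integral>t. t powr r \<partial>unit_interval) = 1 / (r + 1)"
proof -
  have "(\<integral>t. t powr r \<partial>unit_interval) = (\<integral>t. indicator {0<..<1} t * t powr r \<partial>lborel)"
    unfolding unit_interval_def by (subst integral_restrict_space) auto
  also have "\<dots> = (\<integral>t. indicator {0..1} t * t powr r \<partial>lborel)"
    by (rule integral_cong_AE)
      (auto intro!: AE_I[where N = "{0, 1}"] simp: indicator_def emeasure_lborel_countable)
  also have "\<dots> = 1 / (r + 1)"
  proof -
    have "((\<lambda>t. t powr r) has_integral 1 / (r + 1)) {0..1}"
      using has_integral_powr_from_0[of r 1] assms by simp
    then have "(\<integral>\<^sup>+t. ennreal (indicator {0..1} t * t powr r) \<partial>lborel) = ennreal (1 / (r + 1))"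
      by (intro nn_integral_has_integral_lebesgue) auto
    then show ?thesis using assms
      by (subst integral_eq_nn_integral) (auto simp: indicator_def)
  qed
  finally show ?thesis .
qed

section \<open>Exponential clocks\<close>

text \<open>Ties go to the least index. This makes the winner a function of every tape, and it
  agrees with the tree scan, which keeps the left candidate unless the right one is strictly
  larger.\<close>

definition first_argmax :: "nat set \<Rightarrow> (nat \<Rightarrow> real) \<Rightarrow> nat" where
  "first_argmax A \<kappa> = (LEAST p. p \<in> A \<and> (\<forall>q\<in>A. \<kappa> q \<le> \<kappa> p))"

lemma first_argmax:
  assumes "finite A" "A \<noteq> {}"
  shows "first_argmax A \<kappa> \<in> A" "q \<in> A \<Longrightarrow> \<kappa> q \<le> \<kappa> (first_argmax A \<kappa>)"
    "q \<in> A \<Longrightarrow> q < first_argmax A \<kappa> \<Longrightarrow> \<kappa> q < \<kappa> (first_argmax A \<kappa>)"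
proof -
  let ?P = "\<lambda>p. p \<in> A \<and> (\<forall>q\<in>A. \<kappa> q \<le> \<kappa> p)"
  have "Max (\<kappa> ` A) \<in> \<kappa> ` A" using assms by (intro Max_in) auto
  then obtain p where "?P p" using assms by (metis (no_types, lifting) Max_ge finite_imageI image_iff)
  then have *: "?P (first_argmax A \<kappa>)" unfolding first_argmax_def by (rule LeastI)
  then show "first_argmax A \<kappa> \<in> A" "q \<in> A \<Longrightarrow> \<kappa> q \<le> \<kappa> (first_argmax A \<kappa>)" by auto
  assume q: "q \<in> A" "q < first_argmax A \<kappa>"
  then have "\<not> ?P q" unfolding first_argmax_def by (blast dest: not_less_Least)
  with q * show "\<kappa> q < \<kappa> (first_argmax A \<kappa>)" by (meson le_less_trans not_le order_trans)
qed

lemma first_argmax_unique: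
  assumes "p \<in> A" "\<And>q. q \<in> A \<Longrightarrow> \<kappa> q \<le> \<kappa> p" "\<And>q. q \<in> A \<Longrightarrow> q < p \<Longrightarrow> \<kappa> q < \<kappa> p"
  shows "first_argmax A \<kappa> = p"
  unfolding first_argmax_def
proof (rule Least_equality)
  fix q assume q: "q \<in> A \<and> (\<forall>r\<in>A. \<kappa> r \<le> \<kappa> q)"
  show "p \<le> q"
  proof (rule ccontr)
    assume "\<not> p \<le> q"
    with assms(3)[of q] q have "\<kappa> q < \<kappa> p" by auto
    with q assms(1) show False by (meson not_le)
  qed
qed (use assms in auto)

lemma first_argmax_eq_iff:
  assumes "finite A" "A \<noteq> {}"
  shows "first_argmax A \<kappa> = p \<longleftrightarrow> p \<in> A \<and> (\<forall>q\<in>A. \<kappa> q \<le> \<kappa> p \<and> (q < p \<longrightarrow> \<kappa> q < \<kappa> p))"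
  using first_argmax[OF assms] first_argmax_unique[of p A \<kappa>] by blast

text \<open>For uniform w, the value (- ln w) / a is an exponential clock of rate a. The key is the
  reciprocal of its ringing time, so the first clock has the largest key and mass 0 gives key 0
  without a division by zero. \<open>0 - ln\<close> mirrors the machine, which has no
  negation.\<close>

definition clock_key :: "(nat \<Rightarrow> real) \<Rightarrow> (nat \<Rightarrow> real) \<Rightarrow> nat \<Rightarrow> real" where
  "clock_key w a p = a p / (0 - ln (w p))"

lemma clock_key_pos_iff: "0 < w p \<Longrightarrow> w p < 1 \<Longrightarrow> 0 < clock_key w a p \<longleftrightarrow> 0 < a p"
proof -
  assume "0 < w p" "w p < 1"
  then have "0 < 0 - ln (w p)" by simp
  then show ?thesis unfolding clock_key_def by (auto simp only: zero_less_divide_iff)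
qed

lemma measurable_clock_key:
  "(\<lambda>\<omega>. clock_key (\<lambda>p. \<omega> (c p)) a q) \<in> borel_measurable tape"
  unfolding clock_key_def
  by (intro borel_measurable_divide borel_measurable_diff borel_measurable_ln borel_measurable_const
      measurable_tape_coordinate)

lemma prob_tape_indicator: "E \<in> sets tape \<Longrightarrow> measure tape E = (\<integral>\<omega>. indicator E \<omega> \<partial>tape)"
  by simp

text \<open>Given the variate t of clock i, clock p loses exactly when its own variate lies below t
  to the power a p / a i. These events are independent, so the probabilities multiply to t to the
  power (S - a i) / a i, where S is the total mass; integrating over t gives a i / S. The injection
  \<open>c\<close> assigns to clock p its tape cell.\<close>

lemma prob_strict_winner:
  fixes a :: "nat \<Rightarrow> real" and c :: "nat \<Rightarrow> nat"
  assumes c: "inj c" and a: "\<And>p. p < N \<Longrightarrow> 0 \<le> a p" and i: "i < N" "0 < a i"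
  shows "measure tape {\<omega> \<in> space tape. \<forall>p<N. p \<noteq> i \<longrightarrow>
      clock_key (\<lambda>p. \<omega> (c p)) a p < clock_key (\<lambda>p. \<omega> (c p)) a i} = a i / (\<Sum>p<N. a p)"
    (is "measure tape ?E = _")
proof -
  let ?k = "\<lambda>\<omega>. clock_key (\<lambda>p. \<omega> (c p)) a"
  define S where "S = (\<Sum>p<N. a p)"
  define R where "R = {..<N} - {i}"
  have fin: "finite R" by (simp add: R_def)
  have S: "S = a i + (\<Sum>p\<in>R. a p)" unfolding S_def R_def using i by (simp add: sum.remove)
  have Spos: "0 < S" using S i a by (auto simp: R_def intro!: add_pos_nonneg sum_nonneg)
  have E: "?E \<in> sets tape" 
    by (intro sets.sets_Collect_conj sets.sets_Collect_const sets.sets_Collect_countable_All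
        sets.sets_Collect_imp borel_measurable_le borel_measurable_less measurable_clock_key)
  have gen: "x / A < y / B \<longleftrightarrow> x * B < y * A" if "0 < A" "0 < B" for x y A B :: real
    using that by (simp add: field_simps)
  \<comment> \<open>Both logarithms are negative, so cross-multiplication turns the comparison of
    keys into a linear inequality between them. For \<open>a p = 0\<close> the threshold is 1 and
    clock p always loses.\<close>
  have iff: "?k \<omega> p < ?k \<omega> i \<longleftrightarrow> \<omega> (c p) < \<omega> (c i) powr (a p / a i)"
    if "\<omega> \<in> space tape" "p < N" for \<omega> p
  proof -
    have 0: "0 < \<omega> (c p)" "\<omega> (c p) < 1" "0 < \<omega> (c i)" "\<omega> (c i) < 1" using that by (auto simp: space_tape)
    then have l: "ln (\<omega> (c p)) < 0" "ln (\<omega> (c i)) < 0" by auto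
    have "?k \<omega> p < ?k \<omega> i \<longleftrightarrow> ln (\<omega> (c p)) < a p / a i * ln (\<omega> (c i))"
    proof -
      have "?k \<omega> p < ?k \<omega> i \<longleftrightarrow> a p * (0 - ln (\<omega> (c i))) < a i * (0 - ln (\<omega> (c p)))"
        unfolding clock_key_def using l by (intro gen) auto
      also have "\<dots> \<longleftrightarrow> ln (\<omega> (c p)) < a p * ln (\<omega> (c i)) / a i"
        using i by (subst pos_less_divide_eq) (auto simp: mult.commute)
      finally show ?thesis by simp
    qed
    also have "\<dots> \<longleftrightarrow> \<omega> (c p) < \<omega> (c i) powr (a p / a i)"
    proof -
      have "ln (\<omega> (c p)) < ln (\<omega> (c i) powr (a p / a i)) \<longleftrightarrow> \<omega> (c p) < \<omega> (c i) powr (a p / a i)"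
        using 0 by (intro ln_less_cancel_iff) simp_all
      then show ?thesis using 0 by (simp only: ln_powr)
    qed
    finally show ?thesis .
  qed
  have "measure tape ?E = (\<integral>\<omega>. indicator ?E \<omega> \<partial>tape)" by (rule prob_tape_indicator[OF E])
  also have "\<dots> = (\<integral>\<omega>. (\<integral>\<omega>'. indicator ?E (tape_merge {c i} \<omega> \<omega>') \<partial>tape) \<partial>tape)"
    by (rule expectation_tape_merge[where B = 1], rule borel_measurable_indicator[OF E]) simp
  also have "\<dots> = (\<integral>\<omega>. \<omega> (c i) powr ((S - a i) / a i) \<partial>tape)"
  proof (intro Bochner_Integration.integral_cong refl)
    fix \<omega> assume w: "\<omega> \<in> space tape"
    let ?t = "\<lambda>p. \<omega> (c i) powr (a p / a i)"
    have t: "0 < \<omega> (c i)" "\<omega> (c i) < 1" using w by (auto simp: space_tape)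
    have "(\<integral>\<omega>'. indicator ?E (tape_merge {c i} \<omega> \<omega>') \<partial>tape)
        = (\<integral>\<omega>'. indicator {\<omega>' \<in> space tape. \<forall>j\<in>c ` R. \<omega>' j < ?t (inv c j)} \<omega>' \<partial>tape)"
    proof (intro Bochner_Integration.integral_cong refl)
      fix \<omega>' assume w': "\<omega>' \<in> space tape"
      have "tape_merge {c i} \<omega> \<omega>' \<in> ?E \<longleftrightarrow> (\<forall>p\<in>R. \<omega>' (c p) < ?t p)"
      proof -
        let ?\<nu> = "tape_merge {c i} \<omega> \<omega>'"
        have \<nu>: "?\<nu> \<in> space tape" using w w' by (rule tape_merge_in_space)
        have "?k ?\<nu> p < ?k ?\<nu> i \<longleftrightarrow> \<omega>' (c p) < ?t p" if "p \<in> R" for p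
        proof -
          have p: "p < N" "p \<noteq> i" using that by (simp_all add: R_def)
          have "?\<nu> (c p) = \<omega>' (c p)" "?\<nu> (c i) = \<omega> (c i)"
            using p(2) c by (simp_all add: tape_merge_def inj_eq)
          then show ?thesis using iff[OF \<nu> p(1)] by (simp only:)
        qed
        then have "(\<forall>p\<in>R. ?k ?\<nu> p < ?k ?\<nu> i) \<longleftrightarrow> (\<forall>p\<in>R. \<omega>' (c p) < ?t p)"
          by (rule ball_cong[OF refl])
        moreover have "?\<nu> \<in> ?E \<longleftrightarrow> (\<forall>p\<in>R. ?k ?\<nu> p < ?k ?\<nu> i)"
          using \<nu> unfolding R_def by blast
        ultimately show ?thesis by (simp only:)
      qed
      then show "indicator ?E (tape_merge {c i} \<omega> \<omega>')
        = indicator {\<omega>' \<in> space tape. \<forall>j\<in>c ` R. \<omega>' j < ?t (inv c j)} \<omega>'"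
        using w' c by (simp add: indicator_def)
    qed
    also have "\<dots> = measure tape {\<omega>' \<in> space tape. \<forall>j\<in>c ` R. \<omega>' j < ?t (inv c j)}"
      by (rule prob_tape_indicator[symmetric]) (intro sets.sets_Collect_finite_All sets_tape_coordinate_less finite_imageI fin)
    also have "\<dots> = (\<Prod>j\<in>c ` R. ?t (inv c j))"
      using fin t a i by (intro prob_tape_box) (auto intro!: powr_le1 simp: R_def c)
    also have "\<dots> = (\<Prod>p\<in>R. ?t p)"
      using c by (subst prod.reindex) (auto intro: inj_on_subset)
    also have "\<dots> = \<omega> (c i) powr (\<Sum>p\<in>R. a p / a i)" using t fin by (simp add: powr_sum)
    also have "(\<Sum>p\<in>R. a p / a i) = (S - a i) / a i" by (simp add: S sum_divide_distrib)
    finally show "(\<integral>\<omega>'. indicator ?E (tape_merge {c i} \<omega> \<omega>') \<partial>tape) = \<omega> (c i) powr ((S - a i) / a i)" .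
  qed
  also have "\<dots> = (\<integral>t. t powr ((S - a i) / a i) \<partial>unit_interval)"
    by (rule integral_tape_coordinate[of "\<lambda>t. t powr ((S - a i) / a i)"])
      (rule measurable_compose[OF measurable_unit_interval_ident], measurable)
  also have "\<dots> = 1 / ((S - a i) / a i + 1)"
    using i a by (intro integral_unit_interval_powr) (auto simp: S R_def intro!: sum_nonneg divide_nonneg_pos)
  also have "\<dots> = a i / S" using i Spos by (simp add: field_simps)
  finally show ?thesis by (simp add: S_def)
qed

text \<open>The events of a strict win have total probability one, so ties can be ignored.\<close>

lemma prob_winner:
  fixes a :: "nat \<Rightarrow> real" and c :: "nat \<Rightarrow> nat"
  assumes c: "inj c" and a: "\<And>p. p < N \<Longrightarrow> 0 \<le> a p" and i: "i < N" and S: "0 < (\<Sum>p<N. a p)"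
  shows "measure tape {\<omega> \<in> space tape. first_argmax {..<N} (clock_key (\<lambda>p. \<omega> (c p)) a) = i}
     = a i / (\<Sum>p<N. a p)"
proof -
  let ?k = "\<lambda>\<omega>. clock_key (\<lambda>p. \<omega> (c p)) a"
  define W where "W p = {\<omega> \<in> space tape. first_argmax {..<N} (?k \<omega>) = p}" for p
  have N: "{..<N} \<noteq> {}" using i by auto
  have W: "W p \<in> sets tape" for p
    
  proof -
    have "W p = {\<omega> \<in> space tape. p < N \<and> (\<forall>q<N. ?k \<omega> q \<le> ?k \<omega> p \<and> (q < p \<longrightarrow> ?k \<omega> q < ?k \<omega> p))}"
      unfolding W_def first_argmax_eq_iff[OF finite_lessThan N] by auto
    also have "\<dots> \<in> sets tape" 
    by (intro sets.sets_Collect_conj sets.sets_Collect_const sets.sets_Collect_countable_All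
        sets.sets_Collect_imp borel_measurable_le borel_measurable_less measurable_clock_key)
    finally show ?thesis .
  qed
  have ge: "a p / (\<Sum>p<N. a p) \<le> measure tape (W p)" if "p < N" for p
  proof (cases "a p = 0")
    case False
    then have "0 < a p" using a[OF that] by simp
    have "a p / (\<Sum>p<N. a p) = measure tape {\<omega> \<in> space tape. \<forall>q<N. q \<noteq> p \<longrightarrow> ?k \<omega> q < ?k \<omega> p}"
    proof (rule sym, rule prob_strict_winner[where c = c and N = N and a = a and i = p])
      show "inj c" by (rule c)
      show "0 \<le> a q" if "q < N" for q using that by (rule a)
      show "p < N" by (rule that)
      show "0 < a p" by (rule \<open>0 < a p\<close>)
    qed
    also have "\<dots> \<le> measure tape (W p)"
    proof (rule tape.finite_measure_mono)
      show "{\<omega> \<in> space tape. \<forall>q<N. q \<noteq> p \<longrightarrow> ?k \<omega> q < ?k \<omega> p} \<subseteq> W p"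
      proof safe
        fix \<omega> assume w: "\<omega> \<in> space tape" "\<forall>q<N. q \<noteq> p \<longrightarrow> ?k \<omega> q < ?k \<omega> p"
        have "first_argmax {..<N} (?k \<omega>) = p"
        proof (rule first_argmax_unique)
          fix q assume "q \<in> {..<N}"
          then show "?k \<omega> q \<le> ?k \<omega> p" using w(2) by (cases "q = p") (simp_all add: less_imp_le)
        next
          fix q assume "q \<in> {..<N}" "q < p"
          then show "?k \<omega> q < ?k \<omega> p" using w(2) by simp
        qed (simp add: that)
        then show "\<omega> \<in> W p" using w by (simp add: W_def)
      qed
    qed (rule W)
    finally show ?thesis .
  qed simp
  have "(\<Sum>p<N. measure tape (W p)) = measure tape (\<Union>p<N. W p)"
    by (rule tape.finite_measure_finite_Union[symmetric]) (use W in \<open>auto simp: disjoint_family_on_def W_def\<close>)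
  also have "\<dots> \<le> 1" by (rule tape.prob_le_1)
  finally have le: "(\<Sum>p<N. measure tape (W p)) \<le> 1" .
  have "(\<Sum>p<N. measure tape (W p) - a p / (\<Sum>p<N. a p)) \<le> 0"
    using le S by (simp add: sum_subtractf sum_divide_distrib[symmetric])
  moreover have nn: "0 \<le> measure tape (W p) - a p / (\<Sum>p<N. a p)" if "p \<in> {..<N}" for p
    using ge that by simp
  then have "0 \<le> (\<Sum>p<N. measure tape (W p) - a p / (\<Sum>p<N. a p))" by (rule sum_nonneg)
  ultimately have "(\<Sum>p<N. measure tape (W p) - a p / (\<Sum>p<N. a p)) = 0" by linarith
  then have "\<forall>p\<in>{..<N}. measure tape (W p) - a p / (\<Sum>p<N. a p) = 0"
    using nn by (subst (asm) sum_nonneg_eq_0_iff) auto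
  then show ?thesis using i by (simp add: W_def)
qed

section \<open>Random shifts\<close>

text \<open>For t in the unit interval, the floor of t + Y exceeds that of Y, by one, exactly when t
  reaches 1 - frac Y; a uniform t does so with probability frac Y.\<close>

lemma expectation_floor_shift:
  "(\<integral>\<omega>. real_of_int \<lfloor>\<omega> j + Y\<rfloor> \<partial>tape) = Y"
proof -
  have eq: "real_of_int \<lfloor>\<omega> j + Y\<rfloor> = real_of_int \<lfloor>Y\<rfloor> + 1 - indicator {\<omega> \<in> space tape. \<omega> j < 1 - frac Y} \<omega>"
    if "\<omega> \<in> space tape" for \<omega>
  proof -
    have w: "0 < \<omega> j" "\<omega> j < 1" using that by (auto simp: space_tape)
    have "\<lfloor>\<omega> j + Y\<rfloor> = (if \<omega> j < 1 - frac Y then \<lfloor>Y\<rfloor> else \<lfloor>Y\<rfloor> + 1)"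
      using w frac_ge_0[of Y] frac_lt_1[of Y] by (simp add: floor_eq_iff) (auto simp: frac_def; linarith)
    then show ?thesis using that by (auto simp: indicator_def)
  qed
  have "(\<integral>\<omega>. real_of_int \<lfloor>\<omega> j + Y\<rfloor> \<partial>tape)
    = (\<integral>\<omega>. real_of_int \<lfloor>Y\<rfloor> + 1 - indicator {\<omega> \<in> space tape. \<omega> j < 1 - frac Y} \<omega> \<partial>tape)"
    by (rule Bochner_Integration.integral_cong[OF refl]) (rule eq)
  also have "\<dots> = real_of_int \<lfloor>Y\<rfloor> + 1 - measure tape {\<omega> \<in> space tape. \<omega> j < 1 - frac Y}"
  proof (subst Bochner_Integration.integral_diff)
    show "integrable tape (indicator {\<omega> \<in> space tape. \<omega> j < 1 - frac Y} :: _ \<Rightarrow> real)"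
      by (rule tape.integrable_const_bound[where B = 1])
         (simp add: indicator_def, rule borel_measurable_indicator, rule sets_tape_coordinate_less)
  qed (simp_all add: tape.prob_space)
  also have "measure tape {\<omega> \<in> space tape. \<omega> j < 1 - frac Y} = 1 - frac Y"
    using frac_lt_1[of Y] by (intro prob_tape_coordinate_less) auto
  finally show ?thesis by (simp add: frac_def)
qed

text \<open>For Y at most Z, the difference of the two floors is a nonnegative integer and thus
  dominates the indicator of the event; its expectation is Z - Y.\<close>

lemma prob_floor_shift_differs:
  "measure tape {\<omega> \<in> space tape. \<lfloor>\<omega> j + Y\<rfloor> \<noteq> \<lfloor>\<omega> j + Z\<rfloor>} \<le> \<bar>Y - Z\<bar>"
proof (induction Y Z rule: linorder_wlog)
  case (sym Y Z)
  then show ?case by (simp add: abs_minus_commute eq_commute)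
next
  case (le Y Z)
  have bd: "integrable tape (\<lambda>\<omega>. real_of_int \<lfloor>\<omega> j + Y\<rfloor>)" for Y
  proof (rule tape.integrable_const_bound[where B = "\<bar>Y\<bar> + 2"])
    have "\<bar>real_of_int \<lfloor>\<omega> j + Y\<rfloor>\<bar> \<le> \<bar>Y\<bar> + 2" if "\<omega> \<in> space tape" for \<omega>
    proof -
      have "0 < \<omega> j" "\<omega> j < 1" using that by (auto simp: space_tape)
      then show ?thesis by linarith
    qed
    then show "AE \<omega> in tape. norm (real_of_int \<lfloor>\<omega> j + Y\<rfloor>) \<le> \<bar>Y\<bar> + 2" by (auto intro!: AE_I2)
    show "(\<lambda>\<omega>. real_of_int \<lfloor>\<omega> j + Y\<rfloor>) \<in> borel_measurable tape"
      by (rule measurable_floor_shift)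
  qed
  have sets: "{\<omega> \<in> space tape. \<lfloor>\<omega> j + Y\<rfloor> \<noteq> \<lfloor>\<omega> j + Z\<rfloor>} \<in> sets tape"
    unfolding of_int_eq_iff[where 'a = real, symmetric]
    by (intro sets.sets_Collect_neg measurable_equality_set measurable_floor_shift)
  have "measure tape {\<omega> \<in> space tape. \<lfloor>\<omega> j + Y\<rfloor> \<noteq> \<lfloor>\<omega> j + Z\<rfloor>}
     = (\<integral>\<omega>. indicator {\<omega> \<in> space tape. \<lfloor>\<omega> j + Y\<rfloor> \<noteq> \<lfloor>\<omega> j + Z\<rfloor>} \<omega> \<partial>tape)"
    using sets by simp
  also have "\<dots> \<le> (\<integral>\<omega>. real_of_int \<lfloor>\<omega> j + Z\<rfloor> - real_of_int \<lfloor>\<omega> j + Y\<rfloor> \<partial>tape)"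
  proof (rule integral_mono)
    fix \<omega> assume "\<omega> \<in> space tape"
    have "\<lfloor>\<omega> j + Y\<rfloor> \<le> \<lfloor>\<omega> j + Z\<rfloor>" using le by (intro floor_mono) simp
    then show "indicator {\<omega> \<in> space tape. \<lfloor>\<omega> j + Y\<rfloor> \<noteq> \<lfloor>\<omega> j + Z\<rfloor>} \<omega>
      \<le> real_of_int \<lfloor>\<omega> j + Z\<rfloor> - real_of_int \<lfloor>\<omega> j + Y\<rfloor>"
      by (auto simp: indicator_def)
  next
    show "integrable tape (indicator {\<omega> \<in> space tape. \<lfloor>\<omega> j + Y\<rfloor> \<noteq> \<lfloor>\<omega> j + Z\<rfloor>} :: _ \<Rightarrow> real)"
      by (rule tape.integrable_const_bound[where B = 1])
         (simp add: indicator_def, rule borel_measurable_indicator, rule sets)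
  qed (intro Bochner_Integration.integrable_diff bd)
  also have "\<dots> = Z - Y" using bd by (simp add: expectation_floor_shift)
  finally show ?case using le by simp
qed

text \<open>The condition \<open>int s = \<lfloor>K * \<omega> j\<rfloor>\<close> defines a uniform variate on \<open>{..<K}\<close>.\<close>

lemma prob_floor_scale:
  assumes "s < K"
  shows "measure tape {\<omega> \<in> space tape. nat \<lfloor>real K * \<omega> j\<rfloor> = s} = 1 / real K"
proof -
  have K: "0 < K" using assms by simp
  let ?A = "\<lambda>c. {\<omega> \<in> space tape. \<omega> j < c / real K}"
  have "nat \<lfloor>real K * t\<rfloor> = s \<longleftrightarrow> \<not> t < real s / real K \<and> t < real (Suc s) / real K" if "0 < t" for t
  proof -
    have "0 \<le> \<lfloor>real K * t\<rfloor>" using that by simp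
    then have "nat \<lfloor>real K * t\<rfloor> = s \<longleftrightarrow> \<lfloor>real K * t\<rfloor> = int s" by auto
    also have "\<dots> \<longleftrightarrow> real s \<le> real K * t \<and> real K * t < real s + 1" by (simp add: floor_eq_iff)
    also have "\<dots> \<longleftrightarrow> \<not> t < real s / real K \<and> t < real (Suc s) / real K"
      using K by (simp add: pos_less_divide_eq pos_le_divide_eq not_less mult.commute pos_divide_le_eq add.commute)
    finally show ?thesis .
  qed
  then have "{\<omega> \<in> space tape. nat \<lfloor>real K * \<omega> j\<rfloor> = s} = ?A (real (Suc s)) - ?A (real s)"
    by (simp add: space_tape set_eq_iff del: of_nat_Suc) blast
  also have "measure tape \<dots> = measure tape (?A (real (Suc s))) - measure tape (?A (real s))"
  proof (rule tape.finite_measure_Diff)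
    have "real s / real K \<le> real (Suc s) / real K" by (rule divide_right_mono) auto
    then show "?A (real s) \<subseteq> ?A (real (Suc s))" by (auto simp del: of_nat_Suc)
  qed (rule sets_tape_coordinate_less)+
  also have "measure tape (?A (real (Suc s))) = real (Suc s) / real K"
    using assms K by (intro prob_tape_coordinate_less) simp_all
  also have "measure tape (?A (real s)) = real s / real K"
    using assms K by (intro prob_tape_coordinate_less) simp_all
  also have "real (Suc s) / real K - real s / real K = 1 / real K"
    unfolding diff_divide_distrib[symmetric] by simp
  finally show ?thesis .
qed

section \<open>Binary trees in heap order\<close>

text \<open>Heap layout: the children of v are 2v and 2v + 1, and the indices from \<open>M\<close>
  on are leaves, so a tree of depth L has its leaves at \<open>2 ^ L\<close> up to
  \<open>2 * 2 ^ L\<close>. Index 0 is not a node; it would be its own left child, and treating it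
  as a leaf lets the recursion terminate.\<close>

function ntree :: "('a \<Rightarrow> 'a \<Rightarrow> 'a) \<Rightarrow> nat \<Rightarrow> (nat \<Rightarrow> 'a) \<Rightarrow> nat \<Rightarrow> 'a" where
  "ntree f M lf v = (if v = 0 \<or> M \<le> v then lf v
     else f (ntree f M lf (2 * v)) (ntree f M lf (2 * v + 1)))"
  by pat_completeness auto
termination by (relation "Wellfounded.measure (\<lambda>(f, M, lf, v). M - v)") auto

declare ntree.simps [simp del]

lemma ntree_leaf: "M \<le> v \<Longrightarrow> ntree f M lf v = lf v"
  by (simp add: ntree.simps)

lemma ntree_node:
  "0 < v \<Longrightarrow> v < M \<Longrightarrow> ntree f M lf v = f (ntree f M lf (2 * v)) (ntree f M lf (2 * v + 1))"
  by (simp add: ntree.simps[of f M lf v])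

abbreviation nsum :: "nat \<Rightarrow> (nat \<Rightarrow> 'a::comm_monoid_add) \<Rightarrow> nat \<Rightarrow> 'a" where
  "nsum \<equiv> ntree (+)"

lemma nsum_nonneg:
  fixes lf :: "nat \<Rightarrow> 'a::ordered_comm_monoid_add"
  assumes "\<And>u. 0 \<le> lf u"
  shows "0 \<le> nsum M lf v"
proof (induction "M - v" arbitrary: v rule: less_induct)
  case less
  show ?case
  proof (cases "v = 0 \<or> M \<le> v")
    case True
    then show ?thesis using assms by (subst ntree.simps) simp
  next
    case False
    then have "0 \<le> nsum M lf (2 * v)" "0 \<le> nsum M lf (2 * v + 1)" by (auto intro!: less)
    with False show ?thesis by (simp add: ntree_node)
  qed
qed

lemma sum_heap_children:
  fixes f :: "nat \<Rightarrow> 'a::comm_monoid_add"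
  shows "(\<Sum>v\<in>{2 * W..<4 * W}. f v) = (\<Sum>v\<in>{W..<2 * W}. f (2 * v) + f (2 * v + 1))"
proof -
  have eq: "{2 * W..<4 * W} = (\<lambda>v. 2 * v) ` {W..<2 * W} \<union> (\<lambda>v. 2 * v + 1) ` {W..<2 * W}"
  proof (intro equalityI subsetI)
    fix v assume v: "v \<in> {2 * W..<4 * W}"
    show "v \<in> (\<lambda>v. 2 * v) ` {W..<2 * W} \<union> (\<lambda>v. 2 * v + 1) ` {W..<2 * W}"
    proof (cases "even v")
      case True
      then have "v = 2 * (v div 2)" "v div 2 \<in> {W..<2 * W}" using v by auto
      then show ?thesis by blast
    next
      case False
      then have "v = 2 * (v div 2) + 1" "v div 2 \<in> {W..<2 * W}" using v by auto
      then show ?thesis by blast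
    qed
  qed auto
  have disj: "(\<lambda>v. 2 * v) ` {W..<2 * W} \<inter> (\<lambda>v. 2 * v + 1) ` {W..<2 * W} = {}"
    by auto presburger
  have "(\<Sum>v\<in>{2 * W..<4 * W}. f v)
      = (\<Sum>v\<in>(\<lambda>v. 2 * v) ` {W..<2 * W}. f v) + (\<Sum>v\<in>(\<lambda>v. 2 * v + 1) ` {W..<2 * W}. f v)"
    unfolding eq by (rule sum.union_disjoint) (use disj in auto)
  also have "\<dots> = (\<Sum>v\<in>{W..<2 * W}. f (2 * v)) + (\<Sum>v\<in>{W..<2 * W}. f (2 * v + 1))"
    by (subst (1 2) sum.reindex) (auto simp: inj_on_def)
  finally show ?thesis by (simp add: sum.distrib)
qed

text \<open>Every level partitions the leaves; the induction descends from level j to the leaves,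
  doubling the level by \<open>sum_heap_children\<close>.\<close>

lemma nsum_level:
  assumes "j \<le> L"
  shows "(\<Sum>v\<in>{2 ^ j..<2 * 2 ^ j}. nsum (2 ^ L) lf v) = (\<Sum>v\<in>{2 ^ L..<2 * 2 ^ L}. lf v)"
  using assms
proof (induction "L - j" arbitrary: j)
  case 0
  then have "j = L" by simp
  then show ?case by (auto intro!: sum.cong simp: ntree_leaf)
next
  case (Suc d)
  then have jL: "j < L" by simp
  have lt: "v < 2 ^ L" if "v < 2 * 2 ^ j" for v :: nat
  proof -
    have "(2::nat) * 2 ^ j \<le> 2 ^ L" using jL
      by (metis Suc_leI power_Suc power_increasing one_le_numeral)
    with that show ?thesis by linarith
  qed
  have "(\<Sum>v\<in>{2 ^ j..<2 * 2 ^ j}. nsum (2 ^ L) lf v)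
     = (\<Sum>v\<in>{2 ^ j..<2 * 2 ^ j}. nsum (2 ^ L) lf (2 * v) + nsum (2 ^ L) lf (2 * v + 1))"
  proof (rule sum.cong)
    fix v :: nat assume v: "v \<in> {2 ^ j..<2 * 2 ^ j}"
    then have "0 < v" by (auto intro: less_le_trans[OF zero_less_power])
    with v show "nsum (2 ^ L) lf v = nsum (2 ^ L) lf (2 * v) + nsum (2 ^ L) lf (2 * v + 1)"
      by (intro ntree_node lt) auto
  qed simp
  also have "\<dots> = (\<Sum>v\<in>{2 * 2 ^ j..<4 * 2 ^ j}. nsum (2 ^ L) lf v)"
    by (rule sum_heap_children[symmetric])
  also have "\<dots> = (\<Sum>v\<in>{2 ^ L..<2 * 2 ^ L}. lf v)"
    using Suc.hyps(1)[of "Suc j"] Suc.hyps(2) Suc.prems jL by simp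
  finally show ?case .
qed

lemma nsum_root: "nsum (2 ^ L) lf 1 = (\<Sum>v\<in>{2 ^ L..<2 * 2 ^ L}. lf v)"
proof -
  have "{1..<2::nat} = {1}" by auto
  then show ?thesis using nsum_level[of 0 L lf] by simp
qed

lemma sum_heap_leaves: "(\<Sum>v\<in>{M..<2 * M}. f v) = (\<Sum>g<M. f (M + g :: nat))"
  by (rule sum.reindex_bij_witness[of _ "\<lambda>g. M + g" "\<lambda>v. v - M"]) auto

section \<open>Dependent rounding of counts\<close>

text \<open>The probability that a single surplus unit goes left, for fractional parts x and y. If x
  + y < 1, the unit is present with probability x + y and must go left with probability x. If x + y
  is at least 1, the surplus is one with probability 2 - x - y and two otherwise; the right child
  stays without a unit, which has probability 1 - y, only if the single unit goes left.\<close>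

definition pleft :: "real \<Rightarrow> real \<Rightarrow> real" where
  "pleft x y = (if x + y < 1 then x / (x + y) else (1 - y) / (2 - x - y))"

text \<open>The left share of the count \<open>n\<close>; the right child receives the rest. The
  surplus r over the two floors is 0, 1 or 2 for valid counts, and only r = 1 consults the
  coin.\<close>

definition lsplit :: "real \<Rightarrow> real \<Rightarrow> real \<Rightarrow> int \<Rightarrow> int" where
  "lsplit t a b n = \<lfloor>a\<rfloor> +
     (let r = n - \<lfloor>a\<rfloor> - \<lfloor>b\<rfloor> in
      if r \<le> 0 then 0 else if 2 \<le> r then 1 else if t < pleft (frac a) (frac b) then 1 else 0)"

text \<open>The counts that a node of total mass \<open>s\<close> may receive.\<close>

definition valid :: "real \<Rightarrow> int \<Rightarrow> bool" where
  "valid s n \<longleftrightarrow> \<lfloor>s\<rfloor> \<le> n \<and> n \<le> \<lceil>s\<rceil>"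

lemma valid_iff: "valid s n \<longleftrightarrow> n = \<lfloor>s\<rfloor> \<or> n = \<lfloor>s\<rfloor> + 1 \<and> 0 < frac s"
  unfolding valid_def ceiling_altdef frac_def by (auto; linarith)

lemma pleft_bounds:
  assumes "0 \<le> x" "x < 1" "0 \<le> y" "y < 1"
  shows "0 \<le> pleft x y" "pleft x y \<le> 1"
  using assms by (auto simp: pleft_def divide_simps)

lemma floor_add_frac:
  "\<lfloor>a + b\<rfloor> = \<lfloor>a\<rfloor> + \<lfloor>b\<rfloor> + (if frac a + frac b < 1 then 0 else 1)"
  "frac (a + b) = frac a + frac b - (if frac a + frac b < 1 then 0 else (1::real))"
  by (auto simp: floor_add frac_add)

text \<open>Each of the two formulas increases in x, and they agree where x + y = 1, both having the
  value 1 - y there.\<close>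

lemma pleft_mono:
  assumes "0 \<le> x" "x \<le> x'" "x' < 1" "0 \<le> y" "y < 1"
  shows "pleft x y \<le> pleft x' y"
proof -
  have A: "u / (u + y) \<le> v / (v + y)" if "0 \<le> u" "u \<le> v" for u v
  proof (cases "u + y = 0")
    case True
    then show ?thesis using that assms by auto
  next
    case False
    then have "0 < u + y" "0 < v + y" using that assms by auto
    then show ?thesis using that assms by (simp add: divide_simps algebra_simps mult_right_mono)
  qed
  have B: "(1 - y) / (2 - u - y) \<le> (1 - y) / (2 - v - y)" if "u \<le> v" "v < 1" for u v
    using that assms by (intro divide_left_mono) (auto intro!: mult_pos_pos)
  consider "x' + y < 1" | "1 \<le> x + y" | "x + y < 1" "1 \<le> x' + y" by linarith
  then show ?thesis
  proof cases
    case 3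
    \<comment> \<open>The two formulas are compared through the intermediate point 1 - y, at which
      the defining case changes.\<close>
    then have "x / (x + y) \<le> (1 - y) / (1 - y + y)" using assms by (intro A) auto
    also have "\<dots> = (1 - y) / (2 - (1 - y) - y)" by simp
    also have "\<dots> \<le> (1 - y) / (2 - x' - y)" using 3 assms by (intro B) auto
    finally show ?thesis using 3 by (simp add: pleft_def)
  qed (use assms A[of x x'] B[of x x'] in \<open>auto simp: pleft_def\<close>)
qed

text \<open>Exchanging the children exchanges the two outcomes of the coin. The case x = y = 0 is
  excluded because both values are then 0, by the convention 0 / 0 = 0.\<close>

lemma pleft_swap:
  assumes "0 \<le> x" "x < 1" "0 \<le> y" "y < 1" "0 < x + y"
  shows "pleft x y = 1 - pleft y x"
proof (cases "x + y < 1")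
  case True
  have "x / (x + y) + y / (x + y) = 1" using assms by (simp add: add_divide_distrib[symmetric])
  with True show ?thesis by (simp add: pleft_def add.commute)
next
  case False
  have "(1 - y) / (2 - x - y) + (1 - x) / (2 - x - y) = (2 - x - y) / (2 - x - y)"
    by (simp add: add_divide_distrib[symmetric])
  also have "\<dots> = 1" using assms by simp
  finally show ?thesis using False by (simp add: pleft_def add.commute) (simp add: algebra_simps)
qed

text \<open>A child with integral mass must not receive a surplus unit, whatever the coin. If x = 0
  the threshold is 0, below every t; if y = 0 and x > 0 it is 1, above every t. This uses that the
  variates avoid both endpoints. A surplus of two occurs only if both fractional parts are
  positive.\<close>

lemma lsplit_valid:
  assumes "valid (a + b) n" "0 < t" "t < 1"
  shows "valid a (lsplit t a b n)" "valid b (n - lsplit t a b n)"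
proof -
  define x y r where "x = frac a" and "y = frac b" and "r = n - \<lfloor>a\<rfloor> - \<lfloor>b\<rfloor>"
  have xy: "0 \<le> x" "x < 1" "0 \<le> y" "y < 1" by (auto simp: x_def y_def frac_lt_1)
  have r: "r = 0 \<and> x + y < 1 \<or> r = 1 \<and> 0 < x + y \<or> r = 2 \<and> 0 < x \<and> 0 < y"
    using assms(1) xy unfolding valid_iff floor_add_frac r_def
    by (auto simp: x_def[symmetric] y_def[symmetric] split: if_splits)
  have p0: "pleft x y = 0" if "x = 0" using that xy by (simp add: pleft_def)
  have p1: "pleft x y = 1" if "y = 0" "0 < x" using that xy by (simp add: pleft_def)
  have l: "lsplit t a b n = \<lfloor>a\<rfloor> + (if r \<le> 0 then 0 else if 2 \<le> r then 1
      else if t < pleft x y then 1 else 0)"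
    by (simp add: lsplit_def Let_def x_def y_def r_def)
  show "valid a (lsplit t a b n)"
    unfolding valid_iff l using r xy p0 assms(2) by (cases "x = 0") (auto simp: x_def[symmetric])
  have n: "n - lsplit t a b n = \<lfloor>b\<rfloor> + (r - (if r \<le> 0 then 0 else if 2 \<le> r then 1
      else if t < pleft x y then 1 else 0))"
    unfolding l by (simp add: r_def)
  show "valid b (n - lsplit t a b n)"
    unfolding valid_iff n using r xy p1 assms(2,3) by (cases "y = 0") (auto simp: y_def[symmetric])
qed

text \<open>With unchanged floor, both the surplus and the threshold grow. With a larger floor, the
  new lower bound already reaches the old maximum, the old floor plus one.\<close>

lemma lsplit_mono_left:
  assumes "a \<le> a'" "n \<le> n'"
  shows "lsplit t a b n \<le> lsplit t a' b n'"
proof (cases "\<lfloor>a\<rfloor> = \<lfloor>a'\<rfloor>")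
  case True
  then have "frac a \<le> frac a'" using assms by (simp add: frac_def)
  then have "pleft (frac a) (frac b) \<le> pleft (frac a') (frac b)"
    by (intro pleft_mono) (auto simp: frac_lt_1)
  then show ?thesis using True assms by (auto simp: lsplit_def Let_def)
next
  case False
  then have "\<lfloor>a\<rfloor> + 1 \<le> \<lfloor>a'\<rfloor>" using floor_mono[OF assms(1)] by linarith
  then show ?thesis by (auto simp: lsplit_def Let_def)
qed

text \<open>The mirror image of \<open>lsplit_mono_left\<close>, with \<open>pleft_swap\<close>
  turning a larger right mass into a smaller threshold. Validity bounds the right share when its
  floor changes.\<close>

lemma lsplit_mono_right:
  assumes "b \<le> b'" "n \<le> n'" "valid (a + b) n" "valid (a + b') n'" "0 < t" "t < 1"
  shows "n - lsplit t a b n \<le> n' - lsplit t a b' n'"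
proof (cases "\<lfloor>b\<rfloor> = \<lfloor>b'\<rfloor>")
  case False
  then have "\<lfloor>b\<rfloor> + 1 \<le> \<lfloor>b'\<rfloor>" using floor_mono[OF assms(1)] by linarith
  moreover have "n - lsplit t a b n \<le> \<lfloor>b\<rfloor> + 1" "\<lfloor>b'\<rfloor> \<le> n' - lsplit t a b' n'"
    using lsplit_valid(2)[OF assms(3,5,6)] lsplit_valid(2)[OF assms(4,5,6)]
    by (auto simp: valid_iff)
  ultimately show ?thesis by linarith
next
  case True
  then have yy: "frac b \<le> frac b'" using assms by (simp add: frac_def)
  \<comment> \<open>If both fractional parts vanished, validity would force surplus 0; hence
    \<open>pleft_swap\<close> is applicable whenever the coin matters.\<close>
  have pos: "0 < frac a + frac b" if "n - \<lfloor>a\<rfloor> - \<lfloor>b\<rfloor> = 1" 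
    using assms(3) that frac_ge_0[of a] frac_ge_0[of b] 
    by (auto simp: valid_iff floor_add_frac split: if_splits)
  have "pleft (frac a) (frac b') \<le> pleft (frac a) (frac b)" if "n - \<lfloor>a\<rfloor> - \<lfloor>b\<rfloor> = 1"
  proof -
    have "pleft (frac b) (frac a) \<le> pleft (frac b') (frac a)"
      using yy by (intro pleft_mono) (auto simp: frac_lt_1)
    then show ?thesis using pos[OF that] yy
      by (subst (1 2) pleft_swap) (auto simp: frac_lt_1)
  qed
  then show ?thesis using True assms(2) by (auto simp: lsplit_def Let_def)
qed

text \<open>Conditional on the count of a node, the left child receives in expectation an affine function
  of that count, so the expectation of the count is passed on to the children.\<close>

lemma lsplit_expectation:
  fixes n :: int
  assumes "valid (a + b) n"
  defines "x \<equiv> frac a" and "y \<equiv> frac b"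
  defines "e \<equiv> (\<lambda>r. if r \<le> 0 then 0 else if 2 \<le> r then 1 else pleft x y)"
  shows "real_of_int \<lfloor>a\<rfloor> + e (n - \<lfloor>a\<rfloor> - \<lfloor>b\<rfloor>)
     = a + (real_of_int n - (a + b)) * (if x + y < 1 then pleft x y else 1 - pleft x y)"
proof -
  have xy: "0 \<le> x" "x < 1" "0 \<le> y" "y < 1" by (auto simp: x_def y_def frac_lt_1)
  define r where "r = n - \<lfloor>a\<rfloor> - \<lfloor>b\<rfloor>"
  have ab: "a = real_of_int \<lfloor>a\<rfloor> + x" "b = real_of_int \<lfloor>b\<rfloor> + y"
    by (simp_all add: x_def y_def frac_def)
  have nr: "real_of_int n - (a + b) = real_of_int r - (x + y)"
    by (simp add: r_def x_def y_def frac_def)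
  have r: "r = 0 \<and> x + y < 1 \<or> r = 1 \<and> 0 < x + y \<or> r = 2 \<and> 1 \<le> x + y"
    using assms(1) xy unfolding valid_iff floor_add_frac r_def
    by (auto simp: x_def[symmetric] y_def[symmetric] split: if_splits)
  \<comment> \<open>Only two surpluses are possible, so \<open>e\<close> is affine on them. Its
    slope is pleft x y on {0, 1}, and 1 - pleft x y on {1, 2}; it takes the value x at the mean x +
    y.\<close>
  have "e r = x + (real_of_int r - (x + y)) * (if x + y < 1 then pleft x y else 1 - pleft x y)"
  proof (cases "x + y < 1")
    case True
    then have "pleft x y * (x + y) = x" using xy by (cases "x + y = 0") (auto simp: pleft_def)
    then show ?thesis using True r by (auto simp: e_def algebra_simps)
  next
    case False
    then have "pleft x y * (2 - x - y) = 1 - y" using xy by (simp add: pleft_def)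
    then show ?thesis using False r by (auto simp: e_def algebra_simps)
  qed
  then show ?thesis unfolding nr r_def[symmetric] using ab(1) by simp
qed


text \<open>Coin \<open>u w\<close> splits the count of node w among its children. Coin
  \<open>u 0\<close> rounds the root, index 0 being free since it is no node. The right child takes
  the remainder, so counts are exactly additive.\<close>

function cnt :: "(nat \<Rightarrow> real) \<Rightarrow> (nat \<Rightarrow> real) \<Rightarrow> nat \<Rightarrow> int" where
  "cnt u S v = (if v \<le> 1 then \<lfloor>S v\<rfloor> + (if u 0 < frac (S v) then 1 else 0)
     else let w = v div 2; l = lsplit (u w) (S (2 * w)) (S (2 * w + 1)) (cnt u S w)
       in if even v then l else cnt u S w - l)"
  by pat_completeness auto
termination by (relation "Wellfounded.measure (\<lambda>(u, S, v). v)") auto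

declare cnt.simps [simp del]

lemma cnt_root: "cnt u S 1 = \<lfloor>S 1\<rfloor> + (if u 0 < frac (S 1) then 1 else 0)"
  by (simp add: cnt.simps)

lemma cnt_left: "0 < v \<Longrightarrow> cnt u S (2 * v) = lsplit (u v) (S (2 * v)) (S (2 * v + 1)) (cnt u S v)"
  by (simp add: cnt.simps[of u S "2 * v"] Let_def)

lemma cnt_right: "0 < v \<Longrightarrow> cnt u S (2 * v + 1) = cnt u S v - cnt u S (2 * v)"
  by (subst cnt_left, simp, subst cnt.simps) (simp add: Let_def)

text \<open>Only the coins of proper ancestors and \<open>u 0\<close> are consulted, and all of
  these have smaller indices. This makes the coin of a node independent of the count it
  splits.\<close>

lemma cnt_cong: "0 < v \<Longrightarrow> (\<And>w. w < v \<Longrightarrow> u w = u' w) \<Longrightarrow> cnt u S v = cnt u' S v"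
proof (induction v rule: less_induct)
  case (less v)
  show ?case
  proof (cases "v \<le> 1")
    case True
    with less show ?thesis by (simp add: cnt.simps[of _ S v])
  next
    case False
    then have "cnt u S (v div 2) = cnt u' S (v div 2)" by (intro less) auto
    moreover have "u (v div 2) = u' (v div 2)" using False by (intro less) auto
    ultimately show ?thesis using False by (simp add: cnt.simps[of _ S v] Let_def)
  qed
qed

text \<open>Induction from the root with \<open>lsplit_valid\<close>. The statement holds for each
  coin sequence, not just almost surely, and is the source of the exact size condition.\<close>

lemma cnt_valid:
  assumes add: "\<And>v. 0 < v \<Longrightarrow> v < M \<Longrightarrow> S v = S (2 * v) + S (2 * v + 1)"
    and u: "\<And>v. 0 < u v \<and> u v < 1"
  shows "0 < v \<Longrightarrow> v < 2 * M \<Longrightarrow> valid (S v) (cnt u S v)"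
proof (induction v rule: less_induct)
  case (less v)
  show ?case
  proof (cases "v = 1")
    case True
    have "0 < u 0" using u by auto
    with True show ?thesis unfolding valid_iff by (auto simp: cnt.simps simp del: frac_gt_0_iff)
  next
    case False
    define w where "w = v div 2"
    have w: "0 < w" "w < M" "w < v" "w < 2 * M" using less.prems False by (auto simp: w_def)
    have "valid (S w) (cnt u S w)" using w by (intro less.IH) auto
    then have "valid (S (2 * w) + S (2 * w + 1)) (cnt u S w)" using add w by simp
    note * = lsplit_valid[OF this, of "u w"]
    consider "v = 2 * w" | "v = 2 * w + 1" unfolding w_def by linarith
    then show ?thesis using * u w by cases (simp_all add: cnt_left cnt_right del: One_nat_def)
  qed
qed

text \<open>In a subtree with unchanged masses, monotonicity hands an increase at the top on to both
  children. No signs are mixed, so the absolute leaf differences add up to the difference at the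
  top.\<close>

lemma cnt_diff_off_path:
  assumes addM: "\<And>v. 0 < v \<Longrightarrow> v < M \<Longrightarrow> S v = S (2 * v) + S (2 * v + 1)"
      "\<And>v. 0 < v \<Longrightarrow> v < M \<Longrightarrow> S' v = S' (2 * v) + S' (2 * v + 1)"
    and u: "\<And>v. 0 < u v \<and> u v < 1"
    and le: "cnt u S v \<le> cnt u S' v"
    and same: "\<And>w i. w div 2 ^ i = v \<Longrightarrow> S w = S' w"
    and v: "0 < v" "v < 2 * M"
  shows "nsum M (\<lambda>w. \<bar>cnt u S' w - cnt u S w\<bar>) v = cnt u S' v - cnt u S v"
  using le same v
proof (induction "M - v" arbitrary: v rule: less_induct)
  case less
  show ?case
  proof (cases "M \<le> v")
    case True
    then show ?thesis using less.prems by (simp add: ntree_leaf)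
  next
    case False
    have desc: "S w = S' w" if "w div 2 ^ i = 2 * v \<or> w div 2 ^ i = 2 * v + 1" for w i
    proof (rule less.prems)
      show "w div 2 ^ Suc i = v" using that
        by (metis Suc_eq_plus1 div_mult2_eq power_Suc2 div_less even_mult_iff
            even_Suc_div_two nonzero_mult_div_cancel_left zero_neq_numeral dvd_triv_left)
    qed
    have eq: "S (2 * v) = S' (2 * v)" "S (2 * v + 1) = S' (2 * v + 1)"
      using desc[of "2 * v" 0] desc[of "2 * v + 1" 0] by auto
    have val: "valid (S (2 * v) + S (2 * v + 1)) (cnt u S v)"
        "valid (S (2 * v) + S (2 * v + 1)) (cnt u S' v)"
      using cnt_valid[of M S u v] cnt_valid[of M S' u v] addM u less.prems False eq by auto
    have l: "cnt u S (2 * v) \<le> cnt u S' (2 * v)"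
      using less.prems eq by (simp add: cnt_left lsplit_mono_left)
    have r: "cnt u S (2 * v + 1) \<le> cnt u S' (2 * v + 1)"
      using less.prems eq val u by (simp add: cnt_left cnt_right lsplit_mono_right del: One_nat_def)
    have "nsum M (\<lambda>w. \<bar>cnt u S' w - cnt u S w\<bar>) (2 * v) = cnt u S' (2 * v) - cnt u S (2 * v)"
      using False less.prems l by (intro less.hyps desc) auto
    moreover have "nsum M (\<lambda>w. \<bar>cnt u S' w - cnt u S w\<bar>) (2 * v + 1)
        = cnt u S' (2 * v + 1) - cnt u S (2 * v + 1)"
      using False less.prems r by (intro less.hyps desc) auto
    ultimately show ?thesis using False less.prems by (simp add: ntree_node cnt_right del: One_nat_def)
  qed
qed

section \<open>Sensitivity of the counts to the mass of one leaf\<close>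

lemma path_level:
  fixes l :: nat
  assumes "l \<in> {2 ^ L..<2 * 2 ^ L}" "j \<le> L"
  shows "l div 2 ^ j \<in> {2 ^ (L - j)..<2 * 2 ^ (L - j)}"
proof -
  have eq: "(2::nat) ^ L = 2 ^ (L - j) * 2 ^ j" using assms(2) by (simp add: power_add[symmetric])
  have "2 ^ (L - j) \<le> l div 2 ^ j" using assms(1) unfolding eq
    by (simp add: less_eq_div_iff_mult_less_eq)
  moreover have "l div 2 ^ j < 2 * 2 ^ (L - j)" using assms(1) unfolding eq
    by (simp add: div_less_iff_less_mult mult.assoc)
  ultimately show ?thesis by simp
qed

lemma level_unique:
  assumes "v \<in> {2 ^ i..<2 * 2 ^ i :: nat}" "v \<in> {2 ^ j..<2 * 2 ^ j}"
  shows "i = j"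
proof (rule ccontr)
  assume "i \<noteq> j"
  then have "Suc i \<le> j \<or> Suc j \<le> i" by auto
  then have "(2::nat) * 2 ^ i \<le> 2 ^ j \<or> (2::nat) * 2 ^ j \<le> 2 ^ i"
    by (metis power_Suc power_increasing one_le_numeral)
  with assms show False by auto
qed

text \<open>Raising the mass of one leaf raises the counts on its path, and by monotonicity the counts
  off the path can only change by as much as the counts on the path do. This yields a constant
  expected change per level.\<close>

context
  fixes L l :: nat and S S' u :: "nat \<Rightarrow> real"
  assumes add: "\<And>v. 0 < v \<Longrightarrow> v < 2 ^ L \<Longrightarrow> S v = S (2 * v) + S (2 * v + 1)"
      "\<And>v. 0 < v \<Longrightarrow> v < 2 ^ L \<Longrightarrow> S' v = S' (2 * v) + S' (2 * v + 1)"
    and u: "\<And>v. 0 < u v \<and> u v < 1"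
    and l: "l \<in> {2 ^ L..<2 * 2 ^ L}"
    and le: "\<And>v. S v \<le> S' v"
    and off: "\<And>v. (\<forall>j. v \<noteq> l div 2 ^ j) \<Longrightarrow> S v = S' v"
begin

lemma path_parent: "l div 2 ^ j div 2 = l div 2 ^ Suc j"
  by (simp add: div_mult2_eq power_Suc2 del: power_Suc)

text \<open>An ancestor of a path node is again on the path, and the path meets each level only
  once; so nothing below a node off the path lies on it.\<close>

lemma off_path_desc:
  assumes "v \<in> {2 ^ (L - j)..<2 * 2 ^ (L - j)}" "j \<le> L" "v \<noteq> l div 2 ^ j" "w div 2 ^ i = v"
  shows "S w = S' w"
proof (rule off, intro allI notI)
  fix k assume "w = l div 2 ^ k"
  then have v: "v = l div 2 ^ (k + i)" using assms(4) by (simp add: div_mult2_eq power_add)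
  have "k + i \<le> L"
  proof (rule ccontr)
    assume "\<not> k + i \<le> L"
    then have "2 * 2 ^ L \<le> (2::nat) ^ (k + i)"
      by (metis power_Suc power_increasing one_le_numeral not_less_eq_eq)
    then have "v = 0" using v l by auto
    then show False using assms(1) by auto
  qed
  from path_level[OF l this] have "v \<in> {2 ^ (L - (k + i))..<2 * 2 ^ (L - (k + i))}" using v by simp
  from level_unique[OF assms(1) this] have "j = k + i" using \<open>k + i \<le> L\<close> assms(2) by simp
  then show False using v assms(3) by simp
qed

lemma path_node:
  assumes "Suc j \<le> L"
  shows "0 < l div 2 ^ Suc j" "l div 2 ^ Suc j < 2 ^ L"
proof -
  have "l div 2 ^ Suc j \<in> {2 ^ (L - Suc j)..<2 * 2 ^ (L - Suc j)}"
    by (rule path_level[OF l assms])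
  moreover have "(2::nat) * 2 ^ (L - Suc j) \<le> 2 ^ L" using assms
    by (metis Suc_diff_Suc Suc_le_eq diff_le_self power_Suc power_increasing one_le_numeral)
  ultimately show "0 < l div 2 ^ Suc j" "l div 2 ^ Suc j < 2 ^ L"
    by (auto intro: less_le_trans[OF zero_less_power] less_le_trans)
qed

lemma sibling:
  assumes "Suc j \<le> L"
  obtains s where "{l div 2 ^ j, s} = {2 * (l div 2 ^ Suc j), 2 * (l div 2 ^ Suc j) + 1}"
    "l div 2 ^ j \<noteq> s" "\<And>w i. w div 2 ^ i = s \<Longrightarrow> S w = S' w" "0 < s" "s < 2 * 2 ^ L"
proof -
  define w where "w = l div 2 ^ Suc j"
  define s where "s = (if even (l div 2 ^ j) then l div 2 ^ j + 1 else l div 2 ^ j - 1)"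
  have "l div 2 ^ j = 2 * w \<or> l div 2 ^ j = 2 * w + 1"
    using path_parent[of j] unfolding w_def by linarith
  moreover have sw: "s = 2 * w + 1 \<and> l div 2 ^ j = 2 * w \<or> s = 2 * w \<and> l div 2 ^ j = 2 * w + 1"
    using calculation by (auto simp: s_def)
  moreover have lev: "w \<in> {2 ^ (L - Suc j)..<2 * 2 ^ (L - Suc j)}"
    unfolding w_def by (rule path_level[OF l assms])
  have "(2::nat) ^ (L - j) = 2 * 2 ^ (L - Suc j)" using assms
    by (metis Suc_diff_Suc Suc_le_eq power_Suc)
  with lev sw have "s \<in> {2 ^ (L - j)..<2 * 2 ^ (L - j)}" by auto
  then have "S x = S' x" if "x div 2 ^ i = s" for x i
    using sw assms that by (intro off_path_desc[of s j x i]) auto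
  moreover have "0 < w" "w < 2 ^ L" using path_node[OF assms] by (auto simp: w_def)
  ultimately show ?thesis using that[of s] unfolding w_def[symmetric] by (auto simp: insert_commute)
qed

text \<open>Descends along the path from the root. The sibling keeps its mass, so the step to the
  path child is \<open>lsplit_mono_left\<close> or \<open>lsplit_mono_right\<close>, depending on
  its side.\<close>

lemma cnt_path_mono: "j \<le> L \<Longrightarrow> cnt u S (l div 2 ^ j) \<le> cnt u S' (l div 2 ^ j)"
proof (induction "L - j" arbitrary: j)
  case 0
  then have "j = L" by simp
  then have "l div 2 ^ j = 1" using path_level[OF l, of L] by auto
  moreover have "\<lfloor>S 1\<rfloor> + (if u 0 < frac (S 1) then 1 else 0)
      \<le> \<lfloor>S' 1\<rfloor> + (if u 0 < frac (S' 1) then 1 else 0)"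
  proof (cases "\<lfloor>S 1\<rfloor> = \<lfloor>S' 1\<rfloor>")
    case True
    then have "frac (S 1) \<le> frac (S' 1)" using le[of 1] by (simp add: frac_def)
    with True show ?thesis by auto
  next
    case False
    then show ?thesis using floor_mono[OF le[of 1]] by auto
  qed
  ultimately show ?case by (simp only: cnt_root)
next
  case (Suc d)
  then have j: "Suc j \<le> L" by simp
  define w where "w = l div 2 ^ Suc j"
  have IH: "cnt u S w \<le> cnt u S' w" unfolding w_def using Suc by (intro Suc.hyps) auto
  have w: "0 < w" "w < 2 ^ L" using path_node[OF j] by (auto simp: w_def)
  have val: "valid (S (2 * w) + S (2 * w + 1)) (cnt u S w)"
      "valid (S' (2 * w) + S' (2 * w + 1)) (cnt u S' w)"
    using cnt_valid[of "2 ^ L" S u w] cnt_valid[of "2 ^ L" S' u w] add u w by auto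
  obtain s where s: "{l div 2 ^ j, s} = {2 * w, 2 * w + 1}" "l div 2 ^ j \<noteq> s"
    "\<And>w i. w div 2 ^ i = s \<Longrightarrow> S w = S' w"
    using sibling[OF j] unfolding w_def by metis
  have eq: "S s = S' s" using s(3)[of s 0] by simp
  from s(1,2) consider "l div 2 ^ j = 2 * w" "s = 2 * w + 1" | "l div 2 ^ j = 2 * w + 1" "s = 2 * w"
    by (auto simp: doubleton_eq_iff)
  then show ?case
  proof cases
    case 1
    then show ?thesis using w eq le IH by (simp add: cnt_left lsplit_mono_left)
  next
    case 2
    then show ?thesis using w eq le IH val u
      by (simp add: cnt_left cnt_right lsplit_mono_right del: One_nat_def)
  qed
qed

text \<open>At a path node with difference d, let the path child have difference d'. Both are
  nonnegative, and the sibling has difference d - d'. By \<open>cnt_diff_off_path\<close> the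
  subtree of the sibling contributes its absolute value, at most d + d'. Summing up the path counts
  each lower path node twice and the top one once.\<close>

lemma cnt_path_diff:
  assumes "j \<le> L"
  shows "nsum (2 ^ L) (\<lambda>w. \<bar>cnt u S' w - cnt u S w\<bar>) (l div 2 ^ j)
     \<le> (cnt u S' (l div 2 ^ j) - cnt u S (l div 2 ^ j))
       + 2 * (\<Sum>i<j. cnt u S' (l div 2 ^ i) - cnt u S (l div 2 ^ i))"
  using assms
proof (induction j)
  case 0
  have "0 < l" using l by (auto intro: less_le_trans[OF zero_less_power])
  then show ?case using l cnt_path_mono[of 0] by (simp add: ntree_leaf)
next
  case (Suc j)
  define w where "w = l div 2 ^ Suc j"
  let ?d = "\<lambda>v. cnt u S' v - cnt u S v"
  let ?D = "nsum (2 ^ L) (\<lambda>w. \<bar>?d w\<bar>)"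
  have w: "0 < w" "w < 2 ^ L" using path_node[OF Suc.prems] by (auto simp: w_def)
  obtain s where s: "{l div 2 ^ j, s} = {2 * w, 2 * w + 1}" "l div 2 ^ j \<noteq> s"
    "\<And>w i. w div 2 ^ i = s \<Longrightarrow> S w = S' w" "0 < s" "s < 2 * 2 ^ L"
    using sibling[OF Suc.prems] unfolding w_def by metis
  from s(1,2) have cases: "l div 2 ^ j = 2 * w \<and> s = 2 * w + 1 \<or> l div 2 ^ j = 2 * w + 1 \<and> s = 2 * w"
    by (auto simp: doubleton_eq_iff)
  have "?D w = ?D (l div 2 ^ j) + ?D s"
    using cases w by (auto simp: ntree_node)
  moreover have d: "?d s = ?d w - ?d (l div 2 ^ j)"
    using cases w by (auto simp: cnt_right simp del: One_nat_def Suc_eq_plus1 add_Suc_right)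
  moreover have "?D s = \<bar>?d s\<bar>"
  proof (cases "cnt u S s \<le> cnt u S' s")
    case True
    then show ?thesis using s add u by (subst cnt_diff_off_path[where M = "2 ^ L"]) auto
  next
    \<comment> \<open>The sibling may also lose units to the path child; the off-path lemma then
      applies with the two mass functions exchanged.\<close>
    case False
    then have "nsum (2 ^ L) (\<lambda>w. \<bar>cnt u S w - cnt u S' w\<bar>) s = cnt u S s - cnt u S' s"
      using s add u by (intro cnt_diff_off_path[where M = "2 ^ L"]) auto
    then show ?thesis using False by (simp add: abs_minus_commute)
  qed
  moreover have "0 \<le> ?d w" "0 \<le> ?d (l div 2 ^ j)"
    using cnt_path_mono[of "Suc j"] cnt_path_mono[of j] Suc.prems by (auto simp: w_def)
  moreover have "?D (l div 2 ^ j) \<le> ?d (l div 2 ^ j) + 2 * (\<Sum>i<j. ?d (l div 2 ^ i))"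
    using Suc by simp
  ultimately show ?case unfolding w_def[symmetric] by (simp add: algebra_simps)
qed

end

section \<open>Program verification\<close>

text \<open>Total correctness together with upper bounds on the costs; upper bounds rather than
  exact costs allow branches and loops to be composed by weakening.\<close>

definition reach ::
    "(nat \<Rightarrow> real) \<Rightarrow> com \<Rightarrow> state \<Rightarrow> (state \<Rightarrow> bool) \<Rightarrow> nat \<Rightarrow> nat \<Rightarrow> bool" where
  "reach \<omega> c s Q W T \<longleftrightarrow> (\<exists>s' w d. run \<omega> c s s' w d \<and> Q s' \<and> w \<le> W \<and> d \<le> T)"

lemma reach_conseq:
  assumes "reach \<omega> c s P W T" "\<And>s'. P s' \<Longrightarrow> Q s'" "W \<le> W'" "T \<le> T'"
  shows "reach \<omega> c s Q W' T'"
  using assms unfolding reach_def by (meson order_trans)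

lemma reach_Seq:
  assumes "reach \<omega> c1 s P W1 T1" "\<And>s'. P s' \<Longrightarrow> reach \<omega> c2 s' Q W2 T2"
  shows "reach \<omega> (Seq c1 c2) s Q (W1 + W2) (T1 + T2)"
  using assms unfolding reach_def by (meson run_Seq add_mono)

lemma reach_ISet:
  "Q (s\<lparr>ivar := (ivar s)(v := ival \<omega> s e)\<rparr>) \<Longrightarrow> reach \<omega> (ISet v e) s Q 1 1"
  unfolding reach_def using run_ISet by blast

lemma reach_Cond:
  assumes "bval \<omega> s b \<Longrightarrow> reach \<omega> c1 s Q W T" "\<not> bval \<omega> s b \<Longrightarrow> reach \<omega> c2 s Q W T"
  shows "reach \<omega> (Cond b c1 c2) s Q (1 + W) (1 + T)"
  using assms unfolding reach_def by (meson run_CondTrue run_CondFalse add_left_mono)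

text \<open>Apart from the writes at the ends of slots, all parallel steps write to consecutive
  cells, for which the simultaneous update has this closed form.\<close>

lemma scatter_add:
  "scatter m (\<lambda>i. b + i) t f = (\<lambda>j. if b \<le> j \<and> j < b + m then t (j - b) else f j)"
proof
  fix j
  have inj: "inj_on (\<lambda>i. b + i) {..<m}" by (auto simp: inj_on_def)
  have img: "(\<lambda>i. b + i) ` {..<m} = {b..<b + m}"
  proof (intro equalityI subsetI)
    fix j assume "j \<in> {b..<b + m}"
    then have "j - b < m" "j = b + (j - b)" by auto
    then show "j \<in> (\<lambda>i. b + i) ` {..<m}" by blast
  qed auto
  have "inv_into {..<m} (\<lambda>i. b + i) j = j - b" if "b \<le> j" "j < b + m"
    using that by (intro inv_into_f_eq[OF inj]) auto
  then show "scatter m (\<lambda>i. b + i) t f j = (if b \<le> j \<and> j < b + m then t (j - b) else f j)"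
    unfolding scatter_def img by auto
qed

lemma scatter_ident: "scatter m (\<lambda>i. i) t f = (\<lambda>j. if j < m then t j else f j)"
  using scatter_add[of m 0 t f] by (simp cong: if_cong)

lemma with_index_simps [simp]:
  "ivar (with_index s v i) = (ivar s)(v := i)" "rvar (with_index s v i) = rvar s"
  "iarr (with_index s v i) = iarr s" "rarr (with_index s v i) = rarr s"
  by (simp_all add: with_index_def)

section \<open>Symbolic execution of straight-line code\<close>

primrec straight :: "com \<Rightarrow> bool" where
  "straight Skip \<longleftrightarrow> False"
| "straight (ISet v e) \<longleftrightarrow> True"
| "straight (RSet v e) \<longleftrightarrow> True"
| "straight (IPar v e a p t) \<longleftrightarrow> True"
| "straight (RPar v e a p t) \<longleftrightarrow> True"
| "straight (Seq c1 c2) \<longleftrightarrow> straight c1 \<and> straight c2"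
| "straight (Cond b c1 c2) \<longleftrightarrow> False"
| "straight (While b c) \<longleftrightarrow> False"

text \<open>Makes straight-line code computable by the simplifier instead of by inversion of
  \<open>run\<close>. The clauses for branches and loops, here and in the next functions, are
  placeholders guarded by \<open>straight\<close>.\<close>

primrec exec :: "(nat \<Rightarrow> real) \<Rightarrow> com \<Rightarrow> state \<Rightarrow> state" where
  "exec \<omega> Skip s = s"
| "exec \<omega> (ISet v e) s = s\<lparr>ivar := (ivar s)(v := ival \<omega> s e)\<rparr>"
| "exec \<omega> (RSet v e) s = s\<lparr>rvar := (rvar s)(v := rval \<omega> s e)\<rparr>"
| "exec \<omega> (IPar v e a p t) s = s\<lparr>iarr := (iarr s)(a := scatter (ival \<omega> s e)
     (\<lambda>i. ival \<omega> (with_index s v i) p) (\<lambda>i. ival \<omega> (with_index s v i) t) (iarr s a))\<rparr>"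
| "exec \<omega> (RPar v e a p t) s = s\<lparr>rarr := (rarr s)(a := scatter (ival \<omega> s e)
     (\<lambda>i. ival \<omega> (with_index s v i) p) (\<lambda>i. rval \<omega> (with_index s v i) t) (rarr s a))\<rparr>"
| "exec \<omega> (Seq c1 c2) s = exec \<omega> c2 (exec \<omega> c1 s)"
| "exec \<omega> (Cond b c1 c2) s = s"
| "exec \<omega> (While b c) s = s"

primrec conflict_free :: "(nat \<Rightarrow> real) \<Rightarrow> com \<Rightarrow> state \<Rightarrow> bool" where
  "conflict_free \<omega> Skip s \<longleftrightarrow> True"
| "conflict_free \<omega> (ISet v e) s \<longleftrightarrow> True"
| "conflict_free \<omega> (RSet v e) s \<longleftrightarrow> True"
| "conflict_free \<omega> (IPar v e a p t) s \<longleftrightarrow>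
     inj_on (\<lambda>i. ival \<omega> (with_index s v i) p) {..<ival \<omega> s e}"
| "conflict_free \<omega> (RPar v e a p t) s \<longleftrightarrow>
     inj_on (\<lambda>i. ival \<omega> (with_index s v i) p) {..<ival \<omega> s e}"
| "conflict_free \<omega> (Seq c1 c2) s \<longleftrightarrow> conflict_free \<omega> c1 s \<and> conflict_free \<omega> c2 (exec \<omega> c1 s)"
| "conflict_free \<omega> (Cond b c1 c2) s \<longleftrightarrow> True"
| "conflict_free \<omega> (While b c) s \<longleftrightarrow> True"

primrec work :: "(nat \<Rightarrow> real) \<Rightarrow> com \<Rightarrow> state \<Rightarrow> nat" where
  "work \<omega> Skip s = 1"
| "work \<omega> (ISet v e) s = 1"
| "work \<omega> (RSet v e) s = 1"
| "work \<omega> (IPar v e a p t) s = 1 + ival \<omega> s e"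
| "work \<omega> (RPar v e a p t) s = 1 + ival \<omega> s e"
| "work \<omega> (Seq c1 c2) s = work \<omega> c1 s + work \<omega> c2 (exec \<omega> c1 s)"
| "work \<omega> (Cond b c1 c2) s = 0"
| "work \<omega> (While b c) s = 0"

primrec depth :: "com \<Rightarrow> nat" where
  "depth Skip = 1"
| "depth (ISet v e) = 1"
| "depth (RSet v e) = 1"
| "depth (IPar v e a p t) = 1"
| "depth (RPar v e a p t) = 1"
| "depth (Seq c1 c2) = depth c1 + depth c2"
| "depth (Cond b c1 c2) = 0"
| "depth (While b c) = 0"

lemma run_exec:
  "straight c \<Longrightarrow> conflict_free \<omega> c s \<Longrightarrow> run \<omega> c s (exec \<omega> c s) (work \<omega> c s) (depth c)"
proof (induction c arbitrary: s)
  case (IPar v e a p t)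
  then show ?case using run_IPar[OF refl refl refl] by simp
next
  case (RPar v e a p t)
  then show ?case using run_RPar[OF refl refl refl] by simp
qed (auto intro: run_ISet[unfolded One_nat_def] run_RSet[unfolded One_nat_def] run_Seq)

lemma reach_exec:
  assumes "straight c" "conflict_free \<omega> c s" "Q (exec \<omega> c s)" "work \<omega> c s \<le> W" "depth c \<le> T"
  shows "reach \<omega> c s Q W T"
  using run_exec[OF assms(1,2)] assms(3-) unfolding reach_def by blast

lemma reach_exec_Seq:
  assumes "straight c1" "conflict_free \<omega> c1 s" "reach \<omega> c2 (exec \<omega> c1 s) Q W T"
    "work \<omega> c1 s + W \<le> W'" "depth c1 + T \<le> T'"
  shows "reach \<omega> (Seq c1 c2) s Q W' T'"
proof (rule reach_conseq[OF reach_Seq])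
  show "reach \<omega> c1 s (\<lambda>s'. s' = exec \<omega> c1 s) (work \<omega> c1 s) (depth c1)"
    using assms(1,2) by (intro reach_exec) auto
qed (use assms in auto)

text \<open>The invariant carries the number of completed rounds and the number of rounds is known
  beforehand, so termination needs no measure. Each round pays one unit for the test, and one more
  unit pays for the failing test.\<close>

lemma reach_While:
  assumes "I 0 s"
    and step: "\<And>j s. j < J \<Longrightarrow> I j s \<Longrightarrow> bval \<omega> s b \<and> reach \<omega> c s (I (Suc j)) (w j) D"
    and exit: "\<And>s. I J s \<Longrightarrow> \<not> bval \<omega> s b"
  shows "reach \<omega> (While b c) s (I J) (1 + (\<Sum>j<J. 1 + w j)) (1 + J * (1 + D))"
proof -
  have "reach \<omega> (While b c) s (I J) (1 + (\<Sum>j\<in>{j0..<J}. 1 + w j)) (1 + (J - j0) * (1 + D))"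
    if "j0 \<le> J" "I j0 s" for j0 s
    using that
  proof (induction "J - j0" arbitrary: j0 s)
    case 0
    then have "j0 = J" by simp
    then show ?case using exit[of s] 0 run_WhileFalse[of \<omega> s b c] unfolding reach_def by auto
  next
    case (Suc d)
    then have j: "j0 < J" by simp
    from step[OF this Suc.prems(2)] obtain s1 w1 d1 where
      1: "bval \<omega> s b" "run \<omega> c s s1 w1 d1" "I (Suc j0) s1" "w1 \<le> w j0" "d1 \<le> D"
      unfolding reach_def by blast
    have "reach \<omega> (While b c) s1 (I J) (1 + (\<Sum>j\<in>{Suc j0..<J}. 1 + w j)) (1 + (J - Suc j0) * (1 + D))"
      using Suc.hyps(2) j 1 by (intro Suc.hyps(1)) auto
    then obtain s2 w2 d2 where
      2: "run \<omega> (While b c) s1 s2 w2 d2" "I J s2" "w2 \<le> 1 + (\<Sum>j\<in>{Suc j0..<J}. 1 + w j)"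
        "d2 \<le> 1 + (J - Suc j0) * (1 + D)"
      unfolding reach_def by blast
    have "1 + w1 + w2 \<le> 1 + (\<Sum>j\<in>{j0..<J}. 1 + w j)"
      using 1 2 j by (simp add: sum.atLeast_Suc_lessThan)
    moreover have "J - j0 = Suc (J - Suc j0)" using j by simp
    then have "1 + d1 + d2 \<le> 1 + (J - j0) * (1 + D)" using 1 2 by simp
    ultimately show ?case using run_WhileTrue[OF 1(1,2) 2(1)] 2(2) unfolding reach_def by blast
  qed
  from this[of 0] assms(1) show ?thesis by (simp add: atLeast0LessThan)
qed

section \<open>Frame conditions\<close>

primrec mod_ivar :: "com \<Rightarrow> vname set" where
  "mod_ivar Skip = {}"
| "mod_ivar (ISet v e) = {v}"
| "mod_ivar (RSet v e) = {}"
| "mod_ivar (IPar v e a p t) = {}"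
| "mod_ivar (RPar v e a p t) = {}"
| "mod_ivar (Seq c1 c2) = mod_ivar c1 \<union> mod_ivar c2"
| "mod_ivar (Cond b c1 c2) = mod_ivar c1 \<union> mod_ivar c2"
| "mod_ivar (While b c) = mod_ivar c"

primrec mod_iarr :: "com \<Rightarrow> vname set" where
  "mod_iarr Skip = {}"
| "mod_iarr (ISet v e) = {}"
| "mod_iarr (RSet v e) = {}"
| "mod_iarr (IPar v e a p t) = {a}"
| "mod_iarr (RPar v e a p t) = {}"
| "mod_iarr (Seq c1 c2) = mod_iarr c1 \<union> mod_iarr c2"
| "mod_iarr (Cond b c1 c2) = mod_iarr c1 \<union> mod_iarr c2"
| "mod_iarr (While b c) = mod_iarr c"

primrec mod_rarr :: "com \<Rightarrow> vname set" where
  "mod_rarr Skip = {}"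
| "mod_rarr (ISet v e) = {}"
| "mod_rarr (RSet v e) = {}"
| "mod_rarr (IPar v e a p t) = {}"
| "mod_rarr (RPar v e a p t) = {a}"
| "mod_rarr (Seq c1 c2) = mod_rarr c1 \<union> mod_rarr c2"
| "mod_rarr (Cond b c1 c2) = mod_rarr c1 \<union> mod_rarr c2"
| "mod_rarr (While b c) = mod_rarr c"

definition frame :: "com \<Rightarrow> state \<Rightarrow> state \<Rightarrow> bool" where
  "frame c s s' \<longleftrightarrow> (\<forall>v. v \<notin> mod_ivar c \<longrightarrow> ivar s' v = ivar s v) \<and>
     (\<forall>a. a \<notin> mod_iarr c \<longrightarrow> iarr s' a = iarr s a) \<and>
     (\<forall>a. a \<notin> mod_rarr c \<longrightarrow> rarr s' a = rarr s a)"

lemma run_frame: "run \<omega> c s s' w d \<Longrightarrow> frame c s s'"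
  by (induction rule: run.induct) (auto simp: frame_def)

abbreviation rone :: rexp where "rone \<equiv> ROfNat (IConst 1)"

text \<open>Nonnegative reals are kept as pairs of an integral and a fractional part, since the machine has
  no rounding.\<close>

abbreviation icarry :: "rexp \<Rightarrow> rexp \<Rightarrow> iexp" where
  "icarry e f \<equiv> IIf (RLess (RAdd e f) rone) (IConst 0) (IConst 1)"

abbreviation rcarry :: "rexp \<Rightarrow> rexp \<Rightarrow> rexp" where
  "rcarry e f \<equiv> RIf (RLess (RAdd e f) rone) (RAdd e f) (RSub (RAdd e f) rone)"

lemma inj_on_offset [simp]: "inj_on (\<lambda>i::nat. b + i) A" "inj_on (\<lambda>i::nat. i) A"
  by (auto simp: inj_on_def)

lemmas exec_simps = scatter_add scatter_ident

lemma sum_work: "(\<Sum>j<J. 1 + (a + b * 2 ^ j)) \<le> J * (1 + a) + b * 2 ^ J" for a b :: nat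
  by (induction J) (auto simp: algebra_simps)

lemma less_doubling: "j < p \<Longrightarrow> (2::nat) * 2 ^ j \<le> 2 ^ p"
  by (metis Suc_leI power_Suc power_increasing one_le_numeral)

text \<open>A loop over doubling widths costs linear work in the last width and logarithmic depth.\<close>

lemma reach_doubling:
  assumes I0: "I 0 s"
    and step: "\<And>j s. j < J \<Longrightarrow> I j s \<Longrightarrow> bval \<omega> s b \<and> reach \<omega> c s (I (Suc j)) (a + d * 2 ^ j) D"
    and exit: "\<And>s. I J s \<Longrightarrow> \<not> bval \<omega> s b"
  shows "reach \<omega> (While b c) s (I J) ((2 + a + d) * 2 ^ J) (1 + J * (1 + D))"
proof (rule reach_conseq[OF reach_While[where w = "\<lambda>j. a + d * 2 ^ j", OF I0 step exit]])
  have "(\<Sum>j<J. 1 + (a + d * 2 ^ j)) \<le> J * (1 + a) + d * 2 ^ J" by (rule sum_work)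
  moreover have "J * (1 + a) \<le> 2 ^ J * (1 + a)" using less_exp[of J] by (intro mult_right_mono) auto
  moreover have "(1::nat) \<le> 2 ^ J" by simp
  moreover have "(2 + a + d) * 2 ^ J = 2 ^ J + 2 ^ J * (1 + a) + d * 2 ^ J"
    by (simp add: algebra_simps)
  ultimately show "1 + (\<Sum>j<J. 1 + (a + d * 2 ^ j)) \<le> (2 + a + d) * 2 ^ J" by linarith
qed auto

text \<open>The widths form the same geometric sum as in \<open>reach_doubling\<close>, read
  backwards.\<close>

lemma reach_halving:
  assumes I0: "I 0 s"
    and step: "\<And>j s. j < J \<Longrightarrow> I j s \<Longrightarrow> bval \<omega> s b \<and> reach \<omega> c s (I (Suc j)) (a + d * 2 ^ (J - Suc j)) D"
    and exit: "\<And>s. I J s \<Longrightarrow> \<not> bval \<omega> s b"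
  shows "reach \<omega> (While b c) s (I J) ((2 + a + d) * 2 ^ J) (1 + J * (1 + D))"
proof (rule reach_conseq[OF reach_While[where w = "\<lambda>j. a + d * 2 ^ (J - Suc j)", OF I0 step exit]])
  have "(\<Sum>j<J. 1 + (a + d * 2 ^ (J - Suc j))) = (\<Sum>j<J. 1 + (a + d * 2 ^ j))"
    by (rule sum.nat_diff_reindex)
  also have "\<dots> \<le> J * (1 + a) + d * 2 ^ J" by (rule sum_work)
  finally have "(\<Sum>j<J. 1 + (a + d * 2 ^ (J - Suc j))) \<le> J * (1 + a) + d * 2 ^ J" .
  moreover have "J * (1 + a) \<le> 2 ^ J * (1 + a)" using less_exp[of J] by (intro mult_right_mono) auto
  moreover have "(1::nat) \<le> 2 ^ J" by simp
  moreover have "(2 + a + d) * 2 ^ J = 2 ^ J + 2 ^ J * (1 + a) + d * 2 ^ J"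
    by (simp add: algebra_simps)
  ultimately show "1 + (\<Sum>j<J. 1 + (a + d * 2 ^ (J - Suc j))) \<le> (2 + a + d) * 2 ^ J" by linarith
qed auto

abbreviation iv :: iexp where "iv \<equiv> IVar ''i''"

subsection \<open>Offsets within blocks\<close>

text \<open>Tabulates i mod m and (i div m) T by doubling, since the machine has neither
  multiplication nor division of integers. The upper half of the table copies the lower half; once P
  has reached m, it adds S, which is T times the number of blocks already covered.\<close>

definition index_body :: com where
  "index_body =
     Seq (IPar ''i'' (IVar ''P'') ''rr'' (IAdd (IVar ''P'') iv)
        (IIf (ILess (IVar ''P'') (IVar ''m'')) (IAdd (IVar ''P'') iv) (IAt ''rr'' iv)))
     (Seq (IPar ''i'' (IVar ''P'') ''sb'' (IAdd (IVar ''P'') iv)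
        (IIf (ILess (IVar ''P'') (IVar ''m'')) (IConst 0) (IAdd (IAt ''sb'' iv) (IVar ''S''))))
     (Seq (ISet ''S'' (IIf (ILess (IVar ''P'') (IVar ''m'')) (IVar ''S'') (IAdd (IVar ''S'') (IVar ''S''))))
     (ISet ''P'' (IAdd (IVar ''P'') (IVar ''P'')))))"

definition index_com :: com where
  "index_com = Seq (Seq (ISet ''P'' (IConst 1)) (ISet ''S'' (IVar ''T'')))
     (While (ILess (IVar ''P'') (IVar ''N'')) index_body)"

lemma reach_index:
  assumes s: "ivar s ''N'' = 2 ^ p" "ivar s ''m'' = 2 ^ r" "ivar s ''T'' = T" "r \<le> p"
    "iarr s ''rr'' 0 = 0" "iarr s ''sb'' 0 = 0"
  shows "reach \<omega> index_com s
    (\<lambda>s'. \<forall>i<2 ^ p. iarr s' ''rr'' i = i mod 2 ^ r \<and> iarr s' ''sb'' i = i div 2 ^ r * T)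
    (12 * 2 ^ p) (3 + 5 * p)"
proof -
  define I where "I j s \<longleftrightarrow> ivar s ''N'' = 2 ^ p \<and> ivar s ''m'' = 2 ^ r \<and> ivar s ''P'' = 2 ^ j \<and>
      ivar s ''S'' = T * 2 ^ (j - r) \<and>
      (\<forall>i<2 ^ j. iarr s ''rr'' i = i mod 2 ^ r \<and> iarr s ''sb'' i = i div 2 ^ r * T)" for j and s :: state
  have step: "bval \<omega> s (ILess (IVar ''P'') (IVar ''N'')) \<and>
      reach \<omega> index_body s (I (Suc j)) (4 + 2 * 2 ^ j) 4" if j: "j < p" and I: "I j s" for j s
  proof
    show "bval \<omega> s (ILess (IVar ''P'') (IVar ''N''))" using I j by (simp add: I_def)
    have idx: "(if i < 2 ^ j then i else (2 ^ j + (i - 2 ^ j))) = i" if "i < 2 * 2 ^ j" for i :: nat by simp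
    \<comment> \<open>While 2^j is below the block length, all positions concerned lie in block 0.
      Afterwards i and i - 2^j are exactly \<open>2 ^ (j - r)\<close> whole blocks apart.\<close>
    have new: "(if j < r then i else (i - 2 ^ j) mod 2 ^ r) = i mod 2 ^ r"
        "(if j < r then 0 else (i - 2 ^ j) div 2 ^ r * T + T * 2 ^ (j - r)) = i div 2 ^ r * T"
      if i: "2 ^ j \<le> i" "i < 2 * 2 ^ j" for i :: nat
    proof -
      have *: "i < 2 ^ r" if "j < r" using i less_doubling[OF that] by simp
      have "i = (i - 2 ^ j) + 2 ^ (j - r) * 2 ^ r" if "\<not> j < r"
        using i that by (simp add: power_add[symmetric])
      then have "i mod 2 ^ r = (i - 2 ^ j) mod 2 ^ r \<and> i div 2 ^ r = (i - 2 ^ j) div 2 ^ r + 2 ^ (j - r)"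
        if "\<not> j < r" using that by (metis mod_mult_self1 div_mult_self1 power_not_zero zero_neq_numeral add.commute)
      with * show "(if j < r then i else (i - 2 ^ j) mod 2 ^ r) = i mod 2 ^ r"
        "(if j < r then 0 else (i - 2 ^ j) div 2 ^ r * T + T * 2 ^ (j - r)) = i div 2 ^ r * T"
        by (auto simp: algebra_simps)
    qed
    show "reach \<omega> index_body s (I (Suc j)) (4 + 2 * 2 ^ j) 4"
    proof (rule reach_exec)
      show "I (Suc j) (exec \<omega> index_body s)"
        using I new[symmetric] unfolding I_def index_body_def
        by (auto simp: exec_simps Suc_diff_le not_less mult.commute)
    qed (use I in \<open>auto simp: I_def index_body_def\<close>)
  qed
  have "reach \<omega> index_com s (I p) (12 * 2 ^ p) (3 + 5 * p)"
    unfolding index_com_def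
    by (rule reach_exec_Seq[OF _ _ reach_doubling[OF _ step]]) (use s in \<open>auto simp: I_def\<close>)
  then show ?thesis by (rule reach_conseq) (auto simp: I_def)
qed

subsection \<open>Random shifts\<close>

text \<open>Extracts the leading l binary digits of each variate: the carry in doubling u is the
  next digit, and H is its weight. Because H ends at m, the result is m times the floor of 2^l times
  the variate, obtained without rounding or multiplication.\<close>

definition shift_body :: com where
  "shift_body =
     Seq (ISet ''H'' (IHalf (IVar ''H'')))
     (Seq (IPar ''i'' (IVar ''m'') ''sg'' iv
        (IIf (RLess (RAdd (RAt ''u'' iv) (RAt ''u'' iv)) rone) (IAt ''sg'' iv) (IAdd (IAt ''sg'' iv) (IVar ''H''))))
     (RPar ''i'' (IVar ''m'') ''u'' iv (rcarry (RAt ''u'' iv) (RAt ''u'' iv))))"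

definition shift_com :: com where
  "shift_com = Seq (Seq (RPar ''i'' (IVar ''m'') ''u'' iv (RRand (IAdd (IAdd iv iv) (IAdd iv iv))))
       (ISet ''H'' (IVar ''N'')))
     (While (ILess (IVar ''m'') (IVar ''H'')) shift_body)"

lemma floor_add_nat:
  fixes x y :: real
  assumes "0 \<le> x" "0 \<le> y"
  shows "nat \<lfloor>x + y\<rfloor> = nat \<lfloor>x\<rfloor> + nat \<lfloor>y\<rfloor> + (if frac x + frac y < 1 then 0 else 1)"
    "frac (x + y) = (if frac x + frac y < 1 then frac x + frac y else frac x + frac y - 1)"
  using assms by (auto simp: floor_add_frac nat_add_distrib)

lemma floor_double:
  fixes u :: real
  assumes "0 \<le> u"
  shows "nat \<lfloor>2 * u\<rfloor> = 2 * nat \<lfloor>u\<rfloor> + (if 2 * frac u < 1 then 0 else 1)"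
    "frac (2 * u) = (if 2 * frac u < 1 then 2 * frac u else 2 * frac u - 1)"
  using floor_add_nat[OF assms assms] by simp_all

lemma reach_shift:
  assumes s: "ivar s ''N'' = 2 ^ p" "ivar s ''m'' = 2 ^ (p - l)" "l \<le> p"
    "\<And>i. iarr s ''sg'' i = 0" and \<omega>: "\<And>i. 0 < \<omega> i \<and> \<omega> i < 1"
  shows "reach \<omega> shift_com s
    (\<lambda>s'. \<forall>r<2 ^ (p - l). iarr s' ''sg'' r = 2 ^ (p - l) * nat \<lfloor>2 ^ l * \<omega> (4 * r)\<rfloor>)
    (12 * 2 ^ p) (3 + 5 * p)"
proof -
  define m :: nat where "m = 2 ^ (p - l)"
  define I where "I j s \<longleftrightarrow> ivar s ''m'' = m \<and> ivar s ''H'' = 2 ^ (p - j) \<and>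
      (\<forall>r<m. iarr s ''sg'' r = 2 ^ (p - j) * nat \<lfloor>2 ^ j * \<omega> (4 * r)\<rfloor> \<and>
        rarr s ''u'' r = frac (2 ^ j * \<omega> (4 * r)))" for j and s :: state
  have step: "bval \<omega> s (ILess (IVar ''m'') (IVar ''H'')) \<and>
      reach \<omega> shift_body s (I (Suc j)) (3 + 2 * m) 3" if j: "j < l" and I: "I j s" for j s
  proof
    have "p - j = Suc (p - Suc j)" using j s(3) by simp
    then have half: "(2::nat) ^ (p - j) = 2 * 2 ^ (p - Suc j)" by simp
    have "p - l < p - j" using j s(3) by simp
    then have "(2::nat) ^ (p - l) < 2 ^ (p - j)" by (rule power_strict_increasing) simp
    then show "bval \<omega> s (ILess (IVar ''m'') (IVar ''H''))" using I by (simp add: I_def m_def)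
    have nn: "0 \<le> 2 ^ j * \<omega> i" for i using \<omega>[of i] by simp
    show "reach \<omega> shift_body s (I (Suc j)) (3 + 2 * m) 3"
    proof (rule reach_exec)
      show "I (Suc j) (exec \<omega> shift_body s)"
        using I unfolding I_def shift_body_def
        by (simp add: exec_simps floor_double[OF nn] half algebra_simps cong: if_cong)
    qed (use I in \<open>auto simp: I_def shift_body_def\<close>)
  qed
  have eq4: "r + r + (r + r) = r * 4" for r :: nat by simp
  have fr: "\<lfloor>\<omega> i\<rfloor> = 0" "frac (\<omega> i) = \<omega> i" for i
    using \<omega>[of i] by (auto simp: floor_eq_iff frac_eq)
  have exit: "\<not> bval \<omega> s (ILess (IVar ''m'') (IVar ''H''))" if "I l s" for s
    using that by (simp add: I_def m_def)
  \<comment> \<open>Although all m rows are touched in each of the l rounds, the work stays linear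
    because l m is at most 2^l m, that is 2^p.\<close>
  have "l * (4 + 2 * m) \<le> 6 * 2 ^ p"
  proof -
    have "l * m \<le> 2 ^ l * 2 ^ (p - l)" unfolding m_def using less_exp[of l] by (intro mult_right_mono) auto
    then have "l * m \<le> 2 ^ p" using s(3) by (simp add: power_add[symmetric])
    moreover have "l \<le> 2 ^ p" using less_exp[of p] s(3) by linarith
    ultimately show ?thesis by (simp add: algebra_simps)
  qed
  moreover have "m \<le> 2 ^ p" "(1::nat) \<le> 2 ^ p" by (simp_all add: m_def)
  ultimately have W: "2 + m + (1 + l * (4 + 2 * m)) \<le> 12 * 2 ^ p" by linarith
  have "reach \<omega> shift_com s (I l) (12 * 2 ^ p) (3 + 5 * p)"
    unfolding shift_com_def
    by (rule reach_exec_Seq[OF _ _ reach_While[where I = I and J = l and w = "\<lambda>_. 3 + 2 * m", OF _ step exit]])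
       (use s W in \<open>auto simp: I_def m_def exec_simps fr mult.commute eq4\<close>)
  then show ?thesis using s(3) by (elim reach_conseq) (auto simp: I_def m_def)
qed

subsection \<open>Bottom-up sums\<close>

definition upsweep_body :: "vname \<Rightarrow> vname \<Rightarrow> com" where
  "upsweep_body q f =
     (let v = IAdd (IVar ''W'') iv; a = IAdd v v; b = IAdd a (IConst 1) in
      Seq (ISet ''W'' (IHalf (IVar ''W'')))
      (Seq (IPar ''i'' (IVar ''W'') q v (IAdd (IAdd (IAt q a) (IAt q b)) (icarry (RAt f a) (RAt f b))))
      (RPar ''i'' (IVar ''W'') f v (rcarry (RAt f a) (RAt f b)))))"

text \<open>The pass stops at width \<open>lo\<close>: at the roots of the blocks when prefix sums
  within blocks are wanted, at the root of the tree for the masses of the slots.\<close>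

definition upsweep :: "vname \<Rightarrow> vname \<Rightarrow> iexp \<Rightarrow> iexp \<Rightarrow> com" where
  "upsweep q f hi lo = Seq (ISet ''W'' hi) (While (ILess lo (IVar ''W'')) (upsweep_body q f))"

definition repr :: "(nat \<Rightarrow> nat) \<Rightarrow> (nat \<Rightarrow> real) \<Rightarrow> nat \<Rightarrow> real \<Rightarrow> bool" where
  "repr q f v x \<longleftrightarrow> q v = nat \<lfloor>x\<rfloor> \<and> f v = frac x"

text \<open>The bound \<open>lo\<close> is an expression evaluated again in each round; hence its
  value is required in all states that agree with \<open>s\<close> on the integer scalars other than
  the loop width.\<close>

lemma reach_upsweep:
  assumes hi: "ival \<omega> s hi = 2 ^ L"
    and lo: "\<And>s'. (\<forall>v. v \<noteq> ''W'' \<longrightarrow> ivar s' v = ivar s v) \<Longrightarrow> ival \<omega> s' lo = 2 ^ l"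
    and l: "l \<le> L"
    and leaf: "\<And>v. 2 ^ L \<le> v \<Longrightarrow> v < 2 * 2 ^ L \<Longrightarrow> repr (iarr s q) (rarr s f) v (lf v)"
    and nn: "\<And>v. 0 \<le> lf v"
  shows "reach \<omega> (upsweep q f hi lo) s
    (\<lambda>s'. \<forall>v\<in>{2 ^ l..<2 * 2 ^ L}. repr (iarr s' q) (rarr s' f) v (nsum (2 ^ L) lf v))
    (8 * 2 ^ L) (2 + 4 * L)"
proof -
  define I where "I j s' \<longleftrightarrow> (\<forall>v. v \<noteq> ''W'' \<longrightarrow> ivar s' v = ivar s v) \<and> ivar s' ''W'' = 2 ^ (L - j) \<and>
      (\<forall>v\<in>{2 ^ (L - j)..<2 * 2 ^ L}. repr (iarr s' q) (rarr s' f) v (nsum (2 ^ L) lf v))" for j and s' :: state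
  have nn': "0 \<le> nsum (2 ^ L) lf v" for v by (rule nsum_nonneg[OF nn])
  have step: "bval \<omega> s' (ILess lo (IVar ''W'')) \<and>
      reach \<omega> (upsweep_body q f) s' (I (Suc j)) (3 + 2 * 2 ^ (L - Suc j)) 3"
    if j: "j < L - l" and I: "I j s'" for j s'
  proof
    have "L - j = Suc (L - Suc j)" using j by simp
    then have half: "(2::nat) ^ (L - j) = 2 * 2 ^ (L - Suc j)" by simp
    have "l < L - j" using j by simp
    then have "(2::nat) ^ l < 2 ^ (L - j)" by (rule power_strict_increasing) simp
    then show "bval \<omega> s' (ILess lo (IVar ''W''))" using I lo[of s'] by (simp add: I_def)
    define w :: nat where "w = 2 ^ (L - Suc j)"
    have w: "0 < w" "2 * w \<le> 2 ^ L" using j less_doubling[of "L - Suc j" L] by (auto simp: w_def)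
    have node: "nsum (2 ^ L) lf v = nsum (2 ^ L) lf (2 * v) + nsum (2 ^ L) lf (2 * v + 1)"
      if "w \<le> v" "v < 2 * w" for v
      using that w by (intro ntree_node) auto
    have r: "repr (iarr s' q) (rarr s' f) v (nsum (2 ^ L) lf v)" if "2 * w \<le> v" "v < 2 * 2 ^ L" for v
      using I that unfolding I_def half w_def[symmetric] by simp
    show "reach \<omega> (upsweep_body q f) s' (I (Suc j)) (3 + 2 * 2 ^ (L - Suc j)) 3"
    proof (rule reach_exec)
      let ?e = "exec \<omega> (upsweep_body q f) s'"
      have e: "ivar ?e = (ivar s')(''W'' := w)"
        "iarr ?e q = (\<lambda>v. if w \<le> v \<and> v < 2 * w then iarr s' q (2 * v) + iarr s' q (2 * v + 1)
            + (if rarr s' f (2 * v) + rarr s' f (2 * v + 1) < 1 then 0 else 1) else iarr s' q v)"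
        "rarr ?e f = (\<lambda>v. if w \<le> v \<and> v < 2 * w then
            (if rarr s' f (2 * v) + rarr s' f (2 * v + 1) < 1 then rarr s' f (2 * v) + rarr s' f (2 * v + 1)
             else rarr s' f (2 * v) + rarr s' f (2 * v + 1) - 1) else rarr s' f v)"
        using I by (auto simp: upsweep_body_def Let_def exec_simps I_def half w_def[symmetric] mult_2 fun_eq_iff)
      have "repr (iarr ?e q) (rarr ?e f) v (nsum (2 ^ L) lf v)" if v: "w \<le> v" "v < 2 * 2 ^ L" for v
      proof (cases "v < 2 * w")
        case True
        have "repr (iarr s' q) (rarr s' f) (2 * v) (nsum (2 ^ L) lf (2 * v))"
          "repr (iarr s' q) (rarr s' f) (2 * v + 1) (nsum (2 ^ L) lf (2 * v + 1))"
          using v True w by (auto intro!: r)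
        then show ?thesis unfolding node[OF v(1) True] repr_def e
          using v True by (simp add: floor_add_nat[OF nn' nn'])
      next
        case False
        then have "repr (iarr s' q) (rarr s' f) v (nsum (2 ^ L) lf v)" using v by (intro r) auto
        then show ?thesis using False v by (simp add: repr_def e)
      qed
      then show "I (Suc j) ?e" using I unfolding I_def w_def[symmetric] by (auto simp: e(1))
    qed (use I half in \<open>auto simp: I_def upsweep_body_def Let_def\<close>)
  qed
  have lo': "ival \<omega> s' lo = 2 ^ l" if "I j s'" for j s' using that by (intro lo) (simp add: I_def)
  have exit: "\<not> bval \<omega> s' (ILess lo (IVar ''W''))" if "I (L - l) s'" for s'
    using that lo'[OF that] l by (simp add: I_def)
  have sum: "1 + (1 + (\<Sum>j<L - l. 1 + (3 + 2 * 2 ^ (L - Suc j)))) \<le> (8 * 2 ^ L :: nat)"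
  proof -
    have "(\<Sum>j<L - l. 1 + (3 + 2 * 2 ^ (L - Suc j))) \<le> (\<Sum>j<L. 1 + (3 + 2 * 2 ^ (L - Suc j)) :: nat)"
      by (rule sum_mono2) auto
    also have "\<dots> = (\<Sum>j<L. 1 + (3 + 2 * 2 ^ j))" by (rule sum.nat_diff_reindex)
    also have "\<dots> \<le> L * (1 + 3) + 2 * 2 ^ L" by (rule sum_work)
    finally have "(\<Sum>j<L - l. 1 + (3 + 2 * 2 ^ (L - Suc j))) + 2 \<le> L * (1 + 3) + 2 * 2 ^ L + (2::nat)"
      by (rule add_right_mono)
    also have "\<dots> \<le> 8 * 2 ^ L"
    proof -
      have "L * (1 + 3) + 2 * x + 2 \<le> 8 * x" if "L < x" for x :: nat using that by simp
      then show ?thesis using less_exp[of L] .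
    qed
    finally show ?thesis by (simp only: add.commute[of _ "2::nat"] add.assoc[symmetric] one_add_one)
  qed
  have "reach \<omega> (upsweep q f hi lo) s (I (L - l)) (8 * 2 ^ L) (2 + 4 * L)"
    unfolding upsweep_def
  proof (rule reach_exec_Seq[OF _ _ reach_While[where I = I and J = "L - l"
          and w = "\<lambda>j. 3 + 2 * 2 ^ (L - Suc j)", OF _ step exit]])
    show "I 0 (exec \<omega> (ISet ''W'' hi) s)" using hi leaf by (auto simp: I_def ntree_leaf)
  qed (use sum in auto)
  then show ?thesis using l by (elim reach_conseq) (auto simp: I_def)
qed

subsection \<open>Prefix sums within blocks\<close>

definition block_sum :: "nat \<Rightarrow> (nat \<Rightarrow> real) \<Rightarrow> nat \<Rightarrow> real" where
  "block_sum m y i = (\<Sum>j\<in>{i div m * m..<i}. y j)"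

lemma nsum_range:
  assumes "j \<le> p" "i < 2 ^ j"
  shows "nsum (2 ^ p) (\<lambda>v. y (v - 2 ^ p)) (2 ^ j + i) = (\<Sum>x\<in>{i * 2 ^ (p - j)..<(i + 1) * 2 ^ (p - j)}. y x)"
  using assms
proof (induction "p - j" arbitrary: i j)
  case 0
  then show ?case by (simp add: ntree_leaf)
next
  case (Suc d)
  then have j: "j < p" by simp
  define h :: nat where "h = 2 ^ (p - Suc j)"
  have "p - j = Suc (p - Suc j)" using j by simp
  then have half: "(2::nat) ^ (p - j) = 2 * h" by (simp add: h_def)
  let ?S = "nsum (2 ^ p) (\<lambda>v. y (v - 2 ^ p))"
  have "2 ^ j + i < 2 ^ p" using Suc.prems less_doubling[OF j] by linarith
  then have "?S (2 ^ j + i) = ?S (2 ^ Suc j + 2 * i) + ?S (2 ^ Suc j + (2 * i + 1))"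
    by (subst ntree_node) (auto simp: algebra_simps)
  also have "?S (2 ^ Suc j + 2 * i) = (\<Sum>x\<in>{2 * i * h..<(2 * i + 1) * h}. y x)"
    unfolding h_def using Suc j by (intro Suc.hyps) auto
  also have "?S (2 ^ Suc j + (2 * i + 1)) = (\<Sum>x\<in>{(2 * i + 1) * h..<(2 * i + 1 + 1) * h}. y x)"
    unfolding h_def using Suc j by (intro Suc.hyps) auto
  also have "(\<Sum>x\<in>{2 * i * h..<(2 * i + 1) * h}. y x) + (\<Sum>x\<in>{(2 * i + 1) * h..<(2 * i + 1 + 1) * h}. y x)
     = (\<Sum>x\<in>{2 * i * h..<(2 * i + 1 + 1) * h}. y x)"
    by (intro sum.atLeastLessThan_concat) auto
  finally show ?case unfolding half by (simp add: algebra_simps)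
qed

text \<open>Advancing by h does not leave the block, so both prefix sums start at the same
  position.\<close>

lemma block_sum_extend:
  assumes "i mod m + h < m"
  shows "block_sum m y (i + h) = block_sum m y i + (\<Sum>j\<in>{i..<i + h}. y j)"
proof -
  have "i + h = (i mod m + h) + i div m * m" by simp
  then have "(i + h) div m = (i mod m + h) div m + i div m"
    using assms by (metis div_mult_self3 not_less_zero add.commute)
  then have "(i + h) div m = i div m" using assms by simp
  then show ?thesis unfolding block_sum_def by (simp add: sum.atLeastLessThan_concat)
qed

text \<open>A left child inherits the prefix of its parent; a right child adds the sum of its left
  sibling, stored by the upward pass. Since the block roots are initialised with the offset in cell
  1 of the tape, every prefix already includes the shift of the cuts.\<close>

definition down_body :: com where
  "down_body =
     (let v = IAdd (IAdd (IVar ''W'') (IVar ''W'')) iv; u = IHalf v; a = IAdd u u; odd = ILess a v in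
      Seq (IPar ''i'' (IAdd (IVar ''W'') (IVar ''W'')) ''pq'' v
         (IIf odd (IAdd (IAdd (IAt ''pq'' u) (IAt ''q'' a)) (icarry (RAt ''pf'' u) (RAt ''f'' a))) (IAt ''pq'' u)))
      (Seq (RPar ''i'' (IAdd (IVar ''W'') (IVar ''W'')) ''pf'' v
         (RIf odd (rcarry (RAt ''pf'' u) (RAt ''f'' a)) (RAt ''pf'' u)))
      (ISet ''W'' (IAdd (IVar ''W'') (IVar ''W'')))))"

definition down_com :: com where
  "down_com = Seq (Seq (IPar ''i'' (IVar ''K'') ''pq'' (IAdd (IVar ''K'') iv) (IConst 0))
       (Seq (RPar ''i'' (IVar ''K'') ''pf'' (IAdd (IVar ''K'') iv) (RRand (IConst 1)))
       (ISet ''W'' (IVar ''K''))))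
     (While (ILess (IVar ''W'') (IVar ''N'')) down_body)"

lemma reach_down:
  assumes s: "ivar s ''N'' = 2 ^ p" "ivar s ''K'' = 2 ^ l" "l \<le> p"
    and sums: "\<And>v. 2 ^ l \<le> v \<Longrightarrow> v < 2 * 2 ^ p \<Longrightarrow>
      repr (iarr s ''q'') (rarr s ''f'') v (nsum (2 ^ p) (\<lambda>v. y (v - 2 ^ p)) v)"
    and y: "\<And>i. 0 \<le> y i" and \<omega>: "0 < \<omega> 1" "\<omega> 1 < 1"
  shows "reach \<omega> down_com s
    (\<lambda>s'. \<forall>i<2 ^ p. repr (iarr s' ''pq'') (rarr s' ''pf'') (2 ^ p + i) (\<omega> 1 + block_sum (2 ^ (p - l)) y i))
    (16 * 2 ^ p) (4 + 4 * p)"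
proof -
  define m :: nat where "m = 2 ^ (p - l)"
  have pl: "(2::nat) ^ p = 2 ^ l * m" using s(3) by (simp add: m_def power_add[symmetric])
  define I where "I j s' \<longleftrightarrow> ivar s' ''N'' = 2 ^ p \<and> ivar s' ''W'' = 2 ^ (l + j) \<and>
      iarr s' ''q'' = iarr s ''q'' \<and> rarr s' ''f'' = rarr s ''f'' \<and>
      (\<forall>i<2 ^ (l + j). repr (iarr s' ''pq'') (rarr s' ''pf'') (2 ^ (l + j) + i)
         (\<omega> 1 + block_sum m y (i * 2 ^ (p - (l + j)))))" for j and s' :: state
  let ?S = "nsum (2 ^ p) (\<lambda>v. y (v - 2 ^ p))"
  have nn: "0 \<le> block_sum m y i" "0 \<le> ?S v" for i v
    unfolding block_sum_def using y by (auto intro!: sum_nonneg nsum_nonneg)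
  have step: "bval \<omega> s' (ILess (IVar ''W'') (IVar ''N'')) \<and>
      reach \<omega> down_body s' (I (Suc j)) (3 + 4 * 2 ^ l * 2 ^ j) 3"
    if j: "j < p - l" and I: "I j s'" for j s'
  proof
    define w :: nat where "w = 2 ^ (l + j)"
    define h :: nat where "h = 2 ^ (p - (l + Suc j))"
    have "p - (l + j) = Suc (p - (l + Suc j))" using j by simp
    then have h2: "(2::nat) ^ (p - (l + j)) = 2 * h" by (simp add: h_def)
    have w2: "(2::nat) ^ (l + Suc j) = 2 * w" by (simp add: w_def)
    have "2 * w \<le> 2 ^ p" unfolding w_def using j by (intro less_doubling) auto
    then have wp: "0 < w" "2 * w \<le> 2 ^ p" by (auto simp: w_def)
    then show "bval \<omega> s' (ILess (IVar ''W'') (IVar ''N''))" using I by (simp add: I_def w_def[symmetric])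
    have "p - l = j + Suc (p - (l + Suc j))" using j by simp
    then have m: "m = 2 ^ j * (2 * h)" unfolding m_def h_def by (simp only: power_add power_Suc)
    have hw: "2 ^ p = 2 * w * h" unfolding pl m w_def by (simp add: power_add)
    have h: "0 < h" by (simp add: h_def)
    show "reach \<omega> down_body s' (I (Suc j)) (3 + 4 * 2 ^ l * 2 ^ j) 3"
    proof (rule reach_exec)
      let ?e = "exec \<omega> down_body s'"
      define P where "P = iarr s' ''pq''" define F where "F = rarr s' ''pf''"
      define q where "q = iarr s ''q''" define f where "f = rarr s ''f''"
      have old: "repr P F (w + i) (\<omega> 1 + block_sum m y (i * (2 * h)))" if "i < w" for i
        using I that unfolding I_def w_def[symmetric] h2 P_def F_def by blast
      have e: "ivar ?e = (ivar s')(''W'' := 2 * w)" "iarr ?e ''q'' = q" "rarr ?e ''f'' = f"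
        "iarr ?e ''pq'' = (\<lambda>v. if 2 * w \<le> v \<and> v < 2 * w + 2 * w then
            (if 2 * (v div 2) < v then P (v div 2) + q (2 * (v div 2))
               + (if F (v div 2) + f (2 * (v div 2)) < 1 then 0 else 1) else P (v div 2)) else P v)"
        "rarr ?e ''pf'' = (\<lambda>v. if 2 * w \<le> v \<and> v < 2 * w + 2 * w then
            (if 2 * (v div 2) < v then (if F (v div 2) + f (2 * (v div 2)) < 1 then F (v div 2) + f (2 * (v div 2))
               else F (v div 2) + f (2 * (v div 2)) - 1) else F (v div 2)) else F v)"
        using I by (auto simp: down_body_def Let_def exec_simps I_def w_def[symmetric] mult_2 fun_eq_iff
            P_def F_def q_def f_def)
      have "repr (iarr ?e ''pq'') (rarr ?e ''pf'') (2 * w + i) (\<omega> 1 + block_sum m y (i * h))"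
        if i: "i < 2 * w" for i
      proof -
        define c where "c = i div 2"
        have c: "c < w" and half: "(2 * w + i) div 2 = w + c" using i by (auto simp: c_def)
        consider "i = 2 * c" | "i = 2 * c + 1" unfolding c_def by linarith
        then show ?thesis
        proof cases
          case 1
          then show ?thesis using old[OF c] i unfolding repr_def e half by (simp add: mult.assoc mult.left_commute)
        next
          case 2
          have sub: "repr q f (2 * w + 2 * c) (?S (2 * w + 2 * c))"
          proof -
            have "2 ^ l \<le> 2 * w" by (simp add: w_def power_add)
            then show ?thesis unfolding q_def f_def using c wp by (intro sums) auto
          qed
          have "?S (2 * w + 2 * c) = (\<Sum>x\<in>{2 * c * h..<(2 * c + 1) * h}. y x)"
          proof -
            have "l + Suc j \<le> p" "2 * c < 2 ^ (l + Suc j)" using j c unfolding w2 by simp_all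
            from nsum_range[OF this, of y] show ?thesis unfolding w2 h_def[symmetric] .
          qed
          moreover have "block_sum m y (2 * c * h + h) = block_sum m y (2 * c * h) + (\<Sum>x\<in>{2 * c * h..<2 * c * h + h}. y x)"
          proof (rule block_sum_extend)
            \<comment> \<open>The start is a multiple of 2h, and 2h divides the block length, so at
              least 2h positions of the block remain from there on.\<close>
            have "2 * c * h = 2 * h * c" "m = 2 * h * 2 ^ j" unfolding m by simp_all
            then have "2 * c * h mod m = 2 * h * (c mod 2 ^ j)" by (simp only: mult_mod_right)
            moreover have "c mod 2 ^ j < 2 ^ j" by simp
            from mult_le_mono2[OF Suc_leI[OF this], of "2 * h"]
            have "2 * h * (c mod 2 ^ j) + 2 * h \<le> m" unfolding m by (simp add: mult.commute)
            ultimately show "2 * c * h mod m + h < m" using h by linarith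
          qed
          ultimately have bs: "\<omega> 1 + block_sum m y (i * h)
              = (\<omega> 1 + block_sum m y (c * (2 * h))) + ?S (2 * w + 2 * c)"
            using 2 by (simp add: algebra_simps)
          have nn1: "0 \<le> \<omega> 1 + block_sum m y (c * (2 * h))" using \<omega> nn by (simp add: add_nonneg_nonneg)
          have i2: "2 * (w + c) < 2 * w + i" "2 * (w + c) = 2 * w + 2 * c" using 2 by auto
          show ?thesis unfolding bs repr_def e half floor_add_nat[OF nn1 nn(2)]
            using old[OF c] sub i i2 by (simp add: repr_def)
        qed
      qed
      then show "I (Suc j) ?e" using I unfolding I_def w2 h_def[symmetric] by (simp add: e q_def f_def)
    qed (use I in \<open>auto simp: I_def down_body_def Let_def power_add\<close>)
  qed
  have exit: "\<not> bval \<omega> s' (ILess (IVar ''W'') (IVar ''N''))" if "I (p - l) s'" for s'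
    using that s(3) by (simp add: I_def)
  have *: "\<lfloor>\<omega> 1\<rfloor> = 0" "frac (\<omega> 1) = \<omega> 1" using \<omega> by (auto simp: floor_eq_iff frac_eq)
  have b0: "block_sum m y (i * m) = 0" for i by (cases "m = 0") (simp_all add: block_sum_def)
  have W: "3 + 2 * 2 ^ l + (2 + 3 + 4 * 2 ^ l) * 2 ^ (p - l) \<le> (16 * 2 ^ p :: nat)"
  proof -
    have "3 + 2 * a + (2 + 3 + 4 * a) * b \<le> 16 * (a * b)" if "1 \<le> a" "1 \<le> b" for a b :: nat
    proof -
      have "a \<le> a * b" "b \<le> a * b" "1 \<le> a * b" using that by auto
      moreover have "(2 + 3 + 4 * a) * b = 5 * b + 4 * (a * b)" by (simp add: algebra_simps)
      ultimately show ?thesis by linarith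
    qed
    from this[of "2 ^ l" "2 ^ (p - l)"] show ?thesis unfolding pl m_def by simp
  qed
  have "reach \<omega> down_com s (I (p - l)) (16 * 2 ^ p) (4 + 4 * p)"
    unfolding down_com_def
  proof (rule reach_exec_Seq[OF _ _ reach_doubling[where I = I and J = "p - l" and a = 3 and d = "4 * 2 ^ l", OF _ step exit]])
    show "I 0 (exec \<omega> (Seq (IPar ''i'' (IVar ''K'') ''pq'' (IAdd (IVar ''K'') iv) (IConst 0))
       (Seq (RPar ''i'' (IVar ''K'') ''pf'' (IAdd (IVar ''K'') iv) (RRand (IConst 1)))
       (ISet ''W'' (IVar ''K'')))) s)"
      using s by (simp add: I_def exec_simps repr_def *[unfolded One_nat_def] m_def[symmetric] b0)
  qed (use s W in auto)
  then show ?thesis using s(3) by (elim reach_conseq) (auto simp: I_def m_def)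
qed

subsection \<open>Reading the permuted input\<close>

text \<open>Cyclic rotations of N positions, written with one comparison because the machine has no
  remainder; for s below N they are inverse to each other.\<close>

definition rot_fwd :: "nat \<Rightarrow> nat \<Rightarrow> nat \<Rightarrow> nat" where
  "rot_fwd N s i = (if i + s < N then i + s else i + s - N)"

definition rot_back :: "nat \<Rightarrow> nat \<Rightarrow> nat \<Rightarrow> nat" where
  "rot_back N s i = (if i < s then i + N - s else i - s)"

text \<open>The entries lie in the closed unit interval, so the integral part is 1 only for the
  value 1 itself and one comparison replaces the floor.\<close>

definition leaf_com :: "iexp \<Rightarrow> vname \<Rightarrow> vname \<Rightarrow> vname \<Rightarrow> com" where
  "leaf_com n y q f =
     Seq (IPar ''i'' n q (IAdd n iv) (IIf (RLess (RAt y iv) rone) (IConst 0) (IConst 1)))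
       (RPar ''i'' n f (IAdd n iv) (RIf (RLess (RAt y iv) rone) (RAt y iv) (RSub (RAt y iv) rone)))"

definition gather_com :: com where
  "gather_com =
     (let sh = IAt ''sg'' (IAt ''rr'' iv) in
      Seq (RPar ''i'' (IVar ''N'') ''y'' iv
         (RAt ''x'' (IIf (ILess iv sh) (ISub (IAdd iv (IVar ''N'')) sh) (ISub iv sh))))
      (leaf_com (IVar ''N'') ''y'' ''q'' ''f''))"

lemma repr_unit:
  fixes x :: real
  assumes "0 \<le> x" "x \<le> 1"
  shows "nat \<lfloor>x\<rfloor> = (if x < 1 then 0 else 1)" "frac x = (if x < 1 then x else x - 1)"
proof -
  have "\<lfloor>x\<rfloor> = (if x < 1 then 0 else 1)" using assms by (auto simp: floor_eq_iff)
  then show "nat \<lfloor>x\<rfloor> = (if x < 1 then 0 else 1)" "frac x = (if x < 1 then x else x - 1)"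
    by (auto simp: frac_def)
qed

lemma reach_gather:
  assumes s: "ivar s ''N'' = N"
    and y: "\<And>i. i < N \<Longrightarrow> y i = rarr s ''x'' (rot_back N (iarr s ''sg'' (iarr s ''rr'' i)) i)"
    and bd: "\<And>i. i < N \<Longrightarrow> 0 \<le> y i \<and> y i \<le> 1"
  shows "reach \<omega> gather_com s
    (\<lambda>s'. \<forall>i<N. rarr s' ''y'' i = y i \<and> repr (iarr s' ''q'') (rarr s' ''f'') (N + i) (y i))
    (3 + 3 * N) 3"
proof (rule reach_exec)
  let ?e = "exec \<omega> gather_com s"
  have "rarr ?e ''y'' i = y i" if "i < N" for i
    using s y[OF that] that by (simp add: gather_com_def leaf_com_def Let_def exec_simps rot_back_def)
  moreover have "repr (iarr ?e ''q'') (rarr ?e ''f'') (N + i) (y i)" if "i < N" for i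
    using s y[OF that] bd[OF that] that unfolding repr_def
    by (simp add: gather_com_def leaf_com_def Let_def exec_simps rot_back_def repr_unit)
  ultimately show "\<forall>i<N. rarr ?e ''y'' i = y i \<and> repr (iarr ?e ''q'') (rarr ?e ''f'') (N + i) (y i)"
    by blast
qed (use s in \<open>auto simp: gather_com_def leaf_com_def Let_def\<close>)

subsection \<open>Slots and keys\<close>

definition slot_com :: com where
  "slot_com =
     (let v = IAdd (IVar ''N'') iv in
      Seq (IPar ''i'' (IVar ''N'') ''g'' iv
        (IAdd (IAdd (IAt ''sb'' iv) (IAt ''pq'' v))
          (IAdd (IAdd (IAt ''pq'' v) (IAt ''q'' v)) (icarry (RAt ''pf'' v) (RAt ''f'' v)))))
      (RPar ''i'' (IVar ''N'') ''ky'' iv (RDiv (RAt ''y'' iv) (RSub (ROfNat (IConst 0))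
        (RLn (RRand (IAdd (IAdd (IAdd iv iv) (IAdd iv iv)) (IConst 3))))))))"

lemma reach_slot:
  assumes s: "ivar s ''N'' = N"
    and Y: "\<And>i. i < N \<Longrightarrow> repr (iarr s ''pq'') (rarr s ''pf'') (N + i) (Y i)"
    and q: "\<And>i. i < N \<Longrightarrow> repr (iarr s ''q'') (rarr s ''f'') (N + i) (y i)"
    and y: "\<And>i. i < N \<Longrightarrow> rarr s ''y'' i = y i"
    and nn: "\<And>i. i < N \<Longrightarrow> 0 \<le> Y i \<and> 0 \<le> y i"
  shows "reach \<omega> slot_com s
    (\<lambda>s'. \<forall>i<N. iarr s' ''g'' i = iarr s ''sb'' i + nat \<lfloor>Y i\<rfloor> + nat \<lfloor>Y i + y i\<rfloor> \<and>
        rarr s' ''ky'' i = clock_key (\<lambda>i. \<omega> (4 * i + 3)) y i) (2 + 2 * N) 2"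
proof (rule reach_exec)
  have eq4: "i + i + (i + i) = 4 * i" for i :: nat by simp
  let ?e = "exec \<omega> slot_com s"
  have "iarr ?e ''g'' i = iarr s ''sb'' i + nat \<lfloor>Y i\<rfloor> + nat \<lfloor>Y i + y i\<rfloor>" if i: "i < N" for i
  proof -
    have nn': "0 \<le> Y i" "0 \<le> y i" using nn[OF i] by auto
    show ?thesis using s Y[OF i] q[OF i] i unfolding floor_add_nat[OF nn'] repr_def
      by (simp add: slot_com_def Let_def exec_simps)
  qed
  moreover have "rarr ?e ''ky'' i = clock_key (\<lambda>i. \<omega> (4 * i + 3)) y i" if "i < N" for i
    using s y[OF that] that by (simp add: slot_com_def Let_def exec_simps clock_key_def eq4 add.commute)
  ultimately show "\<forall>i<N. iarr ?e ''g'' i = iarr s ''sb'' i + nat \<lfloor>Y i\<rfloor> + nat \<lfloor>Y i + y i\<rfloor> \<and>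
        rarr ?e ''ky'' i = clock_key (\<lambda>i. \<omega> (4 * i + 3)) y i" by blast
qed (use s in \<open>auto simp: slot_com_def Let_def\<close>)

subsection \<open>Winners and masses of the slots\<close>

text \<open>For a monotone g this is the trailing run of the segment, the only part that a later
  segment can still extend. In a prefix ending at the last position of a slot it is the whole
  slot.\<close>

definition run_of :: "(nat \<Rightarrow> nat) \<Rightarrow> nat \<Rightarrow> nat \<Rightarrow> nat set" where
  "run_of g lo hi = {x. lo \<le> x \<and> x < hi \<and> g x = g (hi - 1)}"

lemma finite_run_of [simp]: "finite (run_of g lo hi)"
  by (rule finite_subset[of _ "{..<hi}"]) (auto simp: run_of_def)

lemma run_of_nonempty: "lo < hi \<Longrightarrow> run_of g lo hi \<noteq> {}"
  by (auto simp: run_of_def intro!: exI[of _ "hi - 1"])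

text \<open>All of A precedes B, so keeping the winner of A on a tie preserves the least-index
  rule.\<close>

lemma first_argmax_Un:
  assumes "finite A" "A \<noteq> {}" "finite B" "B \<noteq> {}" "\<And>x y. x \<in> A \<Longrightarrow> y \<in> B \<Longrightarrow> x < y"
  shows "first_argmax (A \<union> B) \<kappa> = (if \<kappa> (first_argmax A \<kappa>) < \<kappa> (first_argmax B \<kappa>)
     then first_argmax B \<kappa> else first_argmax A \<kappa>)"
proof -
  note a = first_argmax[OF assms(1,2), where \<kappa> = \<kappa>] and b = first_argmax[OF assms(3,4), where \<kappa> = \<kappa>]
  show ?thesis
  proof (cases "\<kappa> (first_argmax A \<kappa>) < \<kappa> (first_argmax B \<kappa>)")
    case True
    have "first_argmax (A \<union> B) \<kappa> = first_argmax B \<kappa>"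
    proof (rule first_argmax_unique)
      fix q assume q: "q \<in> A \<union> B"
      show "\<kappa> q \<le> \<kappa> (first_argmax B \<kappa>)" using q a(2)[of q] b(2)[of q] True by force
      show "\<kappa> q < \<kappa> (first_argmax B \<kappa>)" if "q < first_argmax B \<kappa>"
        using q a(2)[of q] b(3)[of q] True that by force
    qed (use b in blast)
    with True show ?thesis by simp
  next
    case False
    have "first_argmax (A \<union> B) \<kappa> = first_argmax A \<kappa>"
    proof (rule first_argmax_unique)
      fix q assume q: "q \<in> A \<union> B"
      show "\<kappa> q \<le> \<kappa> (first_argmax A \<kappa>)" using q a(2)[of q] b(2)[of q] False by force
      show "\<kappa> q < \<kappa> (first_argmax A \<kappa>)" if "q < first_argmax A \<kappa>"
        using q a(3)[of q] assms(5)[OF a(1), of q] that by force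
    qed (use a in blast)
    with False show ?thesis by simp
  qed
qed

definition best :: "(nat \<Rightarrow> nat) \<Rightarrow> (nat \<Rightarrow> real) \<Rightarrow> nat \<Rightarrow> nat \<Rightarrow> nat" where
  "best g \<kappa> lo hi = first_argmax (run_of g lo hi) \<kappa>"

definition seg :: "(nat \<Rightarrow> nat) \<Rightarrow> (nat \<Rightarrow> real) \<Rightarrow> nat \<Rightarrow> nat \<Rightarrow> real" where
  "seg g y lo hi = (\<Sum>x\<in>run_of g lo hi. y x)"

lemma g_best: "lo < hi \<Longrightarrow> g (best g \<kappa> lo hi) = g (hi - 1)"
  using first_argmax(1)[OF finite_run_of run_of_nonempty, of lo hi g \<kappa>] by (simp add: best_def run_of_def)

text \<open>The slot of a segment's trailing run can be read off its winner as g of that position,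
  so no separate field is needed. If the two slots differ, the trailing run lies in the right part;
  otherwise the two runs join.\<close>

lemma best_seg_combine:
  fixes g :: "nat \<Rightarrow> nat" and \<kappa> y :: "nat \<Rightarrow> real"
  assumes "lo < mid" "mid < hi" and mono: "\<And>x x'. x \<le> x' \<Longrightarrow> x' < hi \<Longrightarrow> g x \<le> g x'"
  shows "best g \<kappa> lo hi = (if \<not> g (best g \<kappa> lo mid) < g (best g \<kappa> mid hi) \<and> \<not> \<kappa> (best g \<kappa> lo mid) < \<kappa> (best g \<kappa> mid hi)
      then best g \<kappa> lo mid else best g \<kappa> mid hi)"
    "seg g y lo hi = (if g (best g \<kappa> lo mid) < g (best g \<kappa> mid hi) then seg g y mid hi else seg g y lo mid + seg g y mid hi)"
proof -
  define l r where "l = best g \<kappa> lo mid" and "r = best g \<kappa> mid hi"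
  have gl: "g l = g (mid - 1)" and gr: "g r = g (hi - 1)"
    using assms(1,2) by (simp_all add: l_def r_def g_best)
  have le: "g x \<le> g (mid - 1)" if "x < mid" for x using that assms(2) by (intro mono) auto
  have le': "g (mid - 1) \<le> g (hi - 1)" using assms by (intro mono) auto
  have "best g \<kappa> lo hi = (if \<not> g l < g r \<and> \<not> \<kappa> l < \<kappa> r then l else r) \<and>
    seg g y lo hi = (if g l < g r then seg g y mid hi else seg g y lo mid + seg g y mid hi)"
  proof (cases "g l < g r")
    case True
    then have lt: "g x < g (hi - 1)" if "x < mid" for x using le[OF that] gl gr by linarith
    have "mid \<le> x" if "g x = g (hi - 1)" for x using lt[of x] that by (cases "x < mid") auto
    then have "run_of g lo hi = run_of g mid hi"
      unfolding run_of_def using assms(1) by fastforce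
    then show ?thesis using True by (simp add: best_def seg_def r_def)
  next
    case False
    then have eq: "g (mid - 1) = g (hi - 1)" using le' gl gr by linarith
    have run: "run_of g lo hi = run_of g lo mid \<union> run_of g mid hi"
      unfolding run_of_def eq using assms(1,2) by auto
    have disj: "run_of g lo mid \<inter> run_of g mid hi = {}" by (auto simp: run_of_def)
    have "best g \<kappa> lo hi = (if \<kappa> l < \<kappa> r then r else l)"
      unfolding best_def run l_def r_def
      by (rule first_argmax_Un) (use assms(1,2) run_of_nonempty in \<open>auto simp: run_of_def\<close>)
    moreover have "seg g y lo hi = seg g y lo mid + seg g y mid hi"
      unfolding seg_def run by (rule sum.union_disjoint) (use disj in auto)
    ultimately show ?thesis using False by simp
  qed
  then show "best g \<kappa> lo hi = (if \<not> g (best g \<kappa> lo mid) < g (best g \<kappa> mid hi) \<and> \<not> \<kappa> (best g \<kappa> lo mid) < \<kappa> (best g \<kappa> mid hi)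
      then best g \<kappa> lo mid else best g \<kappa> mid hi)"
    "seg g y lo hi = (if g (best g \<kappa> lo mid) < g (best g \<kappa> mid hi) then seg g y mid hi else seg g y lo mid + seg g y mid hi)"
    unfolding l_def r_def by blast+
qed

abbreviation better :: "iexp \<Rightarrow> iexp \<Rightarrow> iexp" where
  "better l r \<equiv> IIf (BAnd (BNot (ILess (IAt ''g'' l) (IAt ''g'' r)))
     (BNot (RLess (RAt ''ky'' l) (RAt ''ky'' r)))) l r"

definition scan_up_body :: com where
  "scan_up_body =
     (let v = IAdd (IVar ''W'') iv; a = IAdd v v; c = IAdd a (IConst 1) in
      Seq (ISet ''W'' (IHalf (IVar ''W'')))
      (Seq (IPar ''i'' (IVar ''W'') ''b'' v (better (IAt ''b'' a) (IAt ''b'' c)))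
      (RPar ''i'' (IVar ''W'') ''zs'' v
        (RIf (ILess (IAt ''g'' (IAt ''b'' a)) (IAt ''g'' (IAt ''b'' c))) (RAt ''zs'' c)
          (RAdd (RAt ''zs'' a) (RAt ''zs'' c))))))"

definition scan_up_com :: com where
  "scan_up_com = Seq (Seq (IPar ''i'' (IVar ''N'') ''b'' (IAdd (IVar ''N'') iv) iv)
       (Seq (RPar ''i'' (IVar ''N'') ''zs'' (IAdd (IVar ''N'') iv) (RAt ''y'' iv))
       (ISet ''W'' (IVar ''N''))))
     (While (ILess (IConst 1) (IVar ''W'')) scan_up_body)"

definition summary :: "(nat \<Rightarrow> nat) \<Rightarrow> (nat \<Rightarrow> real) \<Rightarrow> (nat \<Rightarrow> real) \<Rightarrow>
    (nat \<Rightarrow> nat) \<Rightarrow> (nat \<Rightarrow> real) \<Rightarrow> nat \<Rightarrow> nat \<Rightarrow> nat \<Rightarrow> bool" where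
  "summary g \<kappa> y B Z v lo hi \<longleftrightarrow> B v = best g \<kappa> lo hi \<and> Z v = seg g y lo hi"

lemma run_of_single: "run_of g i (Suc i) = {i}"
  by (auto simp: run_of_def)

lemma reach_scan_up:
  assumes s: "ivar s ''N'' = 2 ^ p" "iarr s ''g'' = g" "rarr s ''ky'' = \<kappa>" "rarr s ''y'' = y"
    and mono: "\<And>x x'. x \<le> x' \<Longrightarrow> x' < 2 ^ p \<Longrightarrow> g x \<le> g x'"
  shows "reach \<omega> scan_up_com s
    (\<lambda>s'. \<forall>j\<le>p. \<forall>i<2 ^ j. summary g \<kappa> y (iarr s' ''b'') (rarr s' ''zs'') (2 ^ j + i)
        (i * 2 ^ (p - j)) ((i + 1) * 2 ^ (p - j)))
    (16 * 2 ^ p) (4 + 4 * p)"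
proof -
  define I where "I d s' \<longleftrightarrow> ivar s' ''W'' = 2 ^ (p - d) \<and> iarr s' ''g'' = g \<and> rarr s' ''ky'' = \<kappa> \<and>
      (\<forall>j. p - d \<le> j \<longrightarrow> j \<le> p \<longrightarrow> (\<forall>i<2 ^ j. summary g \<kappa> y (iarr s' ''b'') (rarr s' ''zs'') (2 ^ j + i)
        (i * 2 ^ (p - j)) ((i + 1) * 2 ^ (p - j))))" for d and s' :: state
  have step: "bval \<omega> s' (ILess (IConst 1) (IVar ''W'')) \<and>
      reach \<omega> scan_up_body s' (I (Suc d)) (3 + 2 * 2 ^ (p - Suc d)) 3"
    if d: "d < p" and I: "I d s'" for d s'
  proof
    define e0 where "e0 = p - Suc d"
    define w :: nat where "w = 2 ^ e0"
    define h :: nat where "h = 2 ^ d"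
    have pd: "p - d = Suc e0" using d by (simp add: e0_def)
    have half: "(2::nat) ^ (p - d) = 2 * w" by (simp add: pd w_def)
    have hd: "p - e0 = Suc d" "p - Suc e0 = d" using d by (auto simp: e0_def)
    have w: "0 < w" by (simp add: w_def)
    have h: "0 < h" by (simp add: h_def)
    have wh: "2 ^ p = 2 * w * h" unfolding w_def h_def using d
      by (simp add: e0_def power_add[symmetric] flip: power_Suc)
    show "bval \<omega> s' (ILess (IConst 1) (IVar ''W''))" using I w by (simp add: I_def half)
    show "reach \<omega> scan_up_body s' (I (Suc d)) (3 + 2 * 2 ^ (p - Suc d)) 3"
    proof (rule reach_exec)
      let ?e = "exec \<omega> scan_up_body s'"
      define B where "B = iarr s' ''b''" define Z where "Z = rarr s' ''zs''"
      have old: "summary g \<kappa> y B Z (2 ^ j + i) (i * 2 ^ (p - j)) ((i + 1) * 2 ^ (p - j))"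
        if "e0 < j" "j \<le> p" "i < 2 ^ j" for i j
        using I that unfolding I_def pd B_def Z_def by simp
      have e: "ivar ?e = (ivar s')(''W'' := w)" "iarr ?e ''g'' = g" "rarr ?e ''ky'' = \<kappa>"
        "iarr ?e ''b'' = (\<lambda>v. if w \<le> v \<and> v < 2 * w then
           (if \<not> g (B (2 * v)) < g (B (2 * v + 1)) \<and> \<not> \<kappa> (B (2 * v)) < \<kappa> (B (2 * v + 1))
            then B (2 * v) else B (2 * v + 1)) else B v)"
        "rarr ?e ''zs'' = (\<lambda>v. if w \<le> v \<and> v < 2 * w then
           (if g (B (2 * v)) < g (B (2 * v + 1)) then Z (2 * v + 1) else Z (2 * v) + Z (2 * v + 1)) else Z v)"
        using I by (auto simp: scan_up_body_def Let_def exec_simps I_def half mult_2 fun_eq_iff B_def Z_def)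
      have new: "summary g \<kappa> y (iarr ?e ''b'') (rarr ?e ''zs'') (w + i) (i * (2 * h)) ((i + 1) * (2 * h))"
        if i: "i < w" for i
      proof -
        define m0 m1 m2 where "m0 = 2 * i * h" and "m1 = (2 * i + 1) * h" and "m2 = (2 * i + 2) * h"
        have "summary g \<kappa> y B Z (2 * (w + i)) m0 m1" "summary g \<kappa> y B Z (2 * (w + i) + 1) m1 m2"
          using old[of "Suc e0" "2 * i"] old[of "Suc e0" "2 * i + 1"] i d
          by (simp_all add: w_def[symmetric] hd h_def[symmetric] e0_def[symmetric] distrib_left m0_def m1_def m2_def)
             (simp_all add: e0_def)
        note c = this[unfolded summary_def]
        have lt: "x' < 2 ^ p" if "x' < m2" for x'
          using that mult_le_mono1[of "2 * i + 2" "2 * w" h] i unfolding wh m2_def by linarith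
        have mono': "x \<le> x' \<Longrightarrow> x' < m2 \<Longrightarrow> g x \<le> g x'" for x x'
          by (rule mono, assumption, rule lt)
        have "m0 < m1" "m1 < m2" using h by (simp_all add: m0_def m1_def m2_def)
        then have comb: "best g \<kappa> m0 m2 = (if \<not> g (best g \<kappa> m0 m1) < g (best g \<kappa> m1 m2) \<and>
              \<not> \<kappa> (best g \<kappa> m0 m1) < \<kappa> (best g \<kappa> m1 m2) then best g \<kappa> m0 m1 else best g \<kappa> m1 m2)"
            "seg g y m0 m2 = (if g (best g \<kappa> m0 m1) < g (best g \<kappa> m1 m2) then seg g y m1 m2
              else seg g y m0 m1 + seg g y m1 m2)"
          using mono' by (blast intro: best_seg_combine)+
        have eqs: "i * (2 * h) = m0" "(i + 1) * (2 * h) = m2" by (simp_all add: algebra_simps m0_def m2_def)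
        show ?thesis unfolding summary_def eqs comb using i c by (simp add: e)
      qed
      have "summary g \<kappa> y (iarr ?e ''b'') (rarr ?e ''zs'') (2 ^ j + i) (i * 2 ^ (p - j)) ((i + 1) * 2 ^ (p - j))"
        if j: "e0 \<le> j" "j \<le> p" and i: "i < 2 ^ j" for j i
      proof (cases "j = e0")
        case True
        then show ?thesis using new[of i] i by (simp add: w_def hd h_def)
      next
        case False
        then have "e0 < j" using j by simp
        moreover from this have "2 * w \<le> 2 ^ j" unfolding w_def by (rule less_doubling)
        ultimately show ?thesis using old[of j i] j i by (simp add: summary_def e)
      qed
      then show "I (Suc d) ?e" unfolding I_def by (simp add: e e0_def[symmetric] w_def)
    qed (use I in \<open>auto simp: I_def scan_up_body_def Let_def half w_def e0_def\<close>)
  qed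
  have exit: "\<not> bval \<omega> s' (ILess (IConst 1) (IVar ''W''))" if "I p s'" for s'
    using that by (simp add: I_def)
  have "reach \<omega> scan_up_com s (I p) (16 * 2 ^ p) (4 + 4 * p)"
    unfolding scan_up_com_def
  proof (rule reach_exec_Seq[OF _ _ reach_halving[where I = I and J = p and a = 3 and d = 2, OF _ step exit]])
    show "I 0 (exec \<omega> (Seq (IPar ''i'' (IVar ''N'') ''b'' (IAdd (IVar ''N'') iv) iv)
       (Seq (RPar ''i'' (IVar ''N'') ''zs'' (IAdd (IVar ''N'') iv) (RAt ''y'' iv))
       (ISet ''W'' (IVar ''N'')))) s)"
      using s by (auto simp: I_def exec_simps summary_def best_def seg_def run_of_single
          intro!: first_argmax_unique[symmetric])
    show "work \<omega> (Seq (IPar ''i'' (IVar ''N'') ''b'' (IAdd (IVar ''N'') iv) iv)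
       (Seq (RPar ''i'' (IVar ''N'') ''zs'' (IAdd (IVar ''N'') iv) (RAt ''y'' iv))
       (ISet ''W'' (IVar ''N'')))) s + (2 + 3 + 2) * 2 ^ p \<le> 16 * 2 ^ p"
    proof -
      have "3 + 2 * x + 7 * x \<le> 16 * x" if "1 \<le> x" for x :: nat using that by simp
      from this[of "2 ^ p"] show ?thesis using s by simp
    qed
  qed (use s in auto)
  then show ?thesis by (rule reach_conseq) (auto simp: I_def)
qed

text \<open>Computes inclusive prefixes. A right child ends where its parent ends and inherits its
  value. A left child combines the prefix of the parent's left neighbour with its own segment; the
  first node of a level has no such neighbour, which is what the comparison of \<open>u\<close> with
  the width detects.\<close>

definition scan_down_body :: com where
  "scan_down_body =
     (let v = IAdd (IAdd (IVar ''W'') (IVar ''W'')) iv; u = IHalf v; odd = ILess (IAdd u u) v;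
          pv = ISub u (IConst 1) in
      Seq (IPar ''i'' (IAdd (IVar ''W'') (IVar ''W'')) ''ib'' v
         (IIf odd (IAt ''ib'' u) (IIf (ILess (IVar ''W'') u) (better (IAt ''ib'' pv) (IAt ''b'' v)) (IAt ''b'' v))))
      (Seq (RPar ''i'' (IAdd (IVar ''W'') (IVar ''W'')) ''iz'' v
         (RIf odd (RAt ''iz'' u) (RIf (ILess (IVar ''W'') u)
            (RIf (ILess (IAt ''g'' (IAt ''ib'' pv)) (IAt ''g'' (IAt ''b'' v))) (RAt ''zs'' v)
              (RAdd (RAt ''iz'' pv) (RAt ''zs'' v))) (RAt ''zs'' v))))
      (ISet ''W'' (IAdd (IVar ''W'') (IVar ''W'')))))"

definition scan_down_init :: com where
  "scan_down_init =
     Seq (IPar ''i'' (IConst 1) ''ib'' (IAdd (IConst 1) iv) (IAt ''b'' (IConst 1)))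
     (Seq (RPar ''i'' (IConst 1) ''iz'' (IAdd (IConst 1) iv) (RAt ''zs'' (IConst 1)))
     (ISet ''W'' (IConst 1)))"

definition scan_down_com :: com where
  "scan_down_com = Seq scan_down_init (While (ILess (IVar ''W'') (IVar ''N'')) scan_down_body)"

lemma scatter_single: "scatter (Suc 0) Suc t f = f(Suc 0 := t 0)"
  using scatter_add[of 1 1 t f] by (auto simp: fun_eq_iff)

lemma reach_scan_down:
  assumes s: "ivar s ''N'' = 2 ^ p" "iarr s ''g'' = g" "rarr s ''ky'' = \<kappa>"
    and up: "\<And>j i. j \<le> p \<Longrightarrow> i < 2 ^ j \<Longrightarrow> summary g \<kappa> y (iarr s ''b'') (rarr s ''zs'') (2 ^ j + i)
        (i * 2 ^ (p - j)) ((i + 1) * 2 ^ (p - j))"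
    and mono: "\<And>x x'. x \<le> x' \<Longrightarrow> x' < 2 ^ p \<Longrightarrow> g x \<le> g x'"
  shows "reach \<omega> scan_down_com s
    (\<lambda>s'. \<forall>i<2 ^ p. summary g \<kappa> y (iarr s' ''ib'') (rarr s' ''iz'') (2 ^ p + i) 0 (i + 1))
    (16 * 2 ^ p) (4 + 4 * p)"
proof -
  define Bu where "Bu = iarr s ''b''"
  define Zu where "Zu = rarr s ''zs''"
  define I where "I j s' \<longleftrightarrow> ivar s' ''N'' = 2 ^ p \<and> ivar s' ''W'' = 2 ^ j \<and> iarr s' ''g'' = g \<and>
      rarr s' ''ky'' = \<kappa> \<and> iarr s' ''b'' = Bu \<and> rarr s' ''zs'' = Zu \<and>
      (\<forall>i<2 ^ j. summary g \<kappa> y (iarr s' ''ib'') (rarr s' ''iz'') (2 ^ j + i) 0 ((i + 1) * 2 ^ (p - j)))"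
    for j and s' :: state
  have step: "bval \<omega> s' (ILess (IVar ''W'') (IVar ''N'')) \<and>
      reach \<omega> scan_down_body s' (I (Suc j)) (3 + 4 * 2 ^ j) 3"
    if j: "j < p" and I: "I j s'" for j s'
  proof
    define w :: nat where "w = 2 ^ j"
    define h :: nat where "h = 2 ^ (p - Suc j)"
    have "p - j = Suc (p - Suc j)" using j by simp
    then have h2: "(2::nat) ^ (p - j) = 2 * h" by (simp add: h_def)
    have w2: "(2::nat) ^ Suc j = 2 * w" by (simp add: w_def)
    have w: "0 < w" by (simp add: w_def)
    have h: "0 < h" by (simp add: h_def)
    have wh: "2 ^ p = 2 * w * h" unfolding w_def h_def using j
      by (simp add: power_add[symmetric] flip: power_Suc)
    show "bval \<omega> s' (ILess (IVar ''W'') (IVar ''N''))" using I j by (simp add: I_def)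
    show "reach \<omega> scan_down_body s' (I (Suc j)) (3 + 4 * 2 ^ j) 3"
    proof (rule reach_exec)
      let ?e = "exec \<omega> scan_down_body s'"
      define B where "B = iarr s' ''ib''" define Z where "Z = rarr s' ''iz''"
      have old: "B (w + i) = best g \<kappa> 0 ((i + 1) * (2 * h))" "Z (w + i) = seg g y 0 ((i + 1) * (2 * h))"
        if "i < w" for i
        using I that unfolding I_def w_def[symmetric] h2 B_def Z_def summary_def by blast+
      have u: "Bu (2 * w + i) = best g \<kappa> (i * h) ((i + 1) * h)" "Zu (2 * w + i) = seg g y (i * h) ((i + 1) * h)"
        if "i < 2 * w" for i
        using up[of "Suc j" i] that j unfolding w2 h_def[symmetric] Bu_def Zu_def summary_def by simp_all
      have e: "ivar ?e = (ivar s')(''W'' := 2 * w)" "iarr ?e ''g'' = g" "rarr ?e ''ky'' = \<kappa>"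
        "iarr ?e ''b'' = Bu" "rarr ?e ''zs'' = Zu"
        using I by (auto simp: scan_down_body_def Let_def exec_simps I_def w_def[symmetric] mult_2)
      have vv: "v = w + w" if "\<not> w < v div 2" "\<not> v div 2 + v div 2 < v" "w + w \<le> v" for v
        using that by linarith
      have e'': "iarr ?e ''ib'' v = (if 2 * w \<le> v \<and> v < 2 * w + 2 * w then
           (if 2 * (v div 2) < v then B (v div 2) else if w < v div 2 then
             (if \<not> g (B (v div 2 - 1)) < g (Bu v) \<and> \<not> \<kappa> (B (v div 2 - 1)) < \<kappa> (Bu v)
              then B (v div 2 - 1) else Bu v) else Bu v) else B v)" for v
        using I by (simp add: scan_down_body_def Let_def exec_simps I_def w_def[symmetric] mult_2 B_def cong: if_cong)
           (intro conjI impI; metis vv)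
      \<comment> \<open>The array \<open>ib\<close> has already been overwritten from 2w on when
        \<open>iz\<close> is computed. The neighbour that is read lies below 2w, so its old value is
        still there.\<close>
      have low: "v div 2 - 1 < 2 * w" if "v < 2 * w + 2 * w" "w < v div 2" for v using that w by linarith
      have e': "rarr ?e ''iz'' v = (if 2 * w \<le> v \<and> v < 2 * w + 2 * w then
           (if 2 * (v div 2) < v then Z (v div 2) else if w < v div 2 then
             (if g (B (v div 2 - 1)) < g (Bu v) then Zu v else Z (v div 2 - 1) + Zu v) else Zu v) else Z v)" for v
      proof (cases "2 * w \<le> v \<and> v < 2 * w + 2 * w \<and> w < v div 2")
        case True
        then have "v div 2 - 1 < 2 * w" by (intro low) auto
        then show ?thesis using I True
          by (simp add: scan_down_body_def Let_def exec_simps I_def w_def[symmetric] mult_2 B_def Z_def cong: if_cong)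
      next
        case False
        then show ?thesis using I
          by (auto simp add: scan_down_body_def Let_def exec_simps I_def w_def[symmetric] mult_2 B_def Z_def)
      qed
      have "summary g \<kappa> y (iarr ?e ''ib'') (rarr ?e ''iz'') (2 * w + i) 0 ((i + 1) * h)"
        if i: "i < 2 * w" for i
      proof -
        define c where "c = i div 2"
        have c: "c < w" and half: "(2 * w + i) div 2 = w + c" using i by (auto simp: c_def)
        consider (odd) "i = 2 * c + 1" | (first) "i = 2 * c" "c = 0" | (even) "i = 2 * c" "0 < c"
          unfolding c_def by linarith
        then show ?thesis
        proof cases
          case odd
          then show ?thesis unfolding summary_def e'' e' half using old[OF c] i by (simp add: algebra_simps)
        next
          case first
          then show ?thesis unfolding summary_def e'' e' half using u[OF i] i by simp
        next
          case even
          define m1 m2 where "m1 = c * (2 * h)" and "m2 = (i + 1) * h"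
          have l: "B (w + c - 1) = best g \<kappa> 0 m1" "Z (w + c - 1) = seg g y 0 m1"
            using old[of "c - 1"] even c by (simp_all add: m1_def)
          have r: "Bu (2 * w + i) = best g \<kappa> m1 m2" "Zu (2 * w + i) = seg g y m1 m2"
            using u[OF i] even by (simp_all add: m1_def m2_def mult.assoc mult.left_commute)
          have "i + 1 \<le> 2 * w" using i by simp
          from mult_le_mono1[OF this, of h] have "m2 \<le> 2 ^ p" by (simp add: m2_def wh)
          then have lt: "x' < 2 ^ p" if "x' < m2" for x' using that by linarith
          have mono': "x \<le> x' \<Longrightarrow> x' < m2 \<Longrightarrow> g x \<le> g x'" for x x'
            by (rule mono, assumption, rule lt)
          have "0 < m1" "m1 < m2" using h even by (simp_all add: m1_def m2_def)
          then have comb: "best g \<kappa> 0 m2 = (if \<not> g (best g \<kappa> 0 m1) < g (best g \<kappa> m1 m2) \<and>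
              \<not> \<kappa> (best g \<kappa> 0 m1) < \<kappa> (best g \<kappa> m1 m2) then best g \<kappa> 0 m1 else best g \<kappa> m1 m2)"
            "seg g y 0 m2 = (if g (best g \<kappa> 0 m1) < g (best g \<kappa> m1 m2) then seg g y m1 m2
              else seg g y 0 m1 + seg g y m1 m2)"
            using mono' by (blast intro: best_seg_combine)+
          have i2: "\<not> 2 * (w + c) < 2 * w + i" "w < w + c" using even by auto
          show ?thesis unfolding m2_def[symmetric] summary_def e'' e' half comb using l r i i2 by simp
        qed
      qed
      then show "I (Suc j) ?e" using I unfolding I_def w2 h_def[symmetric] by (simp add: e)
    qed (use I in \<open>auto simp: I_def scan_down_body_def Let_def\<close>)
  qed
  have exit: "\<not> bval \<omega> s' (ILess (IVar ''W'') (IVar ''N''))" if "I p s'" for s'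
    using that by (simp add: I_def)
  have W: "3 + 2 * 1 + (2 + 3 + 4) * x \<le> 16 * x" if "1 \<le> x" for x :: nat using that by simp
  have "reach \<omega> scan_down_com s (I p) (16 * 2 ^ p) (4 + 4 * p)"
    unfolding scan_down_com_def
  proof (rule reach_exec_Seq[OF _ _ reach_doubling[where I = I and J = p and a = 3 and d = 4, OF _ step exit]])
    show "I 0 (exec \<omega> scan_down_init s)"
      using s up[of 0 0] by (simp add: scan_down_init_def I_def scatter_single summary_def Bu_def Zu_def)
    show "work \<omega> scan_down_init s + (2 + 3 + 4) * 2 ^ p \<le> 16 * 2 ^ p"
      using W[of "2 ^ p"] by (simp add: scan_down_init_def)
  qed (auto simp: scan_down_init_def)
  then show ?thesis by (rule reach_conseq) (auto simp: I_def)
qed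

lemma scatter_at:
  assumes "inj_on p {..<m}"
  shows "i < m \<Longrightarrow> scatter m p t f (p i) = t i" "(\<And>i. i < m \<Longrightarrow> p i \<noteq> j) \<Longrightarrow> scatter m p t f j = f j"
  using assms by (auto simp: scatter_def)

text \<open>Only the last position of a slot writes to the cell of the slot. All other positions are
  sent to private dummy cells from M on, so that the write is exclusive.\<close>

definition slot_end :: iexp where
  "slot_end = IIf (BAnd (ILess (IAdd iv (IConst 1)) (IVar ''N''))
     (BNot (ILess (IAt ''g'' iv) (IAt ''g'' (IAdd iv (IConst 1)))))) (IAdd (IVar ''M'') iv) (IAt ''g'' iv)"

definition scatter_com :: com where
  "scatter_com =
     Seq (IPar ''i'' (IVar ''N'') ''win'' slot_end (IAt ''ib'' (IAdd (IVar ''N'') iv)))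
     (Seq (RPar ''i'' (IVar ''N'') ''zz'' slot_end (RAt ''iz'' (IAdd (IVar ''N'') iv)))
     (leaf_com (IVar ''M'') ''zz'' ''q2'' ''f2''))"

text \<open>By monotonicity a slot is an interval of positions, and the prefix summary at its last
  position covers all of it. Scattering these summaries turns data indexed by positions into data
  indexed by slots.\<close>

lemma reach_scatter:
  assumes s: "ivar s ''N'' = N" "ivar s ''M'' = M" "iarr s ''g'' = g" "\<And>i. rarr s ''zz'' i = 0"
    and pre: "\<And>i. i < N \<Longrightarrow> summary g \<kappa> y (iarr s ''ib'') (rarr s ''iz'') (N + i) 0 (i + 1)"
    and mono: "\<And>x x'. x \<le> x' \<Longrightarrow> x' < N \<Longrightarrow> g x \<le> g x'"
    and gM: "\<And>i. i < N \<Longrightarrow> g i < M"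
    and bd: "\<And>h. h < M \<Longrightarrow> 0 \<le> (\<Sum>x | x < N \<and> g x = h. y x) \<and> (\<Sum>x | x < N \<and> g x = h. y x) \<le> 1"
  shows "reach \<omega> scatter_com s
    (\<lambda>s'. (\<forall>h<M. repr (iarr s' ''q2'') (rarr s' ''f2'') (M + h) (\<Sum>x | x < N \<and> g x = h. y x)) \<and>
      (\<forall>i<N. iarr s' ''win'' (g i) = first_argmax {x. x < N \<and> g x = g i} \<kappa>))
    (4 + 2 * N + 2 * M) 4"
proof (rule reach_exec)
  define P where "P i = (if i + 1 < N \<and> \<not> g i < g (i + 1) then M + i else g i)" for i
  have P: "ival \<omega> (with_index s' ''i'' i) slot_end = P i"
    if "ivar s' ''N'' = N" "ivar s' ''M'' = M" "iarr s' ''g'' = g" for s' i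
    using that by (simp add: slot_end_def P_def)
  have last: "i = j" if ij: "i < N" "j < N" "\<not> (i + 1 < N \<and> \<not> g i < g (i + 1))"
      "\<not> (j + 1 < N \<and> \<not> g j < g (j + 1))" "g i = g j" for i j
  proof (rule ccontr)
    assume "i \<noteq> j"
    then consider "i < j" | "j < i" by linarith
    then show False
    proof cases
      case 1
      then have "g (i + 1) \<le> g j" using ij by (intro mono) auto
      then show False using ij 1 by auto
    next
      case 2
      then have "g (j + 1) \<le> g i" using ij by (intro mono) auto
      then show False using ij 2 by auto
    qed
  qed
  \<comment> \<open>Addresses of slots lie below M, dummy addresses are M + i, and two positions
    ending the same slot coincide by \<open>last\<close>.\<close>
  have inj: "inj_on P {..<N}"
  proof (rule inj_onI)
    fix i j assume ij: "i \<in> {..<N}" "j \<in> {..<N}" "P i = P j"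
    then show "i = j" using last[of i j] gM[of i] gM[of j] by (auto simp: P_def split: if_splits)
  qed
  have exists_last: "\<exists>i'<N. P i' = g i \<and> g i' = g i" if i: "i < N" for i
  proof -
    let ?A = "{x. x < N \<and> g x = g i}"
    have A: "finite ?A" "i \<in> ?A" using i by auto
    then have "Max ?A \<in> ?A" by (intro Max_in) auto
    moreover have "\<not> (Max ?A + 1 < N \<and> \<not> g (Max ?A) < g (Max ?A + 1))"
    proof
      assume *: "Max ?A + 1 < N \<and> \<not> g (Max ?A) < g (Max ?A + 1)"
      then have "g (Max ?A + 1) = g i" using calculation mono[of "Max ?A" "Max ?A + 1"] by auto
      then have "Max ?A + 1 \<le> Max ?A" using * A by (intro Max_ge) auto
      then show False by simp
    qed
    ultimately have "P (Max ?A) = g (Max ?A)" unfolding P_def by (intro if_not_P)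
    with \<open>Max ?A \<in> ?A\<close> show ?thesis by (intro exI[of _ "Max ?A"]) auto
  qed
  have run: "run_of g 0 (i + 1) = {x. x < N \<and> g x = g i}" if i: "i < N" "P i = g i" for i
  proof -
    have l: "\<not> (i + 1 < N \<and> \<not> g i < g (i + 1))" using i gM[of i] by (auto simp: P_def split: if_splits)
    have "x \<le> i" if "x < N" "g x = g i" for x
    proof (rule ccontr)
      assume "\<not> x \<le> i"
      then have "g (i + 1) \<le> g x" using that by (intro mono) auto
      then show False using l that \<open>\<not> x \<le> i\<close> by auto
    qed
    then show ?thesis using i by (auto simp: run_of_def less_Suc_eq_le)
  qed
  let ?e = "exec \<omega> scatter_com s"
  define ZZ where "ZZ = scatter N P (\<lambda>i. rarr s ''iz'' (N + i)) (rarr s ''zz'')"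
  have win: "iarr ?e ''win'' = scatter N P (\<lambda>i. iarr s ''ib'' (N + i)) (iarr s ''win'')"
    using s P by (simp add: scatter_com_def leaf_com_def)
  have q2: "iarr ?e ''q2'' = (\<lambda>j. if M \<le> j \<and> j < M + M then (if ZZ (j - M) < 1 then 0 else 1) else iarr s ''q2'' j)"
    and f2: "rarr ?e ''f2'' = (\<lambda>j. if M \<le> j \<and> j < M + M then
      (if ZZ (j - M) < 1 then ZZ (j - M) else ZZ (j - M) - 1) else rarr s ''f2'' j)"
    using s P by (auto simp: scatter_com_def leaf_com_def exec_simps ZZ_def fun_eq_iff)
  have ZZ: "ZZ h = (\<Sum>x | x < N \<and> g x = h. y x)" if h: "h < M" for h
  proof (cases "\<exists>i<N. g i = h")
    case True
    then obtain i where i: "i < N" "P i = h" "g i = h" using exists_last by metis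
    have "ZZ (P i) = seg g y 0 (i + 1)"
      unfolding ZZ_def using pre[OF i(1)] i(1) by (simp add: scatter_at[OF inj] summary_def)
    then show ?thesis using run[of i] i by (simp add: seg_def)
  next
    \<comment> \<open>The cell of an empty slot is never written; its initial content 0 is the
      correct mass.\<close>
    case False
    then have "P i \<noteq> h" if "i < N" for i using that h by (auto simp: P_def)
    then have "ZZ h = 0" unfolding ZZ_def by (subst scatter_at(2)[OF inj]) (auto simp: s)
    moreover have "{x. x < N \<and> g x = h} = {}" using False by auto
    ultimately show ?thesis by (simp only: sum.empty)
  qed
  have "iarr ?e ''win'' (g i) = first_argmax {x. x < N \<and> g x = g i} \<kappa>" if "i < N" for i
  proof -
    obtain i' where i': "i' < N" "P i' = g i" "g i' = g i" using exists_last[OF \<open>i < N\<close>] by blast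
    have "iarr ?e ''win'' (P i') = best g \<kappa> 0 (i' + 1)"
      unfolding win using pre[OF i'(1)] i'(1) by (simp add: scatter_at[OF inj] summary_def)
    then show ?thesis using run[of i'] i' by (simp add: best_def)
  qed
  moreover have "repr (iarr ?e ''q2'') (rarr ?e ''f2'') (M + h) (\<Sum>x | x < N \<and> g x = h. y x)" if "h < M" for h
    using bd[OF that] that unfolding repr_def q2 f2 by (simp add: ZZ repr_unit)
  ultimately show "(\<forall>h<M. repr (iarr ?e ''q2'') (rarr ?e ''f2'') (M + h) (\<Sum>x | x < N \<and> g x = h. y x)) \<and>
      (\<forall>i<N. iarr ?e ''win'' (g i) = first_argmax {x. x < N \<and> g x = g i} \<kappa>)" by blast
  show "conflict_free \<omega> scatter_com s"
    using s P inj by (simp add: scatter_com_def leaf_com_def)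
qed (use s in \<open>auto simp: scatter_com_def leaf_com_def\<close>)

subsection \<open>Counts of the slots\<close>

text \<open>The excess of the count of a node over the integral parts of the masses of its children, and
  the part of it that goes to the left child.\<close>

definition excess :: "(nat \<Rightarrow> nat) \<Rightarrow> (nat \<Rightarrow> real) \<Rightarrow> nat \<Rightarrow> nat" where
  "excess c f u = c u + (if f (2 * u) + f (2 * u + 1) < 1 then 0 else 1)"

definition excess_left :: "(nat \<Rightarrow> real) \<Rightarrow> (nat \<Rightarrow> nat) \<Rightarrow> (nat \<Rightarrow> real) \<Rightarrow> nat \<Rightarrow> nat" where
  "excess_left \<omega> c f u = (if excess c f u < 1 then 0 else if 1 < excess c f u then 1
     else if \<omega> (4 * u + 2) < pleft (f (2 * u)) (f (2 * u + 1)) then 1 else 0)"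

definition excess_exp :: "iexp \<Rightarrow> iexp" where
  "excess_exp u = IAdd (IAt ''c'' u)
     (icarry (RAt ''f2'' (IAdd u u)) (RAt ''f2'' (IAdd (IAdd u u) (IConst 1))))"

definition pleft_exp :: "rexp \<Rightarrow> rexp \<Rightarrow> rexp" where
  "pleft_exp x y = RIf (RLess (RAdd x y) rone) (RDiv x (RAdd x y))
     (RDiv (RSub rone y) (RSub (RSub (ROfNat (IConst 2)) x) y))"

definition excess_left_exp :: "iexp \<Rightarrow> iexp" where
  "excess_left_exp u = IIf (ILess (excess_exp u) (IConst 1)) (IConst 0)
     (IIf (ILess (IConst 1) (excess_exp u)) (IConst 1)
       (IIf (RLess (RRand (IAdd (IAdd (IAdd u u) (IAdd u u)) (IConst 2)))
          (pleft_exp (RAt ''f2'' (IAdd u u)) (RAt ''f2'' (IAdd (IAdd u u) (IConst 1))))) (IConst 1) (IConst 0)))"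

lemma ival_excess_exp: "ival \<omega> s (excess_exp u) = excess (iarr s ''c'') (rarr s ''f2'') (ival \<omega> s u)"
  by (simp add: excess_exp_def excess_def mult_2)

lemma rval_pleft_exp: "rval \<omega> s (pleft_exp x y) = pleft (rval \<omega> s x) (rval \<omega> s y)"
  by (simp add: pleft_exp_def pleft_def)

lemma ival_excess_left_exp:
  "ival \<omega> s (excess_left_exp u) = excess_left \<omega> (iarr s ''c'') (rarr s ''f2'') (ival \<omega> s u)"
proof -
  have eq4: "x + x + (x + x) = 4 * x" for x :: nat by simp
  show ?thesis
    unfolding excess_left_exp_def excess_left_def ival.simps bval.simps rval.simps rval_pleft_exp
      ival_excess_exp eq4 by (simp only: mult_2)
qed

definition count_body :: com where
  "count_body =
     (let v = IAdd (IAdd (IVar ''W'') (IVar ''W'')) iv; u = IHalf v in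
      Seq (IPar ''i'' (IAdd (IVar ''W'') (IVar ''W'')) ''c'' v
        (IIf (ILess (IAdd u u) v) (ISub (excess_exp u) (excess_left_exp u)) (excess_left_exp u)))
      (ISet ''W'' (IAdd (IVar ''W'') (IVar ''W''))))"

definition count_init :: com where
  "count_init = Seq (IPar ''i'' (IConst 1) ''c'' (IAdd (IConst 1) iv)
       (IIf (RLess (RRand (IConst 2)) (RAt ''f2'' (IConst 1))) (IConst 1) (IConst 0)))
     (ISet ''W'' (IConst 1))"

definition count_com :: com where
  "count_com = Seq count_init (While (ILess (IVar ''W'') (IVar ''M'')) count_body)"

text \<open>Only the difference between a count and the integral part of the mass is stored in
  \<open>c\<close>. The surplus at a node is this difference plus the carry of the children's
  fractional parts, because the floor of a sum is the sum of the floors plus that carry.\<close>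

lemma reach_count:
  assumes s: "ivar s ''M'' = 2 ^ L"
    and rep: "\<And>v. 1 \<le> v \<Longrightarrow> v < 2 * 2 ^ L \<Longrightarrow> repr (iarr s ''q2'') (rarr s ''f2'') v (S v)"
    and S: "\<And>v. 0 < v \<Longrightarrow> v < 2 ^ L \<Longrightarrow> S v = S (2 * v) + S (2 * v + 1)" "\<And>v. 0 \<le> S v"
  shows "reach \<omega> count_com s
    (\<lambda>s'. \<forall>v. 1 \<le> v \<longrightarrow> v < 2 * 2 ^ L \<longrightarrow>
       int (iarr s ''q2'' v) + int (iarr s' ''c'' v) = cnt (\<lambda>v. \<omega> (4 * v + 2)) S v)
    (16 * 2 ^ L) (3 + 3 * L)"
proof -
  define q where "q = iarr s ''q2''"
  define f where "f = rarr s ''f2''"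
  let ?c = "cnt (\<lambda>v. \<omega> (4 * v + 2)) S"
  have rep': "int (q v) = \<lfloor>S v\<rfloor>" "f v = frac (S v)" if "1 \<le> v" "v < 2 * 2 ^ L" for v
    using rep[OF that] S(2)[of v] by (simp_all add: repr_def q_def f_def)
  define I where "I j s' \<longleftrightarrow> ivar s' ''M'' = 2 ^ L \<and> ivar s' ''W'' = 2 ^ j \<and> rarr s' ''f2'' = f \<and>
      (\<forall>v. 1 \<le> v \<longrightarrow> v < 2 * 2 ^ j \<longrightarrow> int (q v) + int (iarr s' ''c'' v) = ?c v)" for j and s' :: state
  have step: "bval \<omega> s' (ILess (IVar ''W'') (IVar ''M'')) \<and>
      reach \<omega> count_body s' (I (Suc j)) (2 + 2 * 2 ^ j) 2"
    if j: "j < L" and I: "I j s'" for j s'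
  proof
    define w :: nat where "w = 2 ^ j"
    have w2: "(2::nat) ^ Suc j = 2 * w" by (simp add: w_def)
    have w: "0 < w" "2 * w \<le> 2 ^ L" unfolding w_def using less_doubling[OF j] by auto
    show "bval \<omega> s' (ILess (IVar ''W'') (IVar ''M''))" using I j by (simp add: I_def)
    show "reach \<omega> count_body s' (I (Suc j)) (2 + 2 * 2 ^ j) 2"
    proof (rule reach_exec)
      let ?e = "exec \<omega> count_body s'"
      define C where "C = iarr s' ''c''"
      define r where "r = excess C f"
      define l where "l = excess_left \<omega> C f"
      have e: "ivar ?e = (ivar s')(''W'' := 2 * w)" "rarr ?e ''f2'' = f"
        using I by (auto simp: count_body_def Let_def exec_simps I_def w_def[symmetric] ival_excess_exp
            ival_excess_left_exp)
      have ec: "iarr ?e ''c'' v = (if 2 * w \<le> v \<and> v < 2 * w + 2 * w then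
          (if 2 * (v div 2) < v then r (v div 2) - l (v div 2) else l (v div 2)) else C v)" for v
        using I by (simp add: count_body_def Let_def exec_simps I_def w_def[symmetric] mult_2 C_def r_def l_def
            ival_excess_exp ival_excess_left_exp cong: if_cong)
      have new: "int (q v) + int (iarr ?e ''c'' v) = ?c v" if v: "2 * w \<le> v" "v < 2 * (2 * w)" for v
      proof -
        define u where "u = v div 2"
        have u1: "w \<le> u" "u < 2 * w" using v by (auto simp: u_def)
        then have u: "w \<le> u" "u < 2 * w" "0 < u" "u < 2 ^ L" "u < 2 * 2 ^ L" using w by linarith+
        have old: "int (q u) + int (C u) = ?c u" using I u w by (simp add: I_def w_def[symmetric] C_def)
        have S2: "S u = S (2 * u) + S (2 * u + 1)" using u by (intro S)
        have ra: "int (q (2 * u)) = \<lfloor>S (2 * u)\<rfloor>" "f (2 * u) = frac (S (2 * u))"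
          "int (q (2 * u + 1)) = \<lfloor>S (2 * u + 1)\<rfloor>" "f (2 * u + 1) = frac (S (2 * u + 1))"
          using u by (auto intro!: rep' simp del: One_nat_def)
        have ru: "int (r u) = ?c u - \<lfloor>S (2 * u)\<rfloor> - \<lfloor>S (2 * u + 1)\<rfloor>"
          using old rep'(1)[of u] u unfolding r_def excess_def S2 floor_add_frac ra by (simp split: if_splits)
        have lu: "?c (2 * u) = \<lfloor>S (2 * u)\<rfloor> + int (l u)"
          unfolding cnt_left[OF u(3)] lsplit_def Let_def ru[symmetric] unfolding l_def excess_left_def r_def ra by simp
        have "l u \<le> r u" by (simp add: l_def excess_left_def r_def)
        then have ru': "?c (2 * u + 1) = \<lfloor>S (2 * u + 1)\<rfloor> + int (r u - l u)"
          unfolding cnt_right[OF u(3)] lu using ru by (simp add: of_nat_diff)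
        consider "v = 2 * u" | "v = 2 * u + 1" unfolding u_def by linarith
        then show ?thesis using v lu ru' ra by cases (simp_all add: ec u_def[symmetric] del: One_nat_def)
      qed
      have "int (q v) + int (iarr ?e ''c'' v) = ?c v" if v: "1 \<le> v" "v < 2 * (2 * w)" for v
      proof (cases "2 * w \<le> v")
        case False
        then show ?thesis using I v by (simp add: ec I_def w_def[symmetric] C_def)
      qed (use new v in auto)
      then show "I (Suc j) ?e" using I unfolding I_def w2 by (simp add: e)
    qed (use I in \<open>auto simp: I_def count_body_def Let_def\<close>)
  qed
  have exit: "\<not> bval \<omega> s' (ILess (IVar ''W'') (IVar ''M''))" if "I L s'" for s'
    using that by (simp add: I_def)
  have W: "3 + (2 + 2 + 2) * x \<le> 16 * x" if "1 \<le> x" for x :: nat using that by simp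
  have "reach \<omega> count_com s (I L) (16 * 2 ^ L) (3 + 3 * L)"
    unfolding count_com_def
  proof (rule reach_exec_Seq[OF _ _ reach_doubling[where I = I and J = L and a = 2 and d = 2, OF _ step exit]])
    have "(1::nat) < 2 * 2 ^ L" using zero_less_power[of "2::nat" L] by linarith
    then have "int (q 1) + int (if \<omega> 2 < f 1 then 1 else 0) = ?c 1"
      using rep'[of 1] unfolding cnt_root by (simp add: numeral_2_eq_2)
    moreover have v1: "v = Suc 0" if "Suc 0 \<le> v" "v < 2" for v :: nat using that by simp
    ultimately show "I 0 (exec \<omega> count_init s)"
      using s by (auto simp: count_init_def I_def scatter_single f_def dest!: v1)
    show "work \<omega> count_init s + (2 + 2 + 2) * 2 ^ L \<le> 16 * 2 ^ L"
      using W[of "2 ^ L"] by (simp add: count_init_def)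
  qed (auto simp: count_init_def)
  then show ?thesis by (rule reach_conseq) (auto simp: I_def q_def)
qed

subsection \<open>Output\<close>

text \<open>Each coordinate looks up its own position and compares it with the winner of its slot,
  instead of winners writing to coordinates. Equality of integers is expressed by two negated
  comparisons.\<close>

definition output_com :: com where
  "output_com =
     (let sh = IAt ''sg'' (IAt ''rr'' iv); j = IAdd iv sh;
          pos = IIf (ILess j (IVar ''N'')) j (ISub j (IVar ''N'')); h = IAt ''g'' pos;
          v = IAdd (IVar ''M'') h in
      IPar ''i'' (IVar ''n'') ''out'' iv
        (IIf (BAnd (ILess (IConst 0) (IAdd (IAt ''q2'' v) (IAt ''c'' v)))
          (BAnd (BNot (ILess (IAt ''win'' h) pos)) (BNot (ILess pos (IAt ''win'' h))))) (IConst 1) (IConst 0)))"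

lemma reach_output:
  assumes s: "ivar s ''n'' = n" "ivar s ''N'' = N" "ivar s ''M'' = M" "iarr s ''g'' = g"
    and d: "\<And>i. i < n \<Longrightarrow> d i = rot_fwd N (iarr s ''sg'' (iarr s ''rr'' i)) i"
  shows "reach \<omega> output_com s
    (\<lambda>s'. output_set n s' = {i. i < n \<and> 0 < iarr s ''q2'' (M + g (d i)) + iarr s ''c'' (M + g (d i)) \<and>
        iarr s ''win'' (g (d i)) = d i}) (1 + n) 1"
proof (rule reach_exec)
  have "iarr (exec \<omega> output_com s) ''out'' i \<noteq> 0 \<longleftrightarrow>
      0 < iarr s ''q2'' (M + g (d i)) + iarr s ''c'' (M + g (d i)) \<and> iarr s ''win'' (g (d i)) = d i"
    if "i < n" for i
    using s d[OF that] that by (simp add: output_com_def Let_def exec_simps rot_fwd_def)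
  then show "output_set n (exec \<omega> output_com s) = {i. i < n \<and> 0 < iarr s ''q2'' (M + g (d i)) + iarr s ''c'' (M + g (d i)) \<and>
        iarr s ''win'' (g (d i)) = d i}" by (auto simp: output_set_def)
qed (use s in \<open>auto simp: output_com_def Let_def\<close>)

section \<open>Slots\<close>

text \<open>The two floors count the cuts up to either end of the item. They are equal if no cut
  separates the ends and differ by one otherwise, so their sum encodes the interval in its half and
  the presence of a cut in its parity. Block b owns the numbers from b T on.\<close>

definition slot :: "nat \<Rightarrow> nat \<Rightarrow> real \<Rightarrow> (nat \<Rightarrow> real) \<Rightarrow> nat \<Rightarrow> nat" where
  "slot m T \<theta> y i = i div m * T + nat \<lfloor>\<theta> + block_sum m y i\<rfloor> + nat \<lfloor>\<theta> + block_sum m y i + y i\<rfloor>"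

text \<open>Cutting the line of a block at the points \<open>\<int> - \<theta>\<close>, items between two cuts share an even slot of mass
  at most one, and an item containing a cut has an odd slot for itself.\<close>

locale slots =
  fixes m K T :: nat and k :: real and \<theta> :: real and y :: "nat \<Rightarrow> real"
  assumes m: "0 < m" and \<theta>: "0 < \<theta>" "\<theta> < 1"
    and y: "\<And>i. 0 \<le> y i \<and> y i \<le> 1" and total: "(\<Sum>i<K * m. y i) \<le> k"
    and T: "2 * min (real m) k + 2 \<le> real T"
begin

abbreviation "B \<equiv> block_sum m y"
abbreviation "sl \<equiv> slot m T \<theta> y"

lemma B_nonneg: "0 \<le> B i"
  unfolding block_sum_def using y by (auto intro: sum_nonneg)

lemma B_Suc: "B i + y i = (\<Sum>j\<in>{i div m * m..<Suc i}. y j)"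
  unfolding block_sum_def by (subst sum.atLeastLessThan_Suc) auto

lemma B_bound:
  assumes "i < K * m"
  shows "B i + y i \<le> min (real m) k"
proof -
  have "Suc i - i div m * m \<le> m" using m
    by (metis Suc_leI add_diff_cancel_left' div_mult_mod_eq mod_less_divisor Suc_diff_le times_div_less_eq_dividend mult.commute)
  moreover have "(\<Sum>j\<in>{i div m * m..<Suc i}. y j) \<le> (\<Sum>j\<in>{i div m * m..<Suc i}. 1)"
    using y by (intro sum_mono) auto
  ultimately have 1: "B i + y i \<le> real m" unfolding B_Suc by simp
  have "(\<Sum>j\<in>{i div m * m..<Suc i}. y j) \<le> (\<Sum>j<K * m. y j)"
    using assms y by (intro sum_mono2) auto
  then have "B i + y i \<le> k" unfolding B_Suc using total by simp
  with 1 show ?thesis by simp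
qed

text \<open>The right end of an item lies below 1 + min m k, offset included, so twice its floor is
  below 2 min m k + 2. This is where the condition on \<open>T\<close> comes from.\<close>

lemma slot_bounds:
  assumes i: "i < K * m"
  shows "i div m * T \<le> sl i" "sl i < (i div m + 1) * T"
proof -
  define b where "b = min (real m) k"
  have "B i + y i \<le> b" using B_bound[OF i] by (simp add: b_def)
  define c where "c = \<lfloor>\<theta> + B i + y i\<rfloor>"
  have a: "\<lfloor>\<theta> + B i\<rfloor> \<le> c" unfolding c_def using y by (intro floor_mono) simp
  have a0: "0 \<le> \<lfloor>\<theta> + B i\<rfloor>" using \<theta> B_nonneg[of i] by simp
  have "real_of_int c \<le> \<theta> + B i + y i" by (simp add: c_def)
  then have "real_of_int c < 1 + b" using \<theta> \<open>B i + y i \<le> b\<close> by linarith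
  then have "2 * real_of_int c < real T" using T by (simp add: b_def)
  then have "2 * c < int T" by linarith
  then have "nat \<lfloor>\<theta> + B i\<rfloor> + nat c < T" using a a0 by linarith
  then show "i div m * T \<le> sl i" "sl i < (i div m + 1) * T"
    unfolding slot_def c_def by (simp_all add: algebra_simps)
qed

lemma block_sum_le:
  assumes "i < j" "i div m = j div m"
  shows "B i + y i \<le> B j"
  unfolding B_Suc unfolding block_sum_def assms(2) using assms y by (intro sum_mono2) auto

lemma slot_mono:
  assumes "i \<le> j" "j < K * m"
  shows "sl i \<le> sl j"
proof (cases "i = j")
  case False
  then have ij: "i < j" using assms by simp
  show ?thesis
  proof (cases "i div m = j div m")
    case True
    note le = block_sum_le[OF ij True]
    have "\<lfloor>\<theta> + B i\<rfloor> \<le> \<lfloor>\<theta> + B j\<rfloor>" "\<lfloor>\<theta> + B i + y i\<rfloor> \<le> \<lfloor>\<theta> + B j + y j\<rfloor>"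
      using le y[of i] y[of j] by (auto intro!: floor_mono)
    then show ?thesis unfolding slot_def True by (intro add_mono nat_mono) auto
  next
    case False
    then have "i div m + 1 \<le> j div m" using div_le_mono[of i j m] assms by simp
    then have "(i div m + 1) * T \<le> j div m * T" by (rule mult_le_mono1)
    then show ?thesis using slot_bounds[of i] slot_bounds[of j] assms by linarith
  qed
qed simp

lemma slot_less: "i < K * m \<Longrightarrow> sl i < K * T"
proof -
  assume i: "i < K * m"
  then have "i div m + 1 \<le> K" by (metis Suc_eq_plus1 Suc_leI less_mult_imp_div_less)
  then have "(i div m + 1) * T \<le> K * T" by (rule mult_le_mono1)
  with slot_bounds[OF i] show "sl i < K * T" by linarith
qed

text \<open>The four floors at the ends of items i and j are increasing. Equal sums then force all
  four to be equal.\<close>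

lemma slot_eq:
  assumes "i < j" "j < K * m" "sl i = sl j"
  shows "i div m = j div m" "\<lfloor>\<theta> + B j + y j\<rfloor> = \<lfloor>\<theta> + B i\<rfloor>"
proof -
  show d: "i div m = j div m"
  proof (rule ccontr)
    assume "i div m \<noteq> j div m"
    then have "i div m + 1 \<le> j div m" using div_le_mono[of i j m] assms by simp
    then have "(i div m + 1) * T \<le> j div m * T" by (rule mult_le_mono1)
    then show False using slot_bounds[of i] slot_bounds[of j] assms by linarith
  qed
  note le = block_sum_le[OF assms(1) d]
  define a a' c c' where "a = \<lfloor>\<theta> + B i\<rfloor>" and "a' = \<lfloor>\<theta> + B j\<rfloor>"
    and "c = \<lfloor>\<theta> + B i + y i\<rfloor>" and "c' = \<lfloor>\<theta> + B j + y j\<rfloor>"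
  have "0 \<le> a" unfolding a_def using \<theta> B_nonneg[of i] by simp
  moreover have "a \<le> c" "c \<le> a'" "a' \<le> c'"
    unfolding a_def c_def a'_def c'_def using le y[of i] y[of j] by (auto intro!: floor_mono)
  moreover have "nat a + nat c = nat a' + nat c'"
    using assms(3) unfolding slot_def d a_def a'_def c_def c'_def by simp
  ultimately have "c' = a" by linarith
  then show "\<lfloor>\<theta> + B j + y j\<rfloor> = \<lfloor>\<theta> + B i\<rfloor>" by (simp add: a_def c'_def)
qed

text \<open>A slot with a single item has at most that item's mass. Otherwise its first left end and
  its last right end have the same floor, so they are less than one apart, and the slot's mass fits
  in between.\<close>

lemma slot_mass:
  "0 \<le> (\<Sum>x | x < K * m \<and> sl x = h. y x)" "(\<Sum>x | x < K * m \<and> sl x = h. y x) \<le> 1"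
proof -
  let ?X = "{x. x < K * m \<and> sl x = h}"
  show "0 \<le> (\<Sum>x\<in>?X. y x)" using y by (intro sum_nonneg) auto
  show "(\<Sum>x\<in>?X. y x) \<le> 1"
  proof (cases "?X = {}")
    case False
    have fin: "finite ?X" by simp
    define i j where "i = Min ?X" and "j = Max ?X"
    have ij: "i \<in> ?X" "j \<in> ?X" unfolding i_def j_def using fin False by (auto intro!: Min_in Max_in simp del: mem_Collect_eq)
    have sub: "?X \<subseteq> {i..<Suc j}" using fin by (auto simp: i_def j_def less_Suc_eq_le)
    show ?thesis
    proof (cases "i = j")
      case True
      then have "(\<Sum>x\<in>?X. y x) \<le> (\<Sum>x\<in>{i..<Suc i}. y x)" using sub y by (intro sum_mono2) auto
      then show ?thesis using y[of i] by simp
    next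
      case False
      then have lt: "i < j" using ij sub by force
      have eq: "i div m = j div m" "\<lfloor>\<theta> + B j + y j\<rfloor> = \<lfloor>\<theta> + B i\<rfloor>"
        using slot_eq[OF lt] ij by auto
      have "(\<Sum>x\<in>?X. y x) \<le> (\<Sum>x\<in>{i..<Suc j}. y x)" using sub y by (intro sum_mono2) auto
      also have "B i + (\<Sum>x\<in>{i..<Suc j}. y x) = B j + y j"
        unfolding B_Suc[of j] unfolding block_sum_def eq(1)
        by (rule sum.atLeastLessThan_concat) (use lt in \<open>auto simp: eq(1)[symmetric]\<close>)
      then have "(\<Sum>x\<in>{i..<Suc j}. y x) = (\<theta> + B j + y j) - (\<theta> + B i)" by simp
      also have "\<dots> \<le> 1" using eq(2) by linarith
      finally show ?thesis .
    qed
  next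
    case True
    then show ?thesis by (simp only: sum.empty)
  qed
qed

end

section \<open>Expected counts\<close>

lemma cnt_root_tape: "cnt (\<lambda>v. \<omega> (4 * v + 2)) S 1 = \<lfloor>S 1\<rfloor> + (if \<omega> 2 < frac (S 1) then 1 else 0)"
  unfolding cnt_root mult_0_right add_0 ..

text \<open>The parent's count has countably many values, and for each fixed value the split depends
  on one coin; this is why measurability is stated into the counting space.\<close>

lemma measurable_cnt: "0 < v \<Longrightarrow> (\<lambda>\<omega>. cnt (\<lambda>v. \<omega> (4 * v + 2)) S v) \<in> measurable tape (count_space UNIV)"
proof (induction v rule: less_induct)
  case (less v)
  let ?c = "\<lambda>v \<omega>. cnt (\<lambda>v. \<omega> (4 * v + 2)) S v"
  show ?case
  proof (cases "v = 1")
    case True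
    have "{\<omega> \<in> space tape. \<omega> 2 < frac (S 1)} \<in> sets tape" by simp
    then have "(\<lambda>\<omega>. if \<omega> 2 < frac (S 1) then \<lfloor>S 1\<rfloor> + 1 else \<lfloor>S 1\<rfloor> + 0) \<in> measurable tape (count_space UNIV)"
      by (intro measurable_If) simp_all
    then show ?thesis unfolding True cnt_root_tape by (simp add: if_distrib[of "(+) _"] cong: if_cong)
  next
    case False
    define w where "w = v div 2"
    have w: "0 < w" "w < v" using less.prems False by (auto simp: w_def)
    let ?l = "\<lambda>n \<omega>. lsplit (\<omega> (4 * w + 2)) (S (2 * w)) (S (2 * w + 1)) n"
    have "?l n \<in> measurable tape (count_space UNIV)" for n
    proof -
      define r where "r = n - \<lfloor>S (2 * w)\<rfloor> - \<lfloor>S (2 * w + 1)\<rfloor>"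
      have "(\<lambda>\<omega>. if \<omega> (4 * w + 2) < pleft (frac (S (2 * w))) (frac (S (2 * w + 1)))
          then \<lfloor>S (2 * w)\<rfloor> + 1 else \<lfloor>S (2 * w)\<rfloor> + 0) \<in> measurable tape (count_space UNIV)"
        by (intro measurable_If) simp_all
      then show ?thesis unfolding lsplit_def Let_def r_def[symmetric]
        by (cases "r \<le> 0"; cases "2 \<le> r") (simp_all add: if_distrib[of "(+) _"] cong: if_cong)
    qed
    then have l: "(\<lambda>\<omega>. ?l (?c w \<omega>) \<omega>) \<in> measurable tape (count_space UNIV)"
      by (rule measurable_compose_countable) (rule less.IH[OF w(2,1)])
    have r: "(\<lambda>\<omega>. ?c w \<omega> - ?l (?c w \<omega>) \<omega>) \<in> measurable tape (count_space UNIV)"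
      by (rule measurable_compose_countable[OF _ l, of "\<lambda>n \<omega>. ?c w \<omega> - n"])
         (rule measurable_compose[OF less.IH[OF w(2,1)]], simp)
    consider "v = 2 * w" | "v = 2 * w + 1" unfolding w_def by linarith
    then show ?thesis
    proof cases
      case 1
      show ?thesis unfolding 1 cnt_left[OF w(1)] by (rule l)
    next
      case 2
      show ?thesis unfolding 2 cnt_right[OF w(1)] cnt_left[OF w(1)] by (rule r)
    qed
  qed
qed

lemma valid_bound: "valid s n \<Longrightarrow> \<bar>real_of_int n\<bar> \<le> \<bar>s\<bar> + 1"
  unfolding valid_def by linarith

lemma integral_coin:
  assumes "0 \<le> p" "p \<le> 1"
  shows "(\<integral>\<omega>. (if \<omega> c < p then x + 1 else x :: real) \<partial>tape) = x + p"
proof -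
  let ?A = "{\<omega> \<in> space tape. \<omega> c < p}"
  have "(\<integral>\<omega>. (if \<omega> c < p then x + 1 else x) \<partial>tape) = (\<integral>\<omega>. x + indicator ?A \<omega> \<partial>tape)"
    by (intro Bochner_Integration.integral_cong refl) (auto simp: indicator_def)
  also have "\<dots> = (\<integral>\<omega>. x \<partial>tape) + (\<integral>\<omega>. indicator ?A \<omega> \<partial>tape)"
  proof (rule Bochner_Integration.integral_add)
    show "integrable tape (indicator ?A :: _ \<Rightarrow> real)"
      by (rule tape.integrable_const_bound[where B = 1])
         (simp add: indicator_def, rule borel_measurable_indicator, rule sets_tape_coordinate_less)
  qed simp
  also have "(\<integral>\<omega>. indicator ?A \<omega> \<partial>tape) = p"
    using prob_tape_indicator[OF sets_tape_coordinate_less, symmetric, of c p] prob_tape_coordinate_less[OF assms] by simp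
  finally show ?thesis by (simp add: tape.prob_space)
qed

context
  fixes L :: nat and S :: "nat \<Rightarrow> real"
  assumes add: "\<And>v. 0 < v \<Longrightarrow> v < 2 ^ L \<Longrightarrow> S v = S (2 * v) + S (2 * v + 1)"
begin

abbreviation "C \<equiv> \<lambda>v \<omega>. cnt (\<lambda>v. \<omega> (4 * v + 2)) S v"

lemma cnt_valid_tape: "\<omega> \<in> space tape \<Longrightarrow> 0 < v \<Longrightarrow> v < 2 * 2 ^ L \<Longrightarrow> valid (S v) (C v \<omega>)"
  using add by (intro cnt_valid[where M = "2 ^ L"]) (auto simp: space_tape)

lemma borel_measurable_cnt: "0 < v \<Longrightarrow> (\<lambda>\<omega>. real_of_int (C v \<omega>)) \<in> borel_measurable tape"
  by (rule measurable_compose[OF measurable_cnt]) simp_all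

lemma integrable_cnt:
  assumes "0 < v" "v < 2 * 2 ^ L"
  shows "integrable tape (\<lambda>\<omega>. real_of_int (C v \<omega>))"
proof (rule tape.integrable_const_bound[where B = "\<bar>S v\<bar> + 1"])
  show "AE \<omega> in tape. norm (real_of_int (C v \<omega>)) \<le> \<bar>S v\<bar> + 1"
    unfolding real_norm_def by (intro AE_I2 valid_bound cnt_valid_tape assms)
qed (rule borel_measurable_cnt[OF assms(1)])

text \<open>All cells except the coin of the parent w are fixed. The count of w does not depend on
  that coin, so \<open>lsplit_expectation\<close> gives the conditional mean of the left count as an
  affine function of the count of w. Averaging with the induction hypothesis cancels the correction
  term; the right child follows by subtraction.\<close>

lemma expectation_cnt:
  "0 < v \<Longrightarrow> v < 2 * 2 ^ L \<Longrightarrow> (\<integral>\<omega>. real_of_int (C v \<omega>) \<partial>tape) = S v"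
proof (induction v rule: less_induct)
  case (less v)
  show ?case
  proof (cases "v = 1")
    case True
    have "(\<integral>\<omega>. real_of_int (C 1 \<omega>) \<partial>tape)
      = (\<integral>\<omega>. (if \<omega> 2 < frac (S 1) then real_of_int \<lfloor>S 1\<rfloor> + 1 else real_of_int \<lfloor>S 1\<rfloor>) \<partial>tape)"
      unfolding cnt_root_tape by (intro Bochner_Integration.integral_cong refl) simp
    also have "\<dots> = real_of_int \<lfloor>S 1\<rfloor> + frac (S 1)" by (rule integral_coin) (auto simp: frac_lt_1 less_imp_le)
    finally show ?thesis unfolding True by (simp add: frac_def)
  next
    case False
    define w where "w = v div 2"
    have w: "0 < w" "w < v" "w < 2 ^ L" "w < 2 * 2 ^ L" using less.prems False by (auto simp: w_def)
    define a b where "a = S (2 * w)" and "b = S (2 * w + 1)"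
    have Sw: "S w = a + b" using add w by (simp add: a_def b_def)
    define c where "c = 4 * w + 2"
    define J where "J = - {c}"
    define \<gamma> where "\<gamma> = (if frac a + frac b < 1 then pleft (frac a) (frac b) else 1 - pleft (frac a) (frac b))"
    have EC: "(\<integral>\<omega>. real_of_int (C w \<omega>) \<partial>tape) = a + b" using less.IH[OF w(2,1,4)] Sw by simp
    have l: "(\<integral>\<omega>. real_of_int (C (2 * w) \<omega>) \<partial>tape) = a"
    proof -
      have w2: "0 < 2 * w" "2 * w < 2 * 2 ^ L" using w by auto
      have "(\<integral>\<omega>. real_of_int (C (2 * w) \<omega>) \<partial>tape)
          = (\<integral>\<omega>. (\<integral>\<omega>'. real_of_int (C (2 * w) (tape_merge J \<omega> \<omega>')) \<partial>tape) \<partial>tape)"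
        by (rule expectation_tape_merge[where B = "\<bar>S (2 * w)\<bar> + 1", OF borel_measurable_cnt[OF w2(1)]])
           (rule valid_bound, rule cnt_valid_tape, assumption, rule w2, rule w2)
      also have "\<dots> = (\<integral>\<omega>. a + (real_of_int (C w \<omega>) - (a + b)) * \<gamma> \<partial>tape)"
      proof (intro Bochner_Integration.integral_cong refl)
        fix \<omega> assume \<omega>: "\<omega> \<in> space tape"
        define n where "n = C w \<omega>"
        have v: "valid (a + b) n" unfolding n_def Sw[symmetric] using \<omega> w by (intro cnt_valid_tape) auto
        define r where "r = n - \<lfloor>a\<rfloor> - \<lfloor>b\<rfloor>"
        have "C (2 * w) (tape_merge J \<omega> \<omega>') = lsplit (\<omega>' c) a b n" for \<omega>'
        proof -
          have "C w (tape_merge J \<omega> \<omega>') = n" unfolding n_def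
            by (rule cnt_cong[OF w(1)]) (simp add: tape_merge_def J_def c_def)
          then show ?thesis unfolding cnt_left[OF w(1)] a_def b_def
            by (simp add: tape_merge_def J_def c_def)
        qed
        then have "(\<integral>\<omega>'. real_of_int (C (2 * w) (tape_merge J \<omega> \<omega>')) \<partial>tape)
            = (\<integral>\<omega>'. real_of_int (lsplit (\<omega>' c) a b n) \<partial>tape)" by simp
        also have "\<dots> = real_of_int \<lfloor>a\<rfloor> + (if r \<le> 0 then 0 else if 2 \<le> r then 1 else pleft (frac a) (frac b))"
        proof -
          consider "r \<le> 0" | "2 \<le> r" | "\<not> r \<le> 0" "\<not> 2 \<le> r" by linarith
          then show ?thesis
          proof cases
            case 3
            have "(\<integral>\<omega>'. real_of_int (lsplit (\<omega>' c) a b n) \<partial>tape) = (\<integral>\<omega>'. (if \<omega>' c < pleft (frac a) (frac b)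
               then real_of_int \<lfloor>a\<rfloor> + 1 else real_of_int \<lfloor>a\<rfloor>) \<partial>tape)"
              unfolding lsplit_def Let_def r_def[symmetric] using 3
              by (intro Bochner_Integration.integral_cong refl) simp
            also have "\<dots> = real_of_int \<lfloor>a\<rfloor> + pleft (frac a) (frac b)"
              by (rule integral_coin) (auto intro!: pleft_bounds simp: frac_lt_1)
            finally show ?thesis using 3 by simp
          qed (simp_all add: lsplit_def r_def[symmetric] tape.prob_space)
        qed
        also have "\<dots> = a + (real_of_int n - (a + b)) * \<gamma>"
          unfolding \<gamma>_def r_def using lsplit_expectation[OF v] by simp
        finally show "(\<integral>\<omega>'. real_of_int (C (2 * w) (tape_merge J \<omega> \<omega>')) \<partial>tape)
          = a + (real_of_int (C w \<omega>) - (a + b)) * \<gamma>" by (simp add: n_def)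
      qed
      also have "\<dots> = a + ((\<integral>\<omega>. real_of_int (C w \<omega>) \<partial>tape) - (a + b)) * \<gamma>"
        using integrable_cnt[OF w(1,4)] by (simp add: tape.prob_space)
      finally show ?thesis using EC by simp
    qed
    consider "v = 2 * w" | "v = 2 * w + 1" unfolding w_def by linarith
    then show ?thesis
    proof cases
      case 1
      then show ?thesis using l by (simp add: a_def)
    next
      case 2
      have "(\<integral>\<omega>. real_of_int (C v \<omega>) \<partial>tape) = (\<integral>\<omega>. real_of_int (C w \<omega>) - real_of_int (C (2 * w) \<omega>) \<partial>tape)"
        unfolding 2 cnt_right[OF w(1)] by simp
      also have "\<dots> = (a + b) - a"
        using integrable_cnt[of w] integrable_cnt[of "2 * w"] w EC l by simp
      finally show ?thesis using 2 by (simp add: b_def)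
    qed
  qed
qed

text \<open>Each node's count is split exactly among its children, so the leaf counts of a subtree
  add up to the count at its top.\<close>

lemma nsum_cnt: "0 < v \<Longrightarrow> nsum (2 ^ L) (\<lambda>v. C v \<omega>) v = C v \<omega>"
proof (induction "2 ^ L - v" arbitrary: v rule: less_induct)
  case less
  show ?case
  proof (cases "2 ^ L \<le> v")
    case False
    have "nsum (2 ^ L) (\<lambda>v. C v \<omega>) (2 * v) = C (2 * v) \<omega>" "nsum (2 ^ L) (\<lambda>v. C v \<omega>) (2 * v + 1) = C (2 * v + 1) \<omega>"
      using False less.prems by (intro less.hyps; linarith)+
    then show ?thesis using False less.prems by (simp add: ntree_node cnt_right del: One_nat_def)
  qed (simp add: ntree_leaf)
qed

end


section \<open>Sampling groups and winners\<close>

text \<open>A group \<open>g\<close> of mass \<open>\<Sum>p. a g p \<le> 1\<close> receives a count in \<open>{0, 1}\<close>, and if the count is one then the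
  exponential clocks select its winner.\<close>

definition gmass :: "nat \<Rightarrow> (nat \<Rightarrow> nat \<Rightarrow> real) \<Rightarrow> nat \<Rightarrow> real" where
  "gmass N a g = (\<Sum>p<N. a g p)"

definition nodesum :: "nat \<Rightarrow> nat \<Rightarrow> (nat \<Rightarrow> nat \<Rightarrow> real) \<Rightarrow> nat \<Rightarrow> real" where
  "nodesum L N a = nsum (2 ^ L) (\<lambda>v. gmass N a (v - 2 ^ L))"

definition gcount :: "nat \<Rightarrow> nat \<Rightarrow> (nat \<Rightarrow> real) \<Rightarrow> (nat \<Rightarrow> nat \<Rightarrow> real) \<Rightarrow> nat \<Rightarrow> int" where
  "gcount L N \<omega> a g = cnt (\<lambda>v. \<omega> (4 * v + 2)) (nodesum L N a) (2 ^ L + g)"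

definition gwin :: "nat \<Rightarrow> (nat \<Rightarrow> real) \<Rightarrow> (nat \<Rightarrow> nat \<Rightarrow> real) \<Rightarrow> nat \<Rightarrow> nat" where
  "gwin N \<omega> a g = first_argmax {..<N} (clock_key (\<lambda>p. \<omega> (4 * p + 3)) (a g))"

definition sampler :: "nat \<Rightarrow> nat \<Rightarrow> (nat \<Rightarrow> real) \<Rightarrow> (nat \<Rightarrow> nat \<Rightarrow> real) \<Rightarrow> (nat \<times> nat) set" where
  "sampler L N \<omega> a = {(g, p). g < 2 ^ L \<and> p < N \<and> 1 \<le> gcount L N \<omega> a g \<and> gwin N \<omega> a g = p}"

definition feasible :: "nat \<Rightarrow> nat \<Rightarrow> (nat \<Rightarrow> nat \<Rightarrow> real) \<Rightarrow> bool" where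
  "feasible L N a \<longleftrightarrow> (\<forall>g p. 0 \<le> a g p) \<and> (\<forall>g<2 ^ L. gmass N a g \<le> 1)"

lemma nodesum_add:
  "0 < v \<Longrightarrow> v < 2 ^ L \<Longrightarrow> nodesum L N a v = nodesum L N a (2 * v) + nodesum L N a (2 * v + 1)"
  unfolding nodesum_def by (rule ntree_node)

lemma nodesum_leaf: "nodesum L N a (2 ^ L + g) = gmass N a g"
  unfolding nodesum_def by (simp add: ntree_leaf)

lemma gmass_nonneg: "feasible L N a \<Longrightarrow> 0 \<le> gmass N a g"
  unfolding feasible_def gmass_def by (intro sum_nonneg) auto

text \<open>Validity for a mass in the unit interval leaves only 0 and 1, and an empty group has
  floor and ceiling 0. Thus a group that elects a member has positive mass on every tape.\<close>

lemma gcount_cases: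
  assumes "feasible L N a" "\<omega> \<in> space tape" "g < 2 ^ L"
  shows "gcount L N \<omega> a g = 0 \<or> gcount L N \<omega> a g = 1 \<and> 0 < gmass N a g"
proof -
  have "valid (nodesum L N a (2 ^ L + g)) (gcount L N \<omega> a g)"
    unfolding gcount_def using assms by (intro cnt_valid_tape[where L = L] nodesum_add) auto
  then have v: "valid (gmass N a g) (gcount L N \<omega> a g)" by (simp only: nodesum_leaf)
  have z: "0 \<le> gmass N a g" "gmass N a g \<le> 1"
    using assms gmass_nonneg by (auto simp: feasible_def)
  then have "\<lceil>gmass N a g\<rceil> \<le> 1" "0 \<le> \<lfloor>gmass N a g\<rfloor>" by (simp_all add: ceiling_le_iff)
  then have "gcount L N \<omega> a g = 0 \<or> gcount L N \<omega> a g = 1" using v unfolding valid_def by linarith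
  moreover have "gcount L N \<omega> a g = 0" if "gmass N a g = 0" using v that by (simp add: valid_def)
  ultimately show ?thesis using z by fastforce
qed

lemma gwin_less: "0 < N \<Longrightarrow> gwin N \<omega> a g < N"
  using first_argmax(1)[of "{..<N}"] by (auto simp: gwin_def)

text \<open>One pair is sampled for each group of count one, so the size is the sum of the leaf
  counts, which is the count of the root, a valid rounding of the total mass.\<close>

lemma card_sampler:
  assumes "feasible L N a" "\<omega> \<in> space tape" "0 < N"
  shows "valid (\<Sum>g<2 ^ L. gmass N a g) (int (card (sampler L N \<omega> a)))"
proof -
  let ?S = "nodesum L N a" and ?c = "gcount L N \<omega> a"
  have c: "?c g = 0 \<or> ?c g = 1" if "g < 2 ^ L" for g using gcount_cases[OF assms(1,2) that] by auto
  have "sampler L N \<omega> a = (\<lambda>g. (g, gwin N \<omega> a g)) ` {g. g < 2 ^ L \<and> 1 \<le> ?c g}"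
    using gwin_less[OF assms(3)] by (auto simp: sampler_def)
  then have "card (sampler L N \<omega> a) = card {g. g < 2 ^ L \<and> 1 \<le> ?c g}"
    by (simp add: card_image inj_on_def)
  also have "int \<dots> = (\<Sum>g | g < 2 ^ L \<and> 1 \<le> ?c g. 1)" by simp
  also have "\<dots> = (\<Sum>g<2 ^ L. if 1 \<le> ?c g then 1 else 0)"
    by (subst sum.inter_filter[symmetric]) auto
  also have "\<dots> = (\<Sum>g<2 ^ L. ?c g)" using c by (intro sum.cong) force+
  also have "\<dots> = nsum (2 ^ L) (\<lambda>v. cnt (\<lambda>v. \<omega> (4 * v + 2)) ?S v) 1"
    unfolding nsum_root sum_heap_leaves gcount_def ..
  also have "\<dots> = cnt (\<lambda>v. \<omega> (4 * v + 2)) ?S 1"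
    by (rule nsum_cnt) (simp_all add: nodesum_add del: One_nat_def)
  finally have "int (card (sampler L N \<omega> a)) = cnt (\<lambda>v. \<omega> (4 * v + 2)) ?S 1" .
  moreover have "valid (?S 1) (cnt (\<lambda>v. \<omega> (4 * v + 2)) ?S 1)"
  proof (rule cnt_valid_tape[where L = L])
    show "(1::nat) < 2 * 2 ^ L" using zero_less_power[of "2::nat" L] by linarith
  qed (use assms in \<open>simp_all add: nodesum_add del: One_nat_def\<close>)
  moreover have "?S 1 = (\<Sum>g<2 ^ L. gmass N a g)"
    unfolding nodesum_def nsum_root sum_heap_leaves by simp
  ultimately show ?thesis by simp
qed

lemma sets_gwin: "0 < N \<Longrightarrow> {\<omega> \<in> space tape. gwin N \<omega> a g = p} \<in> sets tape"
proof -
  assume "0 < N"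
  then have N: "{..<N} \<noteq> {}" by auto
  have "{\<omega> \<in> space tape. gwin N \<omega> a g = p} = {\<omega> \<in> space tape. p < N \<and> (\<forall>q<N.
      clock_key (\<lambda>p. \<omega> (4 * p + 3)) (a g) q \<le> clock_key (\<lambda>p. \<omega> (4 * p + 3)) (a g) p \<and>
      (q < p \<longrightarrow> clock_key (\<lambda>p. \<omega> (4 * p + 3)) (a g) q < clock_key (\<lambda>p. \<omega> (4 * p + 3)) (a g) p))}"
    unfolding gwin_def first_argmax_eq_iff[OF finite_lessThan N] by auto
  also have "\<dots> \<in> sets tape"
    by (intro sets.sets_Collect_conj sets.sets_Collect_const sets.sets_Collect_countable_All
        sets.sets_Collect_imp borel_measurable_le borel_measurable_less measurable_clock_key)
  finally show ?thesis .
qed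

lemma sets_gcount: "{\<omega> \<in> space tape. 1 \<le> gcount L N \<omega> a g} \<in> sets tape"
proof -
  have "(\<lambda>\<omega>. gcount L N \<omega> a g) -` {1..} \<inter> space tape \<in> sets tape"
    unfolding gcount_def by (rule measurable_sets[OF measurable_cnt]) auto
  then show ?thesis by (simp add: vimage_def Int_def conj_commute)
qed

lemma sets_sampler: "0 < N \<Longrightarrow> {\<omega> \<in> space tape. gp \<in> sampler L N \<omega> a} \<in> sets tape"
proof -
  assume N: "0 < N"
  obtain g p where gp: "gp = (g, p)" by fastforce
  have "{\<omega> \<in> space tape. g < 2 ^ L \<and> p < N \<and> 1 \<le> gcount L N \<omega> a g \<and> gwin N \<omega> a g = p} \<in> sets tape"
    by (intro sets.sets_Collect_conj sets.sets_Collect_const sets_gcount sets_gwin[OF N])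
  moreover have "gp \<in> sampler L N \<omega> a \<longleftrightarrow>
      g < 2 ^ L \<and> p < N \<and> 1 \<le> gcount L N \<omega> a g \<and> gwin N \<omega> a g = p" for \<omega>
    unfolding gp sampler_def by blast
  ultimately show ?thesis by (simp only:)
qed

lemma integrable_sampler: "0 < N \<Longrightarrow> integrable tape (\<lambda>\<omega>. of_bool (gp \<in> sampler L N \<omega> a) :: real)"
proof (rule tape.integrable_const_bound[where B = 1])
  assume N: "0 < N"
  have "(\<lambda>\<omega>. if gp \<in> sampler L N \<omega> a then 1 else 0 :: real) \<in> borel_measurable tape"
    by (intro measurable_If sets_sampler N) simp_all
  then show "(\<lambda>\<omega>. of_bool (gp \<in> sampler L N \<omega> a) :: real) \<in> borel_measurable tape"
    by (simp add: of_bool_def)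
qed simp

text \<open>Coins and clocks use disjoint cells: the expected count of the group is its mass z, and
  independently p wins with probability a g p / z.\<close>

lemma expectation_sampler:
  assumes a: "feasible L N a" and N: "0 < N" and g: "g < 2 ^ L" and p: "p < N"
  shows "(\<integral>\<omega>. of_bool ((g, p) \<in> sampler L N \<omega> a) \<partial>tape) = a g p"
proof (cases "gmass N a g = 0")
  case True
  have "a g p = 0" using True a p sum_nonneg_eq_0_iff[of "{..<N}" "a g"]
    by (auto simp: gmass_def feasible_def)
  moreover have "(\<integral>\<omega>. of_bool ((g, p) \<in> sampler L N \<omega> a) \<partial>tape) = (\<integral>\<omega>. (0 :: real) \<partial>tape)"
    using gcount_cases[OF a _ g] True
    by (intro Bochner_Integration.integral_cong refl) (auto simp: sampler_def)
  ultimately show ?thesis by simp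
next
  case False
  \<comment> \<open>Residue 2 modulo 4 marks the coins; the clocks, of residue 3, are
    redrawn.\<close>
  define J where "J = {j::nat. j mod 4 = 2}"
  define z where "z = gmass N a g"
  have z: "0 < z" using False gmass_nonneg[OF a, of g] by (simp add: z_def)
  have "(\<integral>\<omega>. (of_bool ((g, p) \<in> sampler L N \<omega> a) :: real) \<partial>tape)
      = (\<integral>\<omega>. (\<integral>\<omega>'. of_bool ((g, p) \<in> sampler L N (tape_merge J \<omega> \<omega>') a) \<partial>tape) \<partial>tape)"
    by (rule expectation_tape_merge[where B = 1, OF borel_measurable_integrable[OF integrable_sampler[OF N]]]) simp
  also have "\<dots> = (\<integral>\<omega>. real_of_int (gcount L N \<omega> a g) * (a g p / z) \<partial>tape)"
  proof (intro Bochner_Integration.integral_cong refl)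
    fix \<omega> assume \<omega>: "\<omega> \<in> space tape"
    have "gcount L N (tape_merge J \<omega> \<omega>') a g = gcount L N \<omega> a g" for \<omega>'
    proof -
      have "(4 * w + 2) mod 4 = 2" for w :: nat by presburger
      then show ?thesis unfolding gcount_def by (intro cnt_cong) (simp_all add: tape_merge_def J_def)
    qed
    moreover have "gwin N (tape_merge J \<omega> \<omega>') a g = gwin N \<omega>' a g" for \<omega>'
    proof -
      have "(4 * w + 3) mod 4 \<noteq> 2" for w :: nat by presburger
      then show ?thesis unfolding gwin_def by (simp add: tape_merge_def J_def)
    qed
    ultimately have "(\<integral>\<omega>'. of_bool ((g, p) \<in> sampler L N (tape_merge J \<omega> \<omega>') a) \<partial>tape)
       = (\<integral>\<omega>'. real_of_int (gcount L N \<omega> a g) * indicator {\<omega> \<in> space tape. gwin N \<omega> a g = p} \<omega>' \<partial>tape)"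
      using gcount_cases[OF a \<omega> g] g p
      by (intro Bochner_Integration.integral_cong refl) (auto simp: sampler_def indicator_def)
    also have "\<dots> = real_of_int (gcount L N \<omega> a g) * measure tape {\<omega> \<in> space tape. gwin N \<omega> a g = p}"
      by (simp only: integral_mult_right_zero prob_tape_indicator[OF sets_gwin[OF N], symmetric])
    also have "measure tape {\<omega> \<in> space tape. gwin N \<omega> a g = p} = a g p / z"
      unfolding gwin_def z_def gmass_def
    proof (rule prob_winner)
      show "inj (\<lambda>p::nat. 4 * p + 3)" by (auto simp: inj_on_def)
      show "0 < (\<Sum>p<N. a g p)" using z by (simp add: z_def gmass_def)
    qed (use a p in \<open>auto simp: feasible_def\<close>)
    finally show "(\<integral>\<omega>'. of_bool ((g, p) \<in> sampler L N (tape_merge J \<omega> \<omega>') a) \<partial>tape)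
       = real_of_int (gcount L N \<omega> a g) * (a g p / z)" .
  qed
  also have "\<dots> = (\<integral>\<omega>. real_of_int (gcount L N \<omega> a g) \<partial>tape) * (a g p / z)" by simp
  also have "(\<integral>\<omega>. real_of_int (gcount L N \<omega> a g) \<partial>tape) = nodesum L N a (2 ^ L + g)"
    unfolding gcount_def by (rule expectation_cnt[where L = L, OF nodesum_add]) (use g in auto)
  also have "\<dots> = z" by (simp only: nodesum_leaf z_def)
  finally show ?thesis using z by simp
qed

subsection \<open>Parameters\<close>

definition lg :: "nat \<Rightarrow> nat" where
  "lg n = (LEAST p. n \<le> 2 ^ p)"

text \<open>The number of rounds of the loop that doubles K = 2^j until K reaches k or K^2 = 4^j
  exceeds the padded length. In either case 2^j < k before the last round, so it is at most log k +
  1.\<close>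

definition lgk :: "nat \<Rightarrow> nat \<Rightarrow> nat" where
  "lgk n k = (LEAST j. k \<le> 2 ^ j \<or> 2 ^ lg n < (4::nat) ^ j)"

definition many :: "nat \<Rightarrow> nat \<Rightarrow> bool" where
  "many n k \<longleftrightarrow> 2 ^ lg n < (4::nat) ^ lgk n k"

text \<open>There are \<open>2 ^ blk n k\<close> blocks of \<open>2 ^ (lg n - blk n k)\<close> positions and \<open>2 ^ slt n k\<close> slots. If \<open>k\<close> exceeds
  about the square root of \<open>n\<close>, a tree over single positions already has depth \<open>O(log k)\<close>.\<close>

definition blk :: "nat \<Rightarrow> nat \<Rightarrow> nat" where
  "blk n k = (if many n k then lg n else lgk n k)"

text \<open>The number T of slots per block must be at least 2 min m k + 2. This is at most 4 for
  blocks of one position, and at most 4K if 1 <= k <= K.\<close>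

definition slt :: "nat \<Rightarrow> nat \<Rightarrow> nat" where
  "slt n k = (if many n k then 2 else lgk n k + 2)"

lemma lg: "n \<le> 2 ^ lg n" "j < lg n \<Longrightarrow> 2 ^ j < n"
proof -
  have "n \<le> 2 ^ n" using less_exp[of n] by linarith
  then show "n \<le> 2 ^ lg n" unfolding lg_def by (rule LeastI)
  show "2 ^ j < n" if "j < lg n" using not_less_Least[of j "\<lambda>p. n \<le> 2 ^ p"] that by (simp add: lg_def)
qed

lemma lgk: "k \<le> 2 ^ lgk n k \<or> 2 ^ lg n < (4::nat) ^ lgk n k"
    "j < lgk n k \<Longrightarrow> 2 ^ j < k \<and> (4::nat) ^ j \<le> 2 ^ lg n"
proof -
  have "k \<le> 2 ^ k" using less_exp[of k] by linarith
  then have "k \<le> 2 ^ k \<or> 2 ^ lg n < (4::nat) ^ k" ..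
  from LeastI[where P = "\<lambda>j. k \<le> 2 ^ j \<or> 2 ^ lg n < (4::nat) ^ j", OF this]
  show "k \<le> 2 ^ lgk n k \<or> 2 ^ lg n < (4::nat) ^ lgk n k" unfolding lgk_def .
  show "2 ^ j < k \<and> (4::nat) ^ j \<le> 2 ^ lg n" if "j < lgk n k"
    using not_less_Least[of j "\<lambda>j. k \<le> 2 ^ j \<or> 2 ^ lg n < (4::nat) ^ j"] that by (simp add: lgk_def not_le not_less)
qed

lemma four_power: "(4::nat) ^ j = 2 ^ (2 * j)"
  by (simp add: power_mult)

lemma lgk_le: "lgk n k \<le> lg n + 1"
proof (rule ccontr)
  assume "\<not> lgk n k \<le> lg n + 1"
  then have "(4::nat) ^ (lg n + 1) \<le> 2 ^ lg n" using lgk(2)[of "lg n + 1" n k] by (simp only: not_le)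
  then show False unfolding four_power by (simp add: power_increasing_iff del: power_Suc)
qed

lemma not_many: "\<not> many n k \<Longrightarrow> 2 * lgk n k \<le> lg n \<and> k \<le> 2 ^ lgk n k"
  using lgk(1)[of k n] unfolding many_def four_power by (simp add: not_less power_increasing_iff)

lemma blk_le: "blk n k \<le> lg n"
  using not_many[of n k] by (auto simp: blk_def)

text \<open>The tree over the slots has at most four times as many leaves as there are positions, so
  the work spent on it is linear too.\<close>

lemma slots_le: "blk n k + slt n k \<le> lg n + 2"
  using not_many[of n k] by (auto simp: blk_def slt_def)

text \<open>\<open>Q\<close> carries the square of \<open>K\<close>, by quadrupling, since the
  machine cannot multiply integers.\<close>

definition grow_body :: com where
  "grow_body = Seq (ISet ''K'' (IAdd (IVar ''K'') (IVar ''K'')))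
     (Seq (ISet ''Q'' (IAdd (IAdd (IVar ''Q'') (IVar ''Q'')) (IAdd (IVar ''Q'') (IVar ''Q''))))
     (ISet ''m'' (IHalf (IVar ''m''))))"

definition grow_init :: com where
  "grow_init = Seq (ISet ''K'' (IConst 1)) (Seq (ISet ''Q'' (IConst 1)) (ISet ''m'' (IVar ''N'')))"

definition size_many :: com where
  "size_many = Seq (ISet ''K'' (IVar ''N'')) (Seq (ISet ''m'' (IConst 1)) (Seq (ISet ''T'' (IConst 4))
     (ISet ''M'' (IAdd (IAdd (IVar ''N'') (IVar ''N'')) (IAdd (IVar ''N'') (IVar ''N''))))))"

definition size_few :: com where
  "size_few = Seq (ISet ''T'' (IAdd (IAdd (IVar ''K'') (IVar ''K'')) (IAdd (IVar ''K'') (IVar ''K''))))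
     (Seq (ISet ''M'' (IAdd (IAdd (IVar ''Q'') (IVar ''Q'')) (IAdd (IVar ''Q'') (IVar ''Q'')))) (ISet ''H'' (IConst 0)))"

definition width_com :: com where
  "width_com = Seq (ISet ''N'' (IConst 1)) (While (ILess (IVar ''N'') (IVar ''n'')) (ISet ''N'' (IAdd (IVar ''N'') (IVar ''N''))))"

definition grow_com :: com where
  "grow_com = Seq grow_init (While (BAnd (ILess (IVar ''K'') (IVar ''k'')) (BNot (ILess (IVar ''N'') (IVar ''Q'')))) grow_body)"

definition params_com :: com where
  "params_com = Seq width_com (Seq grow_com (Cond (ILess (IVar ''N'') (IVar ''Q'')) size_many size_few))"

lemma reach_size:
  assumes s: "ivar s ''n'' = n" "ivar s ''k'' = k"
  shows "reach \<omega> params_com s (\<lambda>s'. ivar s' ''n'' = n \<and> ivar s' ''N'' = 2 ^ lg n \<and> ivar s' ''K'' = 2 ^ blk n k \<and>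
      ivar s' ''m'' = 2 ^ (lg n - blk n k) \<and> ivar s' ''T'' = 2 ^ slt n k \<and> ivar s' ''M'' = 2 ^ (blk n k + slt n k))
    (40 * 2 ^ lg n) (40 * (lg n + 1))"
proof -
  define p where "p = lg n"
  define J where "J = lgk n k"
  define I where "I j s \<longleftrightarrow> ivar s ''n'' = n \<and> ivar s ''k'' = k \<and> ivar s ''N'' = 2 ^ j" for j and s :: state
  have 1: "reach \<omega> width_com s (I p) (1 + (1 + (\<Sum>j<p. 1 + 1))) (1 + (1 + p * (1 + 1)))"
    unfolding width_com_def
  proof (rule reach_exec_Seq[OF _ _ reach_While[where I = I and J = p and w = "\<lambda>_. 1" and D = 1]])
    fix j s' assume "j < p" and I: "I j s'"
    show "bval \<omega> s' (ILess (IVar ''N'') (IVar ''n'')) \<and> reach \<omega> (ISet ''N'' (IAdd (IVar ''N'') (IVar ''N''))) s' (I (Suc j)) 1 1"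
      using I lg(2)[of j n] \<open>j < p\<close> by (auto simp: I_def p_def intro!: reach_ISet[unfolded One_nat_def])
  next
    fix s' assume "I p s'"
    then show "\<not> bval \<omega> s' (ILess (IVar ''N'') (IVar ''n''))" using lg(1)[of n] by (simp add: I_def p_def)
  qed (use s in \<open>auto simp: I_def\<close>)
  define I2 where "I2 j s \<longleftrightarrow> ivar s ''n'' = n \<and> ivar s ''k'' = k \<and> ivar s ''N'' = 2 ^ p \<and> ivar s ''K'' = 2 ^ j \<and>
      ivar s ''Q'' = 4 ^ j \<and> ivar s ''m'' = 2 ^ p div 2 ^ j" for j and s :: state
  have 2: "reach \<omega> grow_com s1 (I2 J) (3 + (1 + (\<Sum>j<J. 1 + 3))) (3 + (1 + J * (1 + 3)))" if "I p s1" for s1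
    unfolding grow_com_def
  proof (rule reach_exec_Seq[OF _ _ reach_While[where I = I2 and J = J and w = "\<lambda>_. 3" and D = 3]])
    fix j s' assume "j < J" and I: "I2 j s'"
    then have "2 ^ j < k \<and> (4::nat) ^ j \<le> 2 ^ p" using lgk(2)[of j n k] by (simp add: J_def p_def)
    moreover have "reach \<omega> grow_body s' (I2 (Suc j)) 3 3"
      by (rule reach_exec) (use I in \<open>auto simp: grow_body_def I2_def div_mult2_eq power_Suc2 simp del: power_Suc\<close>)
    ultimately show "bval \<omega> s' (BAnd (ILess (IVar ''K'') (IVar ''k'')) (BNot (ILess (IVar ''N'') (IVar ''Q'')))) \<and>
        reach \<omega> grow_body s' (I2 (Suc j)) 3 3"
      using I by (simp add: I2_def not_less)
  next
    fix s' assume "I2 J s'"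
    then show "\<not> bval \<omega> s' (BAnd (ILess (IVar ''K'') (IVar ''k'')) (BNot (ILess (IVar ''N'') (IVar ''Q''))))"
      using lgk(1)[of k n] by (auto simp: I2_def J_def p_def)
  qed (use that in \<open>auto simp: I_def I2_def grow_init_def\<close>)
  define P where "P s' \<longleftrightarrow> ivar s' ''n'' = n \<and> ivar s' ''N'' = 2 ^ p \<and> ivar s' ''K'' = 2 ^ blk n k \<and>
      ivar s' ''m'' = 2 ^ (p - blk n k) \<and> ivar s' ''T'' = 2 ^ slt n k \<and> ivar s' ''M'' = 2 ^ (blk n k + slt n k)" for s' :: state
  have 3: "reach \<omega> (Cond (ILess (IVar ''N'') (IVar ''Q'')) size_many size_few) s2 P (1 + 4) (1 + 4)" if I: "I2 J s2" for s2
  proof (rule reach_Cond)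
    assume "bval \<omega> s2 (ILess (IVar ''N'') (IVar ''Q''))"
    then have m: "many n k" using I by (simp add: I2_def many_def J_def p_def)
    show "reach \<omega> size_many s2 P 4 4"
      by (rule reach_exec) (use I m in \<open>auto simp: size_many_def P_def I2_def blk_def slt_def p_def power_add\<close>)
  next
    assume "\<not> bval \<omega> s2 (ILess (IVar ''N'') (IVar ''Q''))"
    then have m: "\<not> many n k" using I by (simp add: I2_def many_def J_def p_def)
    then have "2 * J \<le> p" using not_many by (simp add: J_def p_def)
    then have "(2::nat) ^ p div 2 ^ J = 2 ^ (p - J)" by (simp add: power_diff)
    moreover have "(4::nat) ^ J = 2 ^ J * 2 ^ J" by (simp add: power_mult_distrib[symmetric])
    ultimately show "reach \<omega> size_few s2 P 4 4"
      by (intro reach_exec) (use I m in \<open>auto simp: size_few_def P_def I2_def blk_def slt_def J_def power_add\<close>)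
  qed
  have J: "J \<le> p + 1" using lgk_le by (simp add: J_def p_def)
  have "reach \<omega> params_com s P (40 * 2 ^ p) (40 * (p + 1))"
    unfolding params_com_def
  proof (rule reach_conseq[OF reach_Seq[OF 1 reach_Seq[OF 2 3]]])
    have gen: "2 * p + 4 * J + 11 \<le> 40 * x" if "p < x" for x :: nat using that J by linarith
    have "1 + (1 + (\<Sum>j<p. 1 + 1)) + (3 + (1 + (\<Sum>j<J. 1 + 3)) + (1 + 4)) = 2 * p + 4 * J + (11 :: nat)" by simp
    then show "1 + (1 + (\<Sum>j<p. 1 + 1)) + (3 + (1 + (\<Sum>j<J. 1 + 3)) + (1 + 4)) \<le> (40 * 2 ^ p :: nat)"
      using gen[OF less_exp] by (simp only:)
    show "1 + (1 + p * (1 + 1)) + (3 + (1 + J * (1 + 3)) + (1 + 4)) \<le> 40 * (p + 1)" using J by simp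
  qed
  then show ?thesis by (rule reach_conseq) (simp_all add: P_def p_def)
qed

section \<open>The algorithm\<close>

text \<open>Rounding to a multiple of the block length makes the rotation act on blocks and preserve
  rows; the leading l binary digits of the variate give the number of blocks.\<close>

definition shift :: "nat \<Rightarrow> nat \<Rightarrow> (nat \<Rightarrow> real) \<Rightarrow> nat \<Rightarrow> nat" where
  "shift p l \<omega> r = 2 ^ (p - l) * nat \<lfloor>2 ^ l * \<omega> (4 * r)\<rfloor>"

definition dest :: "nat \<Rightarrow> nat \<Rightarrow> (nat \<Rightarrow> real) \<Rightarrow> nat \<Rightarrow> nat" where
  "dest p l \<omega> i = rot_fwd (2 ^ p) (shift p l \<omega> (i mod 2 ^ (p - l))) i"

definition src :: "nat \<Rightarrow> nat \<Rightarrow> (nat \<Rightarrow> real) \<Rightarrow> nat \<Rightarrow> nat" where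
  "src p l \<omega> i = rot_back (2 ^ p) (shift p l \<omega> (i mod 2 ^ (p - l))) i"

definition padded :: "real list \<Rightarrow> nat \<Rightarrow> real" where
  "padded x i = (if i < length x then x ! i else 0)"

definition perm :: "nat \<Rightarrow> nat \<Rightarrow> (nat \<Rightarrow> real) \<Rightarrow> real list \<Rightarrow> nat \<Rightarrow> real" where
  "perm p l \<omega> x i = (if i < 2 ^ p then padded x (src p l \<omega> i) else 0)"

definition slot_of :: "nat \<Rightarrow> nat \<Rightarrow> nat \<Rightarrow> (nat \<Rightarrow> real) \<Rightarrow> real list \<Rightarrow> nat \<Rightarrow> nat" where
  "slot_of p l t \<omega> x = slot (2 ^ (p - l)) (2 ^ t) (\<omega> 1) (perm p l \<omega> x)"

definition alloc :: "nat \<Rightarrow> nat \<Rightarrow> nat \<Rightarrow> (nat \<Rightarrow> real) \<Rightarrow> real list \<Rightarrow> nat \<Rightarrow> nat \<Rightarrow> real" where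
  "alloc p l t \<omega> x g i = (if i < 2 ^ p \<and> slot_of p l t \<omega> x i = g then perm p l \<omega> x i else 0)"

text \<open>The tape for the grouping and the tape for rounding and clocks are separate arguments,
  so that one can be fixed while the other is averaged. The program runs the algorithm with both
  equal.\<close>

definition alg :: "nat \<Rightarrow> nat \<Rightarrow> nat \<Rightarrow> (nat \<Rightarrow> real) \<Rightarrow> (nat \<Rightarrow> real) \<Rightarrow> real list \<Rightarrow> nat set" where
  "alg p l t \<omega> \<omega>' x = {i. i < length x \<and>
     (slot_of p l t \<omega> x (dest p l \<omega> i), dest p l \<omega> i) \<in> sampler (l + t) (2 ^ p) \<omega>' (alloc p l t \<omega> x)}"

text \<open>The program elects among the members of a slot, the sampler among all positions with
  keys 0 outside the slot. The winners agree because a slot of positive mass contains a positive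
  key.\<close>

lemma first_argmax_support:
  assumes "\<And>p. p < N \<Longrightarrow> 0 \<le> y p" "\<And>p. 0 < w p \<and> w p < 1"
    and mass: "0 < (\<Sum>p<N. if G p = g then y p else 0)"
  shows "first_argmax {..<N} (clock_key w (\<lambda>p. if p < N \<and> G p = g then y p else 0))
    = first_argmax {p. p < N \<and> G p = g} (clock_key w y)"
proof -
  let ?A = "{p. p < N \<and> G p = g}" and ?a = "\<lambda>p. if p < N \<and> G p = g then y p else 0"
  obtain q0 where q0: "q0 < N" "G q0 = g" "0 < y q0"
  proof -
    have "\<exists>q<N. 0 < (if G q = g then y q else 0)"
    proof (rule ccontr)
      assume "\<not> ?thesis"
      then have "(\<Sum>p<N. if G p = g then y p else 0) \<le> (\<Sum>p<N. 0)" by (intro sum_mono) (meson lessThan_iff not_less)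
      then show False using mass by simp
    qed
    then show ?thesis using that by (auto split: if_splits)
  qed
  then have A: "finite ?A" "?A \<noteq> {}" by auto
  define f where "f = first_argmax ?A (clock_key w y)"
  note F = first_argmax[OF A, where \<kappa> = "clock_key w y", folded f_def]
  have key: "clock_key w ?a q = (if q \<in> ?A then clock_key w y q else 0)" for q by (simp add: clock_key_def)
  have "0 < clock_key w y q0" using q0 assms(2) by (simp add: clock_key_pos_iff)
  then have pos: "0 < clock_key w y f" using F(2)[of q0] q0 by simp
  have "first_argmax {..<N} (clock_key w ?a) = f"
  proof (rule first_argmax_unique)
    show "f \<in> {..<N}" using F(1) by simp
    fix q assume "q \<in> {..<N}"
    show "clock_key w ?a q \<le> clock_key w ?a f" unfolding key using F(1) F(2)[of q] pos by simp
    show "clock_key w ?a q < clock_key w ?a f" if "q < f"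
      unfolding key using F(1) F(3)[of q] pos that by simp
  qed
  then show ?thesis by (simp add: f_def)
qed

section \<open>The random rotations as a permutation of the positions\<close>

locale sampling_params =
  fixes p l t k n :: nat
  assumes l: "l \<le> p" and n: "n \<le> 2 ^ p" and T: "2 * min (real (2 ^ (p - l))) (real k) + 2 \<le> real (2 ^ t)"
begin

abbreviation "N \<equiv> (2::nat) ^ p"
abbreviation "m \<equiv> (2::nat) ^ (p - l)"

lemma N_eq: "N = 2 ^ l * m"
  using l by (simp add: power_add[symmetric])

lemma shift_less: "\<omega> \<in> space tape \<Longrightarrow> shift p l \<omega> r < N" "m dvd shift p l \<omega> r"
proof -
  show "m dvd shift p l \<omega> r" by (simp add: shift_def)
  assume "\<omega> \<in> space tape"
  then have "0 < \<omega> (4 * r)" "\<omega> (4 * r) < 1" by (auto simp: space_tape)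
  then have "2 ^ l * \<omega> (4 * r) < 2 ^ l" by simp
  then have "nat \<lfloor>2 ^ l * \<omega> (4 * r)\<rfloor> < 2 ^ l" by (simp add: nat_less_iff floor_less_iff \<open>0 < \<omega> (4 * r)\<close>)
  then show "shift p l \<omega> r < N" unfolding shift_def N_eq by simp
qed

context
  fixes \<omega> assumes \<omega>: "\<omega> \<in> space tape"
begin

text \<open>Both the shift and N are multiples of m, so the residue modulo m is untouched.\<close>

lemma rot:
  assumes "i < N" "s < N" "m dvd s"
  shows "rot_fwd N s i < N" "rot_back N s i < N" "rot_fwd N s i mod m = i mod m" "rot_back N s i mod m = i mod m"
    "rot_back N s (rot_fwd N s i) = i" "rot_fwd N s (rot_back N s i) = i"
proof -
  obtain a where a: "s = m * a" using assms(3) by (auto simp: dvd_def)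
  have dN: "m dvd N" by (simp add: N_eq)
  show "rot_fwd N s i mod m = i mod m"
  proof (cases "i + s < N")
    case False
    then have "(rot_fwd N s i + N) mod m = (i + s) mod m" by (simp add: rot_fwd_def)
    then show ?thesis using dN by (simp add: a mod_add_right_eq[symmetric, of _ N] del: mod_add_right_eq)
  qed (simp add: rot_fwd_def a)
  show "rot_back N s i mod m = i mod m"
  proof (cases "i < s")
    case True
    then have "rot_back N s i + s = i + N" using assms by (simp add: rot_back_def)
    then have "(rot_back N s i + s) mod m = (i + N) mod m" by simp
    then show ?thesis using dN by (simp add: a mod_add_right_eq[symmetric, of _ N] del: mod_add_right_eq)
  next
    case False
    then have "rot_back N s i + s = i" by (simp add: rot_back_def)
    then have "(rot_back N s i + s) mod m = i mod m" by simp
    then show ?thesis by (simp add: a)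
  qed
qed (use assms in \<open>auto simp: rot_fwd_def rot_back_def\<close>)

lemma dest_src:
  assumes "i < N"
  shows "dest p l \<omega> i < N" "src p l \<omega> i < N" "dest p l \<omega> (src p l \<omega> i) = i" "src p l \<omega> (dest p l \<omega> i) = i"
    "dest p l \<omega> i mod m = i mod m"
  using rot[OF assms shift_less(1)[OF \<omega>] shift_less(2)] unfolding dest_def src_def by simp_all

lemma perm_dest: "i < N \<Longrightarrow> perm p l \<omega> x (dest p l \<omega> i) = padded x i"
  by (simp add: perm_def dest_src)

lemma sum_dest: "(\<Sum>i<N. f i) = (\<Sum>i<N. f (dest p l \<omega> i))"
  by (rule sum.reindex_bij_witness[of _ "dest p l \<omega>" "src p l \<omega>"]) (auto simp: dest_src)

lemma padded_bounds: "x \<in> Delta n k \<Longrightarrow> 0 \<le> padded x i \<and> padded x i \<le> 1"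
  by (auto simp: padded_def Delta_def)

lemma sum_padded: "x \<in> Delta n k \<Longrightarrow> (\<Sum>i<N. padded x i) = l1 x"
proof -
  assume x: "x \<in> Delta n k"
  then have len: "length x = n" by (simp add: Delta_def)
  have "(\<Sum>i<N. padded x i) = (\<Sum>i<n. padded x i)"
    using n by (intro sum.mono_neutral_right) (auto simp: padded_def len)
  also have "\<dots> = l1 x" unfolding l1_def len using x by (intro sum.cong) (auto simp: padded_def len Delta_def)
  finally show ?thesis .
qed

lemma slots_perm: assumes x: "x \<in> Delta n k" shows "slots m (2 ^ l) (2 ^ t) (real k) (\<omega> 1) (perm p l \<omega> x)"
proof
  show "0 < m" by simp
  show "0 < \<omega> 1" "\<omega> 1 < 1" using \<omega> by (auto simp: space_tape)
  show "0 \<le> perm p l \<omega> x i \<and> perm p l \<omega> x i \<le> 1" for i using padded_bounds[OF x] by (simp add: perm_def)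
  have "(\<Sum>i<2 ^ l * m. perm p l \<omega> x i) = (\<Sum>i<N. perm p l \<omega> x (dest p l \<omega> i))"
    unfolding N_eq[symmetric] by (rule sum_dest)
  also have "\<dots> = l1 x" using sum_padded[OF x] by (simp add: perm_dest)
  finally show "(\<Sum>i<2 ^ l * m. perm p l \<omega> x i) \<le> real k" using x by (simp add: Delta_def)
  show "2 * min (real m) (real k) + 2 \<le> real (2 ^ t)" by (rule T)
qed

lemma gmass_alloc: "gmass N (alloc p l t \<omega> x) g = (\<Sum>i | i < N \<and> slot_of p l t \<omega> x i = g. perm p l \<omega> x i)"
proof -
  have "gmass N (alloc p l t \<omega> x) g = (\<Sum>i<N. if slot_of p l t \<omega> x i = g then perm p l \<omega> x i else 0)"
    unfolding gmass_def by (intro sum.cong) (auto simp: alloc_def)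
  also have "\<dots> = (\<Sum>i | i \<in> {..<N} \<and> slot_of p l t \<omega> x i = g. perm p l \<omega> x i)"
    by (rule sum.inter_filter[symmetric]) simp
  finally show ?thesis by simp
qed

lemma feasible_alloc: assumes x: "x \<in> Delta n k" shows "feasible (l + t) N (alloc p l t \<omega> x)"
proof -
  interpret slots m "2 ^ l" "2 ^ t" "real k" "\<omega> 1" "perm p l \<omega> x" by (rule slots_perm[OF x])
  show ?thesis unfolding feasible_def gmass_alloc
    using slot_mass(2) y by (simp add: alloc_def slot_of_def N_eq[symmetric])
qed

lemma slot_of_less: assumes x: "x \<in> Delta n k" and i: "i < N" shows "slot_of p l t \<omega> x i < 2 ^ (l + t)"
proof -
  interpret slots m "2 ^ l" "2 ^ t" "real k" "\<omega> 1" "perm p l \<omega> x" by (rule slots_perm[OF x])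
  show ?thesis using slot_less[of i] i by (simp add: slot_of_def N_eq[symmetric] power_add)
qed

end

end

lemma first_argmax_cong: "(\<And>q. q \<in> A \<Longrightarrow> \<kappa> q = \<kappa>' q) \<Longrightarrow> first_argmax A \<kappa> = first_argmax A \<kappa>'"
  unfolding first_argmax_def by (rule arg_cong[where f = Least]) (auto simp: fun_eq_iff)

section \<open>Correctness and cost of the whole program\<close>

definition prog :: com where
  "prog = Seq params_com (Seq index_com (Seq shift_com (Seq gather_com
     (Seq (upsweep ''q'' ''f'' (IVar ''N'') (IVar ''K'')) (Seq down_com (Seq slot_com (Seq scan_up_com
     (Seq scan_down_com (Seq scatter_com (Seq (upsweep ''q2'' ''f2'' (IVar ''M'') (IConst 1))
     (Seq count_com output_com)))))))))))"

lemma reachD: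
  "reach \<omega> c s Q W T \<Longrightarrow> \<exists>s' w d. run \<omega> c s s' w d \<and> Q s' \<and> frame c s s' \<and> w \<le> W \<and> d \<le> T"
  unfolding reach_def using run_frame by blast

text \<open>The specifications of the phases are chained, with frame facts carrying earlier results
  to the phase that uses them. Each phase costs a constant times 2^p in work and a constant times p
  + 1 in depth.\<close>

lemma run_prog:
  fixes n k :: nat and x :: "real list"
  defines "p \<equiv> lg n" and "l \<equiv> blk n k" and "t \<equiv> slt n k"
  assumes par: "sampling_params p l t k n" and x: "x \<in> Delta n k" and \<omega>: "\<omega> \<in> space tape"
  shows "\<exists>s w d. run \<omega> prog (input_state n k x) s w d \<and> output_set n s = alg p l t \<omega> \<omega> x \<and>
    w \<le> 300 * 2 ^ p \<and> d \<le> 150 * (p + 1)"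
proof -
  interpret sampling_params p l t k n by (rule par)
  interpret slots m "2 ^ l" "2 ^ t" "real k" "\<omega> 1" "perm p l \<omega> x" by (rule slots_perm[OF \<omega> x])
  let ?y = "perm p l \<omega> x" and ?G = "slot_of p l t \<omega> x"
  define L where "L = l + t"
  have \<omega>': "0 < \<omega> i \<and> \<omega> i < 1" for i using \<omega> by (auto simp: space_tape)
  have len: "length x = n" using x by (simp add: Delta_def)
  define s0 where "s0 = input_state n k x"
  have s0: "ivar s0 ''n'' = n" "ivar s0 ''k'' = k" "iarr s0 a i = 0" "rarr s0 ''x'' = padded x" "rarr s0 ''zz'' i = 0" for a i
    by (auto simp: s0_def input_state_def padded_def)
  from reachD[OF reach_size[OF s0(1,2), of \<omega>]] obtain s1 w1 d1 where r1: "run \<omega> params_com s0 s1 w1 d1"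
    and q1: "ivar s1 ''n'' = n" "ivar s1 ''N'' = 2 ^ p" "ivar s1 ''K'' = 2 ^ l" "ivar s1 ''m'' = m"
      "ivar s1 ''T'' = 2 ^ t" "ivar s1 ''M'' = 2 ^ L"
    and f1: "frame params_com s0 s1" and b1: "w1 \<le> 40 * 2 ^ p" "d1 \<le> 40 * (p + 1)"
    unfolding p_def l_def t_def L_def by blast
  have F1: "iarr s1 a = iarr s0 a" "rarr s1 a = rarr s0 a" for a
    using f1 by (simp_all add: frame_def params_com_def width_com_def grow_com_def grow_init_def grow_body_def size_many_def size_few_def)
  have "reach \<omega> index_com s1 (\<lambda>s'. \<forall>i<2 ^ p. iarr s' ''rr'' i = i mod m \<and> iarr s' ''sb'' i = i div m * 2 ^ t)
    (12 * 2 ^ p) (3 + 5 * p)" by (rule reach_index) (simp_all add: q1 F1 s0)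
  from reachD[OF this] obtain s2 w2 d2 where r2: "run \<omega> index_com s1 s2 w2 d2"
    and q2: "\<And>i. i < 2 ^ p \<Longrightarrow> iarr s2 ''rr'' i = i mod m \<and> iarr s2 ''sb'' i = i div m * 2 ^ t"
    and f2: "frame index_com s1 s2" and b2: "w2 \<le> 12 * 2 ^ p" "d2 \<le> 3 + 5 * p" by blast
  have F2: "v \<noteq> ''P'' \<and> v \<noteq> ''S'' \<Longrightarrow> ivar s2 v = ivar s1 v" "a \<noteq> ''rr'' \<and> a \<noteq> ''sb'' \<Longrightarrow> iarr s2 a = iarr s1 a" "rarr s2 a = rarr s1 a" for v a
    using f2 by (simp_all add: frame_def index_com_def index_body_def)
  have "reach \<omega> shift_com s2 (\<lambda>s'. \<forall>r<2 ^ (p - l). iarr s' ''sg'' r = 2 ^ (p - l) * nat \<lfloor>2 ^ l * \<omega> (4 * r)\<rfloor>)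
    (12 * 2 ^ p) (3 + 5 * p)" by (rule reach_shift) (use l \<omega>' in \<open>simp_all add: q1 F1 F2 s0\<close>)
  from reachD[OF this] obtain s3 w3 d3 where r3: "run \<omega> shift_com s2 s3 w3 d3"
    and q3: "\<And>r. r < m \<Longrightarrow> iarr s3 ''sg'' r = shift p l \<omega> r"
    and f3: "frame shift_com s2 s3" and b3: "w3 \<le> 12 * 2 ^ p" "d3 \<le> 3 + 5 * p" unfolding shift_def by blast
  have F3: "v \<noteq> ''H'' \<Longrightarrow> ivar s3 v = ivar s2 v" "a \<noteq> ''sg'' \<Longrightarrow> iarr s3 a = iarr s2 a" "a \<noteq> ''u'' \<Longrightarrow> rarr s3 a = rarr s2 a" for v a
    using f3 by (simp_all add: frame_def shift_com_def shift_body_def)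
  have sg: "iarr s3 ''sg'' (iarr s3 ''rr'' i) = shift p l \<omega> (i mod m)" if "i < N" for i
    using q2[OF that] q3[of "i mod m"] by (simp add: F3)
  have "reach \<omega> gather_com s3 (\<lambda>s'. \<forall>i<N. rarr s' ''y'' i = ?y i \<and> repr (iarr s' ''q'') (rarr s' ''f'') (N + i) (?y i))
    (3 + 3 * N) 3"
  proof (rule reach_gather)
    fix i assume i: "i < N"
    show "?y i = rarr s3 ''x'' (rot_back N (iarr s3 ''sg'' (iarr s3 ''rr'' i)) i)"
      unfolding sg[OF i] using i by (simp add: perm_def src_def F1 F2 F3 s0)
    show "0 \<le> ?y i \<and> ?y i \<le> 1" by (rule y)
  qed (simp add: q1 F2 F3)
  from reachD[OF this] obtain s4 w4 d4 where r4: "run \<omega> gather_com s3 s4 w4 d4"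
    and q4: "\<And>i. i < N \<Longrightarrow> rarr s4 ''y'' i = ?y i" "\<And>i. i < N \<Longrightarrow> repr (iarr s4 ''q'') (rarr s4 ''f'') (N + i) (?y i)"
    and f4: "frame gather_com s3 s4" and b4: "w4 \<le> 3 + 3 * N" "d4 \<le> 3" by blast
  have F4: "ivar s4 v = ivar s3 v" "a \<noteq> ''q'' \<Longrightarrow> iarr s4 a = iarr s3 a" "a \<noteq> ''y'' \<and> a \<noteq> ''f'' \<Longrightarrow> rarr s4 a = rarr s3 a" for v a
    using f4 by (simp_all add: frame_def gather_com_def leaf_com_def Let_def)
  have "reach \<omega> (upsweep ''q'' ''f'' (IVar ''N'') (IVar ''K'')) s4
    (\<lambda>s'. \<forall>v\<in>{2 ^ l..<2 * 2 ^ p}. repr (iarr s' ''q'') (rarr s' ''f'') v (nsum (2 ^ p) (\<lambda>v. ?y (v - 2 ^ p)) v))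
    (8 * 2 ^ p) (2 + 4 * p)"
  proof (rule reach_upsweep)
    fix v :: nat assume "2 ^ p \<le> v" "v < 2 * 2 ^ p"
    then show "repr (iarr s4 ''q'') (rarr s4 ''f'') v (?y (v - 2 ^ p))" using q4(2)[of "v - N"] by simp
  qed (use l y in \<open>simp_all add: q1 F2 F3 F4\<close>)
  from reachD[OF this] obtain s5 w5 d5 where r5: "run \<omega> (upsweep ''q'' ''f'' (IVar ''N'') (IVar ''K'')) s4 s5 w5 d5"
    and q5: "\<And>v. 2 ^ l \<le> v \<Longrightarrow> v < 2 * 2 ^ p \<Longrightarrow> repr (iarr s5 ''q'') (rarr s5 ''f'') v (nsum (2 ^ p) (\<lambda>v. ?y (v - 2 ^ p)) v)"
    and f5: "frame (upsweep ''q'' ''f'' (IVar ''N'') (IVar ''K'')) s4 s5" and b5: "w5 \<le> 8 * 2 ^ p" "d5 \<le> 2 + 4 * p"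
    by (metis atLeastLessThan_iff)
  have F5: "v \<noteq> ''W'' \<Longrightarrow> ivar s5 v = ivar s4 v" "a \<noteq> ''q'' \<Longrightarrow> iarr s5 a = iarr s4 a" "a \<noteq> ''f'' \<Longrightarrow> rarr s5 a = rarr s4 a" for v a
    using f5 by (simp_all add: frame_def upsweep_def upsweep_body_def Let_def)
  have "reach \<omega> down_com s5 (\<lambda>s'. \<forall>i<2 ^ p. repr (iarr s' ''pq'') (rarr s' ''pf'') (2 ^ p + i) (\<omega> 1 + block_sum (2 ^ (p - l)) ?y i))
    (16 * 2 ^ p) (4 + 4 * p)"
    by (rule reach_down[OF _ _ l q5]) (use y \<omega>' in \<open>simp_all add: q1 F2 F3 F4 F5\<close>)
  from reachD[OF this] obtain s6 w6 d6 where r6: "run \<omega> down_com s5 s6 w6 d6"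
    and q6: "\<And>i. i < N \<Longrightarrow> repr (iarr s6 ''pq'') (rarr s6 ''pf'') (N + i) (\<omega> 1 + B i)"
    and f6: "frame down_com s5 s6" and b6: "w6 \<le> 16 * 2 ^ p" "d6 \<le> 4 + 4 * p" by blast
  have F6: "v \<noteq> ''W'' \<Longrightarrow> ivar s6 v = ivar s5 v" "a \<noteq> ''pq'' \<Longrightarrow> iarr s6 a = iarr s5 a" "a \<noteq> ''pf'' \<Longrightarrow> rarr s6 a = rarr s5 a" for v a
    using f6 by (simp_all add: frame_def down_com_def down_body_def Let_def)
  have lp: "(2::nat) ^ l \<le> 2 ^ p" using l by (simp add: power_increasing)
  have "reach \<omega> slot_com s6 (\<lambda>s'. \<forall>i<N. iarr s' ''g'' i = iarr s6 ''sb'' i + nat \<lfloor>\<omega> 1 + B i\<rfloor> + nat \<lfloor>\<omega> 1 + B i + ?y i\<rfloor> \<and>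
        rarr s' ''ky'' i = clock_key (\<lambda>i. \<omega> (4 * i + 3)) ?y i) (2 + 2 * N) 2"
  proof (rule reach_slot)
    fix i assume i: "i < N"
    show "repr (iarr s6 ''q'') (rarr s6 ''f'') (N + i) (?y i)"
      using q5[of "N + i"] i lp by (simp add: F6 ntree_leaf)
    show "0 \<le> \<omega> 1 + B i \<and> 0 \<le> ?y i" using \<omega>'[of 1] B_nonneg[of i] y[of i] by simp
  qed (use q6 q4 in \<open>simp_all add: q1 F2 F3 F4 F5 F6\<close>)
  from reachD[OF this] obtain s7 w7 d7 where r7: "run \<omega> slot_com s6 s7 w7 d7"
    and q7: "\<And>i. i < N \<Longrightarrow> iarr s7 ''g'' i = iarr s6 ''sb'' i + nat \<lfloor>\<omega> 1 + B i\<rfloor> + nat \<lfloor>\<omega> 1 + B i + ?y i\<rfloor>"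
      "\<And>i. i < N \<Longrightarrow> rarr s7 ''ky'' i = clock_key (\<lambda>i. \<omega> (4 * i + 3)) ?y i"
    and f7: "frame slot_com s6 s7" and b7: "w7 \<le> 2 + 2 * N" "d7 \<le> 2" by blast
  have F7: "ivar s7 v = ivar s6 v" "a \<noteq> ''g'' \<Longrightarrow> iarr s7 a = iarr s6 a" "a \<noteq> ''ky'' \<Longrightarrow> rarr s7 a = rarr s6 a" for v a
    using f7 by (simp_all add: frame_def slot_com_def Let_def)
  define g where "g = iarr s7 ''g''"
  define \<kappa> where "\<kappa> = rarr s7 ''ky''"
  define y' where "y' = rarr s7 ''y''"
  have g: "g i = ?G i" if "i < N" for i
    using q7(1)[OF that] q2[OF that] by (simp add: g_def slot_of_def slot_def F3 F4 F5 F6)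
  have y': "y' i = ?y i" if "i < N" for i using q4(1)[OF that] by (simp add: y'_def F5 F6 F7)
  have gmono: "g i \<le> g j" if "i \<le> j" "j < 2 ^ p" for i j
    using slot_mono[of i j] that g[of i] g[of j] by (simp add: slot_of_def N_eq[symmetric])
  have gL: "g i < 2 ^ L" if "i < 2 ^ p" for i using slot_of_less[OF \<omega> x that] g[OF that] by (simp add: L_def)
  have set_g: "{i. i < N \<and> g i = h} = {i. i < N \<and> ?G i = h}" for h using g by auto
  have mass: "(\<Sum>i | i < N \<and> g i = h. y' i) = gmass N (alloc p l t \<omega> x) h" for h
    unfolding gmass_alloc[OF \<omega>] set_g using y' by (intro sum.cong) auto
  have win: "first_argmax {i. i < N \<and> g i = h} \<kappa> = first_argmax {i. i < N \<and> ?G i = h} (clock_key (\<lambda>i. \<omega> (4 * i + 3)) ?y)" for h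
    unfolding set_g \<kappa>_def using q7(2) by (intro first_argmax_cong) auto
  have "reach \<omega> scan_up_com s7 (\<lambda>s'. \<forall>j\<le>p. \<forall>i<2 ^ j. summary g \<kappa> y' (iarr s' ''b'') (rarr s' ''zs'') (2 ^ j + i)
        (i * 2 ^ (p - j)) ((i + 1) * 2 ^ (p - j))) (16 * 2 ^ p) (4 + 4 * p)"
    by (rule reach_scan_up) (use gmono in \<open>simp_all add: q1 F2 F3 F4 F5 F6 F7 g_def \<kappa>_def y'_def\<close>)
  from reachD[OF this] obtain s8 w8 d8 where r8: "run \<omega> scan_up_com s7 s8 w8 d8"
    and q8: "\<And>j i. j \<le> p \<Longrightarrow> i < 2 ^ j \<Longrightarrow> summary g \<kappa> y' (iarr s8 ''b'') (rarr s8 ''zs'') (2 ^ j + i)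
        (i * 2 ^ (p - j)) ((i + 1) * 2 ^ (p - j))"
    and f8: "frame scan_up_com s7 s8" and b8: "w8 \<le> 16 * 2 ^ p" "d8 \<le> 4 + 4 * p" by blast
  have F8: "v \<noteq> ''W'' \<Longrightarrow> ivar s8 v = ivar s7 v" "a \<noteq> ''b'' \<Longrightarrow> iarr s8 a = iarr s7 a" "a \<noteq> ''zs'' \<Longrightarrow> rarr s8 a = rarr s7 a" for v a
    using f8 by (simp_all add: frame_def scan_up_com_def scan_up_body_def Let_def)
  have "reach \<omega> scan_down_com s8 (\<lambda>s'. \<forall>i<2 ^ p. summary g \<kappa> y' (iarr s' ''ib'') (rarr s' ''iz'') (2 ^ p + i) 0 (i + 1))
    (16 * 2 ^ p) (4 + 4 * p)"
    by (rule reach_scan_down[OF _ _ _ q8 gmono]) (simp_all add: q1 F2 F3 F4 F5 F6 F7 F8 g_def \<kappa>_def)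
  from reachD[OF this] obtain s9 w9 d9 where r9: "run \<omega> scan_down_com s8 s9 w9 d9"
    and q9: "\<And>i. i < N \<Longrightarrow> summary g \<kappa> y' (iarr s9 ''ib'') (rarr s9 ''iz'') (N + i) 0 (i + 1)"
    and f9: "frame scan_down_com s8 s9" and b9: "w9 \<le> 16 * 2 ^ p" "d9 \<le> 4 + 4 * p" by blast
  have F9: "v \<noteq> ''W'' \<Longrightarrow> ivar s9 v = ivar s8 v" "a \<noteq> ''ib'' \<Longrightarrow> iarr s9 a = iarr s8 a" "a \<noteq> ''iz'' \<Longrightarrow> rarr s9 a = rarr s8 a" for v a
    using f9 by (simp_all add: frame_def scan_down_com_def scan_down_init_def scan_down_body_def Let_def)
  have fe: "feasible L N (alloc p l t \<omega> x)" unfolding L_def by (rule feasible_alloc[OF \<omega> x])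
  have gm: "0 \<le> gmass N (alloc p l t \<omega> x) h" for h by (rule gmass_nonneg[OF fe])
  have "reach \<omega> scatter_com s9 (\<lambda>s'. (\<forall>h<2 ^ L. repr (iarr s' ''q2'') (rarr s' ''f2'') (2 ^ L + h) (\<Sum>i | i < N \<and> g i = h. y' i)) \<and>
      (\<forall>i<N. iarr s' ''win'' (g i) = first_argmax {j. j < N \<and> g j = g i} \<kappa>)) (4 + 2 * N + 2 * 2 ^ L) 4"
    by (rule reach_scatter[OF _ _ _ _ q9 gmono gL])
       (use gm fe in \<open>simp_all add: q1 F1 F2 F3 F4 F5 F6 F7 F8 F9 s0 g_def[symmetric] mass feasible_def\<close>)
  from reachD[OF this] obtain s10 w10 d10 where r10: "run \<omega> scatter_com s9 s10 w10 d10"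
    and q10: "\<And>h. h < 2 ^ L \<Longrightarrow> repr (iarr s10 ''q2'') (rarr s10 ''f2'') (2 ^ L + h) (gmass N (alloc p l t \<omega> x) h)"
      "\<And>i. i < N \<Longrightarrow> iarr s10 ''win'' (g i) = first_argmax {j. j < N \<and> ?G j = g i} (clock_key (\<lambda>i. \<omega> (4 * i + 3)) ?y)"
    and f10: "frame scatter_com s9 s10" and b10: "w10 \<le> 4 + 2 * N + 2 * 2 ^ L" "d10 \<le> 4"
    unfolding mass win by blast
  have F10: "ivar s10 v = ivar s9 v" "a \<noteq> ''win'' \<and> a \<noteq> ''q2'' \<Longrightarrow> iarr s10 a = iarr s9 a" for v a
    using f10 by (simp_all add: frame_def scatter_com_def leaf_com_def)
  have "reach \<omega> (upsweep ''q2'' ''f2'' (IVar ''M'') (IConst 1)) s10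
    (\<lambda>s'. \<forall>v\<in>{2 ^ 0..<2 * 2 ^ L}. repr (iarr s' ''q2'') (rarr s' ''f2'') v (nsum (2 ^ L) (\<lambda>v. gmass N (alloc p l t \<omega> x) (v - 2 ^ L)) v))
    (8 * 2 ^ L) (2 + 4 * L)"
  proof (rule reach_upsweep)
    fix v :: nat assume "2 ^ L \<le> v" "v < 2 * 2 ^ L"
    then show "repr (iarr s10 ''q2'') (rarr s10 ''f2'') v (gmass N (alloc p l t \<omega> x) (v - 2 ^ L))"
      using q10(1)[of "v - 2 ^ L"] by simp
  qed (use gm in \<open>simp_all add: q1 F2 F3 F4 F5 F6 F7 F8 F9 F10\<close>)
  from reachD[OF this] obtain s11 w11 d11 where r11: "run \<omega> (upsweep ''q2'' ''f2'' (IVar ''M'') (IConst 1)) s10 s11 w11 d11"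
    and q11: "\<And>v. 1 \<le> v \<Longrightarrow> v < 2 * 2 ^ L \<Longrightarrow> repr (iarr s11 ''q2'') (rarr s11 ''f2'') v (nodesum L N (alloc p l t \<omega> x) v)"
    and f11: "frame (upsweep ''q2'' ''f2'' (IVar ''M'') (IConst 1)) s10 s11" and b11: "w11 \<le> 8 * 2 ^ L" "d11 \<le> 2 + 4 * L"
    unfolding nodesum_def by (metis atLeastLessThan_iff power_0)
  have F11: "v \<noteq> ''W'' \<Longrightarrow> ivar s11 v = ivar s10 v" "a \<noteq> ''q2'' \<Longrightarrow> iarr s11 a = iarr s10 a" for v a
    using f11 by (simp_all add: frame_def upsweep_def upsweep_body_def Let_def)
  have nn: "0 \<le> nodesum L N (alloc p l t \<omega> x) v" for v unfolding nodesum_def by (rule nsum_nonneg) (rule gm)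
  have "reach \<omega> count_com s11 (\<lambda>s'. \<forall>v. 1 \<le> v \<longrightarrow> v < 2 * 2 ^ L \<longrightarrow>
       int (iarr s11 ''q2'' v) + int (iarr s' ''c'' v) = cnt (\<lambda>v. \<omega> (4 * v + 2)) (nodesum L N (alloc p l t \<omega> x)) v)
    (16 * 2 ^ L) (3 + 3 * L)"
    by (rule reach_count[OF _ q11 nodesum_add nn]) (simp_all add: q1 F2 F3 F4 F5 F6 F7 F8 F9 F10 F11)
  from reachD[OF this] obtain s12 w12 d12 where r12: "run \<omega> count_com s11 s12 w12 d12"
    and q12: "\<And>v. 1 \<le> v \<Longrightarrow> v < 2 * 2 ^ L \<Longrightarrow>
       int (iarr s11 ''q2'' v) + int (iarr s12 ''c'' v) = cnt (\<lambda>v. \<omega> (4 * v + 2)) (nodesum L N (alloc p l t \<omega> x)) v"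
    and f12: "frame count_com s11 s12" and b12: "w12 \<le> 16 * 2 ^ L" "d12 \<le> 3 + 3 * L" by blast
  have F12: "v \<noteq> ''W'' \<Longrightarrow> ivar s12 v = ivar s11 v" "a \<noteq> ''c'' \<Longrightarrow> iarr s12 a = iarr s11 a" for v a
    using f12 by (simp_all add: frame_def count_com_def count_init_def count_body_def Let_def)
  let ?d = "dest p l \<omega>"
  have "reach \<omega> output_com s12 (\<lambda>s'. output_set n s' = {i. i < n \<and> 0 < iarr s12 ''q2'' (2 ^ L + g (?d i)) + iarr s12 ''c'' (2 ^ L + g (?d i)) \<and>
        iarr s12 ''win'' (g (?d i)) = ?d i}) (1 + n) 1"
  proof (rule reach_output)
    fix i assume "i < n"
    then have "i < N" using n by simp
    then show "?d i = rot_fwd N (iarr s12 ''sg'' (iarr s12 ''rr'' i)) i"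
      using sg[of i] by (simp add: dest_def F4 F5 F6 F7 F8 F9 F10 F11 F12)
  qed (simp_all add: q1 F2 F3 F4 F5 F6 F7 F8 F9 F10 F11 F12 g_def)
  from reachD[OF this] obtain s13 w13 d13 where r13: "run \<omega> output_com s12 s13 w13 d13"
    and q13: "output_set n s13 = {i. i < n \<and> 0 < iarr s12 ''q2'' (2 ^ L + g (?d i)) + iarr s12 ''c'' (2 ^ L + g (?d i)) \<and>
        iarr s12 ''win'' (g (?d i)) = ?d i}" and b13: "w13 \<le> 1 + n" "d13 \<le> 1" by blast
  have out: "output_set n s13 = alg p l t \<omega> \<omega> x"
  proof -
    have memb: "(0 < iarr s12 ''q2'' (2 ^ L + g (?d i)) + iarr s12 ''c'' (2 ^ L + g (?d i)) \<and> iarr s12 ''win'' (g (?d i)) = ?d i)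
      \<longleftrightarrow> (?G (?d i), ?d i) \<in> sampler L N \<omega> (alloc p l t \<omega> x)" if "i < n" for i
    proof -
      have "i < N" using that n by simp
      then have d: "?d i < N" by (rule dest_src(1)[OF \<omega>])
      have h: "g (?d i) = ?G (?d i)" "?G (?d i) < 2 ^ L" using g[OF d] gL[OF d] by auto
      let ?h = "?G (?d i)"
      have "int (iarr s12 ''q2'' (2 ^ L + ?h)) + int (iarr s12 ''c'' (2 ^ L + ?h)) = gcount L N \<omega> (alloc p l t \<omega> x) ?h"
        using q12[of "2 ^ L + ?h"] h(2) by (simp add: gcount_def F12)
      then have c: "0 < iarr s12 ''q2'' (2 ^ L + ?h) + iarr s12 ''c'' (2 ^ L + ?h) \<longleftrightarrow> 1 \<le> gcount L N \<omega> (alloc p l t \<omega> x) ?h"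
        by linarith
      have w: "iarr s12 ''win'' ?h = first_argmax {j. j < N \<and> ?G j = ?h} (clock_key (\<lambda>i. \<omega> (4 * i + 3)) ?y)"
        using q10(2)[OF d] h(1) by (simp add: F11 F12)
      \<comment> \<open>The elected member of a slot matters only if its count is positive; then the
        slot has positive mass and the two notions of winner coincide.\<close>
      have "gwin N \<omega> (alloc p l t \<omega> x) ?h = iarr s12 ''win'' ?h" if "1 \<le> gcount L N \<omega> (alloc p l t \<omega> x) ?h"
      proof -
        have "0 < gmass N (alloc p l t \<omega> x) ?h" using gcount_cases[OF fe \<omega> h(2)] that by auto
        then have "0 < (\<Sum>j<N. if ?G j = ?h then ?y j else 0)" unfolding gmass_def alloc_def by (simp cong: if_cong)
        then show ?thesis unfolding w gwin_def alloc_def using y \<omega>' by (intro first_argmax_support) auto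
      qed
      then show ?thesis unfolding h(1) c using d h(2) by (auto simp: sampler_def)
    qed
    show ?thesis unfolding q13 alg_def len L_def[symmetric] by (intro Collect_cong conj_cong refl memb)
  qed
  note total = run_Seq[OF r1 run_Seq[OF r2 run_Seq[OF r3 run_Seq[OF r4 run_Seq[OF r5 run_Seq[OF r6 run_Seq[OF r7
    run_Seq[OF r8 run_Seq[OF r9 run_Seq[OF r10 run_Seq[OF r11 run_Seq[OF r12 r13]]]]]]]]]]], folded prog_def s0_def]
  have Lp: "L \<le> p + 2" using slots_le[of n k] by (simp add: L_def p_def l_def t_def)
  have "(2::nat) ^ L \<le> 2 ^ (p + 2)" using Lp by (rule power_increasing) simp
  then have LN: "(2::nat) ^ L \<le> 4 * N" by simp
  have "w1 + (w2 + (w3 + (w4 + (w5 + (w6 + (w7 + (w8 + (w9 + (w10 + (w11 + (w12 + w13))))))))))) \<le> 300 * 2 ^ p"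
  proof -
    have "w1 + w2 + w3 \<le> 64 * N" using b1 b2 b3 by linarith
    moreover have "w4 + w5 + w6 + w7 \<le> 5 + 29 * N" using b4 b5 b6 b7 by linarith
    moreover have "w8 + w9 + w10 \<le> 4 + 42 * N" using b8 b9 b10 LN by linarith
    moreover have "w11 + w12 + w13 \<le> 97 * N + 1" using b11 b12 b13 LN n by linarith
    moreover have "1 \<le> N" by simp
    ultimately show ?thesis by linarith
  qed
  moreover have "d1 + (d2 + (d3 + (d4 + (d5 + (d6 + (d7 + (d8 + (d9 + (d10 + (d11 + (d12 + d13))))))))))) \<le> 150 * (p + 1)"
  proof -
    have "d1 + d2 + d3 \<le> 46 + 50 * p" using b1(2) b2(2) b3(2) by (simp add: algebra_simps)
    moreover have "d4 + d5 + d6 + d7 \<le> 11 + 8 * p" using b4(2) b5(2) b6(2) b7(2) by (simp add: algebra_simps)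
    moreover have "d8 + d9 + d10 \<le> 12 + 8 * p" using b8(2) b9(2) b10(2) by (simp add: algebra_simps)
    moreover have "d11 + d12 + d13 \<le> 20 + 7 * p" using b11(2) b12(2) b13(2) Lp by (simp add: algebra_simps)
    ultimately show ?thesis unfolding add_mult_distrib2 by linarith
  qed
  ultimately show ?thesis using out total unfolding s0_def by blast
qed

section \<open>Stability of the sampler\<close>

text \<open>If the new winner is not p, its key is unchanged, and it dominated keys that were at
  least the old ones; so it had won before.\<close>

lemma first_argmax_raise:
  assumes "finite A" "A \<noteq> {}" "\<kappa> p \<le> \<kappa>' p" "\<And>q. q \<noteq> p \<Longrightarrow> \<kappa>' q = \<kappa> q"
  shows "first_argmax A \<kappa>' = p \<or> first_argmax A \<kappa>' = first_argmax A \<kappa>"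
proof (cases "first_argmax A \<kappa>' = p")
  case False
  note f = first_argmax[OF assms(1,2), where \<kappa> = \<kappa>']
  have le: "\<kappa> q \<le> \<kappa>' q" for q using assms(3,4) by (cases "q = p") auto
  have eq: "\<kappa> (first_argmax A \<kappa>') = \<kappa>' (first_argmax A \<kappa>')" using assms(4)[OF False] by simp
  have "first_argmax A \<kappa> = first_argmax A \<kappa>'"
  proof (rule first_argmax_unique)
    fix q assume q: "q \<in> A"
    show "\<kappa> q \<le> \<kappa> (first_argmax A \<kappa>')" unfolding eq by (rule order_trans[OF le f(2)[OF q]])
    show "\<kappa> q < \<kappa> (first_argmax A \<kappa>')" if "q < first_argmax A \<kappa>'"
      unfolding eq by (rule le_less_trans[OF le f(3)[OF q that]])
  qed (rule f(1))
  then show ?thesis by simp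
qed simp

text \<open>The change of the node masses when leaf l gains \<delta>. The bound on path nodes
  follows from nonnegativity, as the whole level sums to \<delta>.\<close>

lemma nsum_point:
  fixes \<delta> :: real
  assumes "0 \<le> \<delta>" "l \<in> {2 ^ L..<2 * 2 ^ L}"
  defines "D \<equiv> nsum (2 ^ L) (\<lambda>v. if v = l then \<delta> else 0)"
  shows "0 \<le> D v" "(\<forall>j. v \<noteq> l div 2 ^ j) \<Longrightarrow> D v = 0" "j \<le> L \<Longrightarrow> D (l div 2 ^ j) \<le> \<delta>"
proof -
  show nn: "0 \<le> D v" for v unfolding D_def using assms(1) by (intro nsum_nonneg) auto
  show "D v = 0" if "\<forall>j. v \<noteq> l div 2 ^ j"
    using that
  proof (induction "2 ^ L - v" arbitrary: v rule: less_induct)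
    case less
    show ?case
    proof (cases "v = 0 \<or> 2 ^ L \<le> v")
      case True
      have "v \<noteq> l div 2 ^ 0" using less.prems by blast
      then show ?thesis using True unfolding D_def by (subst ntree.simps) simp
    next
      case False
      have ch: "\<forall>j. x \<noteq> l div 2 ^ j" if "x div 2 = v" for x
      proof (intro allI notI)
        fix j assume "x = l div 2 ^ j"
        then have "v = l div 2 ^ Suc j" using that by (simp add: div_mult2_eq power_Suc2 del: power_Suc)
        then show False using less.prems by blast
      qed
      have "D (2 * v) = 0" "D (2 * v + 1) = 0"
        using False by (intro less.hyps ch; linarith)+
      then show ?thesis using False unfolding D_def by (simp add: ntree_node)
    qed
  qed
  assume j: "j \<le> L"
  have "D (l div 2 ^ j) \<le> (\<Sum>v\<in>{2 ^ (L - j)..<2 * 2 ^ (L - j)}. D v)"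
    using path_level[OF assms(2) j] nn by (intro member_le_sum) auto
  also have "\<dots> = (\<Sum>v\<in>{2 ^ L..<2 * 2 ^ L}. if v = l then \<delta> else 0)"
    unfolding D_def by (rule nsum_level) simp
  also have "\<dots> = \<delta>" using assms(2) by simp
  finally show "D (l div 2 ^ j) \<le> \<delta>" .
qed

text \<open>A group with a changed count alters one pair; a group of count one before and after
  alters two pairs if its winner changes.\<close>

lemma sum_of_bool_diff:
  fixes w w' N :: nat
  assumes "w < N" "w' < N"
  shows "(\<Sum>p<N. \<bar>of_bool (b' \<and> w' = p) - of_bool (b \<and> w = p)\<bar> :: real)
    \<le> \<bar>of_bool b' - of_bool b\<bar> + (if b \<and> b' \<and> w \<noteq> w' then 2 else 0)"
proof -
  have one: "(\<Sum>p<N. of_bool (w = p) :: real) = 1" if "w < N" for w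
    using that by (simp add: of_bool_def)
  show ?thesis
  proof (cases "b \<and> b'")
    case True
    show ?thesis
    proof (cases "w = w'")
      case False
      have "(\<Sum>p<N. \<bar>of_bool (w' = p) - of_bool (w = p)\<bar> :: real)
        \<le> (\<Sum>p<N. of_bool (w' = p) + of_bool (w = p))" by (intro sum_mono) auto
      then show ?thesis using one assms True False by (simp add: sum.distrib)
    qed (use True in simp)
  next
    case False
    then consider "b" "\<not> b'" | "\<not> b" "b'" | "\<not> b" "\<not> b'" by blast
    then show ?thesis using one[OF assms(1)] one[OF assms(2)] by cases simp_all
  qed
qed

text \<open>The size of the symmetric difference of the two samples, written as an l1 distance of
  indicators so that the triangle inequality and linearity of expectation apply termwise.\<close>

definition sdist :: "nat \<Rightarrow> nat \<Rightarrow> (nat \<Rightarrow> real) \<Rightarrow> (nat \<Rightarrow> nat \<Rightarrow> real) \<Rightarrow> (nat \<Rightarrow> nat \<Rightarrow> real) \<Rightarrow> real" where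
  "sdist L N \<omega> a b = (\<Sum>x\<in>{..<2 ^ L} \<times> {..<N}. \<bar>of_bool (x \<in> sampler L N \<omega> a) - of_bool (x \<in> sampler L N \<omega> b)\<bar>)"

lemma integrable_sdist: "0 < N \<Longrightarrow> integrable tape (\<lambda>\<omega>. sdist L N \<omega> a b)"
  unfolding sdist_def
  by (intro Bochner_Integration.integrable_sum Bochner_Integration.integrable_abs
      Bochner_Integration.integrable_diff integrable_sampler)

lemma sdist_commute: "sdist L N \<omega> a b = sdist L N \<omega> b a"
  unfolding sdist_def by (simp add: abs_minus_commute)

lemma sdist_triangle: "sdist L N \<omega> a c \<le> sdist L N \<omega> a b + sdist L N \<omega> b c"
  unfolding sdist_def sum.distrib[symmetric] by (intro sum_mono) linarith

lemma expectation_sdist_triangle: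
  assumes "0 < N"
  shows "(\<integral>\<omega>. sdist L N \<omega> a c \<partial>tape) \<le> (\<integral>\<omega>. sdist L N \<omega> a b \<partial>tape) + (\<integral>\<omega>. sdist L N \<omega> b c \<partial>tape)"
proof -
  have "(\<integral>\<omega>. sdist L N \<omega> a c \<partial>tape) \<le> (\<integral>\<omega>. sdist L N \<omega> a b + sdist L N \<omega> b c \<partial>tape)"
    by (intro integral_mono Bochner_Integration.integrable_add integrable_sdist assms sdist_triangle)
  also have "\<dots> = (\<integral>\<omega>. sdist L N \<omega> a b \<partial>tape) + (\<integral>\<omega>. sdist L N \<omega> b c \<partial>tape)"
    by (intro Bochner_Integration.integral_add integrable_sdist assms)
  finally show ?thesis .
qed

text \<open>The raised entry changes the masses on one path only. Each path node gains at most
  \<delta> in expectation; by \<open>cnt_path_diff\<close> the counts contribute one such term for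
  the root and two for each of the L lower levels. A change of winner contributes two more, whence
  2L + 3.\<close>

lemma expectation_sdist_single:
  assumes a: "feasible L N a" and a': "feasible L N a'" and N: "0 < N"
    and g0: "g0 < 2 ^ L" and p0: "p0 < N" and le: "a g0 p0 \<le> a' g0 p0"
    and eq: "\<And>g p. (g, p) \<noteq> (g0, p0) \<Longrightarrow> a' g p = a g p"
  shows "(\<integral>\<omega>. sdist L N \<omega> a' a \<partial>tape) \<le> real (2 * L + 3) * (a' g0 p0 - a g0 p0)"
proof -
  define \<delta> where "\<delta> = a' g0 p0 - a g0 p0"
  have \<delta>: "0 \<le> \<delta>" using le by (simp add: \<delta>_def)
  define l where "l = 2 ^ L + g0"
  have l: "l \<in> {2 ^ L..<2 * 2 ^ L}" using g0 by (simp add: l_def)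
  define D where "D = nsum (2 ^ L) (\<lambda>v. if v = l then \<delta> else 0)"
  note D = nsum_point[OF \<delta> l, folded D_def]
  let ?S = "nodesum L N a" and ?S' = "nodesum L N a'"
  have gm: "gmass N a' g = gmass N a g + (if g = g0 then \<delta> else 0)" for g
  proof (cases "g = g0")
    case True
    have "gmass N a' g0 = (\<Sum>p<N. a g0 p + (if p = p0 then \<delta> else 0))"
      unfolding gmass_def by (intro sum.cong refl) (use eq in \<open>auto simp: \<delta>_def\<close>)
    then show ?thesis using True p0 by (simp add: sum.distrib gmass_def)
  next
    case False
    then show ?thesis using eq by (simp add: gmass_def)
  qed
  have SD: "?S' v = ?S v + D v" if "0 < v" for v
    using that
  proof (induction "2 ^ L - v" arbitrary: v rule: less_induct)
    case less
    show ?case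
    proof (cases "2 ^ L \<le> v")
      case True
      then have "v - 2 ^ L = g0 \<longleftrightarrow> v = l" by (auto simp: l_def)
      then show ?thesis using True by (simp add: nodesum_def D_def ntree_leaf gm)
    next
      case False
      then have "?S' (2 * v) = ?S (2 * v) + D (2 * v)" "?S' (2 * v + 1) = ?S (2 * v + 1) + D (2 * v + 1)"
        using less.prems by (intro less.hyps; linarith)+
      moreover have "D v = D (2 * v) + D (2 * v + 1)"
        unfolding D_def by (rule ntree_node) (use False less.prems in auto)
      ultimately show ?thesis using nodesum_add[of v L N a] nodesum_add[of v L N a'] False less.prems
        by simp
    qed
  qed
  have S0: "?S 0 = ?S' 0 \<or> ?S 0 + \<delta> = ?S' 0"
    unfolding nodesum_def by (subst (1 2 3 4) ntree.simps) (simp add: gm)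
  \<comment> \<open>Index 0 is not a node; setting both mass functions to 0 there makes the
    pointwise hypotheses of the tree lemmas hold at every index.\<close>
  define T where "T v = (if v = 0 then 0 else ?S v)" for v
  define T' where "T' v = (if v = 0 then 0 else ?S' v)" for v
  have addT: "\<And>v. 0 < v \<Longrightarrow> v < 2 ^ L \<Longrightarrow> T v = T (2 * v) + T (2 * v + 1)"
    "\<And>v. 0 < v \<Longrightarrow> v < 2 ^ L \<Longrightarrow> T' v = T' (2 * v) + T' (2 * v + 1)"
    by (simp_all add: T_def T'_def nodesum_add del: One_nat_def)
  have leT: "T v \<le> T' v" for v using SD[of v] D(1)[of v] by (simp add: T_def T'_def)
  have offT: "T v = T' v" if "\<forall>j. v \<noteq> l div 2 ^ j" for v
    using SD[of v] D(2)[OF that] by (simp add: T_def T'_def)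
  define c where "c v \<omega> = cnt (\<lambda>v. \<omega> (4 * v + 2)) T v" for v \<omega>
  define c' where "c' v \<omega> = cnt (\<lambda>v. \<omega> (4 * v + 2)) T' v" for v \<omega>
  have cntT: "cnt u T v = cnt u ?S v" "cnt u T' v = cnt u ?S' v" if "0 < v" for u v
  proof -
    have *: "cnt u X v = cnt u Y v" if "\<And>v. 0 < v \<Longrightarrow> X v = Y v" "0 < v" for X Y :: "nat \<Rightarrow> real" and v
      using that(2)
    proof (induction v rule: less_induct)
      case (less v)
      show ?case
      proof (cases "v \<le> 1")
        case True
        then show ?thesis using less.prems that(1)[of v] by (simp add: cnt.simps[of u _ v])
      next
        case False
        define w where "w = v div 2"
        have "0 < w" "w < v" using False by (auto simp: w_def)
        then show ?thesis using False less.IH[of w] that(1)[of "2 * w"] that(1)[of "2 * w + 1"]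
          by (simp add: cnt.simps[of u _ v] Let_def w_def[symmetric])
      qed
    qed
    show "cnt u T v = cnt u ?S v" "cnt u T' v = cnt u ?S' v"
      by (rule *[OF _ that]; simp add: T_def T'_def)+
  qed
  have gc: "gcount L N \<omega> a g = c (2 ^ L + g) \<omega>" "gcount L N \<omega> a' g = c' (2 ^ L + g) \<omega>" for \<omega> g
    by (simp_all add: gcount_def c_def c'_def cntT)
  let ?in = "\<lambda>\<omega> b. of_bool ((g0, p0) \<in> sampler L N \<omega> b) :: real"
  define R where "R \<omega> = real_of_int (c' (l div 2 ^ L) \<omega> - c (l div 2 ^ L) \<omega>)
      + 2 * (\<Sum>i<L. real_of_int (c' (l div 2 ^ i) \<omega> - c (l div 2 ^ i) \<omega>)) + 2 * (?in \<omega> a' - ?in \<omega> a)" for \<omega>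
  have path: "sdist L N \<omega> a' a \<le> R \<omega>" if \<omega>: "\<omega> \<in> space tape" for \<omega>
  proof -
    have u: "0 < \<omega> (4 * v + 2) \<and> \<omega> (4 * v + 2) < 1" for v using \<omega> by (simp add: space_tape)
    define w w' where "w = gwin N \<omega> a" and "w' = gwin N \<omega> a'"
    have wN: "w g < N" "w' g < N" for g unfolding w_def w'_def by (rule gwin_less[OF N])+
    define \<gamma> \<gamma>' where "\<gamma> = gcount L N \<omega> a" and "\<gamma>' = gcount L N \<omega> a'"
    have \<gamma>: "\<gamma> g = 0 \<or> \<gamma> g = 1" "\<gamma>' g = 0 \<or> \<gamma>' g = 1" if "g < 2 ^ L" for g
      unfolding \<gamma>_def \<gamma>'_def using gcount_cases[OF a \<omega> that] gcount_cases[OF a' \<omega> that] by auto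
    have ww: "w' g = w g" if "g \<noteq> g0" for g
    proof -
      have "a' g = a g" using eq that by auto
      then show ?thesis by (simp add: w_def w'_def gwin_def)
    qed
    have wg0: "w' g0 = p0 \<or> w' g0 = w g0"
      unfolding w_def w'_def gwin_def
    proof (rule first_argmax_raise)
      have "ln (\<omega> (4 * p0 + 3)) < 0" using \<omega> by (simp add: space_tape)
      then show "clock_key (\<lambda>p. \<omega> (4 * p + 3)) (a g0) p0 \<le> clock_key (\<lambda>p. \<omega> (4 * p + 3)) (a' g0) p0"
        unfolding clock_key_def using le by (intro divide_right_mono) simp_all
    qed (use N eq in \<open>auto simp: clock_key_def\<close>)
    have mono: "\<gamma> g0 \<le> \<gamma>' g0"
      using cnt_path_mono[OF addT u l leT offT, of 0] unfolding \<gamma>_def \<gamma>'_def gc c_def c'_def l_def by simp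
    have "sdist L N \<omega> a' a = (\<Sum>g<2 ^ L. \<Sum>p<N. \<bar>of_bool ((g, p) \<in> sampler L N \<omega> a') - of_bool ((g, p) \<in> sampler L N \<omega> a)\<bar>)"
      unfolding sdist_def sum.cartesian_product by (simp add: case_prod_unfold)
    also have "\<dots> = (\<Sum>g<2 ^ L. \<Sum>p<N. \<bar>of_bool (1 \<le> \<gamma>' g \<and> w' g = p) - of_bool (1 \<le> \<gamma> g \<and> w g = p)\<bar>)"
      by (intro sum.cong refl) (simp add: sampler_def \<gamma>_def \<gamma>'_def w_def w'_def)
    also have "\<dots> \<le> (\<Sum>g<2 ^ L. \<bar>real_of_int (\<gamma>' g - \<gamma> g)\<bar> + (if g = g0 then 2 * (?in \<omega> a' - ?in \<omega> a) else 0))"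
    proof (rule sum_mono)
      fix g assume "g \<in> {..<2 ^ L :: nat}"
      then have g: "g < 2 ^ L" by simp
      have "(\<Sum>p<N. \<bar>of_bool (1 \<le> \<gamma>' g \<and> w' g = p) - of_bool (1 \<le> \<gamma> g \<and> w g = p)\<bar> :: real)
        \<le> \<bar>of_bool (1 \<le> \<gamma>' g) - of_bool (1 \<le> \<gamma> g)\<bar> + (if 1 \<le> \<gamma> g \<and> 1 \<le> \<gamma>' g \<and> w g \<noteq> w' g then 2 else 0)"
        by (rule sum_of_bool_diff[OF wN])
      moreover have "\<bar>of_bool (1 \<le> \<gamma>' g) - of_bool (1 \<le> \<gamma> g)\<bar> = \<bar>real_of_int (\<gamma>' g - \<gamma> g)\<bar>"
        using \<gamma>[OF g] by auto
      \<comment> \<open>By \<open>first_argmax_raise\<close> a change of winner in g0 means that p0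
        has taken over, so p0 enters the sample. The increment of its indicator is never negative,
        since neither count nor key of p0 can drop out.\<close>
      moreover have "(if 1 \<le> \<gamma> g \<and> 1 \<le> \<gamma>' g \<and> w g \<noteq> w' g then 2 else 0)
        \<le> (if g = g0 then 2 * (?in \<omega> a' - ?in \<omega> a) else 0)"
      proof (cases "g = g0")
        case True
        have "?in \<omega> b = of_bool (1 \<le> gcount L N \<omega> b g0 \<and> gwin N \<omega> b g0 = p0)" for b
          using g0 p0 by (simp add: sampler_def)
        then show ?thesis using True wg0 mono \<gamma>[OF g]
          unfolding \<gamma>_def[symmetric] \<gamma>'_def[symmetric] w_def[symmetric] w'_def[symmetric]
          by (auto simp: \<gamma>_def \<gamma>'_def w_def w'_def)
      qed (use ww in simp)
      ultimately show "(\<Sum>p<N. \<bar>of_bool (1 \<le> \<gamma>' g \<and> w' g = p) - of_bool (1 \<le> \<gamma> g \<and> w g = p)\<bar>)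
        \<le> \<bar>real_of_int (\<gamma>' g - \<gamma> g)\<bar> + (if g = g0 then 2 * (?in \<omega> a' - ?in \<omega> a) else 0)" by linarith
    qed
    also have "\<dots> = real_of_int (\<Sum>g<2 ^ L. \<bar>\<gamma>' g - \<gamma> g\<bar>) + 2 * (?in \<omega> a' - ?in \<omega> a)"
      using g0 by (simp add: sum.distrib)
    also have "(\<Sum>g<2 ^ L. \<bar>\<gamma>' g - \<gamma> g\<bar>) = nsum (2 ^ L) (\<lambda>v. \<bar>c' v \<omega> - c v \<omega>\<bar>) 1"
      unfolding nsum_root sum_heap_leaves \<gamma>_def \<gamma>'_def gc ..
    also have "nsum (2 ^ L) (\<lambda>v. \<bar>c' v \<omega> - c v \<omega>\<bar>) 1 \<le> (c' (l div 2 ^ L) \<omega> - c (l div 2 ^ L) \<omega>)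
       + 2 * (\<Sum>i<L. c' (l div 2 ^ i) \<omega> - c (l div 2 ^ i) \<omega>)"
    proof -
      have "l div 2 ^ L = 1" using path_level[OF l order_refl] by auto
      then show ?thesis using cnt_path_diff[OF addT u l leT offT order_refl]
        unfolding c_def c'_def by simp
    qed
    finally show ?thesis by (simp add: R_def)
  qed
  have lv: "0 < l div 2 ^ i" "l div 2 ^ i < 2 * 2 ^ L" if "i \<le> L" for i
  proof -
    note * = path_level[OF l that]
    then show "0 < l div 2 ^ i" by (auto intro: less_le_trans[OF zero_less_power])
    have "(2::nat) ^ (L - i) \<le> 2 ^ L" by (rule power_increasing) auto
    moreover have "l div 2 ^ i < 2 * 2 ^ (L - i)" using * by simp
    ultimately show "l div 2 ^ i < 2 * 2 ^ L" by linarith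
  qed
  have int: "integrable tape (\<lambda>\<omega>. real_of_int (c (l div 2 ^ i) \<omega>))" "integrable tape (\<lambda>\<omega>. real_of_int (c' (l div 2 ^ i) \<omega>))"
    if "i \<le> L" for i
    unfolding c_def c'_def using integrable_cnt[OF addT(1) lv[OF that]] integrable_cnt[OF addT(2) lv[OF that]] by auto
  have E: "(\<integral>\<omega>. real_of_int (c' (l div 2 ^ i) \<omega> - c (l div 2 ^ i) \<omega>) \<partial>tape) \<le> \<delta>" if "i \<le> L" for i
  proof -
    have "(\<integral>\<omega>. real_of_int (c' (l div 2 ^ i) \<omega> - c (l div 2 ^ i) \<omega>) \<partial>tape)
      = (\<integral>\<omega>. real_of_int (c' (l div 2 ^ i) \<omega>) \<partial>tape) - (\<integral>\<omega>. real_of_int (c (l div 2 ^ i) \<omega>) \<partial>tape)"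
      using int[OF that] by simp
    also have "\<dots> = T' (l div 2 ^ i) - T (l div 2 ^ i)"
      unfolding c_def c'_def using expectation_cnt[OF addT(1) lv[OF that]] expectation_cnt[OF addT(2) lv[OF that]] by simp
    also have "\<dots> = D (l div 2 ^ i)" using SD[OF lv(1)[OF that]] lv(1)[OF that] by (simp add: T_def T'_def)
    finally show ?thesis using D(3)[OF that] by simp
  qed
  have intd: "integrable tape (\<lambda>\<omega>. real_of_int (c' (l div 2 ^ i) \<omega> - c (l div 2 ^ i) \<omega>))" if "i \<le> L" for i
    using int[OF that] by simp
  have inti: "integrable tape (\<lambda>\<omega>. ?in \<omega> a')" "integrable tape (\<lambda>\<omega>. ?in \<omega> a)" by (rule integrable_sampler[OF N])+
  have int1: "integrable tape (\<lambda>\<omega>. 2 * (\<Sum>i<L. real_of_int (c' (l div 2 ^ i) \<omega> - c (l div 2 ^ i) \<omega>)))"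
    by (intro integrable_mult_right Bochner_Integration.integrable_sum intd) simp
  have int2: "integrable tape (\<lambda>\<omega>. 2 * (?in \<omega> a' - ?in \<omega> a))"
    by (intro integrable_mult_right Bochner_Integration.integrable_diff inti)
  have intR: "integrable tape R" unfolding R_def
    by (intro Bochner_Integration.integrable_add intd int1 int2) simp
  have "(\<integral>\<omega>. sdist L N \<omega> a' a \<partial>tape) \<le> (\<integral>\<omega>. R \<omega> \<partial>tape)"
    by (intro integral_mono integrable_sdist N intR path)
  also have "\<dots> = (\<integral>\<omega>. real_of_int (c' (l div 2 ^ L) \<omega> - c (l div 2 ^ L) \<omega>) \<partial>tape)
      + 2 * (\<Sum>i<L. \<integral>\<omega>. real_of_int (c' (l div 2 ^ i) \<omega> - c (l div 2 ^ i) \<omega>) \<partial>tape)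
      + 2 * ((\<integral>\<omega>. ?in \<omega> a' \<partial>tape) - (\<integral>\<omega>. ?in \<omega> a \<partial>tape))"
    unfolding R_def using intd int1 int2 inti
    by (simp add: Bochner_Integration.integral_add Bochner_Integration.integral_sum less_imp_le del: of_int_diff)
  \<comment> \<open>The increase of p0's inclusion probability is \<delta> by
    \<open>expectation_sampler\<close>, so the expected cost of winner changes is 2\<delta>.\<close>
  also have "\<dots> \<le> \<delta> + 2 * (\<Sum>i<L. \<delta>) + 2 * \<delta>"
    using expectation_sampler[OF a' N g0 p0] expectation_sampler[OF a N g0 p0] E
    by (intro add_mono mult_left_mono sum_mono) (auto simp: \<delta>_def)
  also have "\<dots> = real (2 * L + 3) * \<delta>" by (simp add: algebra_simps)
  finally show ?thesis by (simp add: \<delta>_def)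
qed

text \<open>Entries are raised one at a time. Every intermediate allocation \<open>mix X\<close>
  lies between \<open>b\<close> and \<open>a\<close>, so its groups have at most the mass they have
  in \<open>a\<close>, and it stays feasible.\<close>

lemma expectation_sdist_le:
  assumes a: "feasible L N a" and b: "feasible L N b" and N: "0 < N"
    and le: "\<And>g p. b g p \<le> a g p"
    and out: "\<And>g p. \<not> (g < 2 ^ L \<and> p < N) \<Longrightarrow> a g p = b g p"
  shows "(\<integral>\<omega>. sdist L N \<omega> a b \<partial>tape) \<le> real (2 * L + 3) * (\<Sum>(g, p)\<in>{..<2 ^ L} \<times> {..<N}. a g p - b g p)"
proof -
  define F where "F = {..<2 ^ L :: nat} \<times> {..<N}"
  define mix where "mix X g p = (if (g, p) \<in> X then a g p else b g p)" for X g p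
  have fe: "feasible L N (mix X)" for X
  proof -
    have "gmass N (mix X) g \<le> gmass N a g" for g
      unfolding gmass_def mix_def using le by (intro sum_mono) auto
    then have "gmass N (mix X) g \<le> 1" if "g < 2 ^ L" for g
      using a that unfolding feasible_def by (meson order_trans)
    moreover have "0 \<le> mix X g p" for g p using a b by (simp add: feasible_def mix_def)
    ultimately show ?thesis by (simp add: feasible_def)
  qed
  have "(\<integral>\<omega>. sdist L N \<omega> (mix X) b \<partial>tape) \<le> real (2 * L + 3) * (\<Sum>(g, p)\<in>X. a g p - b g p)"
    if "finite X" "X \<subseteq> F" for X
    using that
  proof (induction X)
    case empty
    have "mix {} = b" by (simp add: mix_def fun_eq_iff)
    then show ?case by (simp add: sdist_def)
  next
    case (insert x X)
    obtain g0 p0 where x: "x = (g0, p0)" by fastforce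
    have gp: "g0 < 2 ^ L" "p0 < N" using insert.prems by (auto simp: x F_def)
    have m: "mix (insert x X) g0 p0 = a g0 p0" "mix X g0 p0 = b g0 p0" using insert.hyps by (auto simp: mix_def x)
    have "(\<integral>\<omega>. sdist L N \<omega> (mix (insert x X)) b \<partial>tape) \<le> (\<integral>\<omega>. sdist L N \<omega> (mix (insert x X)) (mix X) \<partial>tape)
       + (\<integral>\<omega>. sdist L N \<omega> (mix X) b \<partial>tape)"
      by (rule expectation_sdist_triangle[OF N])
    also have "(\<integral>\<omega>. sdist L N \<omega> (mix (insert x X)) (mix X) \<partial>tape)
       \<le> real (2 * L + 3) * (mix (insert x X) g0 p0 - mix X g0 p0)"
      by (rule expectation_sdist_single[OF fe fe N gp]) (use le m in \<open>auto simp: mix_def x\<close>)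
    also have "\<dots> = real (2 * L + 3) * (a g0 p0 - b g0 p0)" by (simp only: m)
    finally show ?case using insert by (simp add: x algebra_simps)
  qed
  from this[of F] have "(\<integral>\<omega>. sdist L N \<omega> (mix F) b \<partial>tape) \<le> real (2 * L + 3) * (\<Sum>(g, p)\<in>F. a g p - b g p)"
    by (simp add: F_def)
  moreover have "mix F = a" using out by (auto simp: mix_def F_def fun_eq_iff)
  ultimately show ?thesis by (simp add: F_def)
qed

text \<open>The detour through the entrywise minimum keeps all intermediate allocations feasible,
  and the two parts add up to the absolute difference. Replacing entries directly could push a group
  above mass one.\<close>

lemma expectation_sdist:
  assumes a: "feasible L N a" and b: "feasible L N b" and N: "0 < N"
    and out: "\<And>g p. \<not> (g < 2 ^ L \<and> p < N) \<Longrightarrow> a g p = b g p"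
  shows "(\<integral>\<omega>. sdist L N \<omega> a b \<partial>tape) \<le> real (2 * L + 3) * (\<Sum>(g, p)\<in>{..<2 ^ L} \<times> {..<N}. \<bar>a g p - b g p\<bar>)"
proof -
  define c where "c g p = min (a g p) (b g p)" for g p
  have "gmass N c g \<le> gmass N a g" for g unfolding gmass_def c_def by (intro sum_mono) auto
  then have "gmass N c g \<le> 1" if "g < 2 ^ L" for g
    using a that unfolding feasible_def by (meson order_trans)
  then have c: "feasible L N c" using a b by (simp add: feasible_def c_def)
  have "(\<integral>\<omega>. sdist L N \<omega> a b \<partial>tape) \<le> (\<integral>\<omega>. sdist L N \<omega> a c \<partial>tape) + (\<integral>\<omega>. sdist L N \<omega> b c \<partial>tape)"
    using expectation_sdist_triangle[OF N, of L a b c] by (simp add: sdist_commute[of L N _ c b])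
  also have "\<dots> \<le> real (2 * L + 3) * (\<Sum>(g, p)\<in>{..<2 ^ L} \<times> {..<N}. a g p - c g p)
      + real (2 * L + 3) * (\<Sum>(g, p)\<in>{..<2 ^ L} \<times> {..<N}. b g p - c g p)"
    by (intro add_mono expectation_sdist_le a b c N) (auto simp: c_def out)
  also have "\<dots> = real (2 * L + 3) * (\<Sum>(g, p)\<in>{..<2 ^ L} \<times> {..<N}. \<bar>a g p - b g p\<bar>)"
    unfolding distrib_left[symmetric] sum.distrib[symmetric]
    by (intro arg_cong2[where f = "(*)"] refl sum.cong) (auto simp: c_def)
  finally show ?thesis .
qed

section \<open>Measurability\<close>

lemma measurable_map_list:
  assumes "\<And>r. r \<in> set xs \<Longrightarrow> f r \<in> measurable M (count_space UNIV)"
  shows "(\<lambda>\<omega>. map (\<lambda>r. f r \<omega>) xs) \<in> measurable M (count_space (UNIV :: nat list set))"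
  using assms
proof (induction xs)
  case (Cons a xs)
  have 1: "f a \<in> measurable M (count_space UNIV)" by (rule Cons.prems) simp
  have 2: "(\<lambda>\<omega>. map (\<lambda>r. f r \<omega>) xs) \<in> measurable M (count_space UNIV)" using Cons by simp
  have "(\<lambda>\<omega>. h # map (\<lambda>r. f r \<omega>) xs) \<in> measurable M (count_space UNIV)" for h
    by (rule measurable_compose[OF 2]) simp
  then have "(\<lambda>\<omega>. f a \<omega> # map (\<lambda>r. f r \<omega>) xs) \<in> measurable M (count_space UNIV)"
    by (rule measurable_compose_countable) (rule 1)
  then show ?case by simp
qed simp

lemma measurable_nat_floor:
  assumes "g \<in> borel_measurable M"
  shows "(\<lambda>\<omega>. nat \<lfloor>g \<omega> :: real\<rfloor>) \<in> measurable M (count_space UNIV)"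
proof -
  have "(\<lambda>\<omega>. \<lfloor>g \<omega>\<rfloor>) \<in> measurable M (count_space UNIV)"
    by (rule measurable_compose[OF assms measurable_real_floor])
  from measurable_compose[OF this, where g = nat] show ?thesis by simp
qed

lemma measurable_of_bool:
  "{\<omega> \<in> space M. P \<omega>} \<in> sets M \<Longrightarrow> (\<lambda>\<omega>. of_bool (P \<omega>) :: real) \<in> borel_measurable M"
  unfolding of_bool_def by (rule measurable_If) simp_all

lemma sets_nat_eq:
  fixes f g :: "'a \<Rightarrow> nat"
  assumes f: "f \<in> measurable M (count_space UNIV)" and g: "g \<in> measurable M (count_space UNIV)"
  shows "{\<omega> \<in> space M. f \<omega> = g \<omega>} \<in> sets M" "{\<omega> \<in> space M. f \<omega> \<noteq> g \<omega>} \<in> sets M"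
proof -
  have r: "(\<lambda>\<omega>. real (f \<omega>)) \<in> borel_measurable M" "(\<lambda>\<omega>. real (g \<omega>)) \<in> borel_measurable M"
    using measurable_compose[OF f, where g = real] measurable_compose[OF g, where g = real] by simp_all
  show "{\<omega> \<in> space M. f \<omega> = g \<omega>} \<in> sets M" using borel_measurable_eq[OF r] by simp
  show "{\<omega> \<in> space M. f \<omega> \<noteq> g \<omega>} \<in> sets M" using borel_measurable_neq[OF r] by simp
qed

text \<open>Everything that depends on the shifts factors through the list of shifts, which has countably many
  values.\<close>

definition shifts :: "nat \<Rightarrow> nat \<Rightarrow> (nat \<Rightarrow> real) \<Rightarrow> nat list" where
  "shifts p l \<omega> = map (shift p l \<omega>) [0..<2 ^ (p - l)]"

definition perm_by :: "nat \<Rightarrow> nat \<Rightarrow> nat list \<Rightarrow> real list \<Rightarrow> nat \<Rightarrow> real" where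
  "perm_by p l c x i = (if i < 2 ^ p then padded x (rot_back (2 ^ p) (c ! (i mod 2 ^ (p - l))) i) else 0)"

lemma shifts_nth: "shifts p l \<omega> ! (i mod 2 ^ (p - l)) = shift p l \<omega> (i mod 2 ^ (p - l))"
  by (simp add: shifts_def)

lemma perm_by_shifts: "perm_by p l (shifts p l \<omega>) x = perm p l \<omega> x"
  by (simp add: perm_by_def perm_def src_def shifts_nth fun_eq_iff)

lemma measurable_shifts: "shifts p l \<in> measurable tape (count_space UNIV)"
proof -
  have "(\<lambda>\<omega>. shift p l \<omega> r) \<in> measurable tape (count_space UNIV)" for r
  proof -
    have "(\<lambda>\<omega>. nat \<lfloor>2 ^ l * \<omega> (4 * r) :: real\<rfloor>) \<in> measurable tape (count_space UNIV)"
      by (intro measurable_nat_floor borel_measurable_times borel_measurable_const measurable_tape_coordinate)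
    from measurable_compose[OF this, where g = "\<lambda>z. 2 ^ (p - l) * z" and L = "count_space UNIV"]
    show ?thesis unfolding shift_def by simp
  qed
  then have "(\<lambda>\<omega>. map (\<lambda>r. shift p l \<omega> r) [0..<2 ^ (p - l)]) \<in> measurable tape (count_space UNIV)"
    by (rule measurable_map_list)
  then show ?thesis unfolding shifts_def[abs_def] .
qed

lemma measurable_slot: "(\<lambda>\<omega>. slot m T (\<omega> 1) y i) \<in> measurable tape (count_space UNIV)"
proof -
  have 1: "(\<lambda>\<omega>. nat \<lfloor>\<omega> 1 + Y\<rfloor>) \<in> measurable tape (count_space UNIV)" for Y
    by (intro measurable_nat_floor borel_measurable_add measurable_tape_coordinate borel_measurable_const)
  have 2: "(\<lambda>\<omega>. a + nat \<lfloor>\<omega> 1 + Y\<rfloor>) \<in> measurable tape (count_space UNIV)" for a Y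
    using measurable_compose[OF 1, where g = "\<lambda>z. a + z" and L = "count_space UNIV"] by simp
  have "(\<lambda>\<omega>. (i div m * T + nat \<lfloor>\<omega> 1 + block_sum m y i\<rfloor>) + nat \<lfloor>\<omega> 1 + (block_sum m y i + y i)\<rfloor>)
      \<in> measurable tape (count_space UNIV)"
    by (rule measurable_compose_countable[where f = "\<lambda>a \<omega>. a + nat \<lfloor>\<omega> 1 + (block_sum m y i + y i)\<rfloor>", OF 2 2])
  then show ?thesis unfolding slot_def by (simp only: add.assoc)
qed

lemma measurable_slot_of: "(\<lambda>\<omega>. slot_of p l t \<omega> x i) \<in> measurable tape (count_space UNIV)"
  unfolding slot_of_def perm_by_shifts[symmetric]
  by (rule measurable_compose_countable[where f = "\<lambda>c \<omega>. slot (2 ^ (p - l)) (2 ^ t) (\<omega> 1) (perm_by p l c x) i",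
        OF measurable_slot measurable_shifts])

lemma measurable_perm: "(\<lambda>\<omega>. perm p l \<omega> x i) \<in> borel_measurable tape"
  unfolding perm_by_shifts[symmetric]
  by (rule measurable_compose[where g = "\<lambda>c. perm_by p l c x i", OF measurable_shifts]) simp

lemma measurable_dest: "(\<lambda>\<omega>. dest p l \<omega> i) \<in> measurable tape (count_space UNIV)"
  unfolding dest_def shifts_nth[symmetric]
  by (rule measurable_compose[where g = "\<lambda>c. rot_fwd (2 ^ p) (c ! (i mod 2 ^ (p - l))) i", OF measurable_shifts]) simp

text \<open>Once the list of shifts and the list of slots are frozen, the allocation is a constant
  and \<open>sets_sampler\<close> applies. Both lists have countably many values, so they can be
  substituted back one after the other.\<close>

lemma sets_alg: "{\<omega> \<in> space tape. i \<in> alg p l t \<omega> \<omega> x} \<in> sets tape"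
proof -
  let ?N = "(2::nat) ^ p"
  define sl where "sl \<omega> = map (\<lambda>j. slot_of p l t \<omega> x j) [0..<?N]" for \<omega>
  define al where "al c s g j = (if j < ?N \<and> s ! j = g then perm_by p l c x j else 0)" for c and s :: "nat list" and g j :: nat
  define d where "d c = rot_fwd ?N (c ! (i mod 2 ^ (p - l))) i" for c
  define \<Phi> where "\<Phi> c s \<omega> \<longleftrightarrow> i < length x \<and> d c < ?N \<and> (s ! d c, d c) \<in> sampler (l + t) ?N \<omega> (al c s)" for c s \<omega>
  have sl: "sl \<omega> ! j = slot_of p l t \<omega> x j" if "j < ?N" for \<omega> j
    using that by (simp add: sl_def)
  have al: "al (shifts p l \<omega>) (sl \<omega>) = alloc p l t \<omega> x" for \<omega>
    by (auto simp: al_def alloc_def sl perm_by_shifts fun_eq_iff)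
  have d: "d (shifts p l \<omega>) = dest p l \<omega> i" for \<omega> by (simp add: d_def dest_def shifts_nth)
  have "z \<in> sampler L ?N \<omega> a \<longleftrightarrow> snd z < ?N \<and> z \<in> sampler L ?N \<omega> a" for z L \<omega> a by (auto simp: sampler_def)
  then have eq: "i \<in> alg p l t \<omega> \<omega> x \<longleftrightarrow> \<Phi> (shifts p l \<omega>) (sl \<omega>) \<omega>" for \<omega>
    unfolding alg_def \<Phi>_def al d mem_Collect_eq by (metis sl snd_conv)
  have msl: "sl \<in> measurable tape (count_space UNIV)"
    unfolding sl_def[abs_def] by (rule measurable_map_list) (rule measurable_slot_of)
  have m\<Phi>: "(\<lambda>\<omega>. \<Phi> c s \<omega>) \<in> measurable tape (count_space UNIV)" for c s
  proof -
    have "{\<omega> \<in> space tape. \<Phi> c s \<omega>} \<in> sets tape"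
      unfolding \<Phi>_def by (intro sets.sets_Collect_conj sets.sets_Collect_const sets_sampler) simp_all
    then show ?thesis by (simp add: pred_def)
  qed
  have "(\<lambda>\<omega>. \<Phi> c (sl \<omega>) \<omega>) \<in> measurable tape (count_space UNIV)" for c
    by (rule measurable_compose_countable[OF m\<Phi> msl])
  then have "(\<lambda>\<omega>. \<Phi> (shifts p l \<omega>) (sl \<omega>) \<omega>) \<in> measurable tape (count_space UNIV)"
    by (rule measurable_compose_countable[where f = "\<lambda>c \<omega>. \<Phi> c (sl \<omega>) \<omega>", OF _ measurable_shifts])
  then show ?thesis unfolding eq by (simp add: pred_def)
qed

section \<open>Marginals and stretch\<close>

text \<open>Residue 0 holds the rotations and residue 1 the offset; everything the grouping reads
  lies here, and the coins and clocks lie outside.\<close>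

definition grouping_cells :: "nat set" where
  "grouping_cells = {j. j mod 4 < 2}"

lemma alg_merge:
  "alg p l t (tape_merge grouping_cells \<omega> \<omega>') (tape_merge grouping_cells \<omega> \<omega>') x = alg p l t \<omega> \<omega>' x"
proof -
  let ?\<nu> = "tape_merge grouping_cells \<omega> \<omega>'"
  have "4 * r mod 4 < 2" "(4 * r + 2) mod 4 = 2" "(4 * r + 3) mod 4 = 3" for r :: nat by presburger+
  then have c: "?\<nu> (4 * r) = \<omega> (4 * r)" "?\<nu> (4 * r + 2) = \<omega>' (4 * r + 2)" "?\<nu> (4 * r + 3) = \<omega>' (4 * r + 3)" "?\<nu> 1 = \<omega> 1" for r
    unfolding tape_merge_def grouping_cells_def mem_Collect_eq by auto
  have "shift p l ?\<nu> = shift p l \<omega>" unfolding shift_def c ..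
  then have dp: "dest p l ?\<nu> = dest p l \<omega>" "perm p l ?\<nu> = perm p l \<omega>"
    by (simp_all add: dest_def perm_def src_def fun_eq_iff)
  moreover have sl: "slot_of p l t ?\<nu> = slot_of p l t \<omega>" by (intro ext) (simp only: slot_of_def dp c)
  moreover have "alloc p l t ?\<nu> = alloc p l t \<omega>" by (intro ext) (simp only: alloc_def dp sl)
  moreover have "sampler L N ?\<nu> a = sampler L N \<omega>' a" for L N a
    unfolding sampler_def gcount_def gwin_def c ..
  ultimately show ?thesis by (simp add: alg_def)
qed

text \<open>An elected group has positive mass, hence some member with a positive key, hence a
  winner with a positive key. This holds on every tape, so padding positions and entries 0 are never
  selected.\<close>

lemma sampler_pos:
  assumes a: "feasible L N a" and \<omega>: "\<omega> \<in> space tape" and mem: "(g, q) \<in> sampler L N \<omega> a"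
  shows "0 < a g q"
proof -
  have q: "q < N" "g < 2 ^ L" "1 \<le> gcount L N \<omega> a g" "gwin N \<omega> a g = q" using mem by (auto simp: sampler_def)
  have w: "0 < \<omega> i" "\<omega> i < 1" for i using \<omega> by (auto simp: space_tape)
  have "0 < gmass N a g" using gcount_cases[OF a \<omega> q(2)] q(3) by auto
  then obtain r where r: "r < N" "0 < a g r"
    unfolding gmass_def by (metis lessThan_iff linorder_not_less sum_nonpos)
  have "clock_key (\<lambda>p. \<omega> (4 * p + 3)) (a g) r \<le> clock_key (\<lambda>p. \<omega> (4 * p + 3)) (a g) q"
    using first_argmax(2)[of "{..<N}" r "clock_key (\<lambda>p. \<omega> (4 * p + 3)) (a g)"] r q(4) by (auto simp: gwin_def)
  moreover have "0 < clock_key (\<lambda>p. \<omega> (4 * p + 3)) (a g) r" using r w clock_key_pos_iff by simp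
  ultimately have "0 < clock_key (\<lambda>p. \<omega> (4 * p + 3)) (a g) q" by linarith
  then show ?thesis using w clock_key_pos_iff by simp
qed

context sampling_params
begin

text \<open>The marginals are already correct conditionally on each grouping, so the grouping may be
  arbitrary.\<close>

lemma expectation_alg:
  assumes x: "x \<in> Delta n k" and i: "i < n"
  shows "(\<integral>\<omega>. of_bool (i \<in> alg p l t \<omega> \<omega> x) \<partial>tape) = x ! i"
proof -
  have len: "length x = n" using x by (simp add: Delta_def)
  have iN: "i < N" using i n by simp
  have meas: "(\<lambda>\<omega>. of_bool (i \<in> alg p l t \<omega> \<omega> x) :: real) \<in> borel_measurable tape"
    unfolding of_bool_def by (intro measurable_If sets_alg) simp_all
  have "(\<integral>\<omega>. (of_bool (i \<in> alg p l t \<omega> \<omega> x) :: real) \<partial>tape) = (\<integral>\<omega>. (\<integral>\<omega>'. of_bool (i \<in> alg p l t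
      (tape_merge grouping_cells \<omega> \<omega>') (tape_merge grouping_cells \<omega> \<omega>') x) \<partial>tape) \<partial>tape)"
    by (rule expectation_tape_merge[where B = 1, OF meas]) simp
  also have "\<dots> = (\<integral>\<omega>. x ! i \<partial>tape)"
  proof (intro Bochner_Integration.integral_cong refl)
    fix \<omega> assume \<omega>: "\<omega> \<in> space tape"
    let ?d = "dest p l \<omega> i"
    have d: "?d < N" by (rule dest_src(1)[OF \<omega> iN])
    have "(\<integral>\<omega>'. (of_bool (i \<in> alg p l t \<omega> \<omega>' x) :: real) \<partial>tape)
       = (\<integral>\<omega>'. of_bool ((slot_of p l t \<omega> x ?d, ?d) \<in> sampler (l + t) N \<omega>' (alloc p l t \<omega> x)) \<partial>tape)"
      by (simp add: alg_def len i)
    also have "\<dots> = alloc p l t \<omega> x (slot_of p l t \<omega> x ?d) ?d"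
      by (rule expectation_sampler[OF feasible_alloc[OF \<omega> x] _ slot_of_less[OF \<omega> x d] d]) simp
    also have "\<dots> = x ! i" using d i by (simp add: alloc_def perm_dest[OF \<omega> iN] padded_def len)
    finally show "(\<integral>\<omega>'. of_bool (i \<in> alg p l t (tape_merge grouping_cells \<omega> \<omega>') (tape_merge grouping_cells \<omega> \<omega>') x) \<partial>tape) = x ! i"
      unfolding alg_merge .
  qed
  finally show ?thesis by (simp add: tape.prob_space)
qed

text \<open>Selected coordinates correspond bijectively to sampled pairs: by
  \<open>sampler_pos\<close> a sampled position lies in its own slot and is not padding. The total
  mass is preserved by the permutation, so \<open>card_sampler\<close> applies.\<close>

lemma card_alg:
  assumes x: "x \<in> Delta n k" and \<omega>: "\<omega> \<in> space tape"
  shows "int (card (alg p l t \<omega> \<omega> x)) \<in> {\<lfloor>l1 x\<rfloor>, \<lceil>l1 x\<rceil>}"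
proof -
  let ?a = "alloc p l t \<omega> x" and ?d = "dest p l \<omega>" and ?S = "sampler (l + t) N \<omega> (alloc p l t \<omega> x)"
  have len: "length x = n" using x by (simp add: Delta_def)
  note fe = feasible_alloc[OF \<omega> x]
  have inj: "inj_on ?d {..<N}" by (rule inj_on_inverseI[where g = "src p l \<omega>"]) (simp add: dest_src[OF \<omega>])
  have S: "g = slot_of p l t \<omega> x q \<and> q < N \<and> src p l \<omega> q < n" if "(g, q) \<in> ?S" for g q
  proof -
    have "0 < ?a g q" by (rule sampler_pos[OF fe \<omega> that])
    then have "q < N" "slot_of p l t \<omega> x q = g" "0 < perm p l \<omega> x q" by (auto simp: alloc_def split: if_splits)
    then show ?thesis by (auto simp: perm_def padded_def len split: if_splits)
  qed
  have "?S = (\<lambda>i. (slot_of p l t \<omega> x (?d i), ?d i)) ` alg p l t \<omega> \<omega> x"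
  proof (intro equalityI subsetI)
    fix z assume z: "z \<in> ?S"
    obtain g q where gq: "z = (g, q)" by fastforce
    note * = S[OF z[unfolded gq]]
    then have "?d (src p l \<omega> q) = q" by (simp add: dest_src[OF \<omega>])
    then show "z \<in> (\<lambda>i. (slot_of p l t \<omega> x (?d i), ?d i)) ` alg p l t \<omega> \<omega> x"
      using * z gq by (intro image_eqI[of _ _ "src p l \<omega> q"]) (auto simp: alg_def len)
  qed (auto simp: alg_def)
  moreover have "inj_on (\<lambda>i. (slot_of p l t \<omega> x (?d i), ?d i)) (alg p l t \<omega> \<omega> x)"
    using inj n by (auto simp: inj_on_def alg_def len)
  ultimately have "card ?S = card (alg p l t \<omega> \<omega> x)" by (simp add: card_image)
  moreover have "valid (\<Sum>g<2 ^ (l + t). gmass N ?a g) (int (card ?S))"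
    by (rule card_sampler[OF fe \<omega>]) simp
  moreover have "(\<Sum>g<2 ^ (l + t). gmass N ?a g) = l1 x"
  proof -
    have "(\<Sum>g<2 ^ (l + t). gmass N ?a g) = (\<Sum>i<N. \<Sum>g<2 ^ (l + t). ?a g i)"
      unfolding gmass_def by (rule sum.swap)
    also have "\<dots> = (\<Sum>i<N. perm p l \<omega> x i)"
      using slot_of_less[OF \<omega> x] by (intro sum.cong) (auto simp: alloc_def)
    also have "\<dots> = (\<Sum>i<N. perm p l \<omega> x (?d i))" by (rule sum_dest[OF \<omega>])
    also have "\<dots> = l1 x" using sum_padded[OF \<omega> x] by (simp add: perm_dest[OF \<omega>])
    finally show ?thesis .
  qed
  ultimately show ?thesis unfolding valid_def by (simp add: ceiling_altdef split: if_splits; linarith)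
qed

text \<open>A coordinate on which the outputs differ is sent to its pair in the sample that contains
  it. That pair is missing from the other sample: its presence would make its slot the one assigned
  there, and the coordinate would be selected too.\<close>

lemma card_diff_le_sdist:
  assumes x: "x \<in> Delta n k" "x' \<in> Delta n k" and \<omega>: "\<omega> \<in> space tape" and \<omega>': "\<omega>' \<in> space tape"
  shows "real (card (sym_diff (alg p l t \<omega> \<omega>' x) (alg p l t \<omega> \<omega>' x')))
    \<le> sdist (l + t) N \<omega>' (alloc p l t \<omega> x) (alloc p l t \<omega> x')"
proof -
  let ?d = "dest p l \<omega>" and ?F = "{..<2 ^ (l + t) :: nat} \<times> {..<N}"
  let ?s = "\<lambda>x. sampler (l + t) N \<omega>' (alloc p l t \<omega> x)" and ?G = "slot_of p l t \<omega>" and ?A = "alg p l t \<omega> \<omega>'"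
  have len: "length x = n" "length x' = n" using x by (auto simp: Delta_def)
  have inj: "inj_on ?d {..<N}" by (rule inj_on_inverseI[where g = "src p l \<omega>"]) (simp add: dest_src[OF \<omega>])
  define f where "f i = (if i \<in> ?A x then (?G x (?d i), ?d i) else (?G x' (?d i), ?d i))" for i
  have unique: "?G z (?d i) = g" if "(g, ?d i) \<in> ?s z" "z \<in> Delta n k" for z g i
    using sampler_pos[OF feasible_alloc[OF \<omega> that(2)] \<omega>' that(1)] by (auto simp: alloc_def split: if_splits)
  have sub: "f ` sym_diff (?A x) (?A x') \<subseteq> sym_diff (?s x) (?s x')"
  proof
    fix z assume "z \<in> f ` sym_diff (?A x) (?A x')"
    then obtain i where i: "i \<in> sym_diff (?A x) (?A x')" "z = f i" by blast
    then have "i < n" by (auto simp: alg_def len)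
    then have A: "i \<in> ?A x \<longleftrightarrow> (?G x (?d i), ?d i) \<in> ?s x" "i \<in> ?A x' \<longleftrightarrow> (?G x' (?d i), ?d i) \<in> ?s x'"
      by (simp_all add: alg_def len)
    show "z \<in> sym_diff (?s x) (?s x')"
    proof (cases "i \<in> ?A x")
      case True
      then have z: "z = (?G x (?d i), ?d i)" and no: "i \<notin> ?A x'" using i by (simp_all add: f_def)
      have "z \<notin> ?s x'"
      proof
        assume "z \<in> ?s x'"
        then have "(?G x (?d i), ?d i) \<in> ?s x'" by (simp only: z)
        moreover from unique[OF this x(2)] have "?G x' (?d i) = ?G x (?d i)" .
        ultimately show False using no A(2) by simp
      qed
      moreover have "z \<in> ?s x" using True A(1) z by simp
      ultimately show ?thesis by (simp only: Un_iff Diff_iff simp_thms)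
    next
      case False
      then have z: "z = (?G x' (?d i), ?d i)" and yes: "i \<in> ?A x'" using i by (simp_all add: f_def)
      have "z \<notin> ?s x"
      proof
        assume "z \<in> ?s x"
        then have "(?G x' (?d i), ?d i) \<in> ?s x" by (simp only: z)
        moreover from unique[OF this x(1)] have "?G x (?d i) = ?G x' (?d i)" .
        ultimately show False using False A(1) by simp
      qed
      moreover have "z \<in> ?s x'" using yes A(2) z by simp
      ultimately show ?thesis by (simp only: Un_iff Diff_iff simp_thms)
    qed
  qed
  have "inj_on f (sym_diff (?A x) (?A x'))"
    using inj n by (auto simp: inj_on_def f_def alg_def len split: if_splits)
  moreover have fin: "finite (sym_diff (?s x) (?s x'))"
    by (rule finite_subset[of _ ?F]) (auto simp: sampler_def)
  ultimately have "card (sym_diff (?A x) (?A x')) \<le> card (sym_diff (?s x) (?s x'))"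
    using sub by (metis card_image card_mono)
  also have "real (card (sym_diff (?s x) (?s x'))) = sdist (l + t) N \<omega>' (alloc p l t \<omega> x) (alloc p l t \<omega> x')"
  proof -
    have "sym_diff (?s x) (?s x') = {z \<in> ?F. z \<in> sym_diff (?s x) (?s x')}" by (auto simp: sampler_def)
    then have "real (card (sym_diff (?s x) (?s x'))) = (\<Sum>z\<in>{z \<in> ?F. z \<in> sym_diff (?s x) (?s x')}. 1)" by simp
    also have "\<dots> = (\<Sum>z\<in>?F. if z \<in> sym_diff (?s x) (?s x') then 1 else 0)"
      by (rule sum.inter_filter) simp
    also have "\<dots> = sdist (l + t) N \<omega>' (alloc p l t \<omega> x) (alloc p l t \<omega> x')"
      unfolding sdist_def by (intro sum.cong refl) auto
    finally show ?thesis .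
  qed
  finally show ?thesis by simp
qed

section \<open>Expected change of the grouping\<close>

lemma perm_bounds: "\<omega> \<in> space tape \<Longrightarrow> x \<in> Delta n k \<Longrightarrow> 0 \<le> perm p l \<omega> x q \<and> perm p l \<omega> x q \<le> 1"
  using padded_bounds[of \<omega> x] by (simp add: perm_def)

text \<open>A position that keeps its slot contributes the change of its mass. One that moves
  contributes y + y', which is at most |y - y'| + 2y; so the regrouping cost is charged to the mass
  in \<open>x\<close> alone.\<close>

lemma alloc_diff:
  assumes x: "x \<in> Delta n k" "x' \<in> Delta n k" and \<omega>: "\<omega> \<in> space tape"
  shows "(\<Sum>(g, q)\<in>{..<2 ^ (l + t)} \<times> {..<N}. \<bar>alloc p l t \<omega> x g q - alloc p l t \<omega> x' g q\<bar>)
    \<le> (\<Sum>i<N. \<bar>padded x i - padded x' i\<bar>)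
      + 2 * (\<Sum>q<N. perm p l \<omega> x q * of_bool (slot_of p l t \<omega> x q \<noteq> slot_of p l t \<omega> x' q))"
proof -
  let ?F = "{..<2 ^ (l + t) :: nat}" and ?G = "slot_of p l t \<omega> x" and ?G' = "slot_of p l t \<omega> x'"
  let ?y = "perm p l \<omega> x" and ?y' = "perm p l \<omega> x'"
  have "(\<Sum>(g, q)\<in>?F \<times> {..<N}. \<bar>alloc p l t \<omega> x g q - alloc p l t \<omega> x' g q\<bar>)
     = (\<Sum>q<N. \<Sum>g\<in>?F. \<bar>alloc p l t \<omega> x g q - alloc p l t \<omega> x' g q\<bar>)"
    unfolding sum.cartesian_product[symmetric] by (rule sum.swap)
  also have "\<dots> \<le> (\<Sum>q<N. \<bar>?y q - ?y' q\<bar> + 2 * (?y q * of_bool (?G q \<noteq> ?G' q)))"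
  proof (rule sum_mono)
    fix q assume "q \<in> {..<N}"
    then have q: "q < N" by simp
    have G: "?G q \<in> ?F" "?G' q \<in> ?F" using slot_of_less[OF \<omega> _ q] x by auto
    have b: "0 \<le> ?y q" "0 \<le> ?y' q" using perm_bounds[OF \<omega>] x by auto
    show "(\<Sum>g\<in>?F. \<bar>alloc p l t \<omega> x g q - alloc p l t \<omega> x' g q\<bar>) \<le> \<bar>?y q - ?y' q\<bar> + 2 * (?y q * of_bool (?G q \<noteq> ?G' q))"
    proof (cases "?G q = ?G' q")
      case True
      have "(\<Sum>g\<in>?F. \<bar>alloc p l t \<omega> x g q - alloc p l t \<omega> x' g q\<bar>) = (\<Sum>g\<in>?F. if g = ?G q then \<bar>?y q - ?y' q\<bar> else 0)"
        using True q by (intro sum.cong) (auto simp: alloc_def)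
      also have "\<dots> = \<bar>?y q - ?y' q\<bar>" using G(1) by (simp add: sum.delta del: lessThan_iff)
      finally show ?thesis using True by simp
    next
      case False
      have "(\<Sum>g\<in>?F. \<bar>alloc p l t \<omega> x g q - alloc p l t \<omega> x' g q\<bar>)
        \<le> (\<Sum>g\<in>?F. (if g = ?G q then ?y q else 0) + (if g = ?G' q then ?y' q else 0))"
        using False q b by (intro sum_mono) (auto simp: alloc_def)
      also have "\<dots> = ?y q + ?y' q" unfolding sum.distrib using G by (simp add: sum.delta del: lessThan_iff)
      finally show ?thesis using False by simp
    qed
  qed
  also have "\<dots> = (\<Sum>q<N. \<bar>?y q - ?y' q\<bar>) + 2 * (\<Sum>q<N. ?y q * of_bool (?G q \<noteq> ?G' q))"
    by (simp only: sum.distrib sum_distrib_left)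
  also have "(\<Sum>q<N. \<bar>?y q - ?y' q\<bar>) = (\<Sum>i<N. \<bar>?y (dest p l \<omega> i) - ?y' (dest p l \<omega> i)\<bar>)" by (rule sum_dest[OF \<omega>])
  also have "\<dots> = (\<Sum>i<N. \<bar>padded x i - padded x' i\<bar>)" by (simp add: perm_dest[OF \<omega>])
  finally show ?thesis .
qed

text \<open>Positions of the same row stay distinct and in that row, hence never share a block. For
  different rows, the rotation of the first row is independent of the second and uniform over
  \<open>2 ^ l\<close> values, at most one of which leads to the required block. If l = p there is a
  single row.\<close>

lemma prob_same_block:
  assumes ij: "i < N" "j < N" "i \<noteq> j"
  shows "(\<integral>\<omega>. of_bool (dest p l \<omega> i div m = dest p l \<omega> j div m) \<partial>tape) \<le> (if l = p then 0 else 1 / 2 ^ l :: real)"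
proof (cases "i mod m = j mod m")
  case True
  have "dest p l \<omega> i div m \<noteq> dest p l \<omega> j div m" if \<omega>: "\<omega> \<in> space tape" for \<omega>
  proof
    assume "dest p l \<omega> i div m = dest p l \<omega> j div m"
    moreover have "dest p l \<omega> i mod m = dest p l \<omega> j mod m"
      using dest_src(5)[OF \<omega> ij(1)] dest_src(5)[OF \<omega> ij(2)] True by simp
    ultimately have "dest p l \<omega> i = dest p l \<omega> j" by (metis div_mult_mod_eq)
    then show False using dest_src(4)[OF \<omega> ij(1)] dest_src(4)[OF \<omega> ij(2)] ij(3) by simp
  qed
  then have "(\<integral>\<omega>. (of_bool (dest p l \<omega> i div m = dest p l \<omega> j div m) :: real) \<partial>tape) = (\<integral>\<omega>. 0 \<partial>tape)"
    by (intro Bochner_Integration.integral_cong) auto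
  then show ?thesis by simp
next
  case False
  then have lp: "l \<noteq> p" by auto
  define c where "c = 4 * (i mod m)"
  \<comment> \<open>Everything is fixed except the rotation of the row of i.\<close>
  define J where "J = - {c}"
  have mdiv: "(\<lambda>\<omega>. dest p l \<omega> a div m) \<in> measurable tape (count_space UNIV)" for a
    using measurable_compose[OF measurable_dest, where g = "\<lambda>z. z div m" and L = "count_space UNIV"] by simp
  have meas: "(\<lambda>\<omega>. of_bool (dest p l \<omega> i div m = dest p l \<omega> j div m) :: real) \<in> borel_measurable tape"
    by (intro measurable_of_bool sets_nat_eq mdiv)
  have "(\<integral>\<omega>. (of_bool (dest p l \<omega> i div m = dest p l \<omega> j div m) :: real) \<partial>tape)
    = (\<integral>\<omega>. (\<integral>\<omega>'. of_bool (dest p l (tape_merge J \<omega> \<omega>') i div m = dest p l (tape_merge J \<omega> \<omega>') j div m) \<partial>tape) \<partial>tape)"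
    by (rule expectation_tape_merge[where B = 1, OF meas]) simp
  also have "\<dots> \<le> (\<integral>\<omega>. 1 / 2 ^ l \<partial>tape)"
  proof (rule integral_mono')
    fix \<omega> assume \<omega>: "\<omega> \<in> space tape"
    have di: "dest p l (tape_merge J \<omega> \<omega>') i = dest p l \<omega>' i" for \<omega>'
      by (simp add: dest_def shift_def tape_merge_def J_def c_def)
    have dj: "dest p l (tape_merge J \<omega> \<omega>') j = dest p l \<omega> j" for \<omega>'
      using False by (simp add: dest_def shift_def tape_merge_def J_def c_def)
    have unique: "nat \<lfloor>2 ^ l * \<omega>1 c\<rfloor> = nat \<lfloor>2 ^ l * \<omega>2 c\<rfloor>"
      if s: "\<omega>1 \<in> space tape" "\<omega>2 \<in> space tape" and eq: "dest p l \<omega>1 i div m = dest p l \<omega>2 i div m" for \<omega>1 \<omega>2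
    proof -
      have "dest p l \<omega>1 i mod m = dest p l \<omega>2 i mod m" using dest_src(5)[OF s(1) ij(1)] dest_src(5)[OF s(2) ij(1)] by simp
      with eq have "dest p l \<omega>1 i = dest p l \<omega>2 i" by (metis div_mult_mod_eq)
      then have "rot_fwd N (shift p l \<omega>1 (i mod m)) i = rot_fwd N (shift p l \<omega>2 (i mod m)) i" by (simp only: dest_def)
      then have "shift p l \<omega>1 (i mod m) = shift p l \<omega>2 (i mod m)"
        using shift_less(1)[OF s(1), of "i mod m"] shift_less(1)[OF s(2), of "i mod m"] ij(1)
        unfolding rot_fwd_def by (simp only: split: if_splits) linarith+
      then show ?thesis by (simp add: shift_def c_def)
    qed
    \<comment> \<open>If no tape brings i into the block, any admissible value of s will do, and 0
      is taken.\<close>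
    obtain s where s: "s < 2 ^ l" "\<And>\<omega>'. \<omega>' \<in> space tape \<Longrightarrow> dest p l \<omega>' i div m = dest p l \<omega> j div m \<Longrightarrow> nat \<lfloor>2 ^ l * \<omega>' c\<rfloor> = s"
    proof (cases "\<exists>\<omega>1\<in>space tape. dest p l \<omega>1 i div m = dest p l \<omega> j div m")
      case True
      then obtain \<omega>1 where w: "\<omega>1 \<in> space tape" "dest p l \<omega>1 i div m = dest p l \<omega> j div m" by blast
      have "m * nat \<lfloor>2 ^ l * \<omega>1 c\<rfloor> < m * 2 ^ l"
        using shift_less(1)[OF w(1), of "i mod m"] by (simp only: shift_def c_def N_eq mult.commute)
      then have "nat \<lfloor>2 ^ l * \<omega>1 c\<rfloor> < 2 ^ l" by simp
      then show ?thesis by (rule that) (rule unique[OF _ w(1)], simp_all add: w(2))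
    next
      case False
      show ?thesis by (rule that[of 0]) (use False in auto)
    qed
    define E where "E = {\<omega>' \<in> space tape. nat \<lfloor>real (2 ^ l) * \<omega>' c\<rfloor> = s}"
    have "{\<omega>' \<in> space tape. nat \<lfloor>real (2 ^ l) * \<omega>' c\<rfloor> = (\<lambda>_. s) \<omega>'} \<in> sets tape"
      by (intro sets_nat_eq measurable_nat_floor borel_measurable_times borel_measurable_const measurable_tape_coordinate) simp
    then have E: "E \<in> sets tape" by (simp add: E_def)
    have "(\<integral>\<omega>'. (of_bool (dest p l (tape_merge J \<omega> \<omega>') i div m = dest p l (tape_merge J \<omega> \<omega>') j div m) :: real) \<partial>tape)
      \<le> (\<integral>\<omega>'. indicator E \<omega>' \<partial>tape)"
    proof (rule integral_mono')
      show "integrable tape (indicator E :: _ \<Rightarrow> real)"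
        using E by (intro integrable_real_indicator) (auto simp: tape.emeasure_eq_measure)
      fix \<omega>' assume w: "\<omega>' \<in> space tape"
      show "of_bool (dest p l (tape_merge J \<omega> \<omega>') i div m = dest p l (tape_merge J \<omega> \<omega>') j div m) \<le> (indicator E \<omega>' :: real)"
        unfolding di dj using s(2)[OF w] w by (auto simp: E_def)
    qed simp
    also have "\<dots> = 1 / 2 ^ l"
      using prob_floor_scale[OF s(1), of c] prob_tape_indicator[OF E] by (simp add: E_def)
    finally show "(\<integral>\<omega>'. (of_bool (dest p l (tape_merge J \<omega> \<omega>') i div m = dest p l (tape_merge J \<omega> \<omega>') j div m) :: real) \<partial>tape) \<le> 1 / 2 ^ l" .
  qed simp_all
  also have "\<dots> = 1 / 2 ^ l" by (simp add: tape.prob_space)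
  finally show ?thesis using lp by simp
qed

text \<open>For a fixed position, the slot can change only if one of the two floors does, so a union
  bound over both ends suffices.\<close>

lemma prob_slot_differs:
  "(\<integral>\<omega>. of_bool (slot M T (\<omega> 1) y q \<noteq> slot M T (\<omega> 1) y' q) \<partial>tape)
    \<le> \<bar>block_sum M y q - block_sum M y' q\<bar> + \<bar>(block_sum M y q + y q) - (block_sum M y' q + y' q)\<bar>"
proof -
  define A where "A Y Y' = {\<omega> \<in> space tape. \<lfloor>\<omega> 1 + Y\<rfloor> \<noteq> \<lfloor>\<omega> 1 + Y'\<rfloor>}" for Y Y'
  have A: "A Y Y' \<in> sets tape" for Y Y'
    using borel_measurable_neq[OF measurable_floor_shift[of 1 Y] measurable_floor_shift[of 1 Y']] by (simp add: A_def)
  have int: "integrable tape (indicator (A Y Y') :: _ \<Rightarrow> real)" for Y Y'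
    using A by (intro integrable_real_indicator) (auto simp: tape.emeasure_eq_measure)
  let ?A = "A (block_sum M y q) (block_sum M y' q)" and ?B = "A (block_sum M y q + y q) (block_sum M y' q + y' q)"
  have "(\<integral>\<omega>. (of_bool (slot M T (\<omega> 1) y q \<noteq> slot M T (\<omega> 1) y' q) :: real) \<partial>tape) \<le> (\<integral>\<omega>. indicator ?A \<omega> + indicator ?B \<omega> \<partial>tape)"
  proof (rule integral_mono')
    fix \<omega> assume w: "\<omega> \<in> space tape"
    show "of_bool (slot M T (\<omega> 1) y q \<noteq> slot M T (\<omega> 1) y' q) \<le> (indicator ?A \<omega> + indicator ?B \<omega> :: real)"
    proof (cases "\<omega> \<in> ?A \<or> \<omega> \<in> ?B")
      case False
      then have "slot M T (\<omega> 1) y q = slot M T (\<omega> 1) y' q" using w by (simp add: A_def slot_def add.assoc)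
      then show ?thesis by simp
    qed (auto simp: indicator_def)
  qed (auto intro!: Bochner_Integration.integrable_add int)
  also have "\<dots> = measure tape ?A + measure tape ?B"
    using A by (simp add: Bochner_Integration.integral_add[OF int int])
  also have "\<dots> \<le> \<bar>block_sum M y q - block_sum M y' q\<bar> + \<bar>(block_sum M y q + y q) - (block_sum M y' q + y' q)\<bar>"
    unfolding A_def by (intro add_mono prob_floor_shift_differs)
  finally show ?thesis .
qed

text \<open>Both ends of the item are prefix sums within its block, so each moves by at most the
  total change in that block; the factor 2 counts the ends.\<close>

lemma block_diff:
  assumes q: "q < N"
  shows "\<bar>block_sum m y q - block_sum m y' q\<bar> + \<bar>(block_sum m y q + y q) - (block_sum m y' q + y' q)\<bar>
    \<le> 2 * (\<Sum>j<N. of_bool (q div m = j div m) * \<bar>y j - y' j\<bar>)"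
proof -
  let ?a = "q div m * m" and ?R = "\<Sum>j<N. of_bool (q div m = j div m) * \<bar>y j - y' j\<bar>"
  have le: "\<bar>(\<Sum>j\<in>{?a..<e}. y j) - (\<Sum>j\<in>{?a..<e}. y' j)\<bar> \<le> ?R" if e: "e \<le> Suc q" for e
  proof -
    have same: "q div m = j div m" if j: "j \<in> {?a..<e}" for j
    proof (rule antisym)
      show "j div m \<le> q div m" using j e by (intro div_le_mono) auto
      have "?a div m \<le> j div m" using j by (intro div_le_mono) auto
      then show "q div m \<le> j div m" by simp
    qed
    have "\<bar>(\<Sum>j\<in>{?a..<e}. y j) - (\<Sum>j\<in>{?a..<e}. y' j)\<bar> \<le> (\<Sum>j\<in>{?a..<e}. \<bar>y j - y' j\<bar>)"
      unfolding sum_subtractf[symmetric] by (rule sum_abs)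
    also have "\<dots> = (\<Sum>j\<in>{?a..<e}. of_bool (q div m = j div m) * \<bar>y j - y' j\<bar>)"
    proof (rule sum.cong[OF refl])
      fix j assume "j \<in> {?a..<e}"
      from same[OF this] show "\<bar>y j - y' j\<bar> = of_bool (q div m = j div m) * \<bar>y j - y' j\<bar>" by simp
    qed
    also have "\<dots> \<le> ?R" using e q by (intro sum_mono2) auto
    finally show ?thesis .
  qed
  have s: "block_sum m z q + z q = (\<Sum>j\<in>{?a..<Suc q}. z j)" for z :: "nat \<Rightarrow> real"
    unfolding block_sum_def by (rule sum.atLeastLessThan_Suc[symmetric]) (rule div_times_less_eq_dividend)
  have "\<bar>block_sum m y q - block_sum m y' q\<bar> \<le> ?R"
    unfolding block_sum_def by (rule le) simp
  moreover have "\<bar>(block_sum m y q + y q) - (block_sum m y' q + y' q)\<bar> \<le> ?R"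
    unfolding s by (rule le) simp
  ultimately show ?thesis unfolding mult_2 by (rule add_mono)
qed

lemma integrable_slot_differs:
  fixes x'
  assumes x: "x \<in> Delta n k"
  defines "h \<equiv> (\<lambda>\<omega>. \<Sum>q<N. perm p l \<omega> x q * of_bool (slot_of p l t \<omega> x q \<noteq> slot_of p l t \<omega> x' q))"
  shows "h \<in> borel_measurable tape" "\<omega> \<in> space tape \<Longrightarrow> \<bar>h \<omega>\<bar> \<le> real N" "\<omega> \<in> space tape \<Longrightarrow> 0 \<le> h \<omega>" "integrable tape h"
proof -
  show 1: "h \<in> borel_measurable tape"
    unfolding h_def by (intro borel_measurable_sum borel_measurable_times measurable_perm measurable_of_bool
      sets_nat_eq measurable_slot_of)
  have 2: "0 \<le> h \<omega>" if "\<omega> \<in> space tape" for \<omega>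
    unfolding h_def using perm_bounds[OF that x] by (intro sum_nonneg) simp
  have 3: "\<bar>h \<omega>\<bar> \<le> real N" if w: "\<omega> \<in> space tape" for \<omega>
  proof -
    have "h \<omega> \<le> (\<Sum>q<N. 1)" unfolding h_def using perm_bounds[OF w x] by (intro sum_mono) (simp add: of_bool_def)
    then show ?thesis using 2[OF w] by simp
  qed
  show "\<omega> \<in> space tape \<Longrightarrow> \<bar>h \<omega>\<bar> \<le> real N" "\<omega> \<in> space tape \<Longrightarrow> 0 \<le> h \<omega>" by (fact 3, fact 2)
  show "integrable tape h" by (rule tape.integrable_const_bound[where B = "real N", OF _ 1]) (auto intro!: AE_I2 dest: 3)
qed

text \<open>The offset is averaged first: position i changes slot with probability at most twice the
  change in its block. Averaging over the rotations then leaves 2 times the sum of x_i d_j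
  Pr[i and j share a block]. The diagonal is at most the sum of the d_j because x_i <= 1. The rest
  is at most 1/2^l times the product of the total mass and the total change; since the mass is at
  most k <= 2^l, this is again at most the sum of the d_j, whence 4. If l = p there is no
  off-diagonal part.\<close>

lemma expectation_slot_differs:
  assumes x: "x \<in> Delta n k" and sep: "l = p \<or> k \<le> 2 ^ l"
  shows "(\<integral>\<omega>. (\<Sum>q<N. perm p l \<omega> x q * of_bool (slot_of p l t \<omega> x q \<noteq> slot_of p l t \<omega> x' q)) \<partial>tape)
    \<le> 4 * (\<Sum>i<N. \<bar>padded x i - padded x' i\<bar>)" (is "integral\<^sup>L tape ?h \<le> _")
proof -
  \<comment> \<open>These cells hold the rotations; the offset, in cell 1, is redrawn.\<close>
  define J where "J = {j :: nat. j mod 4 = 0}"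
  define d where "d j = \<bar>padded x j - padded x' j\<bar>" for j
  define I where "I \<omega> i j = (of_bool (dest p l \<omega> i div m = dest p l \<omega> j div m) :: real)" for \<omega> i j
  have d0: "0 \<le> d j" for j by (simp add: d_def)
  \<comment> \<open>\<open>padded_bounds\<close> and \<open>sum_padded\<close> ask for some tape;
    the constant one with value 1/2 serves.\<close>
  have half: "(\<lambda>_. 1 / 2) \<in> space tape" by (simp add: space_tape)
  note pb = padded_bounds[OF half x]
  have Iint: "integrable tape (\<lambda>\<omega>. I \<omega> i j)" for i j
  proof (rule tape.integrable_const_bound[where B = 1])
    have "(\<lambda>\<omega>. dest p l \<omega> a div m) \<in> measurable tape (count_space UNIV)" for a
      using measurable_compose[OF measurable_dest, where g = "\<lambda>z. z div m" and L = "count_space UNIV"] by simp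
    then show "(\<lambda>\<omega>. I \<omega> i j) \<in> borel_measurable tape"
      unfolding I_def by (intro measurable_of_bool sets_nat_eq)
  qed (simp add: I_def)
  have Dint: "integrable tape (\<lambda>\<omega>. 2 * (\<Sum>i<N. \<Sum>j<N. padded x i * d j * I \<omega> i j))"
    by (intro Bochner_Integration.integrable_mult_right Bochner_Integration.integrable_sum Iint)
  have "integral\<^sup>L tape ?h = (\<integral>\<omega>. (\<integral>\<omega>'. ?h (tape_merge J \<omega> \<omega>') \<partial>tape) \<partial>tape)"
    by (rule expectation_tape_merge[where B = "real N", OF integrable_slot_differs(1,2)[OF x]])
  also have "\<dots> \<le> (\<integral>\<omega>. 2 * (\<Sum>i<N. \<Sum>j<N. padded x i * d j * I \<omega> i j) \<partial>tape)"
  proof (rule integral_mono'[OF Dint])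
    fix \<omega> assume w: "\<omega> \<in> space tape"
    let ?y = "perm p l \<omega> x" and ?y' = "perm p l \<omega> x'"
    have "(4 * r) mod 4 = 0" "1 mod 4 = (1 :: nat)" for r :: nat by presburger+
    then have c: "tape_merge J \<omega> \<omega>' (4 * r) = \<omega> (4 * r)" "tape_merge J \<omega> \<omega>' 1 = \<omega>' 1" for \<omega>' r
      unfolding tape_merge_def J_def mem_Collect_eq by auto
    have "shift p l (tape_merge J \<omega> \<omega>') = shift p l \<omega>" for \<omega>' unfolding shift_def c ..
    then have pe: "perm p l (tape_merge J \<omega> \<omega>') = perm p l \<omega>" for \<omega>' by (simp add: perm_def src_def fun_eq_iff)
    have sl: "slot_of p l t (tape_merge J \<omega> \<omega>') z q = slot m (2 ^ t) (\<omega>' 1) (perm p l \<omega> z) q" for \<omega>' z q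
      by (simp only: slot_of_def pe c)
    let ?D = "\<lambda>\<omega>' q. of_bool (slot m (2 ^ t) (\<omega>' 1) ?y q \<noteq> slot m (2 ^ t) (\<omega>' 1) ?y' q) :: real"
    have int: "integrable tape (\<lambda>\<omega>'. ?D \<omega>' q)" for q
      by (rule tape.integrable_const_bound[where B = 1])
         (simp, intro measurable_of_bool sets_nat_eq measurable_slot)
    have "(\<integral>\<omega>'. ?h (tape_merge J \<omega> \<omega>') \<partial>tape) = (\<Sum>q<N. ?y q * (\<integral>\<omega>'. ?D \<omega>' q \<partial>tape))"
      unfolding sl pe using int by (simp only: Bochner_Integration.integral_sum Bochner_Integration.integrable_mult_right integral_mult_right_zero)
    also have "\<dots> \<le> (\<Sum>q<N. ?y q * (2 * (\<Sum>j<N. of_bool (q div m = j div m) * \<bar>?y j - ?y' j\<bar>)))"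
      using perm_bounds[OF w x] by (intro sum_mono mult_left_mono order_trans[OF prob_slot_differs block_diff]) auto
    also have "\<dots> = (\<Sum>q<N. 2 * (?y q * (\<Sum>j<N. of_bool (q div m = j div m) * \<bar>?y j - ?y' j\<bar>)))"
      by (simp only: mult.left_commute)
    also have "\<dots> = 2 * (\<Sum>q<N. ?y q * (\<Sum>j<N. of_bool (q div m = j div m) * \<bar>?y j - ?y' j\<bar>))"
      by (simp only: sum_distrib_left)
    also have "(\<Sum>q<N. ?y q * (\<Sum>j<N. of_bool (q div m = j div m) * \<bar>?y j - ?y' j\<bar>))
      = (\<Sum>i<N. padded x i * (\<Sum>j<N. I \<omega> i j * d j))"
    proof -
      have "(\<Sum>j<N. of_bool (a div m = j div m) * \<bar>?y j - ?y' j\<bar>) = (\<Sum>j<N. of_bool (a div m = dest p l \<omega> j div m) * d j)" for a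
        unfolding sum_dest[OF w, of "\<lambda>j. of_bool (a div m = j div m) * \<bar>?y j - ?y' j\<bar>"]
        by (rule sum.cong) (simp_all add: perm_dest[OF w] d_def)
      then have "(\<Sum>q<N. ?y q * (\<Sum>j<N. of_bool (q div m = j div m) * \<bar>?y j - ?y' j\<bar>))
        = (\<Sum>q<N. ?y q * (\<Sum>j<N. of_bool (q div m = dest p l \<omega> j div m) * d j))" by (simp only:)
      also have "\<dots> = (\<Sum>i<N. ?y (dest p l \<omega> i) * (\<Sum>j<N. of_bool (dest p l \<omega> i div m = dest p l \<omega> j div m) * d j))"
        by (rule sum_dest[OF w])
      also have "\<dots> = (\<Sum>i<N. padded x i * (\<Sum>j<N. I \<omega> i j * d j))"
        unfolding I_def by (rule sum.cong) (simp_all only: perm_dest[OF w] lessThan_iff)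
      finally show ?thesis .
    qed
    also have "\<dots> = (\<Sum>i<N. \<Sum>j<N. padded x i * d j * I \<omega> i j)"
      by (simp only: sum_distrib_left mult.assoc mult.commute[of "I _ _ _"])
    finally show "(\<integral>\<omega>'. ?h (tape_merge J \<omega> \<omega>') \<partial>tape) \<le> 2 * (\<Sum>i<N. \<Sum>j<N. padded x i * d j * I \<omega> i j)" .
  next
    fix \<omega> :: "nat \<Rightarrow> real"
    show "0 \<le> 2 * (\<Sum>i<N. \<Sum>j<N. padded x i * d j * I \<omega> i j)"
      using pb d0 by (intro mult_nonneg_nonneg sum_nonneg) (auto simp: I_def)
  qed
  also have "\<dots> = 2 * (\<Sum>i<N. \<Sum>j<N. padded x i * d j * (\<integral>\<omega>. I \<omega> i j \<partial>tape))"
    using Iint by (simp only: Bochner_Integration.integral_sum Bochner_Integration.integrable_sum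
        Bochner_Integration.integrable_mult_right integral_mult_right_zero)
  also have "\<dots> \<le> 2 * (\<Sum>i<N. \<Sum>j<N. padded x i * d j * (of_bool (i = j) + (if l = p then 0 else 1 / 2 ^ l)))"
  proof (intro mult_left_mono sum_mono)
    fix i j assume ij: "i \<in> {..<N}" "j \<in> {..<N}"
    show "(\<integral>\<omega>. I \<omega> i j \<partial>tape) \<le> of_bool (i = j) + (if l = p then 0 else 1 / 2 ^ l)"
    proof (cases "i = j")
      case True
      then show ?thesis by (simp add: I_def tape.prob_space)
    next
      case False
      then show ?thesis using prob_same_block[of i j] ij unfolding I_def by simp
    qed
  qed (use pb d0 in auto)
  also have "(\<Sum>i<N. \<Sum>j<N. padded x i * d j * (of_bool (i = j) + (if l = p then 0 else 1 / 2 ^ l)))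
    = (\<Sum>i<N. padded x i * d i) + (if l = p then 0 else 1 / 2 ^ l) * ((\<Sum>i<N. padded x i) * (\<Sum>j<N. d j))"
  proof -
    have "(\<Sum>j<N. padded x i * d j * (of_bool (i = j) + e)) = padded x i * d i + e * (padded x i * (\<Sum>j<N. d j))"
      if "i < N" for i e
    proof -
      have "(\<Sum>j<N. padded x i * d j * (of_bool (i = j) + e))
        = (\<Sum>j<N. (if i = j then padded x i * d j else 0) + e * (padded x i * d j))"
        by (intro sum.cong) (auto simp: algebra_simps)
      also have "\<dots> = (\<Sum>j<N. if i = j then padded x i * d j else 0) + e * (padded x i * (\<Sum>j<N. d j))"
        by (simp only: sum.distrib sum_distrib_left)
      also have "(\<Sum>j<N. if i = j then padded x i * d j else 0) = padded x i * d i" using that by simp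
      finally show ?thesis .
    qed
    then show ?thesis by (simp add: sum.distrib sum_distrib_left[symmetric] sum_distrib_right[symmetric])
  qed
  also have "2 * \<dots> \<le> 2 * (2 * (\<Sum>j<N. d j))"
  proof -
    have a1: "(\<Sum>i<N. padded x i * d i) \<le> (\<Sum>i<N. d i)"
      using pb d0 by (intro sum_mono) (simp add: mult_left_le_one_le)
    have a2: "(if l = p then 0 else 1 / 2 ^ l) * ((\<Sum>i<N. padded x i) * (\<Sum>j<N. d j)) \<le> (\<Sum>j<N. d j)"
    proof (cases "l = p")
      case False
      then have "k \<le> 2 ^ l" using sep by blast
      then have kl: "real k \<le> real (2 ^ l)" by (simp only: of_nat_le_iff)
      have "l1 x \<le> real k" using x by (simp add: Delta_def)
      also note kl
      finally have "l1 x / 2 ^ l \<le> 1" by simp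
      moreover have "0 \<le> l1 x" unfolding l1_def by (simp add: sum_nonneg)
      ultimately have "l1 x / 2 ^ l * (\<Sum>j<N. d j) \<le> 1 * (\<Sum>j<N. d j)"
        using d0 by (intro mult_right_mono sum_nonneg) auto
      then show ?thesis using False by (simp add: sum_padded[OF half x])
    qed (simp add: sum_nonneg d0)
    show ?thesis unfolding mult_2[of "\<Sum>j<N. d j"] by (rule mult_left_mono[OF add_mono[OF a1 a2]]) simp
  qed
  finally show ?thesis by (simp add: d_def)
qed

section \<open>The distribution over maps\<close>

definition sizes :: "real list \<Rightarrow> nat set set" where
  "sizes x = {B. B \<subseteq> {..<n} \<and> int (card B) \<in> {\<lfloor>l1 x\<rfloor>, \<lceil>l1 x\<rceil>}}"

lemma measurable_alg:
  assumes x: "x \<in> Delta n k"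
  shows "(\<lambda>\<omega>. alg p l t \<omega> \<omega> x) \<in> measurable tape (count_space (sizes x))"
proof -
  have fin: "finite (sizes x)" by (rule finite_subset[of _ "Pow {..<n}"]) (auto simp: sizes_def)
  have len: "length x = n" using x by (simp add: Delta_def)
  have sub: "alg p l t \<omega> \<omega> x \<subseteq> {..<n}" for \<omega> by (auto simp: alg_def len)
  have "alg p l t \<omega> \<omega> x \<in> sizes x" if "\<omega> \<in> space tape" for \<omega>
    using card_alg[OF x that] sub unfolding sizes_def by blast
  moreover have "(\<lambda>\<omega>. alg p l t \<omega> \<omega> x) -` {S} \<inter> space tape \<in> sets tape" if "S \<in> sizes x" for S
  proof -
    have S: "S \<subseteq> {..<n}" using that by (simp add: sizes_def)
    have eq: "alg p l t \<omega> \<omega> x = S \<longleftrightarrow> (\<forall>i\<in>{..<n}. if i \<in> S then i \<in> alg p l t \<omega> \<omega> x else \<not> i \<in> alg p l t \<omega> \<omega> x)"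
      (is "_ \<longleftrightarrow> ?R") for \<omega>
    proof
      assume R: ?R
      show "alg p l t \<omega> \<omega> x = S"
      proof (rule set_eqI)
        fix i show "i \<in> alg p l t \<omega> \<omega> x \<longleftrightarrow> i \<in> S"
        proof (cases "i \<in> {..<n}")
          case True
          from bspec[OF R True] show ?thesis by (simp split: if_splits)
        next
          case False
          then have "i \<notin> alg p l t \<omega> \<omega> x" "i \<notin> S" using sub[of \<omega>] S by blast+
          then show ?thesis by simp
        qed
      qed
    qed simp
    have "(\<lambda>\<omega>. alg p l t \<omega> \<omega> x) -` {S} \<inter> space tape
      = {\<omega> \<in> space tape. \<forall>i\<in>{..<n}. if i \<in> S then i \<in> alg p l t \<omega> \<omega> x else \<not> i \<in> alg p l t \<omega> \<omega> x}"
      unfolding eq[symmetric] by auto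
    also have "\<dots> \<in> sets tape"
    proof (rule sets.sets_Collect_finite_All)
      fix i
      show "{\<omega> \<in> space tape. if i \<in> S then i \<in> alg p l t \<omega> \<omega> x else \<not> i \<in> alg p l t \<omega> \<omega> x} \<in> sets tape"
        by (cases "i \<in> S") (simp_all add: sets_alg sets.sets_Collect_neg)
    qed simp
    finally show ?thesis .
  qed
  ultimately show ?thesis using fin by (subst measurable_count_space_eq2) auto
qed

lemma l1_dist_padded:
  assumes x: "x \<in> Delta n k" "x' \<in> Delta n k"
  shows "(\<Sum>i<N. \<bar>padded x i - padded x' i\<bar>) = l1_dist x x'"
proof -
  have len: "length x = n" "length x' = n" using x by (auto simp: Delta_def)
  have "(\<Sum>i<N. \<bar>padded x i - padded x' i\<bar>) = (\<Sum>i<n. \<bar>padded x i - padded x' i\<bar>)"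
    using n by (intro sum.mono_neutral_right) (auto simp: padded_def len)
  also have "\<dots> = l1_dist x x'" unfolding l1_dist_def l1_def by (simp add: padded_def len)
  finally show ?thesis .
qed

text \<open>For a fixed grouping, rounding costs 2(l + t) + 3 per unit of change of the allocation,
  as the tree has depth l + t. The allocation changes by the distance plus twice the regrouped mass,
  in expectation at most 1 + 2 * 4 = 9 times the distance.\<close>

lemma stretch_alg:
  assumes x: "x \<in> Delta n k" "x' \<in> Delta n k" and sep: "l = p \<or> k \<le> 2 ^ l"
  shows "(\<integral>\<omega>. real (card (sym_diff (alg p l t \<omega> \<omega> x) (alg p l t \<omega> \<omega> x'))) \<partial>tape) \<le> real (2 * (l + t) + 3) * (9 * l1_dist x x')"
proof -
  let ?c = "\<lambda>\<omega> \<omega>'. real (card (sym_diff (alg p l t \<omega> \<omega>' x) (alg p l t \<omega> \<omega>' x')))"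
  let ?h = "\<lambda>\<omega>. \<Sum>q<N. perm p l \<omega> x q * of_bool (slot_of p l t \<omega> x q \<noteq> slot_of p l t \<omega> x' q)"
  have "finite (sizes z)" for z by (rule finite_subset[of _ "Pow {..<n}"]) (auto simp: sizes_def)
  note cs = countable_finite[OF this]
  have "(\<lambda>\<omega>. real (card (sym_diff (alg p l t \<omega> \<omega> x) B))) \<in> borel_measurable tape" for B
    by (rule measurable_compose[where g = "\<lambda>S. real (card (sym_diff S B))", OF measurable_alg[OF x(1)]]) simp
  then have meas: "(\<lambda>\<omega>. ?c \<omega> \<omega>) \<in> borel_measurable tape"
    by (rule measurable_compose_countable'[where f = "\<lambda>B \<omega>. real (card (sym_diff (alg p l t \<omega> \<omega> x) B))", OF _ measurable_alg[OF x(2)] cs])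
  have bd: "\<bar>?c \<omega> \<omega>'\<bar> \<le> real n" for \<omega> \<omega>'
  proof -
    have "sym_diff (alg p l t \<omega> \<omega>' x) (alg p l t \<omega> \<omega>' x') \<subseteq> {..<n}" using x by (auto simp: alg_def Delta_def)
    then have "card (sym_diff (alg p l t \<omega> \<omega>' x) (alg p l t \<omega> \<omega>' x')) \<le> card {..<n}" by (intro card_mono) auto
    then show ?thesis by simp
  qed
  have "(\<integral>\<omega>. ?c \<omega> \<omega> \<partial>tape) = (\<integral>\<omega>. (\<integral>\<omega>'. ?c (tape_merge grouping_cells \<omega> \<omega>') (tape_merge grouping_cells \<omega> \<omega>') \<partial>tape) \<partial>tape)"
    by (rule expectation_tape_merge[where B = "real n", OF meas bd])
  also have "\<dots> \<le> (\<integral>\<omega>. real (2 * (l + t) + 3) * (l1_dist x x' + 2 * ?h \<omega>) \<partial>tape)"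
  proof (rule integral_mono')
    show "integrable tape (\<lambda>\<omega>. real (2 * (l + t) + 3) * (l1_dist x x' + 2 * ?h \<omega>))"
      by (intro Bochner_Integration.integrable_mult_right Bochner_Integration.integrable_add
          tape.integrable_const integrable_slot_differs(4)[OF x(1)])
    fix \<omega> assume w: "\<omega> \<in> space tape"
    have "0 \<le> l1_dist x x'" by (simp add: l1_dist_def l1_def sum_nonneg)
    then show "0 \<le> real (2 * (l + t) + 3) * (l1_dist x x' + 2 * ?h \<omega>)"
      using integrable_slot_differs(3)[OF x(1) w, of x'] by (intro mult_nonneg_nonneg add_nonneg_nonneg) auto
    show "(\<integral>\<omega>'. ?c (tape_merge grouping_cells \<omega> \<omega>') (tape_merge grouping_cells \<omega> \<omega>') \<partial>tape)
      \<le> real (2 * (l + t) + 3) * (l1_dist x x' + 2 * ?h \<omega>)"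
    proof -
      have "(\<integral>\<omega>'. ?c \<omega> \<omega>' \<partial>tape) \<le> (\<integral>\<omega>'. sdist (l + t) N \<omega>' (alloc p l t \<omega> x) (alloc p l t \<omega> x') \<partial>tape)"
        by (rule integral_mono'[OF integrable_sdist card_diff_le_sdist[OF x w]])
           (auto simp: sdist_def intro!: sum_nonneg)
      also have "\<dots> \<le> real (2 * (l + t) + 3) * (\<Sum>(g, q)\<in>{..<2 ^ (l + t)} \<times> {..<N}. \<bar>alloc p l t \<omega> x g q - alloc p l t \<omega> x' g q\<bar>)"
      proof (rule expectation_sdist[OF feasible_alloc[OF w x(1)] feasible_alloc[OF w x(2)]])
        fix g q :: nat assume o: "\<not> (g < 2 ^ (l + t) \<and> q < N)"
        show "alloc p l t \<omega> x g q = alloc p l t \<omega> x' g q"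
          using o slot_of_less[OF w x(1), of q] slot_of_less[OF w x(2), of q] unfolding alloc_def by auto
      qed simp
      also have "\<dots> \<le> real (2 * (l + t) + 3) * (l1_dist x x' + 2 * ?h \<omega>)"
        using alloc_diff[OF x w] unfolding l1_dist_padded[OF x] by (rule mult_left_mono) simp
      finally show "(\<integral>\<omega>'. ?c (tape_merge grouping_cells \<omega> \<omega>') (tape_merge grouping_cells \<omega> \<omega>') \<partial>tape)
        \<le> real (2 * (l + t) + 3) * (l1_dist x x' + 2 * ?h \<omega>)" unfolding alg_merge .
    qed
  qed
  also have "\<dots> = real (2 * (l + t) + 3) * (l1_dist x x' + 2 * integral\<^sup>L tape ?h)"
  proof -
    have "(\<integral>\<omega>. l1_dist x x' + 2 * ?h \<omega> \<partial>tape) = (\<integral>\<omega>. l1_dist x x' \<partial>tape) + (\<integral>\<omega>. 2 * ?h \<omega> \<partial>tape)"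
      by (intro Bochner_Integration.integral_add tape.integrable_const Bochner_Integration.integrable_mult_right
          integrable_slot_differs(4)[OF x(1)])
    also have "\<dots> = l1_dist x x' + 2 * integral\<^sup>L tape ?h"
      by (simp only: integral_mult_right_zero) (simp add: tape.prob_space)
    finally show ?thesis by (simp only: integral_mult_right_zero)
  qed
  also have "\<dots> \<le> real (2 * (l + t) + 3) * (9 * l1_dist x x')"
    using expectation_slot_differs[OF x(1) sep, of x'] unfolding l1_dist_padded[OF x]
    by (intro mult_left_mono) linarith+
  finally show ?thesis .
qed

text \<open>The carrier contains only maps whose values have admissible sizes, so the size condition
  holds at every point of the space rather than almost everywhere. Each factor is finite and
  discrete, which makes all evaluations measurable although there are uncountably many
  inputs.\<close>

definition maps :: "(real list \<Rightarrow> nat set) measure" where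
  "maps = PiM (Delta n k) (\<lambda>x. count_space (sizes x))"

text \<open>Restricted to \<open>Delta n k\<close> because the points of a product space are
  extensional functions.\<close>

definition alg_map :: "(nat \<Rightarrow> real) \<Rightarrow> real list \<Rightarrow> nat set" where
  "alg_map \<omega> = (\<lambda>x\<in>Delta n k. alg p l t \<omega> \<omega> x)"

lemma measurable_alg_map: "alg_map \<in> measurable tape maps"
  unfolding alg_map_def[abs_def] maps_def by (rule measurable_restrict) (rule measurable_alg)

lemma correlated_sampling_alg:
  assumes sep: "l = p \<or> k \<le> 2 ^ l" and le: "real (2 * (l + t) + 3) * 9 \<le> \<alpha>"
  shows "correlated_sampling n k \<alpha> (distr tape maps alg_map)"
proof -
  let ?D = "distr tape maps alg_map"
  have sp: "space ?D = (\<Pi>\<^sub>E x\<in>Delta n k. sizes x)" by (simp add: maps_def space_PiM)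
  have comp: "(\<lambda>A. A x) \<in> measurable maps (count_space (sizes x))" if "x \<in> Delta n k" for x
    unfolding maps_def using that by (rule measurable_component_singleton)
  have fin: "finite (sizes z)" for z by (rule finite_subset[of _ "Pow {..<n}"]) (auto simp: sizes_def)
  have map: "alg_map \<omega> x = alg p l t \<omega> \<omega> x" if "x \<in> Delta n k" for \<omega> x using that by (simp add: alg_map_def)
  have "(\<lambda>A. A x) \<in> measurable ?D (count_space (Pow {..<n}))" if x: "x \<in> Delta n k" for x
  proof -
    have "(\<lambda>A. id (A x)) \<in> measurable maps (count_space (Pow {..<n}))"
      by (rule measurable_compose[OF comp[OF x]]) (auto simp: sizes_def)
    then show ?thesis by simp
  qed
  moreover have "measure ?D {A \<in> space ?D. i \<in> A x} = x ! i" if x: "x \<in> Delta n k" and i: "i < n" for x i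
  proof -
    have "(\<lambda>A. A x) -` {B \<in> sizes x. i \<in> B} \<inter> space maps \<in> sets maps"
      by (rule measurable_sets[OF comp[OF x]]) simp
    also have "(\<lambda>A. A x) -` {B \<in> sizes x. i \<in> B} \<inter> space maps = {A \<in> space maps. i \<in> A x}"
      using x by (auto simp: maps_def space_PiM)
    finally have S: "{A \<in> space maps. i \<in> A x} \<in> sets maps" .
    have "alg_map -` {A \<in> space maps. i \<in> A x} \<inter> space tape = {\<omega> \<in> space tape. i \<in> alg p l t \<omega> \<omega> x}"
      using measurable_space[OF measurable_alg_map] by (auto simp: map[OF x])
    then have "measure ?D {A \<in> space ?D. i \<in> A x} = measure tape {\<omega> \<in> space tape. i \<in> alg p l t \<omega> \<omega> x}"
      using measure_distr[OF measurable_alg_map S] by simp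
    also have "\<dots> = (\<integral>\<omega>. indicator {\<omega> \<in> space tape. i \<in> alg p l t \<omega> \<omega> x} \<omega> \<partial>tape)"
      by (rule prob_tape_indicator[OF sets_alg])
    also have "\<dots> = (\<integral>\<omega>. of_bool (i \<in> alg p l t \<omega> \<omega> x) \<partial>tape)"
      by (rule Bochner_Integration.integral_cong) (auto simp: indicator_def)
    also have "\<dots> = x ! i" by (rule expectation_alg[OF x i])
    finally show ?thesis .
  qed
  moreover have "(\<integral>A. real (card (sym_diff (A x) (A x'))) \<partial>?D) \<le> \<alpha> * l1_dist x x'"
    if x: "x \<in> Delta n k" "x' \<in> Delta n k" for x x'
  proof -
    have "(\<lambda>A. real (card (sym_diff (A x) B))) \<in> borel_measurable maps" for B
      by (rule measurable_compose[where g = "\<lambda>S. real (card (sym_diff S B))", OF comp[OF x(1)]]) simp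
    then have "(\<lambda>A. real (card (sym_diff (A x) (A x')))) \<in> borel_measurable maps"
      by (rule measurable_compose_countable'[where f = "\<lambda>B A. real (card (sym_diff (A x) B))", OF _ comp[OF x(2)] countable_finite[OF fin]])
    then have "(\<integral>A. real (card (sym_diff (A x) (A x'))) \<partial>?D)
      = (\<integral>\<omega>. real (card (sym_diff (alg_map \<omega> x) (alg_map \<omega> x'))) \<partial>tape)"
      by (rule integral_distr[OF measurable_alg_map])
    also have "\<dots> \<le> real (2 * (l + t) + 3) * 9 * l1_dist x x'"
      using stretch_alg[OF x sep] by (simp only: map x mult.assoc)
    also have "\<dots> \<le> \<alpha> * l1_dist x x'"
      using le by (rule mult_right_mono) (simp add: l1_dist_def l1_def sum_nonneg)
    finally show ?thesis .
  qed
  moreover have "prob_space ?D" by (rule tape.prob_space_distr[OF measurable_alg_map])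
  moreover have sizes: "A x \<in> sizes x" if "A \<in> space ?D" "x \<in> Delta n k" for A x
    using that unfolding sp by (rule PiE_mem)
  have "space ?D \<subseteq> Delta n k \<rightarrow> Pow {..<n}"
  proof (intro subsetI Pi_I)
    fix A x assume "A \<in> space ?D" "x \<in> Delta n k"
    from sizes[OF this] show "A x \<in> Pow {..<n}" by (simp add: sizes_def)
  qed
  moreover have "\<forall>A\<in>space ?D. \<forall>x\<in>Delta n k. int (card (A x)) \<in> {\<lfloor>l1 x\<rfloor>, \<lceil>l1 x\<rceil>}"
    using sizes unfolding sizes_def by blast
  ultimately show ?thesis unfolding correlated_sampling_def by blast
qed

end

section \<open>Parameters and constants\<close>

lemma slots_le_lgk: "blk n k + slt n k \<le> 2 * lgk n k + 2"
proof (cases "many n k")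
  case True
  \<comment> \<open>In this case the tree has depth lg n + 2, and \<open>many\<close> bounds lg n by
    twice the number of doubling rounds.\<close>
  then have "(2::nat) ^ lg n < 2 ^ (2 * lgk n k)" unfolding many_def four_power .
  then have "lg n < 2 * lgk n k" by (rule power_less_imp_less_exp[rotated]) simp
  then show ?thesis using True by (simp add: blk_def slt_def)
qed (simp add: blk_def slt_def)

lemma sampling_params_lg: "1 \<le> k \<Longrightarrow> sampling_params (lg n) (blk n k) (slt n k) k n"
proof
  assume k: "1 \<le> k"
  show "blk n k \<le> lg n" by (rule blk_le)
  show "n \<le> 2 ^ lg n" by (rule lg)
  show "2 * min (real (2 ^ (lg n - blk n k))) (real k) + 2 \<le> real (2 ^ slt n k)"
  proof (cases "many n k")
    case False
    then have "k \<le> 2 ^ lgk n k" using not_many by blast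
    then have "real k \<le> real (2 ^ lgk n k)" by (simp only: of_nat_le_iff)
    moreover have "real (2 ^ slt n k) = 4 * real (2 ^ lgk n k)" using False by (simp add: slt_def power_add)
    ultimately show ?thesis using k by linarith
  qed (simp add: blk_def slt_def)
qed

text \<open>For an exponent e defined by minimality, the power with exponent e - 1 is still below a;
  so it is the logarithm up to one.\<close>

lemma pred_le_log:
  assumes "1 \<le> a" "\<And>j. j < e \<Longrightarrow> 2 ^ j < (a :: nat)"
  shows "real e \<le> log 2 (real a) + 1"
proof (cases e)
  case 0
  then show ?thesis using assms(1) by simp
next
  case (Suc j)
  then have "2 ^ j < a" using assms(2)[of j] by simp
  then have "real (2 ^ j) < real a" by (simp only: of_nat_less_iff)
  then have "2 powr real j \<le> real a" by (simp add: powr_realpow)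
  then have "real j \<le> log 2 (real a)" using assms(1) by (simp add: le_log_iff)
  then show ?thesis using Suc by simp
qed

theorem theorem3p14:
  "\<exists>(c :: com) (C :: real). \<forall>n k :: nat. 1 \<le> n \<longrightarrow> 1 \<le> k \<longrightarrow>
     (\<exists>D. correlated_sampling n k (C * max 1 (log 2 (real k))) D \<and>
          implements c n k D
            (C * (real n * max 1 (real (log_star n))))
            (C * (max 1 (log 2 (real n)) * max 1 (real (log_star n)))))"
proof (intro exI[of _ prog] exI[of _ 600] allI impI)
  \<comment> \<open>The constant 600 is dictated by the work: 300 times 2^p, where padding to a
    power of two at most doubles n. The stretch is at most 9 (4 log k + 11), and the depth at most
    150 (log n + 2).\<close>
  fix n k :: nat assume n1: "1 \<le> n" and k: "1 \<le> k"
  define p l t where "p = lg n" and "l = blk n k" and "t = slt n k"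
  interpret sampling_params p l t k n unfolding p_def l_def t_def by (rule sampling_params_lg[OF k])
  let ?D = "distr tape maps alg_map" and ?S = "max 1 (real (log_star n))"
  have "real (lgk n k) \<le> log 2 (real k) + 1" by (rule pred_le_log[OF k]) (simp add: lgk(2))
  moreover have "real (l + t) \<le> 2 * real (lgk n k) + 2"
    using slots_le_lgk[of n k] unfolding p_def l_def t_def by linarith
  ultimately have "real (2 * (l + t) + 3) * 9 \<le> 600 * max 1 (log 2 (real k))" by simp
  moreover have "l = p \<or> k \<le> 2 ^ l" using not_many[of n k] by (auto simp: p_def l_def t_def blk_def)
  ultimately have 1: "correlated_sampling n k (600 * max 1 (log 2 (real k))) ?D" by (intro correlated_sampling_alg)
  \<comment> \<open>The work is linear and the depth logarithmic; the factor \<open>?S\<close>,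
    being at least 1, only weakens these bounds to the required form.\<close>
  have S: "a \<le> a * ?S" if "0 \<le> a" for a using mult_left_mono[of 1 ?S a] that by simp
  have "2 ^ p \<le> 2 * n"
  proof (cases p)
    case (Suc j)
    then have "2 ^ j < n" using lg(2)[of j n] by (simp add: p_def l_def t_def)
    then show ?thesis by (simp add: Suc)
  qed (use n1 in simp)
  then have "real (300 * 2 ^ p) \<le> real (300 * (2 * n))" by (simp only: of_nat_le_iff mult_le_mono2)
  then have W: "real (300 * 2 ^ p) \<le> 600 * (real n * ?S)" using S[of "real n"] by simp
  have "real p \<le> log 2 (real n) + 1" unfolding p_def l_def t_def by (rule pred_le_log[OF n1]) (rule lg(2))
  then have d: "real (150 * (p + 1)) \<le> 600 * max 1 (log 2 (real n))" by simp
  have M: "max 1 (log 2 (real n)) \<le> max 1 (log 2 (real n)) * ?S" by (rule S) simp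
  have T: "real (150 * (p + 1)) \<le> 600 * (max 1 (log 2 (real n)) * ?S)"
    by (rule order_trans[OF d mult_left_mono[OF M]]) simp
  have "implements prog n k ?D (600 * (real n * ?S)) (600 * (max 1 (log 2 (real n)) * ?S))"
    unfolding implements_def
  proof (intro exI[of _ alg_map] conjI ballI)
    show "alg_map \<in> measurable tape ?D" using measurable_alg_map by simp
    show "distr tape ?D alg_map = ?D" by (rule distr_cong) simp_all
    fix \<omega> x assume w: "\<omega> \<in> space tape" and x: "x \<in> Delta n k"
    from run_prog[OF sampling_params_lg[OF k] x w] obtain s w' d where r: "run \<omega> prog (input_state n k x) s w' d"
      "output_set n s = alg p l t \<omega> \<omega> x" "w' \<le> 300 * 2 ^ p" "d \<le> 150 * (p + 1)"
      unfolding p_def l_def t_def by blast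
    have "real w' \<le> real (300 * 2 ^ p)" "real d \<le> real (150 * (p + 1))" using r(3,4) by (simp_all only: of_nat_le_iff)
    then show "\<exists>s w d. run \<omega> prog (input_state n k x) s w d \<and> output_set n s = alg_map \<omega> x \<and>
        real w \<le> 600 * (real n * ?S) \<and> real d \<le> 600 * (max 1 (log 2 (real n)) * ?S)"
      using r(1,2) W T x by (intro exI[of _ s] exI[of _ w'] exI[of _ d]) (simp add: alg_map_def)
  qed
  with 1 show "\<exists>D. correlated_sampling n k (600 * max 1 (log 2 (real k))) D \<and>
     implements prog n k D (600 * (real n * ?S)) (600 * (max 1 (log 2 (real n)) * ?S))" by blast
qed

end
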